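(* The generalized Fock space $F_T=S(\hat{\mathfrak h}^-_\mu)\otimes T$ affords a representation of the twisted quantum affinization algebra $\mathcal U_q(\hat{\mathfrak g}_\mu)$ with actions given by $$q^{\pm\frac12 c}\mapsto q^{\pm\frac12},\qquad \phi^\pm_{i,m}\mapsto \Phi^\pm_{i,m},\qquad x^\pm_{i,m}\mapsto \epsilon_i X^\pm_{i,m},$$ where $i\in I$, $m\in\mathbb Z$ and $$\epsilon_i=\left(\frac{d_i[d_i]_q}{[2]_{q^{d_{ii}/2}}}\right)^{1/2}\ \text{ if } d_{ii}>0,\qquad \epsilon_i=\left(d_i[d_i]_q\right)^{1/2}\ \text{ if } d_{ii}=0.$$ Here $\phi_{i,m}^\pm$, $\Phi_{i,m}^\pm$ and $X_{i,m}^\pm$ are the coefficients of $z^{-m}$ in $\phi_i^\pm(z)$, $\Phi_i^\pm(z)$ and $X_i^\pm(z)$.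
   Context: Setup. $q$ is a fixed generic nonzero complex number; $[n]_b=\frac{b^n-b^{-n}}{b-b^{-1}}$. $A=(a_{ij})_{i,j\in I}$, $I=\{1,\dots,\nu\}$, is a simply-laced generalized Cartan matrix: $a_{ij}\in\mathbb Z$, $a_{ii}=2$, $a_{ij}\in\{0,-1\}$ for $i\ne j$, and $a_{ij}=0\Leftrightarrow a_{ji}=0$. $\mu$ is a permutation of $I$ of order $N$ with $a_{\mu(i)\mu(j)}=a_{ij}$; $\mathbb Z_N=\mathbb Z/N\mathbb Z$; $\xi$ is a fixed primitive $N$-th root of unity. For $i,j\in I$ put $\Gamma_{ij}=\{k\in\mathbb Z_N: a_{i\mu^k(j)}\neq0\}$, $\Gamma_{ij}^\pm=\{k\in\mathbb Z_N:\pm a_{i\mu^k(j)}>0\}$, $d_{ij}=\mathrm{Card}\,\Gamma_{ij}^-$, $d_i=\mathrm{Card}\,\Gamma_{ii}^+$. Linking condition (assumed): for every $i,j\in I$ with $a_{ij}<0$, $\Gamma_{ij}^-$ is a subgroup of $\mathbb Z_N$. $\mathcal O(i)$ is the $\mu$-orbit of $i$. $Q=\bigoplus_{i\in I}\mathbb Z\alpha_i$ carries the symmetric bilinear form $\langle\alpha_i|\alpha_j\rangle=a_{ij}$, and $\mu$ acts on $Q$ by $\mu(\alpha_i)=\alpha_{\mu(i)}$. $\delta(z)=\sum_{n\in\mathbb Z}z^n$. Polynomials and series. $F^\pm_{ij}(z,w)=\prod_{k\in\Gamma_{ij}}(z-\xi^kq^{\pm a_{i\mu^k(j)}}w)$,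 $G^\pm_{ij}(z,w)=\prod_{k\in\Gamma_{ij}}(q^{\pm a_{i\mu^k(j)}}z-\xi^kw)$, $g_{ij}(z)=\prod_{k\in\Gamma_{ij}}\frac{q^{a_{i\mu^k(j)}}-\xi^kz}{1-\xi^kq^{a_{i\mu^k(j)}}z}$ expanded for $|z|<1$ (in nonnegative powers of $z$). If $a_{ij}<0$ and $i\notin\mathcal O(j)$: $p_{ij}^\pm(z,w)=(z^{d_{ii}}+q^{\mp d_{ii}}w^{d_{ii}})\frac{q^{\pm2d_{ij}}z^{d_{ij}}-w^{d_{ij}}}{q^{\pm2d_i}z^{d_i}-w^{d_i}}$. If $d_{ii}>0$: $p_i^\pm(z_1,z_2,z_3)=\left(q^{\mp\frac32d_{ii}}z_1^{d_{ii}}-(q^{\frac{d_{ii}}2}+q^{-\frac{d_{ii}}2})z_2^{d_{ii}}+q^{\pm\frac32d_{ii}}z_3^{d_{ii}}\right)\prod_{1\le a<b\le3}\frac{(z_a^{d_{ii}}-z_b^{d_{ii}})(z_a^{d_{ii}}-q^{\mp2d_{ii}}z_b^{d_{ii}})}{(z_a^{d_i}-z_b^{d_i})(z_a^{d_i}-q^{\mp2d_i}z_b^{d_i})}$. The algebra. $\mathcal U_q(\hat{\mathfrak g}_\mu)$ is the unital associative $\mathbb C$-algebra generated by $k_\alpha$ ($\alpha\in Q$), $h_{i,m}$ ($i\in I$, $m\in\mathbb Z\setminus\{0\}$), $x^\pm_{i,n}$ ($i\in I$, $n\in\mathbb Z$), $q^{\pm\frac12c}$, with generating series $\phi_i^\pm(z)=k_{\pm\alpha_i}\exp\left(\pm(q-q^{-1})\sum_{\pm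 m>0}h_{i,m}z^{-m}\right)$, $x_i^\pm(z)=\sum_{m\in\mathbb Z}x^\pm_{i,m}z^{-m}$, subject to the following relations for $i,j\in I$, $\alpha,\beta\in Q$: (Q0) $x^\pm_{\mu(i)}(z)=x^\pm_i(\xi^{-1}z)$, $\phi^\pm_{\mu(i)}(z)=\phi_i^\pm(\xi^{-1}z)$, $k_{\mu(\alpha)}=k_\alpha$. (Q1) $q^{\pm\frac12c}q^{\mp\frac12c}=1$ and $q^{\pm\frac12c}$ are central. (Q2) $k_\alpha k_\beta=k_{\alpha+\beta}$, $k_0=1$, $[\phi_i^\pm(z),\phi_j^\pm(w)]=0=[k_\alpha,\phi_i^\pm(z)]$. (Q3) $k_\alpha x_i^\pm(z)k_{-\alpha}=q^{\pm\sum_{k\in\mathbb Z_N}\langle\alpha|\alpha_{\mu^k(i)}\rangle}x_i^\pm(z)$. (Q4) $\phi_i^+(z)\phi_j^-(w)=\phi_j^-(w)\phi_i^+(z)\,g_{ij}(q^cw/z)^{-1}g_{ij}(q^{-c}w/z)$. (Q5) $\phi_i^+(z)x_j^\pm(w)=x_j^\pm(w)\phi_i^+(z)\,g_{ij}(q^{\mp\frac12c}w/z)^{\pm1}$. (Q6) $\phi_i^-(z)x_j^\pm(w)=x_j^\pm(w)\phi_i^-(z)\,g_{ji}(q^{\mp\frac12c}z/w)^{\mp1}$. (Q7) $[x_i^+(z),x_j^-(w)]=\frac1{q-q^{-1}}\sum_{k\in\mathbb Z_N}\delta_{i,\mu^k(j)}\left(\phi_i^+(q^{-\frac12c}z)\delta\left(\frac{q^c\xi^kw}z\right)-\phi_i^-(q^{\frac12c}z)\delta\left(\frac{q^{-c}\xi^kw}z\right)\right)$.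 (Q8) $F^\pm_{ij}(z,w)x_i^\pm(z)x_j^\pm(w)=G^\pm_{ij}(z,w)x_j^\pm(w)x_i^\pm(z)$. (Q9) if $a_{ij}<0$ and $i\notin\mathcal O(j)$: $\sum_{\sigma\in S_2}p^\pm_{ij}(z_{\sigma(1)},z_{\sigma(2)})\left(x_i^\pm(z_{\sigma(1)})x_i^\pm(z_{\sigma(2)})x_j^\pm(w)-[2]_{q^{d_{ij}}}x_i^\pm(z_{\sigma(1)})x_j^\pm(w)x_i^\pm(z_{\sigma(2)})+x_j^\pm(w)x_i^\pm(z_{\sigma(1)})x_i^\pm(z_{\sigma(2)})\right)=0$. (Q10) if $d_{ii}>0$: $\sum_{\sigma\in S_3}p_i^\pm(z_{\sigma(1)},z_{\sigma(2)},z_{\sigma(3)})\,x_i^\pm(z_{\sigma(1)})x_i^\pm(z_{\sigma(2)})x_i^\pm(z_{\sigma(3)})=0$. Heisenberg part. $\mathcal U_q(\hat{\mathfrak h}_\mu)$ is the associative algebra generated by $\alpha_{i,m}$ ($i\in I$, $m\in\mathbb Z\setminus\{0\}$) and $q^{\pm c}$ (central, mutually inverse) with relations (H0) $\alpha_{\mu(i),m}=\xi^m\alpha_{i,m}$, (H1) $[\alpha_{i,m},\alpha_{j,n}]=\delta_{m+n,0}\frac1m\sum_{k\in\mathbb Z_N}\xi^{mk}[m\langle\alpha_i|\mu^k(\alpha_j)\rangle]_q[m]_{q^c}$, where $[m]_{q^c}=\frac{q^{mc}-q^{-mc}}{q-q^{-1}}$. $S(\hat{\mathfrak h}_\mu^-)$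 is the symmetric algebra generated by the $\alpha_{i,n}$, $i\in I$, $n<0$ (isomorphic to the subalgebra of $\mathcal U_q(\hat{\mathfrak h}_\mu)$ they generate). $\mathcal U_q(\hat{\mathfrak h}_\mu)$ acts on it with $q^{\pm c}$ acting as $q^{\pm1}$, $\alpha_{i,-n}$ ($n>0$) as multiplication operator and $\alpha_{i,n}$ ($n>0$) as the annihilation operator subject to (H1). Put $\alpha_i^\pm(z)=\sum_{\pm m>0}\alpha_{i,m}z^{-m}$, $E_\pm(\alpha_i,z)=\exp\left(\mp\sum_{m>0}\frac{\alpha_{i,\pm m}}{[m]_q}z^{\mp m}\right)$, $E_\pm(-\alpha_i,z)=E_\pm(\alpha_i,z)^{-1}$. Lattice part. $\xi'=(-1)^N\xi$, $C(\alpha,\beta)=\prod_{k\in\mathbb Z_N}(-\xi^{-k})^{\langle\alpha|\mu^k(\beta)\rangle}$ for $\alpha,\beta\in Q$. $1\to\langle\xi'\rangle\to\hat Q\xrightarrow{\ \bar{}\ }Q\to1$ is the (unique up to isomorphism) central extension of $Q$ by the cyclic group $\langle\xi'\rangle$ with commutator map $aba^{-1}b^{-1}=C(\bar a,\bar b)$, and $\hat\mu$ is an automorphism of $\hat Q$ with $\overline{\hat\mu(a)}=\mu(\bar a)$ for $a\in\hat Q$, and $\hat\mu(a)=a$ if $\mu(\bar a)=\bar a$. For $\alpha\in Q$, $\alpha_{(0)}=\alpha+\mu(\alpha)+\cdots+\mu^{N-1}(\alpha)$ (write $\alpha_{i(0)}$ for $(\alpha_i)_{(0)}$), and $Q_{(0)}$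 is the subgroup of $Q$ spanned by the $\alpha_{(0)}$, $\alpha\in Q$. $T=\bigoplus_{\gamma\in Q_{(0)}}T_\gamma$ is a fixed $Q_{(0)}$-graded $\hat Q$-module such that $a.t\in T_{(\bar a+\beta)_{(0)}}$ and $\hat\mu(a).t=\xi^{-\langle\bar a_{(0)}|\beta\rangle-\langle\bar a_{(0)}|\bar a\rangle/2}\,a.t$ for $a\in\hat Q$, $t\in T_{\beta_{(0)}}$, $\beta\in Q$. For $\alpha,\beta\in Q$, $t\in T_{\beta_{(0)}}$ and $0\ne c\in\mathbb C$: $z^{\alpha_{(0)}}.t=z^{\langle\alpha_{(0)}|\beta\rangle}t$, $c^{\alpha_{(0)}}.t=c^{\langle\alpha_{(0)}|\beta\rangle}t$. $e:\alpha\mapsto e_\alpha$ is a fixed section from $Q$ to $\hat Q$. Vertex operators on $F_T$ (the $\alpha_{i,n}$ act on the first factor, the $e_\alpha,z^{\alpha_{(0)}},c^{\alpha_{(0)}}$ on the second): $\Phi_i^\pm(z)=\sum_{\pm m\ge0}\Phi^\pm_{i,m}z^{-m}=q^{\pm\alpha_{i(0)}}\exp\left(\pm(q-q^{-1})\alpha_i^\pm(z)\right)$, $X_i^\pm(z)=\sum_{m\in\mathbb Z}X^\pm_{i,m}z^{-m}=E_-(\pm\alpha_i,q^{\mp\frac12}z)\,E_+(\pm\alpha_i,q^{\pm\frac12}z)\,e_{\pm\alpha_i}\,z^{\pm\alpha_{i(0)}+\langle\alpha_{i(0)}|\alpha_i\rangle/2}$.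
   Formalization: The section e is assumed to satisfy e_{μ(α_i)} = μ̂(e_{α_i}) and e_{-α_i} = e_{α_i}^{-1} (which forces d_ii/d_i to be even), and ⟨ξ'⟩ is assumed to act on T by scalar multiplication; for an arbitrary section relations (Q0) and (Q7) fail. *)

theory Defs
  imports
    Complex_Main
    "HOL-Library.Poly_Mapping"
    "HOL-Library.Function_Algebras"
    "HOL-Combinatorics.Permutations"
    "HOL-Computational_Algebra.Polynomial"
    "HOL-Computational_Algebra.Formal_Power_Series"
    "HOL-Algebra.QuotRing"
    "HOL-Algebra.Elementary_Groups"
begin

section \<open>General notions\<close>

text \<open>The two values of a sign that is written \<open>\<plusminus>\<close> (upper sign) or \<open>\<mp>\<close> in formulas.\<close>

datatype pm = Upper | Lower

fun sg :: "pm \<Rightarrow> int" where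
  "sg Upper = 1"
| "sg Lower = - 1"

definition qint :: "complex \<Rightarrow> int \<Rightarrow> complex" where
  "qint b n = (b powi n - b powi (- n)) / (b - inverse b)"

text \<open>The free unital \<open>\<complex>\<close>-algebra on a set of generators is the monoid algebra of the monoid of
  words, with concatenation written additively.\<close>

datatype 'a word = Word (letters: "'a list")

instantiation word :: (type) monoid_add
begin
definition "0 = Word []"
definition "u + v = Word (letters u @ letters v)"
instance by standard (auto simp: zero_word_def plus_word_def)
end

type_synonym 'a free_alg = "'a word \<Rightarrow>\<^sub>0 complex"

definition gen :: "'a \<Rightarrow> 'a free_alg" where
  "gen x = Poly_Mapping.single (Word [x]) 1"

definition sc :: "complex \<Rightarrow> 'a free_alg" where
  "sc c = Poly_Mapping.single 0 c"

definition free_ring :: "'a free_alg ring" where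
  "free_ring = \<lparr>carrier = UNIV, monoid.mult = (*), one = 1, zero = 0, add = (+)\<rparr>"

text \<open>The coefficient of \<open>z\<^sup>n\<close> in \<open>exp f\<close>, for a series \<open>f\<close> without constant term over a not
  necessarily commutative algebra; the powers \<open>f\<^sup>p\<close> with \<open>p > n\<close> do not contribute.\<close>

definition fps_exp_coeff :: "'a free_alg fps \<Rightarrow> nat \<Rightarrow> 'a free_alg" where
  "fps_exp_coeff f n = (\<Sum>p\<le>n. sc (1 / fact p) * fps_nth (f ^ p) n)"

text \<open>The same for a series \<open>f\<close> of operators on a vector space with scalar multiplication \<open>scale\<close>,
  given by its sequence of coefficients.\<close>

fun opser_pow :: "(nat \<Rightarrow> 'v \<Rightarrow> 'v :: comm_monoid_add) \<Rightarrow> nat \<Rightarrow> nat \<Rightarrow> 'v \<Rightarrow> 'v" where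
  "opser_pow f 0 n v = (if n = 0 then v else 0)"
| "opser_pow f (Suc p) n v = (\<Sum>r\<le>n. f r (opser_pow f p (n - r) v))"

definition opser_exp_coeff ::
  "(complex \<Rightarrow> 'v \<Rightarrow> 'v) \<Rightarrow> (nat \<Rightarrow> 'v \<Rightarrow> 'v :: comm_monoid_add) \<Rightarrow> nat \<Rightarrow> 'v \<Rightarrow> 'v" where
  "opser_exp_coeff scale f n v = (\<Sum>p\<le>n. scale (1 / fact p) (opser_pow f p n v))"

text \<open>Polynomials over \<open>\<complex>\<close> in the commuting variables \<open>zv 0\<close>, \<open>zv 1\<close>, \<open>zv 2\<close>.  In this integral
  domain \<open>div\<close> is the exact quotient of a polynomial by a divisor.\<close>

type_synonym poly3 = "complex poly poly poly"

definition cst :: "complex \<Rightarrow> poly3" where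
  "cst c = [:[:[:c:]:]:]"

definition zv :: "nat \<Rightarrow> poly3" where
  "zv t = (if t = 0 then [:[:[:0, 1:]:]:] else if t = 1 then [:[:0, 1:]:] else [:0, 1:])"

text \<open>\<open>D m\<close> is the coefficient of \<open>z\<^sub>0 powi (-m 0) * z\<^sub>1 powi (-m 1) * z\<^sub>2 powi (-m 2)\<close> in a formal
  distribution \<open>D\<close>; multiplication by the monomial with exponents \<open>a, b, c\<close> shifts \<open>m\<close>.
  The values of \<open>m\<close> beyond 2 are irrelevant.\<close>

definition poly_act :: "poly3 \<Rightarrow> ((nat \<Rightarrow> int) \<Rightarrow> 'a free_alg) \<Rightarrow> (nat \<Rightarrow> int) \<Rightarrow> 'a free_alg" where
  "poly_act P D m =
     (\<Sum>c\<le>degree P. \<Sum>b\<le>degree (coeff P c). \<Sum>a\<le>degree (coeff (coeff P c) b).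
        sc (coeff (coeff (coeff P c) b) a) *
        D (\<lambda>t. m t + int (if t = 0 then a else if t = 1 then b else c)))"

definition lin_end_ring :: "(complex \<Rightarrow> 'v \<Rightarrow> 'v :: ab_group_add) \<Rightarrow> ('v \<Rightarrow> 'v) ring" where
  "lin_end_ring scale =
     \<lparr>carrier = {f. Vector_Spaces.linear scale scale f}, monoid.mult = (\<circ>), one = id,
      zero = (\<lambda>_. 0), add = (\<lambda>f g v. f v + g v)\<rparr>"


section \<open>The twisted quantum affinization algebra\<close>

text \<open>Generators: \<open>gK \<alpha>\<close> is \<open>k\<^sub>\<alpha>\<close>; \<open>gH s i n\<close> is \<open>h\<^sub>i\<^sub>,\<^sub>m\<close> with \<open>m = sg s * (n + 1)\<close>, so that \<open>m\<close> runs through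
  the nonzero integers; \<open>gX s i m\<close> is \<open>x\<^sup>\<plusminus>\<^sub>i\<^sub>,\<^sub>m\<close>; \<open>gC s\<close> is \<open>q\<close> to the power \<open>\<plusminus>c/2\<close>.\<close>

datatype 'i gens = gK "'i \<Rightarrow> int" | gH pm 'i nat | gX pm 'i int | gC pm

text \<open>The index set \<open>I\<close> is the finite type \<^typ>\<open>'i\<close>, so \<open>Q\<close> is \<^typ>\<open>'i \<Rightarrow> int\<close>.  The parameter \<open>rt\<close> is
  an arbitrary choice of square roots; it gives the meaning of all half-integral powers.
  Generic means: not a root of unity.\<close>

locale twisted_cartan =
  fixes A :: "'i::finite \<Rightarrow> 'i \<Rightarrow> int"
    and \<mu> :: "'i \<Rightarrow> 'i"
    and N :: nat
    and \<xi> q :: complex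
    and rt :: "complex \<Rightarrow> complex"
  assumes A_diag: "A i i = 2"
    and A_offdiag: "i \<noteq> j \<Longrightarrow> A i j \<in> {0, - 1}"
    and A_zero: "A i j = 0 \<longleftrightarrow> A j i = 0"
    and \<mu>_bij: "bij \<mu>"
    and N_pos: "N > 0"
    and \<mu>_N: "\<mu> ^^ N = id"
    and \<mu>_order: "0 < n \<Longrightarrow> n < N \<Longrightarrow> \<mu> ^^ n \<noteq> id"
    and A_\<mu>: "A (\<mu> i) (\<mu> j) = A i j"
    and \<xi>_N: "\<xi> ^ N = 1"
    and \<xi>_primitive: "0 < n \<Longrightarrow> n < N \<Longrightarrow> \<xi> ^ n \<noteq> 1"
    and q_nonzero: "q \<noteq> 0"
    and q_generic: "n > 0 \<Longrightarrow> q ^ n \<noteq> 1"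
    and rt_square: "rt x ^ 2 = x"
    and linking:
      "A i j < 0 \<Longrightarrow> subgroup {k \<in> {0..<int N}. A i ((\<mu> ^^ nat k) j) < 0} (integer_mod_group N)"
begin

abbreviation ZN :: "int set" where "ZN \<equiv> {0..<int N}"

definition \<Gamma> :: "'i \<Rightarrow> 'i \<Rightarrow> int set" where
  "\<Gamma> i j = {k \<in> ZN. A i ((\<mu> ^^ nat k) j) \<noteq> 0}"

definition \<Gamma>p :: "'i \<Rightarrow> 'i \<Rightarrow> int set" where
  "\<Gamma>p i j = {k \<in> ZN. A i ((\<mu> ^^ nat k) j) > 0}"

definition \<Gamma>m :: "'i \<Rightarrow> 'i \<Rightarrow> int set" where
  "\<Gamma>m i j = {k \<in> ZN. A i ((\<mu> ^^ nat k) j) < 0}"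

definition dd :: "'i \<Rightarrow> 'i \<Rightarrow> nat" where "dd i j = card (\<Gamma>m i j)"

definition d :: "'i \<Rightarrow> nat" where "d i = card (\<Gamma>p i i)"

definition orbit :: "'i \<Rightarrow> 'i set" where "orbit i = {(\<mu> ^^ n) i | n. True}"

definition simple :: "'i \<Rightarrow> 'i \<Rightarrow> int" where
  "simple i = (\<lambda>j. if j = i then 1 else 0)"

definition form :: "('i \<Rightarrow> int) \<Rightarrow> ('i \<Rightarrow> int) \<Rightarrow> int" where
  "form \<alpha> \<beta> = (\<Sum>i\<in>UNIV. \<Sum>j\<in>UNIV. \<alpha> i * A i j * \<beta> j)"

definition \<mu>Q :: "('i \<Rightarrow> int) \<Rightarrow> 'i \<Rightarrow> int" where
  "\<mu>Q \<alpha> = (\<Sum>i\<in>UNIV. (\<lambda>j. \<alpha> i * simple (\<mu> i) j))"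

subsection \<open>Structure polynomials and series\<close>

definition F :: "pm \<Rightarrow> 'i \<Rightarrow> 'i \<Rightarrow> poly3 \<Rightarrow> poly3 \<Rightarrow> poly3" where
  "F s i j z w = (\<Prod>k\<in>\<Gamma> i j. z - cst (\<xi> powi k * q powi (sg s * A i ((\<mu> ^^ nat k) j))) * w)"

definition G :: "pm \<Rightarrow> 'i \<Rightarrow> 'i \<Rightarrow> poly3 \<Rightarrow> poly3 \<Rightarrow> poly3" where
  "G s i j z w = (\<Prod>k\<in>\<Gamma> i j. cst (q powi (sg s * A i ((\<mu> ^^ nat k) j))) * z - cst (\<xi> powi k) * w)"

definition g :: "'i \<Rightarrow> 'i \<Rightarrow> complex fps" where
  "g i j = (\<Prod>k\<in>\<Gamma> i j.
     (fps_const (q powi A i ((\<mu> ^^ nat k) j)) - fps_const (\<xi> powi k) * fps_X) /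
     (1 - fps_const (\<xi> powi k * q powi A i ((\<mu> ^^ nat k) j)) * fps_X))"

fun fps_pm :: "pm \<Rightarrow> complex fps \<Rightarrow> complex fps" where
  "fps_pm Upper f = f"
| "fps_pm Lower f = inverse f"

definition p2 :: "pm \<Rightarrow> 'i \<Rightarrow> 'i \<Rightarrow> poly3 \<Rightarrow> poly3 \<Rightarrow> poly3" where
  "p2 s i j z w =
     (z ^ dd i i + cst (q powi (- sg s * int (dd i i))) * w ^ dd i i) *
     ((cst (q powi (sg s * 2 * int (dd i j))) * z ^ dd i j - w ^ dd i j) div
      (cst (q powi (sg s * 2 * int (d i))) * z ^ d i - w ^ d i))"

definition p3 :: "pm \<Rightarrow> 'i \<Rightarrow> poly3 \<Rightarrow> poly3 \<Rightarrow> poly3 \<Rightarrow> poly3" where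
  "p3 s i z1 z2 z3 =
     (let D = dd i i;
          r = (\<lambda>za zb.
            ((za ^ D - zb ^ D) * (za ^ D - cst (q powi (- sg s * 2 * int D)) * zb ^ D)) div
            ((za ^ d i - zb ^ d i) * (za ^ d i - cst (q powi (- sg s * 2 * int (d i))) * zb ^ d i)))
      in (cst (rt q powi (- sg s * 3 * int D)) * z1 ^ D
          - cst (rt q powi int D + rt q powi (- int D)) * z2 ^ D
          + cst (rt q powi (sg s * 3 * int D)) * z3 ^ D)
         * (r z1 z2 * r z1 z3 * r z2 z3))"

subsection \<open>Generating series and relations\<close>

definition k :: "('i \<Rightarrow> int) \<Rightarrow> 'i gens free_alg" where "k \<alpha> = gen (gK \<alpha>)"

definition x :: "pm \<Rightarrow> 'i \<Rightarrow> int \<Rightarrow> 'i gens free_alg" where "x s i m = gen (gX s i m)"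

definition qc :: "pm \<Rightarrow> 'i gens free_alg" where "qc s = gen (gC s)"

text \<open>\<open>qch n\<close> is \<open>q\<close> to the power \<open>n c / 2\<close>.\<close>

definition qch :: "int \<Rightarrow> 'i gens free_alg" where
  "qch n = (if n \<ge> 0 then qc Upper ^ nat n else qc Lower ^ nat (- n))"

text \<open>\<open>\<phi> s i m\<close> is the coefficient of \<open>z powi (-m)\<close> in \<open>\<phi>\<^sup>\<plusminus>\<^sub>i(z)\<close>; it vanishes if \<open>\<plusminus>m < 0\<close>.\<close>

definition \<phi> :: "pm \<Rightarrow> 'i \<Rightarrow> int \<Rightarrow> 'i gens free_alg" where
  "\<phi> s i m =
     (if sg s * m < 0 then 0
      else k (\<lambda>j. sg s * simple i j) *
        fps_exp_coeff
          (Abs_fps (\<lambda>n. if n = 0 then 0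
                        else sc (of_int (sg s) * (q - inverse q)) * gen (gH s i (n - 1))))
          (nat (sg s * m)))"

text \<open>The coefficient of \<open>u ^ l\<close> in \<open>g\<^sub>i\<^sub>j(q\<^sup>c u) ^ (-1) * g\<^sub>i\<^sub>j(q\<^sup>-\<^sup>c u)\<close>.\<close>

definition gg :: "'i \<Rightarrow> 'i \<Rightarrow> nat \<Rightarrow> 'i gens free_alg" where
  "gg i j l = (\<Sum>r\<le>l. sc (fps_nth (inverse (g i j)) r * fps_nth (g i j) (l - r)) *
                        qch (2 * int r - 2 * int (l - r)))"

text \<open>\<open>defrel u v\<close>: the relation \<open>u = v\<close> is imposed.  Identities of formal distributions are imposed
  coefficientwise, at \<open>z powi (-m) * w powi (-n)\<close> in \<open>Q4\<close> to \<open>Q7\<close>.  In \<open>Q4\<close>, \<open>Q5\<close>, \<open>Q6\<close> the sum over the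
  exponent \<open>l\<close> of \<open>w/z\<close>, \<open>w/z\<close>, \<open>z/w\<close> may be truncated since \<open>\<phi>\<close> vanishes in the other degrees.\<close>

inductive defrel :: "'i gens free_alg \<Rightarrow> 'i gens free_alg \<Rightarrow> bool" where
  Q0_x: "defrel (x s (\<mu> i) m) (sc (\<xi> powi m) * x s i m)"
| Q0_\<phi>: "defrel (\<phi> s (\<mu> i) m) (sc (\<xi> powi m) * \<phi> s i m)"
| Q0_k: "defrel (k (\<mu>Q \<alpha>)) (k \<alpha>)"
| Q1_ul: "defrel (qc Upper * qc Lower) 1"
| Q1_lu: "defrel (qc Lower * qc Upper) 1"
| Q1_central: "defrel (qc s * y) (y * qc s)"
| Q2_k: "defrel (k \<alpha> * k \<beta>) (k (\<alpha> + \<beta>))"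
| Q2_k0: "defrel (k 0) 1"
| Q2_\<phi>: "defrel (\<phi> s i m * \<phi> s j n) (\<phi> s j n * \<phi> s i m)"
| Q2_k\<phi>: "defrel (k \<alpha> * \<phi> s i m) (\<phi> s i m * k \<alpha>)"
| Q3: "defrel (k \<alpha> * x s i m * k (- \<alpha>))
         (sc (q powi (sg s * (\<Sum>n<N. form \<alpha> (simple ((\<mu> ^^ n) i))))) * x s i m)"
| Q4: "defrel (\<phi> Upper i m * \<phi> Lower j n)
         (\<Sum>l\<le>nat m. \<phi> Lower j (n + int l) * \<phi> Upper i (m - int l) * gg i j l)"
| Q5: "defrel (\<phi> Upper i m * x s j n)
         (\<Sum>l\<le>nat m. x s j (n + int l) * \<phi> Upper i (m - int l) *
            (sc (fps_nth (fps_pm s (g i j)) l) * qch (- sg s * int l)))"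
| Q6: "defrel (\<phi> Lower i m * x s j n)
         (\<Sum>l\<le>nat (- m). x s j (n - int l) * \<phi> Lower i (m + int l) *
            (sc (fps_nth (inverse (fps_pm s (g j i))) l) * qch (- sg s * int l)))"
| Q7: "defrel (x Upper i m * x Lower j n - x Lower j n * x Upper i m)
         (sc (1 / (q - inverse q)) *
          (\<Sum>r\<in>{r \<in> ZN. i = (\<mu> ^^ nat r) j}.
             sc (\<xi> powi (- r * n)) *
             (\<phi> Upper i (m + n) * qch (m - n) - \<phi> Lower i (m + n) * qch (n - m))))"
| Q8: "defrel (poly_act (F s i j (zv 0) (zv 1)) (\<lambda>m. x s i (m 0) * x s j (m 1)) m)
         (poly_act (G s i j (zv 0) (zv 1)) (\<lambda>m. x s j (m 1) * x s i (m 0)) m)"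
| Q9: "A i j < 0 \<Longrightarrow> i \<notin> orbit j \<Longrightarrow>
       defrel
         (\<Sum>\<sigma>\<in>{\<sigma>. \<sigma> permutes {0, 1}}.
            poly_act (p2 s i j (zv (\<sigma> 0)) (zv (\<sigma> 1)))
              (\<lambda>m. x s i (m (\<sigma> 0)) * x s i (m (\<sigma> 1)) * x s j (m 2)
                   - sc (qint (q ^ dd i j) 2) * x s i (m (\<sigma> 0)) * x s j (m 2) * x s i (m (\<sigma> 1))
                   + x s j (m 2) * x s i (m (\<sigma> 0)) * x s i (m (\<sigma> 1))) m)
         0"
| Q10: "dd i i > 0 \<Longrightarrow>
       defrel
         (\<Sum>\<sigma>\<in>{\<sigma>. \<sigma> permutes {0, 1, 2}}.
            poly_act (p3 s i (zv (\<sigma> 0)) (zv (\<sigma> 1)) (zv (\<sigma> 2)))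
              (\<lambda>m. x s i (m (\<sigma> 0)) * x s i (m (\<sigma> 1)) * x s i (m (\<sigma> 2))) m)
         0"

definition rel_ideal :: "'i gens free_alg set" where
  "rel_ideal = genideal free_ring {u - v | u v. defrel u v}"

definition Uq :: "'i gens free_alg set ring" where
  "Uq = free_ring Quot rel_ideal"

definition cls :: "'i gens free_alg \<Rightarrow> 'i gens free_alg set" where
  "cls u = rel_ideal +>\<^bsub>free_ring\<^esub> u"

definition is_representation ::
  "(complex \<Rightarrow> 'v \<Rightarrow> 'v :: ab_group_add) \<Rightarrow> ('i gens free_alg set \<Rightarrow> 'v \<Rightarrow> 'v) \<Rightarrow> bool" where
  "is_representation scale \<rho> \<longleftrightarrow>
     \<rho> \<in> ring_hom Uq (lin_end_ring scale) \<and> (\<forall>c. \<rho> (cls (sc c)) = scale c)"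

definition \<epsilon> :: "'i \<Rightarrow> complex" where
  "\<epsilon> i = (if dd i i > 0
          then rt (of_nat (d i) * qint q (int (d i)) / qint (rt q ^ dd i i) 2)
          else rt (of_nat (d i) * qint q (int (d i))))"

subsection \<open>Lattice data\<close>

definition orbit_sum :: "('i \<Rightarrow> int) \<Rightarrow> 'i \<Rightarrow> int" where
  "orbit_sum \<alpha> = (\<Sum>n<N. (\<mu>Q ^^ n) \<alpha>)"

text \<open>Since \<^const>\<open>orbit_sum\<close> is additive, its range is already a subgroup.\<close>

definition Q_orb :: "('i \<Rightarrow> int) set" where
  "Q_orb = range orbit_sum"

definition \<xi>' :: complex where "\<xi>' = (- 1) ^ N * \<xi>"

definition C :: "('i \<Rightarrow> int) \<Rightarrow> ('i \<Rightarrow> int) \<Rightarrow> complex" where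
  "C \<alpha> \<beta> = (\<Prod>n<N. (- (\<xi> powi (- int n))) powi form \<alpha> ((\<mu>Q ^^ n) \<beta>))"

definition \<xi>'_group :: "complex monoid" where
  "\<xi>'_group = \<lparr>carrier = range (\<lambda>n::int. \<xi>' powi n), monoid.mult = (*), one = 1\<rparr>"

definition Q_group :: "('i \<Rightarrow> int) monoid" where
  "Q_group = \<lparr>carrier = UNIV, monoid.mult = (+), one = 0\<rparr>"

end


section \<open>The central extension, its module, and the Fock space\<close>

text \<open>The tensor product of the polynomial algebra in the variables \<open>(i, n)\<close> with \<open>T\<close>; the variable
  \<open>(i, n)\<close> stands for \<open>\<alpha>\<^sub>i\<^sub>,\<^sub>m\<close> with \<open>m = -(n + 1)\<close>.  The symmetric algebra on the \<open>\<alpha>\<^sub>i\<^sub>,\<^sub>m\<close>, \<open>m < 0\<close>, is the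
  quotient of this polynomial algebra by the relations \<open>\<alpha>\<^sub>\<mu>\<^sub>(\<^sub>i\<^sub>)\<^sub>,\<^sub>m = \<xi>\<^sup>m \<alpha>\<^sub>i\<^sub>,\<^sub>m\<close> between them; correspondingly
  \<open>F\<^sub>T\<close> is the quotient by the subspace \<open>H0_space\<close> below.\<close>

type_synonym ('j, 'v) poly_tensor = "('j \<times> nat \<Rightarrow>\<^sub>0 nat) \<Rightarrow>\<^sub>0 'v"

text \<open>The section \<open>e\<close> has to be normalised on the simple roots by \<open>sec_\<mu>\<close> and \<open>sec_inv\<close>: without these,
  \<open>e\<close> may be changed by arbitrary roots of unity and the operators \<open>X\<close> violate \<open>Q0\<close> and \<open>Q7\<close>.\<close>

locale lattice_extension = twisted_cartan A \<mu> N \<xi> q rt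
  for A :: "'i::finite \<Rightarrow> 'i \<Rightarrow> int" and \<mu> N \<xi> q rt +
  fixes Qh :: "'g monoid"
    and \<iota> :: "complex \<Rightarrow> 'g"
    and bar :: "'g \<Rightarrow> 'i \<Rightarrow> int"
    and \<mu>h :: "'g \<Rightarrow> 'g"
    and e :: "('i \<Rightarrow> int) \<Rightarrow> 'g"
  assumes Qh_group: "group Qh"
    and \<iota>_hom: "\<iota> \<in> hom \<xi>'_group Qh"
    and \<iota>_inj: "inj_on \<iota> (carrier \<xi>'_group)"
    and bar_hom: "bar \<in> hom Qh Q_group"
    and bar_surj: "bar ` carrier Qh = carrier Q_group"
    and exact: "\<iota> ` carrier \<xi>'_group = kernel Qh Q_group bar"
    and central: "c \<in> carrier \<xi>'_group \<Longrightarrow> a \<in> carrier Qh \<Longrightarrow> \<iota> c \<otimes>\<^bsub>Qh\<^esub> a = a \<otimes>\<^bsub>Qh\<^esub> \<iota> c"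
    and commutator: "a \<in> carrier Qh \<Longrightarrow> b \<in> carrier Qh \<Longrightarrow>
      a \<otimes>\<^bsub>Qh\<^esub> b \<otimes>\<^bsub>Qh\<^esub> inv\<^bsub>Qh\<^esub> a \<otimes>\<^bsub>Qh\<^esub> inv\<^bsub>Qh\<^esub> b = \<iota> (C (bar a) (bar b))"
    and \<mu>h_auto: "\<mu>h \<in> iso Qh Qh"
    and bar_\<mu>h: "a \<in> carrier Qh \<Longrightarrow> bar (\<mu>h a) = \<mu>Q (bar a)"
    and \<mu>h_fixed: "a \<in> carrier Qh \<Longrightarrow> \<mu>Q (bar a) = bar a \<Longrightarrow> \<mu>h a = a"
    and sec_carrier: "e \<alpha> \<in> carrier Qh"
    and sec_bar: "bar (e \<alpha>) = \<alpha>"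
    and sec_\<mu>: "e (simple (\<mu> i)) = \<mu>h (e (simple i))"
    and sec_inv: "e (- simple i) = inv\<^bsub>Qh\<^esub> (e (simple i))"

text \<open>As usual for modules of such an extension, the subgroup of roots of unity acts by scalars.
  The power of \<open>\<xi>\<close> with exponent \<open>- \<langle>a\<^sub>0|\<beta>\<rangle> - \<langle>a\<^sub>0|a\<rangle>/2\<close> is written through \<open>rt \<xi>\<close>.\<close>

locale graded_module = lattice_extension A \<mu> N \<xi> q rt Qh \<iota> bar \<mu>h e
  for A :: "'i::finite \<Rightarrow> 'i \<Rightarrow> int" and \<mu> N \<xi> q rt
    and Qh :: "'g monoid" and \<iota> bar \<mu>h e +
  fixes scaleT :: "complex \<Rightarrow> 't \<Rightarrow> 't :: ab_group_add"
    and T :: "('i \<Rightarrow> int) \<Rightarrow> 't set"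
    and act :: "'g \<Rightarrow> 't \<Rightarrow> 't"
  assumes T_vector_space: "vector_space scaleT"
    and T_subspace: "\<gamma> \<in> Q_orb \<Longrightarrow> module.subspace scaleT (T \<gamma>)"
    and T_direct_sum: "\<exists>!f. (\<forall>\<gamma>\<in>Q_orb. f \<gamma> \<in> T \<gamma>) \<and> (\<forall>\<gamma>. \<gamma> \<notin> Q_orb \<longrightarrow> f \<gamma> = 0) \<and>
                             finite {\<gamma>. f \<gamma> \<noteq> 0} \<and> t = (\<Sum>\<gamma> | f \<gamma> \<noteq> 0. f \<gamma>)"
    and act_linear: "a \<in> carrier Qh \<Longrightarrow> Vector_Spaces.linear scaleT scaleT (act a)"
    and act_one: "act \<one>\<^bsub>Qh\<^esub> t = t"
    and act_mult: "a \<in> carrier Qh \<Longrightarrow> b \<in> carrier Qh \<Longrightarrow> act (a \<otimes>\<^bsub>Qh\<^esub> b) t = act a (act b t)"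
    and act_scalar: "c \<in> carrier \<xi>'_group \<Longrightarrow> act (\<iota> c) t = scaleT c t"
    and act_degree: "a \<in> carrier Qh \<Longrightarrow> t \<in> T (orbit_sum \<beta>) \<Longrightarrow>
      act a t \<in> T (orbit_sum (bar a + \<beta>))"
    and act_\<mu>h: "a \<in> carrier Qh \<Longrightarrow> t \<in> T (orbit_sum \<beta>) \<Longrightarrow>
      act (\<mu>h a) t =
      scaleT (rt \<xi> powi (- 2 * form (orbit_sum (bar a)) \<beta> - form (orbit_sum (bar a)) (bar a)))
        (act a t)"
begin

definition comp :: "('i \<Rightarrow> int) \<Rightarrow> 't \<Rightarrow> 't" where
  "comp \<gamma> t = (THE f. (\<forall>\<gamma>\<in>Q_orb. f \<gamma> \<in> T \<gamma>) \<and> (\<forall>\<gamma>. \<gamma> \<notin> Q_orb \<longrightarrow> f \<gamma> = 0) \<and>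
                      finite {\<gamma>. f \<gamma> \<noteq> 0} \<and> t = (\<Sum>\<gamma> | f \<gamma> \<noteq> 0. f \<gamma>)) \<gamma>"

text \<open>\<open>weight \<alpha> \<gamma>\<close> is \<open>\<langle>\<alpha>\<^sub>0|\<beta>\<rangle>\<close> for any \<open>\<beta>\<close> with \<open>\<beta>\<^sub>0 = \<gamma>\<close>; it equals \<open>\<langle>\<alpha>|\<gamma>\<rangle>\<close> as the form is invariant.\<close>

definition weight :: "('i \<Rightarrow> int) \<Rightarrow> ('i \<Rightarrow> int) \<Rightarrow> int" where
  "weight \<alpha> \<gamma> = form (orbit_sum \<alpha>) (SOME \<beta>. orbit_sum \<beta> = \<gamma>)"

definition pow_orbit :: "complex \<Rightarrow> ('i \<Rightarrow> int) \<Rightarrow> 't \<Rightarrow> 't" where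
  "pow_orbit c \<alpha> t = (\<Sum>\<gamma> | comp \<gamma> t \<noteq> 0. scaleT (c powi weight \<alpha> \<gamma>) (comp \<gamma> t))"

subsection \<open>Action of the Heisenberg algebra\<close>

definition scaleP :: "complex \<Rightarrow> ('i, 't) poly_tensor \<Rightarrow> ('i, 't) poly_tensor" where
  "scaleP c = Poly_Mapping.map (scaleT c)"

definition mult_var :: "'i \<times> nat \<Rightarrow> ('i, 't) poly_tensor \<Rightarrow> ('i, 't) poly_tensor" where
  "mult_var v f = (\<Sum>m\<in>Poly_Mapping.keys f.
     Poly_Mapping.single (m + Poly_Mapping.single v 1) (Poly_Mapping.lookup f m))"

definition deriv_var :: "'i \<times> nat \<Rightarrow> ('i, 't) poly_tensor \<Rightarrow> ('i, 't) poly_tensor" where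
  "deriv_var v f = (\<Sum>m\<in>Poly_Mapping.keys f.
     Poly_Mapping.single (m - Poly_Mapping.single v 1)
       (scaleT (of_nat (Poly_Mapping.lookup m v)) (Poly_Mapping.lookup f m)))"

definition H0_space :: "('i, 't) poly_tensor set" where
  "H0_space = module.span scaleP
     {mult_var (\<mu> i, n) f - scaleP (\<xi> powi (- int (n + 1))) (mult_var (i, n) f) | i n f. True}"

text \<open>The commutator \<open>[\<alpha>\<^sub>i\<^sub>,\<^sub>m, \<alpha>\<^sub>j\<^sub>,\<^sub>-\<^sub>m]\<close> of the Heisenberg algebra, where \<open>q\<^sup>c\<close> acts as \<open>q\<close>; the other
  commutators of the \<open>\<alpha>\<^sub>i\<^sub>,\<^sub>m\<close> vanish.\<close>

definition H1_scalar :: "'i \<Rightarrow> 'i \<Rightarrow> int \<Rightarrow> complex" where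
  "H1_scalar i j m = (1 / of_int m) *
     (\<Sum>r\<in>ZN. \<xi> powi (m * r) * qint q (m * form (simple i) ((\<mu>Q ^^ nat r) (simple j)))) * qint q m"

text \<open>\<open>\<alpha>\<^sub>i\<^sub>,\<^sub>m\<close> acts for \<open>m < 0\<close> as multiplication, for \<open>m > 0\<close> as the derivation whose values on the variables
  are prescribed by the commutators.\<close>

definition \<alpha>op :: "'i \<Rightarrow> int \<Rightarrow> ('i, 't) poly_tensor \<Rightarrow> ('i, 't) poly_tensor" where
  "\<alpha>op i m f =
     (if m < 0 then mult_var (i, nat (- m) - 1) f
      else if m > 0 then \<Sum>j\<in>UNIV. scaleP (H1_scalar i j m) (deriv_var (j, nat m - 1) f)
      else 0)"

definition onT :: "('t \<Rightarrow> 't) \<Rightarrow> ('i, 't) poly_tensor \<Rightarrow> ('i, 't) poly_tensor" where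
  "onT h = Poly_Mapping.map h"

subsection \<open>Vertex operators\<close>

text \<open>The coefficient of \<open>z powi (-m)\<close> in \<open>\<Phi>\<^sup>\<plusminus>\<^sub>i(z)\<close>, zero if \<open>\<plusminus>m < 0\<close>.\<close>

definition \<Phi> :: "pm \<Rightarrow> 'i \<Rightarrow> int \<Rightarrow> ('i, 't) poly_tensor \<Rightarrow> ('i, 't) poly_tensor" where
  "\<Phi> s i m f =
     (if sg s * m < 0 then 0
      else onT (pow_orbit (q powi sg s) (simple i))
        (opser_exp_coeff scaleP
          (\<lambda>n v. if n = 0 then 0
                 else scaleP (of_int (sg s) * (q - inverse q)) (\<alpha>op i (sg s * int n) v))
          (nat (sg s * m)) f))"

text \<open>\<open>E_minus s i r\<close> is the coefficient of \<open>z ^ r\<close> in \<open>E\<^sub>-(\<plusminus>\<alpha>\<^sub>i, q powr (\<mp>1/2) * z)\<close>, and \<open>E_plus s i r\<close> is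
  the coefficient of \<open>z powi (-r)\<close> in \<open>E\<^sub>+(\<plusminus>\<alpha>\<^sub>i, q powr (\<plusminus>1/2) * z)\<close>; both carry the factor
  \<open>q powr (\<mp>r/2)\<close>.\<close>

definition E_minus :: "pm \<Rightarrow> 'i \<Rightarrow> nat \<Rightarrow> ('i, 't) poly_tensor \<Rightarrow> ('i, 't) poly_tensor" where
  "E_minus s i r f = scaleP (rt q powi (- sg s * int r))
     (opser_exp_coeff scaleP
        (\<lambda>n v. if n = 0 then 0
               else scaleP (of_int (sg s) / qint q (int n)) (\<alpha>op i (- int n) v)) r f)"

definition E_plus :: "pm \<Rightarrow> 'i \<Rightarrow> nat \<Rightarrow> ('i, 't) poly_tensor \<Rightarrow> ('i, 't) poly_tensor" where
  "E_plus s i r f = scaleP (rt q powi (- sg s * int r))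
     (opser_exp_coeff scaleP
        (\<lambda>n v. if n = 0 then 0
               else scaleP (- of_int (sg s) / qint q (int n)) (\<alpha>op i (int n) v)) r f)"

text \<open>The coefficient of \<open>z powi (-m)\<close> in \<open>X\<^sup>\<plusminus>\<^sub>i(z)\<close>.  On vectors of degree \<open>\<gamma>\<close> the last factor is
  \<open>z\<close> to the power \<open>\<plusminus>weight + \<langle>\<alpha>\<^sub>i\<^sub>0|\<alpha>\<^sub>i\<rangle>/2\<close>; all exponents are doubled in order to stay in the integers.
  Applied to a given vector only finitely many summands are nonzero.\<close>

definition X :: "pm \<Rightarrow> 'i \<Rightarrow> int \<Rightarrow> ('i, 't) poly_tensor \<Rightarrow> ('i, 't) poly_tensor" where
  "X s i m f =
     (let S = (\<lambda>(\<gamma>, r, l).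
        if 2 * int r - 2 * int l + 2 * sg s * weight (simple i) \<gamma>
             + form (orbit_sum (simple i)) (simple i) = - 2 * m
        then E_minus s i r (E_plus s i l (onT (act (e (\<lambda>j. sg s * simple i j))) (onT (comp \<gamma>) f)))
        else 0)
      in Sum_any S)"

end

text \<open>\<open>F\<^sub>T\<close> with its canonical projection \<open>\<pi>\<close> from the polynomials with coefficients in \<open>T\<close>: any
  realisation of the quotient by \<open>H0_space\<close>.\<close>

locale fock_space = graded_module A \<mu> N \<xi> q rt Qh \<iota> bar \<mu>h e scaleT T act
  for A :: "'i::finite \<Rightarrow> 'i \<Rightarrow> int" and \<mu> N \<xi> q rt
    and Qh :: "'g monoid" and \<iota> bar \<mu>h e
    and scaleT :: "complex \<Rightarrow> 't \<Rightarrow> 't :: ab_group_add" and T act +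
  fixes scaleF :: "complex \<Rightarrow> 'f \<Rightarrow> 'f :: ab_group_add"
    and \<pi> :: "('i, 't) poly_tensor \<Rightarrow> 'f"
  assumes \<pi>_linear: "Vector_Spaces.linear scaleP scaleF \<pi>"
    and \<pi>_surj: "surj \<pi>"
    and \<pi>_kernel: "{v. \<pi> v = 0} = H0_space"

end

theory Submission
  imports Defs "HOL-Computational_Algebra.Polynomial_FPS"
begin

text \<open>Words in the generators act on polynomials with coefficients in \<open>T\<close> by composition: \<open>k\<^sub>\<alpha>\<close> as
  \<open>q\<close> to the power of the grading, \<open>h\<^sub>i\<^sub>,\<^sub>m\<close> as \<open>\<alpha>\<^sub>i\<^sub>,\<^sub>m\<close>, \<open>x\<^sub>i\<^sub>,\<^sub>m\<close> as \<open>\<epsilon>\<^sub>i X\<^sub>i\<^sub>,\<^sub>m\<close>.  The elements of the free algebra whose action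
  vanishes after projection to the Fock space form an ideal, so the theorem amounts to the validity
  of every defining relation there (\<open>defrel_sound\<close>).  Both sides of a relation are linear, so it is enough to
  apply them to vectors that are homogeneous for the grading of \<open>T\<close>.  On such vectors the zero modes are
  scalars and a current \<open>X\<^sub>i(z)\<close> is, up to a power of \<open>z\<close> and the operator \<open>e\<^sub>i\<close> of the central extension, the
  normally ordered product \<open>Y\<close> of an exponential of creation operators and one of annihilation operators
  (\<open>X_hom\<close>).

  The one computation behind all relations between series is the exchange of two exponentials whose
  exponents have a scalar commutator (\<open>E_E_commutator\<close>): it produces a scalar power series that is
  known through its logarithmic derivative.  For the Cartan currents this gives \<open>heisenberg_relation\<close>,
  \<open>\<Phi>_Upper_X\<close> and \<open>\<Phi>_Lower_X\<close>.  For two currents \<open>X\<close> the series is a product \<open>kap\<close> of linear factors and their inverses, so that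
  \<open>X\<^sub>i(z) X\<^sub>j(w)\<close> is a rational function, expanded for \<open>|w| < |z|\<close>, times the normally ordered product \<open>N2\<close>, which
  does not depend on the order of the factors (\<open>X_X\<close>, \<open>X_X_X\<close>).  The remaining relations are now statements about rational functions:

  \<^item> Multiplication by the polynomials of \<open>Q8\<close> clears the denominators of both expansions; the two
    resulting polynomials differ by the constant that the commutator map \<open>C\<close> contributes
    (\<open>quadratic_relation\<close>).

  \<^item> In the Serre relations \<open>Q9\<close> and \<open>Q10\<close> the linking condition turns the products over \<open>\<Gamma>\<close> into binomials in
    \<open>z\<^sup>d\<close>.  The sum over permutations mixes different expansions and does not vanish factor
    by factor; it cancels by identities in a module over the polynomial ring in which each inverse
    binomial is represented only by the equation that defines it (\<open>cubic_serre_identity\<close>,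
    \<open>quadratic_serre_identity\<close>).

  \<^item> For opposite currents in one orbit, \<open>X\<^sup>+\<^sub>i(z) X\<^sup>-\<^sub>i(w)\<close> and \<open>X\<^sup>-\<^sub>i(w) X\<^sup>+\<^sub>i(z)\<close> are the two expansions of the same rational function, whose
    poles are at \<open>z\<^sup>d = q\<^sup>\<plusminus>\<^sup>d w\<^sup>d\<close>.  Their difference is a combination of delta functions (\<open>kap_coeff_difference\<close>), and at
    \<open>z = q\<^sup>\<plusminus>\<^sup>1 w\<close> the normally ordered product collapses to \<open>\<Phi>\<^sup>\<plusminus>\<close> (\<open>collapse_to_\<Phi>\<close>).  The residues account for the
    constants \<open>\<epsilon>\<^sub>i\<close> (\<open>\<epsilon>_square\<close>).

  Relations that involve \<open>\<mu>\<close> hold only in the Fock space, not before the projection: there replacing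
  \<open>i\<close> by \<open>\<mu>(i)\<close> amounts to replacing \<open>z\<close> by \<open>\<xi>\<^sup>-\<^sup>1 z\<close>, for the Heisenberg part by definition of the Fock space and
  for the operators \<open>e\<^sub>i\<close> by their behaviour under the lift of \<open>\<mu>\<close> (\<open>X_similar\<close>, \<open>\<Phi>_similar\<close>).

  The exponent \<open>\<langle>\<alpha>\<^sub>i\<^sub>0|\<alpha>\<^sub>i\<rangle>/2\<close> of a current is an integer as soon as \<open>T\<close> is nonzero (\<open>even_orbit_form\<close>); if
  \<open>T\<close> is zero there is nothing to prove.\<close>

section \<open>Exponentials of operator series\<close>

lemma sum_triangle_swap:
  fixes h :: "nat \<Rightarrow> nat \<Rightarrow> 'v::comm_monoid_add"
  shows "(\<Sum>k\<le>n. \<Sum>j\<le>n - k. h k j) = (\<Sum>j\<le>n. \<Sum>k\<le>n - j. h k j)"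
  unfolding sum.Sigma[OF finite_atMost ballI[OF finite_atMost]]
  by (rule sum.reindex_bij_witness[of _ "\<lambda>(j, k). (k, j)" "\<lambda>(k, j). (j, k)"]) auto

lemma sum_triangle_diagonal:
  fixes h :: "nat \<Rightarrow> nat \<Rightarrow> 'v::comm_monoid_add"
  shows "(\<Sum>n\<le>l. \<Sum>k\<le>l - n. h n k) = (\<Sum>K\<le>l. \<Sum>n\<le>K. h n (K - n))"
  unfolding sum.Sigma[OF finite_atMost ballI[OF finite_atMost]]
  by (rule sum.reindex_bij_witness[of _ "\<lambda>(K, n). (n, K - n)" "\<lambda>(n, k). (n + k, n)"]) auto

text \<open>Together with its constant term a series is determined by \<open>X f'/f\<close>.  The scalar series below arise as
  exponentials of explicit series and are identified with rational functions in this way.\<close>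

definition log_deriv :: "complex fps \<Rightarrow> complex fps \<Rightarrow> bool" where
  "log_deriv f L \<longleftrightarrow> fps_X * fps_deriv f = L * f"

lemma log_deriv_nth:
  assumes "log_deriv f L"
  shows "of_nat n * fps_nth f n = (\<Sum>r\<le>n. fps_nth L r * fps_nth f (n - r))"
proof -
  have "fps_nth (fps_X * fps_deriv f) n = fps_nth (L * f) n"
    using assms by (simp add: log_deriv_def)
  moreover have "fps_nth (fps_X * fps_deriv f) n = of_nat n * fps_nth f n"
    by (cases n) (simp_all add: fps_X_mult_nth)
  ultimately show ?thesis by (simp add: fps_mult_nth atMost_atLeast0)
qed

text \<open>Linearity is stated by the two equations themselves, since the operators are composed and summed
  as plain functions.\<close>

locale complex_space = vector_space scale for scale :: "complex \<Rightarrow> 'v::ab_group_add \<Rightarrow> 'v"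
begin

definition lin :: "('v \<Rightarrow> 'v) \<Rightarrow> bool" where
  "lin f \<longleftrightarrow> (\<forall>u v. f (u + v) = f u + f v) \<and> (\<forall>c v. f (scale c v) = scale c (f v))"

lemma lin_iff: "Vector_Spaces.linear scale scale f \<longleftrightarrow> lin f"
proof
  assume "Vector_Spaces.linear scale scale f"
  then interpret f: Vector_Spaces.linear scale scale f .
  show "lin f" by (simp add: lin_def f.add f.scale)
next
  assume "lin f"
  then show "Vector_Spaces.linear scale scale f"
    by unfold_locales (auto simp: lin_def)
qed

lemma linI: "(\<And>u v. f (u + v) = f u + f v) \<Longrightarrow> (\<And>c v. f (scale c v) = scale c (f v)) \<Longrightarrow> lin f"
  by (simp add: lin_def)
lemma lin_add: "lin f \<Longrightarrow> f (u + v) = f u + f v" by (simp add: lin_def)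
lemma lin_scale: "lin f \<Longrightarrow> f (scale c v) = scale c (f v)" by (simp add: lin_def)
lemma lin_zero: "lin f \<Longrightarrow> f 0 = 0" by (metis lin_scale scale_zero_left)
lemma lin_minus: "lin f \<Longrightarrow> f (- v) = - f v"
  by (metis lin_add lin_zero add.right_inverse minus_unique)
lemma lin_diff: "lin f \<Longrightarrow> f (u - v) = f u - f v"
  by (metis lin_add lin_minus diff_conv_add_uminus)
lemma lin_sum: "lin f \<Longrightarrow> f (sum h S) = (\<Sum>i\<in>S. f (h i))"
  by (induction S rule: infinite_finite_induct) (simp_all add: lin_zero lin_add)
lemma lin_0 [intro!]: "lin (\<lambda>_. 0)" by (simp add: lin_def)
lemma lin_id [intro!]: "lin (\<lambda>v. v)" by (simp add: lin_def)
lemma lin_scale_fun: "lin f \<Longrightarrow> lin (\<lambda>v. scale c (f v))"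
  by (auto simp: lin_def scale_right_distrib mult.commute)
lemma lin_sum_fun: "(\<And>i. i \<in> S \<Longrightarrow> lin (h i)) \<Longrightarrow> lin (\<lambda>v. \<Sum>i\<in>S. h i v)"
  by (rule linI) (auto simp: sum.distrib lin_add lin_scale scale_sum_right)
lemma lin_add_fun: "lin f \<Longrightarrow> lin g \<Longrightarrow> lin (\<lambda>v. f v + g v)"
  by (rule linI) (auto simp: lin_add lin_scale scale_right_distrib)
lemma lin_comp: "lin f \<Longrightarrow> lin g \<Longrightarrow> lin (\<lambda>v. f (g v))"
  by (auto simp: lin_def)

lemmas lin_intros = lin_0 lin_id lin_scale_fun lin_sum_fun lin_add_fun

lemma scale_nat_cancel: "n > 0 \<Longrightarrow> scale (of_nat n) u = scale (of_nat n) v \<Longrightarrow> u = v"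
  by (metis scale_cancel_left of_nat_eq_0_iff neq0_conv)

text \<open>The conditions under which the finite sums \<open>opser_exp_coeff\<close> are the coefficients of an exponential: no
  constant term, and pairwise commuting linear coefficients.\<close>

definition exponentiable :: "(nat \<Rightarrow> 'v \<Rightarrow> 'v) \<Rightarrow> bool" where
  "exponentiable f \<longleftrightarrow> f 0 = (\<lambda>_. 0) \<and> (\<forall>n. lin (f n)) \<and> (\<forall>m n v. f m (f n v) = f n (f m v))"

lemma exponentiable_lin: "exponentiable f \<Longrightarrow> lin (f n)" by (simp add: exponentiable_def)
lemma exponentiable_0: "exponentiable f \<Longrightarrow> f 0 v = 0" by (simp add: exponentiable_def)
lemma exponentiable_comm: "exponentiable f \<Longrightarrow> f m (f n v) = f n (f m v)" by (simp add: exponentiable_def)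

abbreviation E :: "(nat \<Rightarrow> 'v \<Rightarrow> 'v) \<Rightarrow> nat \<Rightarrow> 'v \<Rightarrow> 'v" where
  "E \<equiv> opser_exp_coeff scale"

lemma opser_pow_zero: "exponentiable f \<Longrightarrow> n < p \<Longrightarrow> opser_pow f p n v = 0"
proof (induction p arbitrary: n)
  case (Suc p)
  have "f r (opser_pow f p (n - r) v) = 0" if "r \<le> n" for r
  proof (cases r)
    case 0 then show ?thesis using Suc.prems by (simp add: exponentiable_0)
  next
    case (Suc r')
    then have "opser_pow f p (n - r) v = 0" using that Suc.prems by (intro Suc.IH) auto
    then show ?thesis using Suc.prems by (simp add: lin_zero exponentiable_lin)
  qed
  then show ?case by simp
qed simp

lemma lin_opser_pow: "(\<And>n. lin (f n)) \<Longrightarrow> lin (opser_pow f p n)"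
proof (induction p arbitrary: n)
  case 0 then show ?case by (auto simp: lin_def)
next
  case (Suc p)
  have "lin (\<lambda>v. \<Sum>r\<le>n. f r (opser_pow f p (n - r) v))"
    by (rule lin_sum_fun, rule lin_comp[of "f _"]) (use Suc in auto)
  moreover have "opser_pow f (Suc p) n = (\<lambda>v. \<Sum>r\<le>n. f r (opser_pow f p (n - r) v))" by (rule ext) simp
  ultimately show ?case by (simp only:)
qed

lemma lin_E: "(\<And>n. lin (f n)) \<Longrightarrow> lin (E f n)"
proof -
  assume "\<And>n. lin (f n)"
  then have "lin (\<lambda>v. \<Sum>p\<le>n. scale (1 / fact p) (opser_pow f p n v))"
    by (intro lin_sum_fun lin_scale_fun lin_opser_pow)
  moreover have "E f n = (\<lambda>v. \<Sum>p\<le>n. scale (1 / fact p) (opser_pow f p n v))"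
    by (rule ext) (simp add: opser_exp_coeff_def)
  ultimately show ?thesis by (simp only:)
qed

text \<open>The rule \<open>X d/dX f\<^sup>p\<^sup>+\<^sup>1 = (p + 1) (X f') f\<^sup>p\<close>, valid since the coefficients commute.\<close>

lemma opser_pow_Suc_rec:
  assumes f: "exponentiable f"
  shows "scale (of_nat n) (opser_pow f (Suc p) n v) =
    scale (of_nat (Suc p)) (\<Sum>k\<le>n. scale (of_nat k) (f k (opser_pow f p (n - k) v)))"
proof (induction p arbitrary: n)
  case 0
  have z: "opser_pow f 0 (n - r) v = (if r = n then v else 0)" if "r \<le> n" for r
    using that by auto
  have "(\<Sum>r\<le>n. f r (opser_pow f 0 (n - r) v)) = (\<Sum>r\<le>n. if r = n then f n v else 0)"
    by (intro sum.cong refl) (auto simp: lin_zero exponentiable_lin[OF f])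
  moreover have "(\<Sum>r\<le>n. scale (of_nat r) (f r (opser_pow f 0 (n - r) v))) =
      (\<Sum>r\<le>n. if r = n then scale (of_nat n) (f n v) else 0)"
    by (intro sum.cong refl) (auto simp: lin_zero exponentiable_lin[OF f])
  ultimately show ?case by (simp add: sum.delta del: opser_pow.simps(1))
next
  case (Suc p)
  let ?P = "\<lambda>p n. opser_pow f p n v"
  let ?F = "\<Sum>k\<le>n. scale (of_nat k) (f k (?P (Suc p) (n - k)))"
  have "scale (of_nat n) (?P (Suc (Suc p)) n) = (\<Sum>k\<le>n. scale (of_nat n) (f k (?P (Suc p) (n - k))))"
    by (simp add: scale_sum_right)
  also have "\<dots> = (\<Sum>k\<le>n. scale (of_nat k) (f k (?P (Suc p) (n - k))) +
                      f k (scale (of_nat (n - k)) (?P (Suc p) (n - k))))"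
    by (intro sum.cong refl)
       (auto simp: lin_scale exponentiable_lin[OF f] scale_left_distrib[symmetric] of_nat_add[symmetric] simp del: of_nat_add opser_pow.simps)
  also have "\<dots> = ?F + (\<Sum>k\<le>n. f k (scale (of_nat (n - k)) (?P (Suc p) (n - k))))"
    by (simp add: sum.distrib del: opser_pow.simps)
  also have "(\<Sum>k\<le>n. f k (scale (of_nat (n - k)) (?P (Suc p) (n - k)))) =
     (\<Sum>k\<le>n. \<Sum>j\<le>n - k. scale (of_nat (Suc p) * of_nat j) (f j (f k (?P p (n - k - j)))))"
    by (intro sum.cong refl, subst Suc.IH)
       (simp only: lin_scale[OF exponentiable_lin[OF f]] lin_sum[OF exponentiable_lin[OF f]] scale_sum_right scale_scale exponentiable_comm[OF f])
  also have "\<dots> = (\<Sum>j\<le>n. \<Sum>k\<le>n - j. scale (of_nat (Suc p) * of_nat j) (f j (f k (?P p (n - k - j)))))"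
    by (rule sum_triangle_swap)
  also have "\<dots> = (\<Sum>j\<le>n. scale (of_nat (Suc p)) (scale (of_nat j) (f j (?P (Suc p) (n - j)))))"
  proof (intro sum.cong refl)
    fix j assume "j \<in> {..n}"
    have "(\<Sum>k\<le>n - j. f j (f k (?P p (n - k - j)))) = f j (?P (Suc p) (n - j))"
      by (simp add: lin_sum exponentiable_lin[OF f] add.commute)
    then show "(\<Sum>k\<le>n - j. scale (of_nat (Suc p) * of_nat j) (f j (f k (?P p (n - k - j))))) =
      scale (of_nat (Suc p)) (scale (of_nat j) (f j (?P (Suc p) (n - j))))"
      by (simp only: scale_sum_right[symmetric] scale_scale)
  qed
  also have "\<dots> = scale (of_nat (Suc p)) ?F" by (simp add: scale_sum_right del: opser_pow.simps of_nat_Suc)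
  finally show ?case
    by (simp only: of_nat_Suc[of "Suc p"] scale_left_distrib scale_one)
qed

lemma E_0: "E f 0 v = v" by (simp add: opser_exp_coeff_def)

lemma E_extend:
  assumes "exponentiable f" "n \<le> M"
  shows "E f n v = (\<Sum>p\<le>M. scale (1 / fact p) (opser_pow f p n v))"
  unfolding opser_exp_coeff_def
  by (rule sum.mono_neutral_left) (use assms in \<open>auto simp: opser_pow_zero\<close>)

text \<open>The differential equation \<open>X d/dX (exp f) = (X f') exp f\<close>; as a recursion it determines the
  exponential, and all further rules for exponentials are derived from it.\<close>

lemma E_rec:
  assumes f: "exponentiable f"
  shows "scale (of_nat n) (E f n v) = (\<Sum>k\<le>n. scale (of_nat k) (f k (E f (n - k) v)))"
proof (cases n)
  case (Suc N)
  let ?P = "\<lambda>p n. opser_pow f p n v"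
  have "scale (of_nat n) (E f n v) = (\<Sum>p\<le>n. scale (1 / fact p) (scale (of_nat n) (?P p n)))"
    by (simp add: opser_exp_coeff_def scale_sum_right mult.commute)
  also have "\<dots> = (\<Sum>p\<le>N. scale (1 / fact (Suc p)) (scale (of_nat n) (?P (Suc p) n)))"
    unfolding Suc by (subst sum.atMost_Suc_shift) simp
  also have "\<dots> = (\<Sum>p\<le>N. \<Sum>k\<le>n. scale (1 / fact p) (scale (of_nat k) (f k (?P p (n - k)))))"
  proof (intro sum.cong refl)
    fix p
    have e: "1 / fact (Suc p) * of_nat (Suc p) = (1 / fact p :: complex)"
      by (simp only: fact_Suc) (simp del: of_nat_Suc)
    show "scale (1 / fact (Suc p)) (scale (of_nat n) (?P (Suc p) n)) =
        (\<Sum>k\<le>n. scale (1 / fact p) (scale (of_nat k) (f k (?P p (n - k)))))"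
      by (simp only: opser_pow_Suc_rec[OF f] scale_scale[of _ "of_nat (Suc p)"] e scale_sum_right)
  qed
  also have "\<dots> = (\<Sum>k\<le>n. \<Sum>p\<le>N. scale (of_nat k) (f k (scale (1 / fact p) (?P p (n - k)))))"
    by (subst sum.swap) (simp add: lin_scale exponentiable_lin[OF f] mult.commute)
  also have "\<dots> = (\<Sum>k\<le>n. scale (of_nat k) (f k (E f (n - k) v)))"
  proof (intro sum.cong refl)
    fix k assume "k \<in> {..n}"
    show "(\<Sum>p\<le>N. scale (of_nat k) (f k (scale (1 / fact p) (?P p (n - k))))) =
      scale (of_nat k) (f k (E f (n - k) v))"
    proof (cases "k = 0")
      case False
      then have "E f (n - k) v = (\<Sum>p\<le>N. scale (1 / fact p) (?P p (n - k)))"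
        using Suc by (intro E_extend[OF f]) auto
      then show ?thesis by (simp add: lin_sum exponentiable_lin[OF f] scale_sum_right)
    qed simp
  qed
  finally show ?thesis .
qed simp

lemma E_unique:
  assumes f: "exponentiable f" and G0: "G 0 = v"
    and G: "\<And>n. scale (of_nat n) (G n) = (\<Sum>k\<le>n. scale (of_nat k) (f k (G (n - k))))"
  shows "G n = E f n v"
proof (induction n rule: less_induct)
  case (less n)
  show ?case
  proof (cases "n = 0")
    case False
    have "scale (of_nat n) (G n) = scale (of_nat n) (E f n v)"
      unfolding G E_rec[OF f]
    proof (intro sum.cong refl)
      fix k assume "k \<in> {..n}"
      then show "scale (of_nat k) (f k (G (n - k))) = scale (of_nat k) (f k (E f (n - k) v))"
        using less False by (cases "k = 0") auto
    qed
    then show ?thesis using False scale_nat_cancel[of n] by blast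
  qed (simp add: G0 E_0)
qed

lemma opser_pow_commute:
  assumes "lin h" "\<And>n v. h (f n v) = f n (h v)"
  shows "h (opser_pow f p n v) = opser_pow f p n (h v)"
  by (induction p arbitrary: n) (simp_all add: assms lin_sum lin_zero)

lemma E_commute:
  assumes "lin h" "\<And>n v. h (f n v) = f n (h v)"
  shows "h (E f n v) = E f n (h v)"
  by (simp add: opser_exp_coeff_def lin_sum lin_scale opser_pow_commute assms)

lemma E_E_commute:
  assumes "\<And>n. lin (f n)" "\<And>n. lin (g n)" "\<And>m n v. f m (g n v) = g n (f m v)"
  shows "E f m (E g n v) = E g n (E f m v)"
  using assms by (intro E_commute lin_E) (auto intro!: E_commute[symmetric])

lemma opser_pow_scaled:
  assumes "\<And>n. lin (f n)"
  shows "opser_pow (\<lambda>n v. scale (c ^ n) (f n v)) p n v = scale (c ^ n) (opser_pow f p n v)"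
proof (induction p arbitrary: n)
  case (Suc p)
  then show ?case
    by (auto simp: lin_scale assms scale_sum_right power_add[symmetric] intro!: sum.cong)
qed simp

lemma E_scaled:
  assumes "\<And>n. lin (f n)"
  shows "E (\<lambda>n v. scale (c ^ n) (f n v)) n v = scale (c ^ n) (E f n v)"
  by (simp add: opser_exp_coeff_def opser_pow_scaled assms scale_sum_right mult.commute)

text \<open>Coefficients indexed by the integers, zero in negative degree, so that shifted indices need no
  case distinction.\<close>

definition Ei :: "(nat \<Rightarrow> 'v \<Rightarrow> 'v) \<Rightarrow> int \<Rightarrow> 'v \<Rightarrow> 'v" where
  "Ei f r v = (if r < 0 then 0 else E f (nat r) v)"

lemma Ei_neg: "r < 0 \<Longrightarrow> Ei f r v = 0" by (simp add: Ei_def)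
lemma Ei_nat: "Ei f (int n) v = E f n v" by (simp add: Ei_def)
lemma Ei_0: "Ei f 0 v = v" by (simp add: Ei_def E_0)
lemma lin_Ei: "(\<And>n. lin (f n)) \<Longrightarrow> lin (Ei f n)"
  using lin_E[of f "nat n"] by (auto simp: lin_def Ei_def)

lemma Ei_commute:
  assumes "lin h" "\<And>n v. h (f n v) = f n (h v)"
  shows "h (Ei f n v) = Ei f n (h v)"
  by (simp add: Ei_def E_commute assms lin_zero)

lemma Ei_rec:
  assumes f: "exponentiable f" and M: "r \<le> int M"
  shows "scale (of_int r) (Ei f r v) = (\<Sum>k\<le>M. scale (of_nat k) (f k (Ei f (r - int k) v)))"
proof (cases "r < 0")
  case True
  then show ?thesis by (simp add: Ei_def lin_zero exponentiable_lin[OF f])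
next
  case False
  then obtain n where n: "r = int n" by (metis nat_eq_iff2 not_less)
  have "(\<Sum>k\<le>M. scale (of_nat k) (f k (Ei f (r - int k) v))) =
        (\<Sum>k\<le>n. scale (of_nat k) (f k (E f (n - k) v)))"
    using M n by (intro sum.mono_neutral_cong_right)
      (auto simp: Ei_def lin_zero exponentiable_lin[OF f] nat_diff_distrib simp flip: of_nat_diff)
  then show ?thesis using E_rec[OF f, of n v] n by (simp add: Ei_nat)
qed

text \<open>The rule \<open>[h, exp g] = [h, g] exp g\<close> for an operator \<open>h\<close> whose commutator with the series \<open>g\<close> is the scalar
  monomial \<open>\<kappa> X\<^sup>n\<close>.\<close>

lemma Ei_commutator:
  assumes g: "exponentiable g" and h: "lin h" and n: "n > 0"
    and c: "\<And>m v. m > 0 \<Longrightarrow> h (g m v) = g m (h v) + (if m = n then scale \<kappa> v else 0)"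
  shows "h (Ei g r v) = Ei g r (h v) + scale \<kappa> (Ei g (r - int n) v)"
proof (cases "r < 0")
  case True then show ?thesis by (simp add: Ei_def lin_zero[OF h])
next
  case False
  then obtain R where R: "r = int R" by (metis nat_eq_iff2 not_less)
  have "h (Ei g (int R) v) = Ei g (int R) (h v) + scale \<kappa> (Ei g (int R - int n) v)"
  proof (induction R rule: less_induct)
    case (less R)
    show ?case
    proof (cases "R = 0")
      case True then show ?thesis using n by (simp add: Ei_0 Ei_neg)
    next
      case False
      let ?e = "\<lambda>m. Ei g (int R - int m)"
      have s: "scale (of_nat m) (h (g m (?e m v))) =
         scale (of_nat m) (g m (?e m (h v))) +
         scale \<kappa> (scale (of_nat m) (g m (Ei g (int R - int n - int m) v))) +
         (if m = n then scale (of_nat n * \<kappa>) (?e n v) else 0)" if "m \<le> R" for m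
      proof (cases "m = 0")
        case True then show ?thesis using n by simp
      next
        case False
        have "h (?e m v) = ?e m (h v) + scale \<kappa> (Ei g (int R - int n - int m) v)"
          using less[of "R - m"] that False by (simp add: of_nat_diff algebra_simps)
        then have "g m (h (?e m v)) = g m (?e m (h v)) + scale \<kappa> (g m (Ei g (int R - int n - int m) v))"
          by (simp add: lin_add lin_scale exponentiable_lin[OF g])
        then show ?thesis using c[of m "?e m v"] False
          by (simp add: scale_right_distrib mult.commute)
      qed
      have "scale (of_nat R) (h (Ei g (int R) v)) = h (scale (of_int (int R)) (Ei g (int R) v))"
        by (simp add: lin_scale[OF h])
      also have "\<dots> = (\<Sum>m\<le>R. scale (of_nat m) (h (g m (?e m v))))"
        by (subst Ei_rec[OF g order.refl]) (simp add: lin_sum[OF h] lin_scale[OF h])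
      also have "\<dots> = (\<Sum>m\<le>R. scale (of_nat m) (g m (?e m (h v)))) +
         scale \<kappa> (\<Sum>m\<le>R. scale (of_nat m) (g m (Ei g (int R - int n - int m) v))) +
         (\<Sum>m\<le>R. if m = n then scale (of_nat n * \<kappa>) (?e n v) else 0)"
        using s by (simp add: sum.distrib scale_sum_right)
      also have "(\<Sum>m\<le>R. scale (of_nat m) (g m (?e m (h v)))) = scale (of_nat R) (Ei g (int R) (h v))"
        using Ei_rec[OF g order.refl, of R "h v"] by simp
      also have "(\<Sum>m\<le>R. scale (of_nat m) (g m (Ei g (int R - int n - int m) v))) =
          scale (of_int (int R - int n)) (Ei g (int R - int n) v)"
        by (rule Ei_rec[OF g, symmetric]) simp
      also have "(\<Sum>m\<le>R. if m = n then scale (of_nat n * \<kappa>) (?e n v) else 0) =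
          scale (of_nat n * \<kappa>) (?e n v)"
        by (auto simp: sum.delta Ei_neg)
      \<comment> \<open>The weights \<open>R - n\<close> and \<open>n\<close> of the two correction terms add up to \<open>R\<close>.\<close>
      finally have "scale (of_nat R) (h (Ei g (int R) v)) =
         scale (of_nat R) (Ei g (int R) (h v) + scale \<kappa> (Ei g (int R - int n) v))"
        by (simp add: scale_right_distrib scale_left_diff_distrib algebra_simps)
      then show ?thesis using False scale_nat_cancel[of R] by blast
    qed
  qed
  then show ?thesis using R by simp
qed

text \<open>The Baker-Campbell-Hausdorff formula \<open>exp f exp g = exp [f, g] exp g exp f\<close> for scalar commutators.  The
  factor \<open>exp [f, g]\<close> is proportional to any series \<open>C\<close> with the right logarithmic derivative; keeping \<open>C 0\<close> in the
  statement allows for series that are not normalised, such as the structure series \<open>g\<^sub>i\<^sub>j\<close>.  Both sides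
  satisfy the same recursion in the degree of \<open>exp f\<close>.\<close>

lemma E_E_commutator:
  assumes f: "exponentiable f" and g: "exponentiable g"
    and c: "\<And>n m v. n > 0 \<Longrightarrow> m > 0 \<Longrightarrow>
      f n (g m v) = g m (f n v) + (if m = n then scale (\<kappa> n) v else 0)"
    and C: "log_deriv C L" and L: "\<And>n. n > 0 \<Longrightarrow> fps_nth L n = of_nat n * \<kappa> n" and L0: "fps_nth L 0 = 0"
  shows "scale (fps_nth C 0) (E f l (Ei g r v)) =
    (\<Sum>k\<le>l. scale (fps_nth C k) (Ei g (r - int k) (E f (l - k) v)))"
proof (induction l rule: less_induct)
  case (less l)
  show ?case
  proof (cases "l = 0")
    case True then show ?thesis by (simp add: E_0)
  next
    case False
    let ?e = "\<lambda>K. Ei g (r - int K) (E f (l - K) v)"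
    have lg: "lin (Ei g s)" for s by (intro lin_Ei exponentiable_lin[OF g])
    have s: "scale (of_nat n) (f n (scale (fps_nth C 0) (E f (l - n) (Ei g r v)))) =
       (\<Sum>k\<le>l - n. scale (fps_nth C k) (Ei g (r - int k) (scale (of_nat n) (f n (E f (l - k - n) v)))))
       + (\<Sum>k\<le>l - n. scale (fps_nth L n * fps_nth C k) (?e (n + k)))" if "n \<le> l" for n
    proof (cases "n = 0")
      case True then show ?thesis by (simp add: L0 lin_zero[OF lg])
    next
      case False
      have *: "f n (Ei g (r - int k) w) = Ei g (r - int k) (f n w) + scale (\<kappa> n) (Ei g (r - int k - int n) w)" for k w
        using False c by (intro Ei_commutator[OF g exponentiable_lin[OF f]]) auto
      have "scale (of_nat n) (f n (scale (fps_nth C 0) (E f (l - n) (Ei g r v)))) =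
        scale (of_nat n) (\<Sum>k\<le>l - n. scale (fps_nth C k) (f n (Ei g (r - int k) (E f (l - n - k) v))))"
        using less[of "l - n"] False that by (simp add: lin_sum lin_scale exponentiable_lin[OF f])
      also have "\<dots> = (\<Sum>k\<le>l - n. scale (fps_nth C k) (Ei g (r - int k) (scale (of_nat n) (f n (E f (l - n - k) v)))) +
          scale (fps_nth L n * fps_nth C k) (Ei g (r - int k - int n) (E f (l - n - k) v)))"
        using False
        by (simp add: * L scale_sum_right scale_right_distrib lin_scale[OF lg] mult_ac)
      also have "\<dots> = (\<Sum>k\<le>l - n. scale (fps_nth C k) (Ei g (r - int k) (scale (of_nat n) (f n (E f (l - k - n) v)))) +
          scale (fps_nth L n * fps_nth C k) (?e (n + k)))"
        by (simp add: diff_diff_eq add.commute)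
      finally show ?thesis by (simp add: sum.distrib)
    qed
    have "scale (of_nat l) (scale (fps_nth C 0) (E f l (Ei g r v))) =
      (\<Sum>n\<le>l. scale (of_nat n) (f n (scale (fps_nth C 0) (E f (l - n) (Ei g r v)))))"
      unfolding scale_left_commute[of "of_nat l"] E_rec[OF f]
      by (simp add: scale_sum_right lin_scale exponentiable_lin[OF f] mult.commute)
    also have "\<dots> = (\<Sum>n\<le>l. \<Sum>k\<le>l - n. scale (fps_nth C k) (Ei g (r - int k) (scale (of_nat n) (f n (E f (l - k - n) v)))))
       + (\<Sum>n\<le>l. \<Sum>k\<le>l - n. scale (fps_nth L n * fps_nth C k) (?e (n + k)))"
      using s by (simp add: sum.distrib)
    also have "(\<Sum>n\<le>l. \<Sum>k\<le>l - n. scale (fps_nth C k) (Ei g (r - int k) (scale (of_nat n) (f n (E f (l - k - n) v))))) =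
       (\<Sum>k\<le>l. \<Sum>n\<le>l - k. scale (fps_nth C k) (Ei g (r - int k) (scale (of_nat n) (f n (E f (l - k - n) v)))))"
      by (rule sum_triangle_swap)
    also have "\<dots> = (\<Sum>k\<le>l. scale (fps_nth C k) (Ei g (r - int k) (scale (of_nat (l - k)) (E f (l - k) v))))"
      by (simp add: E_rec[OF f] lin_sum[OF lg] scale_sum_right del: of_nat_diff diff_diff_left)
    also have "(\<Sum>n\<le>l. \<Sum>k\<le>l - n. scale (fps_nth L n * fps_nth C k) (?e (n + k))) =
       (\<Sum>K\<le>l. \<Sum>n\<le>K. scale (fps_nth L n * fps_nth C (K - n)) (?e (n + (K - n))))"
      by (rule sum_triangle_diagonal)
    also have "\<dots> = (\<Sum>K\<le>l. scale (of_nat K * fps_nth C K) (?e K))"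
      by (simp add: log_deriv_nth[OF C] scale_sum_left)
    \<comment> \<open>The degree \<open>l - k\<close> from \<open>exp f\<close> and the degree \<open>k\<close> from \<open>C\<close> add up to the weight \<open>l\<close> of the left-hand side.\<close>
    also have "(\<Sum>k\<le>l. scale (fps_nth C k) (Ei g (r - int k) (scale (of_nat (l - k)) (E f (l - k) v)))) +
       (\<Sum>K\<le>l. scale (of_nat K * fps_nth C K) (?e K)) = (\<Sum>k\<le>l. scale (of_nat l) (scale (fps_nth C k) (?e k)))"
      unfolding sum.distrib[symmetric]
      by (intro sum.cong refl)
         (simp add: lin_scale[OF lg] lin_diff[OF lg] scale_left_diff_distrib of_nat_diff algebra_simps)
    finally have "scale (of_nat l) (scale (fps_nth C 0) (E f l (Ei g r v))) =
        scale (of_nat l) (\<Sum>k\<le>l. scale (fps_nth C k) (?e k))"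
      by (simp only: scale_sum_right)
    then show ?thesis using False scale_nat_cancel[of l] by blast
  qed
qed

lemma E_mult:
  assumes f: "exponentiable f" and g: "exponentiable g" and c: "\<And>m n v. f m (g n v) = g n (f m v)"
  shows "(\<Sum>k\<le>n. E f k (E g (n - k) v)) = E (\<lambda>n v. f n v + g n v) n v"
proof (rule E_unique)
  show "exponentiable (\<lambda>n v. f n v + g n v)"
    using f g c by (auto simp: exponentiable_def lin_add intro!: lin_intros)
  show "(\<Sum>k\<le>0. E f k (E g (0 - k) v)) = v" by (simp add: E_0)
  fix n
  have ratio_finite: "lin (E f k)" for k by (intro lin_E exponentiable_lin[OF f])
  have cg: "g j (E f k w) = E f k (g j w)" for j k w
    by (rule E_commute) (auto simp: c exponentiable_lin[OF g])
  have "scale (of_nat n) (\<Sum>k\<le>n. E f k (E g (n - k) v)) =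
    (\<Sum>k\<le>n. scale (of_nat k) (E f k (E g (n - k) v)) + E f k (scale (of_nat (n - k)) (E g (n - k) v)))"
    unfolding scale_sum_right
    by (intro sum.cong refl) (auto simp: lin_scale[OF ratio_finite] scale_left_distrib[symmetric] of_nat_add[symmetric] simp del: of_nat_add)
  also have "\<dots> = (\<Sum>k\<le>n. \<Sum>j\<le>k. scale (of_nat j) (f j (E f (k - j) (E g (n - k) v)))) +
     (\<Sum>k\<le>n. \<Sum>j\<le>n - k. scale (of_nat j) (g j (E f k (E g (n - k - j) v))))"
  proof -
    have "E f k (scale (of_nat (n - k)) (E g (n - k) v)) =
        (\<Sum>j\<le>n - k. scale (of_nat j) (g j (E f k (E g (n - k - j) v))))" for k
      unfolding E_rec[OF g] by (simp only: lin_sum[OF ratio_finite] lin_scale[OF ratio_finite] cg)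
    then show ?thesis by (simp add: sum.distrib E_rec[OF f] del: of_nat_diff diff_diff_left)
  qed
  also have "(\<Sum>k\<le>n. \<Sum>j\<le>k. scale (of_nat j) (f j (E f (k - j) (E g (n - k) v)))) =
     (\<Sum>j\<le>n. \<Sum>k\<le>n - j. scale (of_nat j) (f j (E f k (E g (n - j - k) v))))"
    using sum_triangle_diagonal[of "\<lambda>j k. scale (of_nat j) (f j (E f k (E g (n - j - k) v)))" n]
    by (simp add: diff_diff_eq)
  also have "(\<Sum>k\<le>n. \<Sum>j\<le>n - k. scale (of_nat j) (g j (E f k (E g (n - k - j) v)))) =
     (\<Sum>j\<le>n. \<Sum>k\<le>n - j. scale (of_nat j) (g j (E f k (E g (n - j - k) v))))"
    by (subst sum_triangle_swap) (simp add: Nat.diff_commute add.commute)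
  also have "(\<Sum>j\<le>n. \<Sum>k\<le>n - j. scale (of_nat j) (f j (E f k (E g (n - j - k) v)))) +
     (\<Sum>j\<le>n. \<Sum>k\<le>n - j. scale (of_nat j) (g j (E f k (E g (n - j - k) v)))) =
     (\<Sum>j\<le>n. scale (of_nat j) (f j (\<Sum>k\<le>n - j. E f k (E g (n - j - k) v)) + g j (\<Sum>k\<le>n - j. E f k (E g (n - j - k) v))))"
    by (simp add: sum.distrib lin_sum exponentiable_lin[OF f] exponentiable_lin[OF g] scale_right_distrib scale_sum_right)
  finally show "scale (of_nat n) (\<Sum>k\<le>n. E f k (E g (n - k) v)) = \<dots>" .
qed

lemma E_zero: "E (\<lambda>_ _. 0) n v = (if n = 0 then v else 0)"
proof -
  have "(\<lambda>n. if n = 0 then v else 0) n = E (\<lambda>_ _. 0) n v"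
    by (rule E_unique) (auto simp: exponentiable_def)
  then show ?thesis by simp
qed

end

lemma log_deriv_iff:
  "log_deriv f L \<longleftrightarrow> (\<forall>n. of_nat n * fps_nth f n = (\<Sum>r\<le>n. fps_nth L r * fps_nth f (n - r)))"
proof
  assume *: "\<forall>n. of_nat n * fps_nth f n = (\<Sum>r\<le>n. fps_nth L r * fps_nth f (n - r))"
  have "fps_nth (fps_X * fps_deriv f) n = of_nat n * fps_nth f n" for n
    by (cases n) (simp_all add: fps_X_mult_nth)
  then show "log_deriv f L"
    unfolding log_deriv_def using * by (intro fps_ext) (simp add: fps_mult_nth atMost_atLeast0)
qed (use log_deriv_nth in blast)

lemma log_deriv_1: "log_deriv 1 0" by (simp add: log_deriv_def)

lemma log_deriv_mult: "log_deriv f L \<Longrightarrow> log_deriv g M \<Longrightarrow> log_deriv (f * g) (L + M)"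
proof -
  assume a: "log_deriv f L" "log_deriv g M"
  have "fps_X * fps_deriv (f * g) = (fps_X * fps_deriv f) * g + f * (fps_X * fps_deriv g)"
    by (simp add: algebra_simps)
  also have "\<dots> = (L + M) * (f * g)"
    using a by (simp add: log_deriv_def) (simp add: algebra_simps)
  finally show ?thesis by (simp add: log_deriv_def)
qed

lemma log_deriv_const: "log_deriv f L \<Longrightarrow> log_deriv (fps_const c * f) L"
  unfolding log_deriv_def by (simp add: mult.left_commute)

lemma log_deriv_inverse:
  assumes "fps_nth f 0 \<noteq> 0" "log_deriv f L"
  shows "log_deriv (inverse f) (- L)"
proof -
  have i: "inverse f * f = 1" using assms(1) by (rule inverse_mult_eq_1)
  have "fps_X * fps_deriv (inverse f) = - (fps_X * fps_deriv f) * (inverse f)\<^sup>2"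
    using assms(1) by (simp add: fps_inverse_deriv)
  also have "\<dots> = - L * (inverse f * f) * inverse f"
    using assms(2) by (simp add: log_deriv_def power2_eq_square mult_ac)
  finally show ?thesis by (simp add: log_deriv_def i)
qed

lemma log_deriv_prod:
  "(\<And>k. k \<in> S \<Longrightarrow> log_deriv (f k) (L k)) \<Longrightarrow> log_deriv (prod f S) (sum L S)"
  by (induction S rule: infinite_finite_induct) (auto simp: log_deriv_1 intro: log_deriv_mult)

definition geo :: "complex \<Rightarrow> complex fps" where
  "geo c = Abs_fps (\<lambda>n. if n = 0 then 0 else c ^ n)"

lemma log_deriv_linear: "log_deriv (1 - fps_const c * fps_X) (- geo c)"
proof -
  have e: "geo c * (1 - fps_const c * fps_X) = fps_const c * fps_X"
  proof (rule fps_ext)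
    fix n
    have "geo c * (1 - fps_const c * fps_X) = geo c - fps_const c * (fps_X * geo c)"
      by (simp add: algebra_simps)
    then show "fps_nth (geo c * (1 - fps_const c * fps_X)) n = fps_nth (fps_const c * fps_X) n"
      by (cases n) (auto simp: geo_def fps_X_mult_nth fps_X_nth)
  qed
  have d: "fps_deriv (1 - fps_const c * fps_X) = - fps_const c" by simp
  show ?thesis
    unfolding log_deriv_def d mult_minus_left e by (simp only: mult_minus_right mult.commute)
qed

lemma log_deriv_scaled:
  assumes "log_deriv f L"
  shows "log_deriv (Abs_fps (\<lambda>n. c ^ n * fps_nth f n)) (Abs_fps (\<lambda>n. c ^ n * fps_nth L n))"
  unfolding log_deriv_iff
proof
  fix n
  have "of_nat n * (c ^ n * fps_nth f n) = c ^ n * (\<Sum>r\<le>n. fps_nth L r * fps_nth f (n - r))"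
    using log_deriv_nth[OF assms, of n] by simp
  also have "\<dots> = (\<Sum>r\<le>n. (c ^ r * fps_nth L r) * (c ^ (n - r) * fps_nth f (n - r)))"
    unfolding sum_distrib_left
  proof (intro sum.cong refl)
    fix r assume "r \<in> {..n}"
    then have "c ^ n = c ^ r * c ^ (n - r)" by (simp add: power_add[symmetric])
    then show "c ^ n * (fps_nth L r * fps_nth f (n - r)) = c ^ r * fps_nth L r * (c ^ (n - r) * fps_nth f (n - r))"
      by simp
  qed
  finally show "of_nat n * fps_nth (Abs_fps (\<lambda>n. c ^ n * fps_nth f n)) n =
     (\<Sum>r\<le>n. fps_nth (Abs_fps (\<lambda>n. c ^ n * fps_nth L n)) r * fps_nth (Abs_fps (\<lambda>n. c ^ n * fps_nth f n)) (n - r))"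
    by simp
qed

section \<open>Polynomials acting on formal distributions\<close>

text \<open>The action of a polynomial on a module on which its variable acts by \<open>T\<close>.  Iterating it three times makes
  the distributions a module over \<open>poly3\<close>, so that polynomial identities apply to them.\<close>

definition pol :: "('a::comm_ring_1 \<Rightarrow> 'm::ab_group_add \<Rightarrow> 'm) \<Rightarrow> ('m \<Rightarrow> 'm) \<Rightarrow> 'a poly \<Rightarrow> 'm \<Rightarrow> 'm" where
  "pol act T P v = (\<Sum>i\<le>degree P. act (coeff P i) ((T ^^ i) v))"

locale poly_module = module act for act :: "'a::comm_ring_1 \<Rightarrow> 'm::ab_group_add \<Rightarrow> 'm" +
  fixes T :: "'m \<Rightarrow> 'm"
  assumes T_add: "T (u + v) = T u + T v"
    and T_act: "T (act a v) = act a (T v)"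
begin

lemma pow_add: "(T ^^ i) (u + v) = (T ^^ i) u + (T ^^ i) v"
  by (induction i) (simp_all add: T_add)
lemma T_0: "T 0 = 0" using T_add[of 0 0] by simp
lemma T_sum: "T (sum h S) = (\<Sum>i\<in>S. T (h i))"
  by (induction S rule: infinite_finite_induct) (simp_all add: T_add T_0)

lemma pol_extend: "degree P \<le> M \<Longrightarrow> pol act T P v = (\<Sum>i\<le>M. act (coeff P i) ((T ^^ i) v))"
  unfolding pol_def by (rule sum.mono_neutral_left) (auto simp: coeff_eq_0)

lemma pol_add: "pol act T (P + Q) v = pol act T P v + pol act T Q v"
proof -
  define M where "M = max (degree P) (degree Q)"
  have "degree (P + Q) \<le> M" "degree P \<le> M" "degree Q \<le> M"
    by (auto simp: M_def degree_add_le_max)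
  then show ?thesis
    by (simp add: pol_extend[of _ M] sum.distrib scale_left_distrib)
qed

lemma pol_smult: "pol act T (smult a P) v = act a (pol act T P v)"
  using pol_extend[OF degree_smult_le, of a P v] by (simp add: pol_def scale_sum_right)

lemma pol_pCons: "pol act T (pCons a P) v = act a v + T (pol act T P v)"
proof -
  have "pol act T (pCons a P) v = (\<Sum>i\<le>Suc (degree P). act (coeff (pCons a P) i) ((T ^^ i) v))"
    by (rule pol_extend) (rule degree_pCons_le)
  also have "\<dots> = act a v + T (pol act T P v)"
    by (subst sum.atMost_Suc_shift) (simp add: pol_def T_sum T_act)
  finally show ?thesis .
qed

lemma pol_add_right: "pol act T P (u + v) = pol act T P u + pol act T P v"
  by (simp add: pol_def pow_add scale_right_distrib sum.distrib)
lemma pol_0: "pol act T 0 v = 0" by (simp add: pol_def)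
lemma pol_1: "pol act T 1 v = v" by (simp add: pol_def)
lemma pol_const: "pol act T [:a:] v = act a v" by (simp add: pol_def)
lemma pol_X: "pol act T [:0, 1:] v = T v" by (simp add: pol_pCons pol_0 T_0)

lemma pol_mult: "pol act T (P * Q) v = pol act T P (pol act T Q v)"
proof (induction P)
  case (pCons a P)
  have "pol act T (pCons a P * Q) v = act a (pol act T Q v) + T (pol act T (P * Q) v)"
    by (simp add: pol_add pol_smult pol_pCons)
  then show ?case using pCons by (simp add: pol_pCons)
qed (simp add: pol_0)

lemma module_pol: "module (pol act T)"
  by unfold_locales (simp_all add: pol_add_right pol_add pol_mult pol_1)

lemma poly_module_pol:
  assumes "\<And>u v. U (u + v) = U u + U v" "\<And>a v. U (act a v) = act a (U v)" "\<And>v. U (T v) = T (U v)"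
  shows "poly_module (pol act T) U"
proof -
  interpret p: module "pol act T" by (rule module_pol)
  have U0: "U 0 = 0" using assms(1)[of 0 0] by simp
  have Us: "U (sum h S) = (\<Sum>i\<in>S. U (h i))" for h and S :: "nat set"
    by (induction S rule: infinite_finite_induct) (simp_all add: U0 assms(1))
  have Up: "U ((T ^^ i) v) = (T ^^ i) (U v)" for i v by (induction i) (simp_all add: assms(3))
  show ?thesis
    by unfold_locales (simp_all add: assms(1), simp add: pol_def Us assms(2) Up)
qed

end

text \<open>The truncation at 2 mirrors \<open>poly_act\<close>, where the exponent of the third variable shifts all indices beyond 1.\<close>

definition sv :: "nat \<Rightarrow> int \<Rightarrow> nat \<Rightarrow> int" where
  "sv t n = (\<lambda>u. if min u 2 = t then n else 0)"

lemma sv_add: "sv t (m + n) = sv t m + sv t n" by (auto simp: sv_def fun_eq_iff)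
lemma sv_diff: "sv t (m - n) = sv t m - sv t n" by (auto simp: sv_def fun_eq_iff)
lemma sv_minus: "sv t (- n) = - sv t n" by (auto simp: sv_def fun_eq_iff)
lemma sv_0 [simp]: "sv t 0 = 0" by (auto simp: sv_def fun_eq_iff)
lemma sv_apply: "u \<le> 2 \<Longrightarrow> sv t n u = (if t = u then n else 0)" by (auto simp: sv_def)

type_synonym idx = "nat \<Rightarrow> int"

definition Tz :: "nat \<Rightarrow> (idx \<Rightarrow> 'v) \<Rightarrow> idx \<Rightarrow> 'v" where
  "Tz t D m = D (m + sv t 1)"

lemma Tz_add: "Tz t (D + D') = Tz t D + Tz t D'" by (simp add: Tz_def fun_eq_iff)
lemma Tz_commute: "Tz t (Tz u D) = Tz u (Tz t D)" by (simp add: Tz_def fun_eq_iff add_ac)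
lemma Tz_pow: "(Tz t ^^ n) D m = D (m + sv t (int n))"
  by (induction n arbitrary: m) (simp_all add: Tz_def sv_add[of _ 1] add_ac)

context complex_space
begin

definition scf :: "complex \<Rightarrow> (idx \<Rightarrow> 'v) \<Rightarrow> idx \<Rightarrow> 'v" where "scf c D m = scale c (D m)"

definition pact :: "poly3 \<Rightarrow> (idx \<Rightarrow> 'v) \<Rightarrow> idx \<Rightarrow> 'v" where
  "pact = pol (pol (pol scf (Tz 0)) (Tz (Suc 0))) (Tz 2)"

lemma Tz_scf: "Tz t (scf c D) = scf c (Tz t D)" by (simp add: Tz_def scf_def fun_eq_iff)

lemma poly_module0: "poly_module scf (Tz t)"
  by unfold_locales
     (auto simp: scf_def fun_eq_iff scale_right_distrib scale_left_distrib Tz_def)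

lemma poly_module1: "poly_module (pol scf (Tz 0)) (Tz t)"
  by (rule poly_module.poly_module_pol[OF poly_module0]) (simp_all add: Tz_add Tz_scf Tz_commute)

lemma poly_module2: "poly_module (pol (pol scf (Tz 0)) (Tz (Suc 0))) (Tz t)"
  by (rule poly_module.poly_module_pol[OF poly_module1])
     (simp_all add: Tz_add poly_module.T_act[OF poly_module1] Tz_commute)

lemma module_pact: "module pact" unfolding pact_def by (rule poly_module.module_pol[OF poly_module2])

lemma pact_mult: "pact (P * Q) D = pact P (pact Q D)" by (simp add: pact_def poly_module.pol_mult[OF poly_module2])
lemma pact_1: "pact 1 D = D" by (simp add: pact_def poly_module.pol_1[OF poly_module2])
lemma pact_add_right: "pact P (D + D') = pact P D + pact P D'" by (simp add: pact_def poly_module.pol_add_right[OF poly_module2])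
lemma pact_cst: "pact (cst c) D = scf c D"
  by (simp add: pact_def cst_def poly_module.pol_const[OF poly_module2] poly_module.pol_const[OF poly_module1] poly_module.pol_const[OF poly_module0])
lemma pact_zv: "t \<le> 2 \<Longrightarrow> pact (zv t) D = Tz t D"
  by (auto simp: pact_def zv_def poly_module.pol_const[OF poly_module2] poly_module.pol_const[OF poly_module1] poly_module.pol_const[OF poly_module0] poly_module.pol_X[OF poly_module2] poly_module.pol_X[OF poly_module1] poly_module.pol_X[OF poly_module0] le_Suc_eq numeral_2_eq_2)
lemma pact_diff: "pact (P - Q) D = pact P D - pact Q D"
  by (rule module.scale_left_diff_distrib[OF module_pact])
lemma pact_minus: "pact (- P) D = - pact P D"
  by (rule module.scale_minus_left[OF module_pact])
lemma pact_diff_right: "pact P (D - D') = pact P D - pact P D'"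
  by (rule module.scale_right_diff_distrib[OF module_pact])
lemma pact_minus_right: "pact P (- D) = - pact P D"
  by (rule module.scale_minus_right[OF module_pact])
lemma pact_0_right: "pact P 0 = 0"
  by (rule module.scale_zero_right[OF module_pact])
lemma pact_commute: "pact P (pact Q D) = pact Q (pact P D)"
  by (simp add: pact_mult[symmetric] mult.commute)
lemma pact_zv_power: "t \<le> 2 \<Longrightarrow> pact (zv t ^ n) D = (\<lambda>m. D (m + sv t (int n)))"
  by (induction n) (auto simp: pact_1 pact_mult pact_zv Tz_def fun_eq_iff sv_add add_ac)

definition mono_set :: "poly3 \<Rightarrow> (nat \<times> nat \<times> nat) set" where
  "mono_set P = (SIGMA c:{..degree P}. SIGMA b:{..degree (coeff P c)}. {..degree (coeff (coeff P c) b)})"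
definition mono_cf :: "poly3 \<Rightarrow> nat \<times> nat \<times> nat \<Rightarrow> complex" where
  "mono_cf P = (\<lambda>(c, b, a). coeff (coeff (coeff P c) b) a)"
definition mono_sh :: "nat \<times> nat \<times> nat \<Rightarrow> idx" where
  "mono_sh = (\<lambda>(c, b, a). sv 0 (int a) + sv 1 (int b) + sv 2 (int c))"

lemma finite_mono_set: "finite (mono_set P)" by (simp add: mono_set_def)

lemma sum_fun_apply: "(sum h S) m = (\<Sum>i\<in>S. h i m)"
  for h :: "'a \<Rightarrow> 'b \<Rightarrow> 'c::comm_monoid_add"
  by (induction S rule: infinite_finite_induct) simp_all

lemma pact_nested: "pact P D m = (\<Sum>c\<le>degree P. \<Sum>b\<le>degree (coeff P c). \<Sum>a\<le>degree (coeff (coeff P c) b).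
        scale (coeff (coeff (coeff P c) b) a) (D (m + (sv 0 (int a) + sv 1 (int b) + sv 2 (int c)))))"
  by (simp add: pact_def pol_def sum_fun_apply scf_def Tz_pow add_ac)

lemma pact_form: "pact P D m = (\<Sum>i\<in>mono_set P. scale (mono_cf P i) (D (m + mono_sh i)))"
  unfolding pact_nested mono_set_def
  by (simp add: sum.Sigma mono_cf_def mono_sh_def split_def)

end

section \<open>Expansions of rational functions in ratios of variables\<close>

lemma Sum_any_atMost:
  fixes g :: "nat \<Rightarrow> 'v::comm_monoid_add"
  assumes "\<And>l. l > M \<Longrightarrow> g l = 0"
  shows "Sum_any g = (\<Sum>l\<le>M. g l)"
  by (rule Sum_any.expand_superset) (auto, metis assms not_le)

lemma bound_uniform:
  assumes "finite S" "\<And>i. i \<in> S \<Longrightarrow> \<exists>L::nat. \<forall>l>L. P i l"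
  shows "\<exists>L. \<forall>i\<in>S. \<forall>l>L. P i l"
  using assms
proof (induction S rule: finite_induct)
  case (insert x F)
  then obtain L1 L2 where "\<forall>i\<in>F. \<forall>l>L1. P i l" "\<forall>l>L2. P x l" by (metis insertCI)
  then show ?case by (intro exI[of _ "max L1 L2"]) auto
qed simp

text \<open>The following conditions ensure that expansions in \<open>z\<^sub>b/z\<^sub>a\<close>, \<open>z\<^sub>c/z\<^sub>a\<close> and \<open>z\<^sub>c/z\<^sub>b\<close> exist and may be composed.\<close>

definition arrangement :: "nat \<Rightarrow> nat \<Rightarrow> nat \<Rightarrow> bool" where
  "arrangement a b c \<longleftrightarrow> a \<le> 2 \<and> b \<le> 2 \<and> c \<le> 2 \<and> a \<noteq> b \<and> a \<noteq> c \<and> b \<noteq> c"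

text \<open>An expansion moves index weight from a variable to a later one.  Unlike separate bounds for the
  three indices, the bounds for the partial sums from the last variable on survive such moves.\<close>

definition cone_supported :: "nat \<Rightarrow> nat \<Rightarrow> nat \<Rightarrow> (idx \<Rightarrow> 'v::zero) \<Rightarrow> bool" where
  "cone_supported a b c N \<longleftrightarrow> (\<exists>K. \<forall>m. N m \<noteq> 0 \<longrightarrow> m c \<le> K \<and> m b + m c \<le> K \<and> m a + m b + m c \<le> K)"

definition bounded_idx :: "(idx \<Rightarrow> 'v::zero) \<Rightarrow> bool" where
  "bounded_idx N \<longleftrightarrow> (\<exists>K. \<forall>m. N m \<noteq> 0 \<longrightarrow> m 0 \<le> K \<and> m 1 \<le> K \<and> m 2 \<le> K)"

definition ratio_finite :: "nat \<Rightarrow> nat \<Rightarrow> (idx \<Rightarrow> 'v::zero) \<Rightarrow> bool" where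
  "ratio_finite a b N \<longleftrightarrow> (\<forall>m. \<exists>L::nat. \<forall>l>L. N (m + sv a (- int l) + sv b (int l)) = 0)"

definition in_order :: "nat \<Rightarrow> nat \<Rightarrow> nat \<Rightarrow> nat \<Rightarrow> nat \<Rightarrow> bool" where
  "in_order a b c x y \<longleftrightarrow> x = a \<and> y = b \<or> x = a \<and> y = c \<or> x = b \<and> y = c"

lemma arrangement_cases:
  assumes "arrangement a b c"
  obtains "a = 0" "b = 1" "c = 2" | "a = 0" "b = 2" "c = 1" | "a = 1" "b = 0" "c = 2"
    | "a = 1" "b = 2" "c = 0" | "a = 2" "b = 0" "c = 1" | "a = 2" "b = 1" "c = 0"
proof -
  have "a = 0 \<or> a = 1 \<or> a = 2" "b = 0 \<or> b = 1 \<or> b = 2" "c = 0 \<or> c = 1 \<or> c = 2"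
    using assms by (auto simp: arrangement_def)
  then show ?thesis using assms that by (auto simp: arrangement_def)
qed

lemma in_order_sv:
  fixes h l :: int
  assumes "arrangement a b c" "in_order a b c x y" "l \<ge> 0"
    and s_def: "s = sv x (h - l) + sv y l"
  shows "s c \<ge> 0" "s b + s c \<ge> - \<bar>h\<bar>" "s c \<ge> l \<or> s b + s c \<ge> l" "s a + s b + s c = h"
  using assms(1-3) by (auto simp: s_def in_order_def arrangement_def sv_apply)

lemma bounded_idx_cone: assumes "bounded_idx N" "arrangement a b c" shows "cone_supported a b c N"
proof -
  obtain K where K: "\<And>m. N m \<noteq> 0 \<Longrightarrow> m 0 \<le> K \<and> m 1 \<le> K \<and> m 2 \<le> K"
    using assms(1) by (auto simp: bounded_idx_def)
  define L where "L = max K 0"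
  have L: "L \<ge> 0" "\<And>m u. N m \<noteq> 0 \<Longrightarrow> u \<le> 2 \<Longrightarrow> m u \<le> L"
    using K by (fastforce simp: L_def le_Suc_eq numeral_2_eq_2)+
  show ?thesis
    unfolding cone_supported_def
  proof (intro exI[of _ "3 * L"] allI impI)
    fix m assume "N m \<noteq> 0"
    then have "m a \<le> L" "m b \<le> L" "m c \<le> L" using L(2) assms(2) by (auto simp: arrangement_def)
    then show "m c \<le> 3 * L \<and> m b + m c \<le> 3 * L \<and> m a + m b + m c \<le> 3 * L"
      using L(1) by linarith
  qed
qed

lemma cone_ratio_finite:
  assumes "cone_supported a b c N" "arrangement a b c" "in_order a b c x y"
  shows "ratio_finite x y N"
proof -
  obtain K where K: "\<And>m. N m \<noteq> 0 \<Longrightarrow> m c \<le> K \<and> m b + m c \<le> K \<and> m a + m b + m c \<le> K"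
    using assms(1) by (auto simp: cone_supported_def)
  show ?thesis
    unfolding ratio_finite_def
  proof (intro allI exI impI)
    fix m and l :: nat
    assume "l > nat (\<bar>K\<bar> + \<bar>m a\<bar> + \<bar>m b\<bar> + \<bar>m c\<bar>)"
    then have l: "int l > \<bar>K\<bar> + \<bar>m a\<bar> + \<bar>m b\<bar> + \<bar>m c\<bar>" by linarith
    show "N (m + sv x (- int l) + sv y (int l)) = 0"
    proof (rule ccontr)
      assume "N (m + sv x (- int l) + sv y (int l)) \<noteq> 0"
      note n = K[OF this]
      from assms(2,3) n show False
        unfolding in_order_def arrangement_def
        by (elim disjE conjE; simp add: sv_apply; use l in linarith)
    qed
  qed
qed

context complex_space
begin

text \<open>Multiplication by \<open>z\<^sub>a\<^sup>h f(z\<^sub>b/z\<^sub>a)\<close>, where \<open>f\<close> is expanded in nonnegative powers.\<close>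

definition ratio_mult :: "nat \<Rightarrow> nat \<Rightarrow> int \<Rightarrow> complex fps \<Rightarrow> (idx \<Rightarrow> 'v) \<Rightarrow> idx \<Rightarrow> 'v" where
  "ratio_mult a b h f N m = Sum_any (\<lambda>l. scale (fps_nth f l) (N (m + sv a (h - int l) + sv b (int l))))"

lemma ratio_finite_bound:
  assumes "ratio_finite a b N"
  shows "\<exists>L. \<forall>l>L. N (m + sv a (h - int l) + sv b (int l)) = 0"
proof -
  have *: "m + sv a (h - int l) + sv b (int l) = m + sv a h + sv a (- int l) + sv b (int l)" for l
    by (simp add: sv_diff sv_minus algebra_simps)
  show ?thesis unfolding * by (rule assms[unfolded ratio_finite_def, THEN spec])
qed

lemma ratio_mult_atMost:
  assumes "\<And>l. l > L \<Longrightarrow> N (m + sv a (h - int l) + sv b (int l)) = 0"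
  shows "ratio_mult a b h f N m = (\<Sum>l\<le>L. scale (fps_nth f l) (N (m + sv a (h - int l) + sv b (int l))))"
  unfolding ratio_mult_def by (rule Sum_any_atMost) (simp add: assms)

lemma ratio_mult_id: "ratio_mult a b 0 1 N = N"
proof
  fix m
  have "ratio_mult a b 0 1 N m = (\<Sum>l\<le>0. scale (fps_nth 1 l) (N (m + sv a (0 - int l) + sv b (int l))))"
    unfolding ratio_mult_def by (rule Sum_any_atMost) simp
  then show "ratio_mult a b 0 1 N m = N m" by simp
qed

lemma ratio_mult_scf: "ratio_mult a b h f (scf c N) = scf c (ratio_mult a b h f N)"
proof
  fix m
  show "ratio_mult a b h f (scf c N) m = scf c (ratio_mult a b h f N) m"
  proof (cases "c = 0")
    case True then show ?thesis by (simp add: ratio_mult_def scf_def)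
  next
    case False
    then show ?thesis unfolding ratio_mult_def scf_def Sum_any.expand_set
      by (simp add: scale_sum_right mult.commute)
  qed
qed

lemma ratio_mult_f_add: assumes "ratio_finite a b N" shows "ratio_mult a b h (f + g) N = ratio_mult a b h f N + ratio_mult a b h g N"
proof
  fix m
  obtain L where L: "\<And>l. l > L \<Longrightarrow> N (m + sv a (h - int l) + sv b (int l)) = 0" using ratio_finite_bound[OF assms(1)] by blast
  show "ratio_mult a b h (f + g) N m = (ratio_mult a b h f N + ratio_mult a b h g N) m"
    by (simp add: ratio_mult_atMost[of L] L scale_left_distrib sum.distrib)
qed

lemma ratio_mult_f_const: assumes "ratio_finite a b N" shows "ratio_mult a b h (fps_const c * f) N = scf c (ratio_mult a b h f N)"
proof
  fix m
  obtain L where L: "\<And>l. l > L \<Longrightarrow> N (m + sv a (h - int l) + sv b (int l)) = 0" using ratio_finite_bound[OF assms(1)] by blast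
  show "ratio_mult a b h (fps_const c * f) N m = scf c (ratio_mult a b h f N) m"
    by (simp add: ratio_mult_atMost[of L] L scale_sum_right scf_def)
qed

lemma ratio_mult_za: "a \<le> 2 \<Longrightarrow> pact (zv a ^ n) (ratio_mult a b h f N) = ratio_mult a b (h + int n) f N"
  by (simp add: pact_zv_power fun_eq_iff ratio_mult_def sv_add sv_diff algebra_simps)

lemma ratio_mult_zb:
  assumes "b \<le> 2" "ratio_finite a b N"
  shows "pact (zv b ^ n) (ratio_mult a b h f N) = ratio_mult a b (h + int n) (fps_X ^ n * f) N"
proof
  fix m
  obtain L where L: "\<And>l. l > L \<Longrightarrow> N ((m + sv b (int n)) + sv a (h - int l) + sv b (int l)) = 0"
    using ratio_finite_bound[OF assms(2)] by blast
  let ?g = "\<lambda>l. scale (fps_nth (fps_X ^ n * f) l) (N (m + sv a (h + int n - int l) + sv b (int l)))"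
  have e: "m + sv b (int n) + sv a (h - int l) + sv b (int l) =
      m + sv a (h + int n - int (l + n)) + sv b (int (l + n))" for l
    by (simp add: sv_add sv_diff algebra_simps)
  have "pact (zv b ^ n) (ratio_mult a b h f N) m =
    (\<Sum>l\<le>L. scale (fps_nth f l) (N (m + sv b (int n) + sv a (h - int l) + sv b (int l))))"
    using assms L by (simp add: pact_zv_power ratio_mult_atMost)
  also have "\<dots> = (\<Sum>l\<le>L. ?g (l + n))"
    unfolding e by (simp add: fps_X_power_mult_nth)
  also have "\<dots> = (\<Sum>l\<in>{n..L + n}. ?g l)"
    by (rule sum.reindex_bij_witness[of _ "\<lambda>l. l - n" "\<lambda>l. l + n"]) auto
  also have "\<dots> = (\<Sum>l\<le>L + n. ?g l)"
    by (rule sum.mono_neutral_left) (auto simp: fps_X_power_mult_nth)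
  also have "\<dots> = ratio_mult a b (h + int n) (fps_X ^ n * f) N m"
  proof (rule ratio_mult_atMost[symmetric])
    fix l assume "l > L + n"
    then have "l - n > L" "l = l - n + n" by auto
    then show "N (m + sv a (h + int n - int l) + sv b (int l)) = 0"
      using L[of "l - n"] unfolding e by simp
  qed
  finally show "pact (zv b ^ n) (ratio_mult a b h f N) m = ratio_mult a b (h + int n) (fps_X ^ n * f) N m" .
qed

lemma ratio_mult_linear_form:
  assumes "a \<le> 2" "b \<le> 2" "ratio_finite a b N"
  shows "pact (cst u * zv a ^ n - cst v * zv b ^ n) (ratio_mult a b h f N) =
    ratio_mult a b (h + int n) ((fps_const u - fps_const v * fps_X ^ n) * f) N"
proof -
  have "(fps_const u - fps_const v * fps_X ^ n) * f = fps_const u * f + fps_const (- v) * (fps_X ^ n * f)"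
    by (simp add: algebra_simps flip: fps_const_neg)
  then show ?thesis using assms
    by (simp add: ratio_mult_f_add ratio_mult_f_const pact_diff pact_mult pact_cst ratio_mult_za ratio_mult_zb)
       (simp add: fun_eq_iff scf_def)
qed

lemma ratio_mult_linear_forms:
  assumes "a \<le> 2" "b \<le> 2" "ratio_finite a b N"
  shows "pact (\<Prod>k\<in>S. cst (u k) * zv a - cst (v k) * zv b) (ratio_mult a b h f N) =
    ratio_mult a b (h + int (card S)) ((\<Prod>k\<in>S. fps_const (u k) - fps_const (v k) * fps_X) * f) N"
proof (induction S rule: infinite_finite_induct)
  case (insert k S)
  then show ?case
    using ratio_mult_linear_form[OF assms, of "u k" 1 "v k"]
    by (simp add: pact_mult add_ac mult_ac)
qed (simp_all add: pact_1)

lemma ratio_mult_pact: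
  assumes N: "ratio_finite a b N"
  shows "ratio_mult a b h f (pact P N) = pact P (ratio_mult a b h f N)"
proof
  fix m
  have "\<exists>L. \<forall>i\<in>mono_set P. \<forall>l>L. N (m + mono_sh i + sv a (h - int l) + sv b (int l)) = 0"
    by (intro bound_uniform finite_mono_set ratio_finite_bound[OF N])
  then obtain L where L: "\<And>i l. i \<in> mono_set P \<Longrightarrow> l > L \<Longrightarrow> N (m + mono_sh i + sv a (h - int l) + sv b (int l)) = 0"
    by auto
  have e: "m + sv a (h - int l) + sv b (int l) + mono_sh i = m + mono_sh i + sv a (h - int l) + sv b (int l)" for l i
    by (simp add: add_ac)
  have "ratio_mult a b h f (pact P N) m =
    (\<Sum>l\<le>L. scale (fps_nth f l) (\<Sum>i\<in>mono_set P. scale (mono_cf P i) (N (m + mono_sh i + sv a (h - int l) + sv b (int l)))))"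
    by (subst ratio_mult_atMost[of L]) (simp_all add: pact_form e L)
  also have "\<dots> = (\<Sum>i\<in>mono_set P. scale (mono_cf P i) (\<Sum>l\<le>L. scale (fps_nth f l) (N (m + mono_sh i + sv a (h - int l) + sv b (int l)))))"
    unfolding scale_sum_right scale_left_commute[of "mono_cf P _"] by (rule sum.swap)
  also have "\<dots> = pact P (ratio_mult a b h f N) m"
    unfolding pact_form[of P "ratio_mult a b h f N"]
    by (intro sum.cong refl) (simp add: ratio_mult_atMost[of L] L)
  finally show "ratio_mult a b h f (pact P N) m = pact P (ratio_mult a b h f N) m" .
qed

text \<open>Expansions in different ratios commute, because the double sum has finite support on each cone.\<close>

lemma ratio_mult_ratio_mult:
  assumes N: "cone_supported a b c N" and o: "arrangement a b c" and p: "in_order a b c x y" "in_order a b c x' y'"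
  shows "ratio_mult x y h f (ratio_mult x' y' h' f' N) = ratio_mult x' y' h' f' (ratio_mult x y h f N)"
proof
  fix m :: idx
  obtain K where K: "\<And>m. N m \<noteq> 0 \<Longrightarrow> m c \<le> K \<and> m b + m c \<le> K \<and> m a + m b + m c \<le> K"
    using N by (auto simp: cone_supported_def)
  have bd: "\<exists>y\<ge>0. x \<le> y \<and> - x \<le> y" for x :: int by (intro exI[of _ "\<bar>x\<bar>"]) auto
  obtain k ka kb kc kh kh' where k: "k \<ge> 0" "K \<le> k" "ka \<ge> 0" "- m a \<le> ka" "kb \<ge> 0" "- m b \<le> kb"
      "kc \<ge> 0" "- m c \<le> kc" "kh \<ge> 0" "- h \<le> kh" "h \<le> kh" "kh' \<ge> 0" "- h' \<le> kh'" "h' \<le> kh'"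
    using bd[of K] bd[of "m a"] bd[of "m b"] bd[of "m c"] bd[of h] bd[of h'] by blast
  define B where "B = nat (k + ka + kb + kc + kh + kh')"
  let ?i = "\<lambda>l l'. m + sv x (h - int l) + sv y (int l) + sv x' (h' - int l') + sv y' (int l')"
  have B: "N (?i l l') = 0" if "l > B \<or> l' > B" for l l'
  proof (rule ccontr)
    assume "N (?i l l') \<noteq> 0"
    note n = K[OF this]
    define u where "u = sv x (h - int l) + sv y (int l)"
    define u' where "u' = sv x' (h' - int l') + sv y' (int l')"
    have i: "?i l l' v = m v + u v + u' v" for v by (simp add: u_def u'_def)
    have t: "int l > k + ka + kb + kc + kh + kh' \<or> int l' > k + ka + kb + kc + kh + kh'"
      using that by (simp add: B_def) linarith
    have h: "- \<bar>h\<bar> \<ge> - kh" "- \<bar>h'\<bar> \<ge> - kh'" using k by auto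
    note s = in_order_sv[OF o p(1) of_nat_0_le_iff u_def]
      in_order_sv[OF o p(2) of_nat_0_le_iff u'_def]
    from t s(3,7) n[unfolded i] s(1,2,5,6) h k show False
      by (elim disjE conjE) linarith+
  qed
  let ?s = "\<Sum>l\<le>B. \<Sum>l'\<le>B. scale (fps_nth f l * fps_nth f' l') (N (?i l l'))"
  have "ratio_mult x y h f (ratio_mult x' y' h' f' N) m = ?s"
    unfolding ratio_mult_def[of x y]
    by (subst Sum_any_atMost[of B])
       (use B in \<open>auto simp: ratio_mult_atMost[of B] scale_sum_right\<close>)
  moreover have c: "?i l l' = m + sv x' (h' - int l') + sv y' (int l') + sv x (h - int l) + sv y (int l)" for l l'
    by (simp add: add_ac)
  have "ratio_mult x' y' h' f' (ratio_mult x y h f N) m = ?s"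
    unfolding ratio_mult_def[of x' y'] c
    by (subst Sum_any_atMost[of B], use B[unfolded c] in \<open>simp add: ratio_mult_atMost[of B]\<close>,
        subst sum.swap, use B[unfolded c] in \<open>auto simp: ratio_mult_atMost[of B] scale_sum_right mult.commute\<close>)
  ultimately show "ratio_mult x y h f (ratio_mult x' y' h' f' N) m = ratio_mult x' y' h' f' (ratio_mult x y h f N) m" by simp
qed

lemma cone_ratio_mult:
  assumes N: "cone_supported a b c N" and o: "arrangement a b c" and p: "in_order a b c x y"
  shows "cone_supported a b c (ratio_mult x y h f N)"
proof -
  obtain K where K: "\<And>m. N m \<noteq> 0 \<Longrightarrow> m c \<le> K \<and> m b + m c \<le> K \<and> m a + m b + m c \<le> K"
    using N by (auto simp: cone_supported_def)
  obtain k where k: "k \<ge> 0" "k \<ge> K" "k \<ge> K - h" "k \<ge> K + h"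
    using that[of "\<bar>K\<bar> + \<bar>h\<bar>"] by linarith
  show ?thesis unfolding cone_supported_def
  proof (intro exI[of _ k] allI impI)
    fix m assume "ratio_mult x y h f N m \<noteq> 0"
    then obtain l where "N (m + sv x (h - int l) + sv y (int l)) \<noteq> 0"
      unfolding ratio_mult_def by (rule Sum_any.not_neutral_obtains_not_neutral) auto
    note n = K[OF this]
    have i: "(m + sv x (h - int l) + sv y (int l)) v = m v + (sv x (h - int l) + sv y (int l)) v" for v by simp
    have "- \<bar>h\<bar> \<ge> K - k" using k by auto
    moreover have l0: "0 \<le> int l" by simp
    ultimately show "m c \<le> k \<and> m b + m c \<le> k \<and> m a + m b + m c \<le> k"
      using n[unfolded i] in_order_sv[OF o p l0 refl, where h = h] k by (intro conjI; linarith)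
  qed
qed

lemma mono_sh_nonneg: "mono_sh i u \<ge> 0"
  by (auto simp: mono_sh_def sv_def split: prod.splits)

lemma cone_pact:
  assumes N: "cone_supported a b c N" shows "cone_supported a b c (pact P N)"
proof -
  obtain K where K: "\<And>m. N m \<noteq> 0 \<Longrightarrow> m c \<le> K \<and> m b + m c \<le> K \<and> m a + m b + m c \<le> K"
    using N by (auto simp: cone_supported_def)
  show ?thesis unfolding cone_supported_def
  proof (intro exI[of _ K] allI impI)
    fix m assume "pact P N m \<noteq> 0"
    then obtain i where "scale (mono_cf P i) (N (m + mono_sh i)) \<noteq> 0"
      unfolding pact_form by (rule sum.not_neutral_contains_not_neutral)
    then have "N (m + mono_sh i) \<noteq> 0" by auto
    from K[OF this] mono_sh_nonneg[of i a] mono_sh_nonneg[of i b] mono_sh_nonneg[of i c]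
    show "m c \<le> K \<and> m b + m c \<le> K \<and> m a + m b + m c \<le> K" by auto
  qed
qed

text \<open>Multiplication by \<open>1/(z\<^sub>a\<^sup>n - c z\<^sub>b\<^sup>n)\<close>, expanded in powers of \<open>z\<^sub>b/z\<^sub>a\<close>.\<close>

definition inv_binomial :: "nat \<Rightarrow> nat \<Rightarrow> nat \<Rightarrow> complex \<Rightarrow> (idx \<Rightarrow> 'v) \<Rightarrow> idx \<Rightarrow> 'v" where
  "inv_binomial a b n c = ratio_mult a b (- int n) (inverse (1 - fps_const c * fps_X ^ n))"

lemma inv_binomial_inverse:
  assumes "a \<le> 2" "b \<le> 2" "ratio_finite a b N" "n > 0"
  shows "pact (zv a ^ n - cst c * zv b ^ n) (inv_binomial a b n c N) = N"
proof -
  have "fps_nth (1 - fps_const c * fps_X ^ n) 0 \<noteq> 0" using assms(4) by (simp add: fps_X_power_nth)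
  then have i: "inverse (1 - fps_const c * fps_X ^ n) * (1 - fps_const c * fps_X ^ n) = 1"
    by (rule inverse_mult_eq_1)
  have c1: "cst 1 = 1" by (simp add: cst_def one_pCons)
  show ?thesis
    using ratio_mult_linear_form[OF assms(1,2,3), of 1 n c "- int n" "inverse (1 - fps_const c * fps_X ^ n)"]
    by (simp add: inv_binomial_def c1 ratio_mult_id mult.commute[of "1 - _"] i)
qed

end

lemma powi_power: "(c powi a) ^ n = c powi (a * int n)" for c :: complex
  by (simp only: power_int_mult power_int_of_nat)

lemma cst_add: "cst (a + b) = cst a + cst b" by (simp add: cst_def)
lemma cst_mult: "cst (a * b) = cst a * cst b" by (simp add: cst_def)
lemma cst_1: "cst 1 = 1" by (simp add: cst_def one_pCons)
lemma cst_minus: "cst (- a) = - cst a" by (simp add: cst_def)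
lemma cst_power: "cst (a ^ n) = cst a ^ n" by (induction n) (simp_all add: cst_mult cst_1)
lemma cst_numeral: "cst (numeral n) = numeral n" by (simp add: cst_def numeral_poly)

lemma cst_prod: "(\<Prod>r\<in>S. cst (h r)) = cst (\<Prod>r\<in>S. h r)"
  by (induction S rule: infinite_finite_induct) (simp_all add: cst_1 cst_mult)

section \<open>Serre identities in modules over the polynomial ring\<close>

text \<open>\<open>cubP\<close> is the polynomial of the cubic relation after the factors that only change sign under
  permutations have been split off.  Its differences under the exchange of neighbouring arguments are divisible by the
  difference of these arguments, with quotients \<open>cubS\<close> and \<open>cubS'\<close>, and these quotients combine to a multiple
  \<open>cubL\<close> of the denominator \<open>q a + b\<close>.\<close>

definition cubP :: "'a::comm_ring_1 \<Rightarrow> 'a \<Rightarrow> 'a \<Rightarrow> 'a \<Rightarrow> 'a" where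
  "cubP q a b c = (a - (q^2 + q) * b + q^3 * c) * (q^2 * a - b) * (q^2 * b - c)"

definition cubS :: "'a::comm_ring_1 \<Rightarrow> 'a \<Rightarrow> 'a \<Rightarrow> 'a \<Rightarrow> 'a" where
  "cubS q a b c = (q + q^5) * c * (a + b) - (q^3 + q^5) * c^2 - (q^3 + q^4) * (a^2 + b^2)
     + (q^2 - q^3 + q^5 + q^6) * a * b"

definition cubS' :: "'a::comm_ring_1 \<Rightarrow> 'a \<Rightarrow> 'a \<Rightarrow> 'a \<Rightarrow> 'a" where
  "cubS' q a b c = (q^3 + q^4) * (b^2 + c^2) + (q^4 - q - q^2 - q^5) * b * c
     - (q^2 + q^6) * a * (b + c) + (q^2 + q^4) * a^2"

definition cubL :: "'a::comm_ring_1 \<Rightarrow> 'a \<Rightarrow> 'a \<Rightarrow> 'a \<Rightarrow> 'a" where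
  "cubL q a b c = (q^4 - q^2) * c + (q^4 - q^5) * b + (q - q^2) * a"

lemma cubP_swap12: "cubP q a b c - cubP q b a c = (a - b) * cubS q a b c"
  unfolding cubP_def cubS_def by (simp add: algebra_simps eval_nat_numeral)
lemma cubP_swap23: "cubP q a b c - cubP q a c b = (b - c) * cubS' q a b c"
  unfolding cubP_def cubS'_def by (simp add: algebra_simps eval_nat_numeral)
lemma cub_residue: "cubS q c a b + cubS' q a b c = (q * a + b) * cubL q a b c"
  unfolding cubS_def cubS'_def cubL_def by (simp add: algebra_simps eval_nat_numeral)
lemma cubS_sym: "cubS q a b c = cubS q b a c"
  unfolding cubS_def by (simp add: algebra_simps eval_nat_numeral)
lemma cubS'_sym: "cubS' q a b c = cubS' q a c b"
  unfolding cubS'_def by (simp add: algebra_simps eval_nat_numeral)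

context module
begin

text \<open>Here \<open>t\<close>, \<open>A\<close>, \<open>B\<close> and \<open>Y\<close> stand for a vector \<open>n\<close> divided by three, two, two and one of the binomials \<open>q z\<^sub>a + z\<^sub>b\<close>, \<open>q z\<^sub>a + z\<^sub>c\<close>,
  \<open>q z\<^sub>b + z\<^sub>c\<close>, in a normalisation where each division leaves a factor \<open>q\<close>.
  Multiplication by \<open>q\<^sup>2 z\<^sub>a - z\<^sub>c = q (q z\<^sub>a + z\<^sub>b) - (q z\<^sub>b + z\<^sub>c)\<close> decomposes \<open>t\<close> into \<open>A\<close> and \<open>B\<close>.  As \<open>A\<close> is symmetric
  in its first two and \<open>B\<close> in its last two arguments, the alternating sum involves only the differences of
  \<open>cubP\<close>; these are divisible by \<open>z\<^sub>a - z\<^sub>b\<close> and \<open>z\<^sub>b - z\<^sub>c\<close> and so reduce \<open>A\<close> and \<open>B\<close> to \<open>Y\<close>.  The coefficients of each \<open>Y\<close>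
  add up to a multiple of \<open>q z\<^sub>a + z\<^sub>b\<close>, which leaves multiples of \<open>n\<close> by linear forms with sum zero.\<close>

lemma cubic_serre_identity:
  fixes q :: 'a and z :: "nat \<Rightarrow> 'a"
  assumes t: "\<And>a b c. arrangement a b c \<Longrightarrow>
      scale (q^2 * z a - z c) (t a b c) = scale (q^2) (A a b c) - scale q (B a b c)"
    and As: "\<And>a b c. arrangement a b c \<Longrightarrow> A a b c = A b a c"
    and Bs: "\<And>a b c. arrangement a b c \<Longrightarrow> B a b c = B a c b"
    and A: "\<And>a b c. arrangement a b c \<Longrightarrow> scale (z a - z b) (A a b c) = Y b c - Y a c"
    and B: "\<And>a b c. arrangement a b c \<Longrightarrow> scale (z b - z c) (B a b c) = scale q (Y a c - Y a b)"
    and Y: "\<And>a b c. arrangement a b c \<Longrightarrow> scale (q * z a + z b) (Y a b) = scale q n"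
  defines "P \<equiv> \<lambda>a b c. cubP q (z a) (z b) (z c) * (q^2 * z a - z c)"
  shows "scale (P 0 1 2) (t 0 1 2) - scale (P 1 0 2) (t 1 0 2) - scale (P 0 2 1) (t 0 2 1)
    - scale (P 2 1 0) (t 2 1 0) + scale (P 1 2 0) (t 1 2 0) + scale (P 2 0 1) (t 2 0 1) = 0"
proof -
  let ?p = "\<lambda>a b c. cubP q (z a) (z b) (z c)"
  let ?S = "\<lambda>a b c. cubS q (z a) (z b) (z c)"
  let ?S' = "\<lambda>a b c. cubS' q (z a) (z b) (z c)"
  let ?L = "\<lambda>a b c. cubL q (z a) (z b) (z c)"
  have T: "scale (P a b c) (t a b c) = scale (q^2) (scale (?p a b c) (A a b c)) - scale q (scale (?p a b c) (B a b c))"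
    if "arrangement a b c" for a b c
  proof -
    have "scale (P a b c) (t a b c) = scale (?p a b c) (scale (q^2 * z a - z c) (t a b c))"
      by (simp add: P_def)
    also have "\<dots> = scale (?p a b c) (scale (q^2) (A a b c)) - scale (?p a b c) (scale q (B a b c))"
      unfolding t[OF that] by (rule scale_right_diff_distrib)
    finally show ?thesis by (simp only: scale_left_commute)
  qed
  have G1: "scale (?p a b c) (A a b c) = scale (?p b a c) (A b a c) + (scale (?S a b c) (Y b c) - scale (?S a b c) (Y a c))"
    if o: "arrangement a b c" for a b c
  proof -
    have "scale (?p a b c) (A a b c) - scale (?p b a c) (A a b c) = scale (?S a b c) (scale (z a - z b) (A a b c))"
      unfolding scale_left_diff_distrib[symmetric] cubP_swap12 by (simp add: mult.commute)
    then show ?thesis unfolding A[OF o] scale_right_diff_distrib As[OF o, symmetric]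
      by (simp add: algebra_simps)
  qed
  have G2: "scale (?p a b c) (B a b c) = scale (?p a c b) (B a c b) +
      (scale q (scale (?S' a b c) (Y a c)) - scale q (scale (?S' a b c) (Y a b)))"
    if o: "arrangement a b c" for a b c
  proof -
    have "scale (?p a b c) (B a b c) - scale (?p a c b) (B a b c) = scale (?S' a b c) (scale (z b - z c) (B a b c))"
      unfolding scale_left_diff_distrib[symmetric] cubP_swap23 by (simp add: mult.commute)
    then show ?thesis unfolding B[OF o] scale_right_diff_distrib Bs[OF o, symmetric]
      by (simp add: algebra_simps)
  qed
  have G3: "scale (?S c a b) (Y a b) + scale (?S' a b c) (Y a b) = scale q (scale (?L a b c) n)"
    if o: "arrangement a b c" for a b c
  proof -
    have "scale (?S c a b) (Y a b) + scale (?S' a b c) (Y a b) = scale (?L a b c) (scale (q * z a + z b) (Y a b))"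
      unfolding scale_left_distrib[symmetric] cub_residue by (simp add: mult.commute)
    then show ?thesis unfolding Y[OF o] by (simp only: scale_left_commute)
  qed
  have L: "scale (?L 0 1 2) n + scale (?L 1 2 0) n + scale (?L 2 0 1) n
     - scale (?L 0 2 1) n - scale (?L 1 0 2) n - scale (?L 2 1 0) n = 0"
    unfolding scale_left_distrib[symmetric] scale_left_diff_distrib[symmetric]
    by (simp add: cubL_def algebra_simps)
  have o: "arrangement 0 1 2" "arrangement 1 2 0" "arrangement 2 0 1" "arrangement 0 2 1" "arrangement 1 0 2" "arrangement 2 1 0"
    by (auto simp: arrangement_def)
  let ?f = "\<lambda>a b c d e. scale (?S a b c) (Y d e)"
  let ?g = "\<lambda>a b c d e. scale (?S' a b c) (Y d e)"
  have "scale (P 0 1 2) (t 0 1 2) - scale (P 1 0 2) (t 1 0 2) - scale (P 0 2 1) (t 0 2 1)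
    - scale (P 2 1 0) (t 2 1 0) + scale (P 1 2 0) (t 1 2 0) + scale (P 2 0 1) (t 2 0 1) =
    scale (q^2) (?f 0 1 2 1 2 - ?f 0 1 2 0 2 + (?f 1 2 0 2 0 - ?f 1 2 0 1 0) + (?f 2 0 1 0 1 - ?f 2 0 1 2 1))
    - scale (q^2) (?g 0 1 2 0 2 - ?g 0 1 2 0 1 + (?g 1 2 0 1 0 - ?g 1 2 0 1 2) + (?g 2 0 1 2 1 - ?g 2 0 1 2 0))"
    unfolding T[OF o(1)] T[OF o(2)] T[OF o(3)] T[OF o(4)] T[OF o(5)] T[OF o(6)]
      G1[OF o(1)] G1[OF o(2)] G1[OF o(3)] G2[OF o(1)] G2[OF o(2)] G2[OF o(3)]
    by (simp add: scale_right_distrib scale_right_diff_distrib power2_eq_square mult.assoc)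
  also have "\<dots> = scale (q^2) ((?f 2 0 1 0 1 + ?g 0 1 2 0 1) + (?f 0 1 2 1 2 + ?g 1 2 0 1 2) + (?f 1 2 0 2 0 + ?g 2 0 1 2 0)
     - (?f 1 0 2 0 2 + ?g 0 2 1 0 2) - (?f 2 1 0 1 0 + ?g 1 0 2 1 0) - (?f 0 2 1 2 1 + ?g 2 1 0 2 1))"
    unfolding cubS_sym[of q "z 1" "z 0" "z 2"] cubS_sym[of q "z 2" "z 1" "z 0"] cubS_sym[of q "z 0" "z 2" "z 1"]
      cubS'_sym[of q "z 0" "z 2" "z 1"] cubS'_sym[of q "z 1" "z 0" "z 2"] cubS'_sym[of q "z 2" "z 1" "z 0"]
    by (subst scale_right_diff_distrib[symmetric], rule arg_cong[where f = "scale _"])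
       (simp only: algebra_simps)
  also have "\<dots> = scale (q^2) (scale q (scale (?L 0 1 2) n + scale (?L 1 2 0) n + scale (?L 2 0 1) n
     - scale (?L 0 2 1) n - scale (?L 1 0 2) n - scale (?L 2 1 0) n))"
    unfolding G3[OF o(1)] G3[OF o(2)] G3[OF o(3)] G3[OF o(4)] G3[OF o(5)] G3[OF o(6)]
    by (simp only: scale_right_distrib scale_right_diff_distrib)
  also have "\<dots> = 0" unfolding L by simp
  finally show ?thesis .
qed

text \<open>The two variables of the repeated current are \<open>z0\<close>, \<open>z1\<close> and the other one is \<open>w\<close>.  \<open>S1\<close>, \<open>T01\<close>, \<open>T10\<close>, \<open>S3\<close> are
  the quotients of a vector by two binomials, \<open>A0\<close>, \<open>A1\<close>, \<open>B0\<close>, \<open>B1\<close> those by one, expanded for \<open>w\<close> after or before the variable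
  in question.  Each polynomial coefficient is a combination of the binomials, so that the sum reduces to
  \<open>A\<close> and \<open>B\<close> and cancels there.\<close>

lemma quadratic_serre_identity:
  fixes q z0 z1 w :: 'a
  assumes S1: "scale (q * z0 - w) S1 = scale q A1" "scale (q * z1 - w) S1 = scale q A0"
    and S3: "scale (q * w - z0) S3 = scale q B1" "scale (q * w - z1) S3 = scale q B0"
    and T01: "scale (q * z0 - w) T01 = scale q B1" "scale (q * w - z1) T01 = scale q A0"
    and T10: "scale (q * z1 - w) T10 = scale q B0" "scale (q * w - z0) T10 = scale q A1"
  shows "scale (q^2 * z0 - z1) (scale q S1 + scale (q^2 + 1) T01 + scale q S3) -
    scale (q^2 * z1 - z0) (scale q S1 + scale (q^2 + 1) T10 + scale q S3) = 0"
proof -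
  have e1: "scale ((q^2 * z0 - z1) * q - (q^2 * z1 - z0) * q) S1 = scale (q^2 + 1) (scale q A1 - scale q A0)"
  proof -
    have "(q^2 * z0 - z1) * q - (q^2 * z1 - z0) * q = (q^2 + 1) * ((q * z0 - w) - (q * z1 - w))" by (simp add: algebra_simps eval_nat_numeral)
    then show ?thesis by (metis S1 scale_scale scale_left_diff_distrib)
  qed
  have e3: "scale ((q^2 * z0 - z1) * q - (q^2 * z1 - z0) * q) S3 = scale ((q^2 + 1) * q) (scale q B0 - scale q B1)"
  proof -
    have "(q^2 * z0 - z1) * q - (q^2 * z1 - z0) * q = ((q^2 + 1) * q) * ((q * w - z1) - (q * w - z0))" by (simp add: algebra_simps eval_nat_numeral)
    then show ?thesis by (metis S3 scale_scale scale_left_diff_distrib)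
  qed
  have e01: "scale ((q^2 * z0 - z1) * (q^2 + 1)) T01 = scale (q^2 + 1) (scale q (scale q B1) + scale q A0)"
  proof -
    have "(q^2 * z0 - z1) * (q^2 + 1) = (q^2 + 1) * (q * (q * z0 - w) + (q * w - z1))" by (simp add: algebra_simps eval_nat_numeral)
    then show ?thesis by (metis T01 scale_scale scale_left_distrib)
  qed
  have e10: "scale ((q^2 * z1 - z0) * (q^2 + 1)) T10 = scale (q^2 + 1) (scale q (scale q B0) + scale q A1)"
  proof -
    have "(q^2 * z1 - z0) * (q^2 + 1) = (q^2 + 1) * (q * (q * z1 - w) + (q * w - z0))" by (simp add: algebra_simps eval_nat_numeral)
    then show ?thesis by (metis T10 scale_scale scale_left_distrib)
  qed
  have "scale (q^2 * z0 - z1) (scale q S1 + scale (q^2 + 1) T01 + scale q S3) -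
    scale (q^2 * z1 - z0) (scale q S1 + scale (q^2 + 1) T10 + scale q S3) =
    scale ((q^2 * z0 - z1) * q - (q^2 * z1 - z0) * q) S1 + scale ((q^2 * z0 - z1) * q - (q^2 * z1 - z0) * q) S3
    + scale ((q^2 * z0 - z1) * (q^2 + 1)) T01 - scale ((q^2 * z1 - z0) * (q^2 + 1)) T10"
    by (simp only: scale_right_distrib scale_left_diff_distrib scale_scale) (simp only: algebra_simps)
  also have "\<dots> = 0" unfolding e1 e3 e01 e10
    by (simp add: scale_right_distrib scale_right_diff_distrib mult.assoc)
  finally show ?thesis .
qed

end

context complex_space
begin

lemma scf_cancel: "c \<noteq> 0 \<Longrightarrow> scf c X = scf c Y \<Longrightarrow> X = Y"
  by (metis scf_def ext scale_cancel_left)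

lemma pact_cst_cancel: "c \<noteq> 0 \<Longrightarrow> pact (cst c) X = pact (cst c) Y \<Longrightarrow> X = Y"
  unfolding pact_cst by (rule scf_cancel)

lemma pact_mult_right: "pact P (pact Q D) = pact (P * Q) D" by (simp add: pact_mult)

lemma inv_binomial_inv_binomial:
  "cone_supported a b c N \<Longrightarrow> arrangement a b c \<Longrightarrow> in_order a b c x y \<Longrightarrow> in_order a b c x' y' \<Longrightarrow>
    inv_binomial x y n u (inv_binomial x' y' n' u' N) = inv_binomial x' y' n' u' (inv_binomial x y n u N)"
  unfolding inv_binomial_def by (rule ratio_mult_ratio_mult)

lemma cone_inv_binomial: "cone_supported a b c N \<Longrightarrow> arrangement a b c \<Longrightarrow> in_order a b c x y \<Longrightarrow> cone_supported a b c (inv_binomial x y n u N)"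
  unfolding inv_binomial_def by (rule cone_ratio_mult)

lemma inv_binomial_pact': "ratio_finite a b N \<Longrightarrow> inv_binomial a b n u (pact P N) = pact P (inv_binomial a b n u N)"
  unfolding inv_binomial_def by (rule ratio_mult_pact)

lemma inv_binomial_scaled_inverse:
  assumes "a \<le> 2" "b \<le> 2" "ratio_finite a b N" "n > 0" "Q \<noteq> 0"
  shows "pact (cst Q * zv a ^ n + zv b ^ n) (inv_binomial a b n (- inverse Q) N) = pact (cst Q) N"
    "pact (cst Q * zv a ^ n - zv b ^ n) (inv_binomial a b n (inverse Q) N) = pact (cst Q) N"
proof -
  have *: "cst Q * cst (inverse Q) = 1" using assms(5) by (simp add: cst_mult[symmetric] cst_1)
  have "cst Q * (zv a ^ n - cst (- inverse Q) * zv b ^ n) = cst Q * zv a ^ n + (cst Q * cst (inverse Q)) * zv b ^ n"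
    by (simp add: cst_minus algebra_simps)
  then show "pact (cst Q * zv a ^ n + zv b ^ n) (inv_binomial a b n (- inverse Q) N) = pact (cst Q) N"
    using arg_cong[OF inv_binomial_inverse[OF assms(1-4), of "- inverse Q"], of "pact (cst Q)"]
    by (simp add: pact_mult_right *)
  have "cst Q * (zv a ^ n - cst (inverse Q) * zv b ^ n) = cst Q * zv a ^ n - (cst Q * cst (inverse Q)) * zv b ^ n"
    by (simp add: algebra_simps)
  then show "pact (cst Q * zv a ^ n - zv b ^ n) (inv_binomial a b n (inverse Q) N) = pact (cst Q) N"
    using arg_cong[OF inv_binomial_inverse[OF assms(1-4), of "inverse Q"], of "pact (cst Q)"]
    by (simp add: pact_mult_right *)
qed

text \<open>The binomials have degree \<open>D\<close> in the variables, so the abstract identity is applied to \<open>z\<^sub>i\<^sup>D\<close>.\<close>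

lemma cubic_serre:
  assumes N: "bounded_idx N" and D: "D > 0" and Q: "Q \<noteq> 0"
  defines "U \<equiv> \<lambda>x y. inv_binomial x y D (- inverse Q)"
  defines "t \<equiv> \<lambda>a b c. U a b (U a c (U b c N))"
  defines "z \<equiv> \<lambda>i. zv i ^ D"
  defines "P \<equiv> \<lambda>a b c. cubP (cst Q) (z a) (z b) (z c) * (cst Q ^ 2 * z a - z c)"
  shows "pact (P 0 1 2) (t 0 1 2) - pact (P 1 0 2) (t 1 0 2) - pact (P 0 2 1) (t 0 2 1)
    - pact (P 2 1 0) (t 2 1 0) + pact (P 1 2 0) (t 1 2 0) + pact (P 2 0 1) (t 2 0 1) = 0"
  unfolding P_def
proof (rule module.cubic_serre_identity[OF module_pact, where A = "\<lambda>a b c. U a c (U b c N)" and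
      B = "\<lambda>a b c. U a b (U a c N)" and Y = "\<lambda>a b. U a b N" and n = N])
  fix a b c assume o: "arrangement a b c"
  have le: "a \<le> 2" "b \<le> 2" "c \<le> 2" using o by (auto simp: arrangement_def)
  have p: "in_order a b c a b" "in_order a b c a c" "in_order a b c b c" by (auto simp: in_order_def)
  have c: "cone_supported a b c N" using N o by (rule bounded_idx_cone)
  have cU: "cone_supported a b c (U x y M)" if "cone_supported a b c M" "in_order a b c x y" for x y M
    using that o unfolding U_def by (intro cone_inv_binomial)
  have l: "ratio_finite x y M" if "cone_supported a b c M" "in_order a b c x y" for x y M by (rule cone_ratio_finite[OF that(1) o that(2)])
  have u: "pact (cst Q * z x + z y) (U x y M) = pact (cst Q) M"
    if "cone_supported a b c M" "in_order a b c x y" for x y M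
    unfolding U_def z_def using le that l[OF that] D Q
    by (intro inv_binomial_scaled_inverse) (auto simp: in_order_def)
  have pU: "U x y (pact R M) = pact R (U x y M)" if "cone_supported a b c M" "in_order a b c x y" for x y R M
    unfolding U_def by (rule inv_binomial_pact'[OF l[OF that]])
  have U_U: "U x y (U x' y' M) = U x' y' (U x y M)" if "cone_supported a b c M" "in_order a b c x y" "in_order a b c x' y'" for x y x' y' M
    unfolding U_def using that(1) o that(2,3) by (rule inv_binomial_inv_binomial)
  note cs = c cU[OF c p(1)] cU[OF c p(2)] cU[OF c p(3)]
  show Asym: "U a c (U b c N) = U b c (U a c N)" by (rule U_U[OF c p(2,3)])
  show Bsym: "U a b (U a c N) = U a c (U a b N)" by (rule U_U[OF c p(1,2)])
  show "pact (cst Q * z a + z b) (U a b N) = pact (cst Q) N" by (rule u[OF c p(1)])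
  show "pact ((cst Q)\<^sup>2 * z a - z c) (t a b c) = pact ((cst Q)\<^sup>2) (U a c (U b c N)) - pact (cst Q) (U a b (U a c N))"
  proof -
    have e: "(cst Q)\<^sup>2 * z a - z c = cst Q * (cst Q * z a + z b) - (cst Q * z b + z c)"
      by (simp add: power2_eq_square algebra_simps)
    have c3: "cone_supported a b c (U a c (U b c N))" by (intro cU c p)
    have "pact (cst Q * z b + z c) (t a b c) = U a b (U a c (pact (cst Q * z b + z c) (U b c N)))"
      unfolding t_def by (simp add: pU c3 cs p)
    also have "\<dots> = pact (cst Q) (U a b (U a c N))"
      unfolding u[OF c p(3)] by (simp add: pU cs p)
    finally show ?thesis
      unfolding e pact_diff pact_mult[of "cst Q"] using u[OF c3 p(1)] by (simp add: t_def power2_eq_square pact_mult)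
  qed
  show "pact (z a - z b) (U a c (U b c N)) = U b c N - U a c N"
  proof (rule pact_cst_cancel[OF Q])
    have e: "cst Q * (z a - z b) = (cst Q * z a + z c) - (cst Q * z b + z c)" by (simp add: algebra_simps)
    show "pact (cst Q) (pact (z a - z b) (U a c (U b c N))) = pact (cst Q) (U b c N - U a c N)"
      unfolding pact_mult_right unfolding e pact_diff u[OF cs(4) p(2)] pact_diff_right
      unfolding Asym u[OF cs(3) p(3)] by (rule refl)
  qed
  show "pact (z b - z c) (U a b (U a c N)) = pact (cst Q) (U a c N - U a b N)"
  proof -
    have e: "z b - z c = (cst Q * z a + z b) - (cst Q * z a + z c)" by (simp add: algebra_simps)
    show ?thesis
      unfolding e unfolding pact_diff u[OF cs(3) p(1)] pact_diff_right
      unfolding Bsym u[OF cs(2) p(2)] by (rule refl)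
  qed
qed

lemma quadratic_serre:
  assumes N: "bounded_idx N" and M: "M > 0" and Q: "Q \<noteq> 0"
  defines "U \<equiv> \<lambda>x y. inv_binomial x y M (inverse Q)"
  defines "z \<equiv> \<lambda>i. zv i ^ M"
  defines "V \<equiv> \<lambda>a b. pact (cst Q) (U a 2 (U b 2 N)) + pact (cst Q ^ 2 + 1) (U a 2 (U 2 b N))
     + pact (cst Q) (U 2 a (U 2 b N))"
  shows "pact (cst Q ^ 2 * z 0 - z 1) (V 0 1) - pact (cst Q ^ 2 * z 1 - z 0) (V 1 0) = 0"
proof -
  have u: "pact (cst Q * z x - z y) (U x y L) = pact (cst Q) L"
    if "cone_supported a b c L" "in_order a b c x y" "arrangement a b c" for x y a b c L
    unfolding U_def z_def using that cone_ratio_finite[OF that(1,3,2)] M Q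
    by (intro inv_binomial_scaled_inverse) (auto simp: in_order_def arrangement_def)
  have U_U: "U x y (U x' y' L) = U x' y' (U x y L)" if "cone_supported a b c L" "arrangement a b c" "in_order a b c x y" "in_order a b c x' y'" for x y x' y' a b c L
    unfolding U_def using that by (rule inv_binomial_inv_binomial)
  have cU: "cone_supported a b c (U x y L)" if "cone_supported a b c L" "arrangement a b c" "in_order a b c x y" for a b c x y L
    using that unfolding U_def by (rule cone_inv_binomial)
  have o: "arrangement 0 1 2" "arrangement 1 0 2" "arrangement 0 2 1" "arrangement 1 2 0" "arrangement 2 0 1" "arrangement 2 1 0" by (auto simp: arrangement_def)
  note c = bounded_idx_cone[OF N o(1)] bounded_idx_cone[OF N o(2)] bounded_idx_cone[OF N o(3)] bounded_idx_cone[OF N o(4)] bounded_idx_cone[OF N o(5)] bounded_idx_cone[OF N o(6)]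
  have s02: "U 0 2 (U 1 2 N) = U 1 2 (U 0 2 N)" by (rule U_U[OF c(1) o(1)]) (auto simp: in_order_def)
  have s20: "U 2 0 (U 2 1 N) = U 2 1 (U 2 0 N)" by (rule U_U[OF c(5) o(5)]) (auto simp: in_order_def)
  have s021: "U 0 2 (U 2 1 N) = U 2 1 (U 0 2 N)" by (rule U_U[OF c(3) o(3)]) (auto simp: in_order_def)
  have s120: "U 1 2 (U 2 0 N) = U 2 0 (U 1 2 N)" by (rule U_U[OF c(4) o(4)]) (auto simp: in_order_def)
  have "pact (cst Q ^ 2 * z 0 - z 1) (pact (cst Q) (U 0 2 (U 1 2 N)) + pact (cst Q ^ 2 + 1) (U 0 2 (U 2 1 N))
     + pact (cst Q) (U 2 0 (U 2 1 N))) - pact (cst Q ^ 2 * z 1 - z 0) (pact (cst Q) (U 0 2 (U 1 2 N)) + pact (cst Q ^ 2 + 1) (U 1 2 (U 2 0 N))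
     + pact (cst Q) (U 2 0 (U 2 1 N))) = 0"
  proof (rule module.quadratic_serre_identity[OF module_pact, where w = "z 2"])
    show "pact (cst Q * z 0 - z 2) (U 0 2 (U 1 2 N)) = pact (cst Q) (U 1 2 N)"
      by (rule u[OF cU[OF c(1) o(1)] _ o(1)]) (auto simp: in_order_def)
    show "pact (cst Q * z 1 - z 2) (U 0 2 (U 1 2 N)) = pact (cst Q) (U 0 2 N)"
      unfolding s02 by (rule u[OF cU[OF c(1) o(1)] _ o(1)]) (auto simp: in_order_def)
    show "pact (cst Q * z 2 - z 0) (U 2 0 (U 2 1 N)) = pact (cst Q) (U 2 1 N)"
      by (rule u[OF cU[OF c(5) o(5)] _ o(5)]) (auto simp: in_order_def)
    show "pact (cst Q * z 2 - z 1) (U 2 0 (U 2 1 N)) = pact (cst Q) (U 2 0 N)"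
      unfolding s20 by (rule u[OF cU[OF c(5) o(5)] _ o(5)]) (auto simp: in_order_def)
    show "pact (cst Q * z 0 - z 2) (U 0 2 (U 2 1 N)) = pact (cst Q) (U 2 1 N)"
      by (rule u[OF cU[OF c(3) o(3)] _ o(3)]) (auto simp: in_order_def)
    show "pact (cst Q * z 2 - z 1) (U 0 2 (U 2 1 N)) = pact (cst Q) (U 0 2 N)"
      unfolding s021 by (rule u[OF cU[OF c(3) o(3)] _ o(3)]) (auto simp: in_order_def)
    show "pact (cst Q * z 1 - z 2) (U 1 2 (U 2 0 N)) = pact (cst Q) (U 2 0 N)"
      by (rule u[OF cU[OF c(4) o(4)] _ o(4)]) (auto simp: in_order_def)
    show "pact (cst Q * z 2 - z 0) (U 1 2 (U 2 0 N)) = pact (cst Q) (U 1 2 N)"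
      unfolding s120 by (rule u[OF cU[OF c(4) o(4)] _ o(4)]) (auto simp: in_order_def)
  qed
  then show ?thesis unfolding V_def s02[symmetric] s20[symmetric] by this
qed

end

section \<open>Normally ordered products of exponentials\<close>

lemma sum_restrict:
  fixes f :: "nat \<Rightarrow> 'v::comm_monoid_add"
  assumes "\<And>i. i > B \<Longrightarrow> f i = 0" "B \<le> M"
  shows "(\<Sum>i\<le>M. f i) = (\<Sum>i\<le>B. f i)"
  by (rule sum.mono_neutral_right) (use assms in auto)

lemma sum_triangle_shift:
  fixes F :: "nat \<Rightarrow> nat \<Rightarrow> 'v::comm_monoid_add"
  shows "(\<Sum>l\<le>L. \<Sum>k\<le>l. F l k) = (\<Sum>k\<le>L. \<Sum>j\<le>L - k. F (j + k) k)"
  unfolding sum.Sigma[OF finite_atMost ballI[OF finite_atMost]]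
  by (rule sum.reindex_bij_witness[of _ "\<lambda>(k, j). (j + k, k)" "\<lambda>(l, k). (k, l - k)"]) auto

text \<open>An indexed family of creation and annihilation exponents with scalar commutators \<open>lam\<close>; \<open>kap\<close> is the
  exponential of these, the contraction of two currents.  The filtration \<open>Flt\<close> is by the degree in
  the creation operators, so that annihilation operators are locally nilpotent and every sum is finite.\<close>

locale vertex = complex_space scale for scale :: "complex \<Rightarrow> 'v::ab_group_add \<Rightarrow> 'v" +
  fixes am ap :: "'p \<Rightarrow> nat \<Rightarrow> 'v \<Rightarrow> 'v"
    and lam :: "'p \<Rightarrow> 'p \<Rightarrow> nat \<Rightarrow> complex"
    and kap :: "'p \<Rightarrow> 'p \<Rightarrow> complex fps"
    and Flt :: "int \<Rightarrow> 'v set"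
  assumes am_exp: "exponentiable (am p)"
    and ap_exp: "exponentiable (ap p)"
    and am_am: "am p m (am p' n v) = am p' n (am p m v)"
    and ap_ap: "ap p m (ap p' n v) = ap p' n (ap p m v)"
    and ap_am: "n > 0 \<Longrightarrow> m > 0 \<Longrightarrow>
      ap p n (am p' m v) = am p' m (ap p n v) + (if m = n then scale (lam p p' n) v else 0)"
    and kap: "log_deriv (kap p p') (Abs_fps (\<lambda>n. of_nat n * lam p p' n))" "fps_nth (kap p p') 0 = 1"
    and Flt_0: "0 \<in> Flt K"
    and Flt_add: "u \<in> Flt K \<Longrightarrow> v \<in> Flt K \<Longrightarrow> u + v \<in> Flt K"
    and Flt_scale: "u \<in> Flt K \<Longrightarrow> scale c u \<in> Flt K"
    and Flt_mono: "u \<in> Flt K \<Longrightarrow> K \<le> L \<Longrightarrow> u \<in> Flt L"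
    and Flt_neg: "K < 0 \<Longrightarrow> u \<in> Flt K \<Longrightarrow> u = 0"
    and Flt_ex: "\<exists>K. u \<in> Flt K"
    and am_Flt: "u \<in> Flt K \<Longrightarrow> am p n u \<in> Flt (K + int n)"
    and ap_Flt: "u \<in> Flt K \<Longrightarrow> ap p n u \<in> Flt (K - int n)"
begin

lemma Flt_sum: "(\<And>i. i \<in> S \<Longrightarrow> h i \<in> Flt K) \<Longrightarrow> sum h S \<in> Flt K"
  by (induction S rule: infinite_finite_induct) (auto intro: Flt_0 Flt_add)

lemma Flt_exI: obtains K where "K \<ge> 0" "u \<in> Flt K"
  using Flt_ex[of u] Flt_mono[of u] by (metis linear)

abbreviation "Em p \<equiv> Ei (am p)"
abbreviation "Ep p \<equiv> E (ap p)"

lemma lin_am: "lin (am p n)" and lin_ap: "lin (ap p n)"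
  using am_exp ap_exp by (auto intro: exponentiable_lin)
lemma lin_Em: "lin (Em p r)" by (intro lin_Ei lin_am)
lemma lin_Ep: "lin (Ep p r)" by (intro lin_E lin_ap)

lemma E_Flt_graded:
  assumes f: "exponentiable f" and F: "\<And>n K u. u \<in> Flt K \<Longrightarrow> f n u \<in> Flt (K + s * int n)"
  shows "u \<in> Flt K \<Longrightarrow> E f n u \<in> Flt (K + s * int n)"
proof (induction n rule: less_induct)
  case (less n)
  show ?case
  proof (cases "n = 0")
    case True then show ?thesis using less by (simp add: E_0)
  next
    case False
    have "scale (of_nat n) (E f n u) \<in> Flt (K + s * int n)"
      unfolding E_rec[OF f]
    proof (intro Flt_sum Flt_scale)
      fix k assume k: "k \<in> {..n}"
      show "f k (E f (n - k) u) \<in> Flt (K + s * int n)"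
      proof (cases "k = 0")
        case True then show ?thesis using f by (simp add: exponentiable_0 Flt_0)
      next
        case False
        then have "f k (E f (n - k) u) \<in> Flt (K + s * int (n - k) + s * int k)"
            using k by (intro F less.IH less.prems) auto
        moreover have "K + s * int (n - k) + s * int k = K + s * int n"
          using k by (simp add: of_nat_diff algebra_simps)
        ultimately show ?thesis by simp
      qed
    qed
    then have "scale (1 / of_nat n) (scale (of_nat n) (E f n u)) \<in> Flt (K + s * int n)" by (rule Flt_scale)
    then show ?thesis using False by simp
  qed
qed

lemma Ep_Flt: "u \<in> Flt K \<Longrightarrow> Ep p l u \<in> Flt (K - int l)"
  using E_Flt_graded[OF ap_exp, where s = "-1" and p1 = p and u = u and K = K and n = l] ap_Flt by simp

lemma Em_Flt: "u \<in> Flt K \<Longrightarrow> Em p r u \<in> Flt (K + r)"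
  using E_Flt_graded[OF am_exp, where s = 1 and p1 = p and u = u and K = K and n = "nat r"] am_Flt by (auto simp: Ei_def Flt_0)

lemma Ep_zero: "u \<in> Flt K \<Longrightarrow> int l > K \<Longrightarrow> Ep p l u = 0"
  using Ep_Flt[of u K p l] Flt_neg[of "K - int l"] by simp

lemma Sum_any_Ep:
  assumes "u \<in> Flt K" "K \<le> int M" "\<And>l. G l 0 = (0 :: 'v)"
  shows "Sum_any (\<lambda>l. G l (Ep p l u)) = (\<Sum>l\<le>M. G l (Ep p l u))"
  by (rule Sum_any_atMost) (use assms Ep_zero in auto)

text \<open>The coefficients of a current without zero modes, at \<open>z\<close> to the power \<open>- a\<close>, and of the normally ordered
  products of two and three of them.\<close>

definition Y :: "'p \<Rightarrow> int \<Rightarrow> 'v \<Rightarrow> 'v" where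
  "Y p a u = Sum_any (\<lambda>l. Em p (int l - a) (Ep p l u))"

definition N2 :: "'p \<Rightarrow> 'p \<Rightarrow> int \<Rightarrow> int \<Rightarrow> 'v \<Rightarrow> 'v" where
  "N2 p p' a b u = Sum_any (\<lambda>l. Em p (int l - a) (Y p' b (Ep p l u)))"

definition N3 :: "'p \<Rightarrow> 'p \<Rightarrow> 'p \<Rightarrow> int \<Rightarrow> int \<Rightarrow> int \<Rightarrow> 'v \<Rightarrow> 'v" where
  "N3 p p' p'' a b c u = Sum_any (\<lambda>l. Em p (int l - a) (N2 p' p'' b c (Ep p l u)))"

lemma Y_sum: "u \<in> Flt K \<Longrightarrow> K \<le> int M \<Longrightarrow> Y p a u = (\<Sum>l\<le>M. Em p (int l - a) (Ep p l u))"
  unfolding Y_def by (rule Sum_any_Ep) (auto simp: lin_zero[OF lin_Em])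

lemma common_Flt: obtains K M where "u \<in> Flt K" "v \<in> Flt K" "K \<le> int M" "K \<ge> 0"
proof -
  obtain K where K: "K \<ge> 0" "u \<in> Flt K" by (rule Flt_exI)
  obtain L where L: "L \<ge> 0" "v \<in> Flt L" by (rule Flt_exI)
  show thesis
    by (rule that[of "max K L" "nat (max K L)"]) (use K L in \<open>auto intro: Flt_mono\<close>)
qed

lemma lin_Sum_Ep:
  assumes "\<And>l. lin (G l)" shows "lin (\<lambda>u. Sum_any (\<lambda>l. G l (Ep p l u)))"
proof (rule linI)
  have S: "Sum_any (\<lambda>l. G l (Ep p l w)) = (\<Sum>l\<le>M. G l (Ep p l w))" if "w \<in> Flt K" "K \<le> int M" for w K M
    using that by (rule Sum_any_Ep) (rule lin_zero[OF assms])
  fix u v :: 'v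
  obtain K M where K: "u \<in> Flt K" "v \<in> Flt K" "K \<le> int M" "K \<ge> 0" by (rule common_Flt)
  show "Sum_any (\<lambda>l. G l (Ep p l (u + v))) = Sum_any (\<lambda>l. G l (Ep p l u)) + Sum_any (\<lambda>l. G l (Ep p l v))"
    unfolding S[OF Flt_add[OF K(1,2)] K(3)] S[OF K(1,3)] S[OF K(2,3)]
    by (simp add: lin_add[OF lin_Ep] lin_add[OF assms] sum.distrib)
next
  have S: "Sum_any (\<lambda>l. G l (Ep p l w)) = (\<Sum>l\<le>M. G l (Ep p l w))" if "w \<in> Flt K" "K \<le> int M" for w K M
    using that by (rule Sum_any_Ep) (rule lin_zero[OF assms])
  fix c u
  obtain K M where K: "u \<in> Flt K" "u \<in> Flt K" "K \<le> int M" "K \<ge> 0" by (rule common_Flt)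
  show "Sum_any (\<lambda>l. G l (Ep p l (scale c u))) = scale c (Sum_any (\<lambda>l. G l (Ep p l u)))"
    unfolding S[OF Flt_scale[OF K(1)] K(3)] S[OF K(1,3)]
    by (simp add: lin_scale[OF lin_Ep] lin_scale[OF assms] scale_sum_right)
qed

lemma lin_Y: "lin (Y p a)"
  unfolding Y_def[abs_def] by (rule lin_Sum_Ep) (rule lin_Em)
lemma lin_N2: "lin (N2 p p' a b)"
  unfolding N2_def[abs_def] by (rule lin_Sum_Ep) (rule lin_comp[OF lin_Em lin_Y])
lemma lin_N3: "lin (N3 p p' p'' a b c)"
  unfolding N3_def[abs_def] by (rule lin_Sum_Ep) (rule lin_comp[OF lin_Em lin_N2])

lemma N2_sum: "u \<in> Flt K \<Longrightarrow> K \<le> int M \<Longrightarrow> N2 p p' a b u = (\<Sum>l\<le>M. Em p (int l - a) (Y p' b (Ep p l u)))"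
  unfolding N2_def by (rule Sum_any_Ep) (auto simp: lin_zero[OF lin_Em] lin_zero[OF lin_Y])
lemma N3_sum: "u \<in> Flt K \<Longrightarrow> K \<le> int M \<Longrightarrow>
   N3 p p' p'' a b c u = (\<Sum>l\<le>M. Em p (int l - a) (N2 p' p'' b c (Ep p l u)))"
  unfolding N3_def by (rule Sum_any_Ep) (auto simp: lin_zero[OF lin_Em] lin_zero[OF lin_N2])

lemma Ep_Flt': "u \<in> Flt K \<Longrightarrow> Ep p l u \<in> Flt K"
  by (rule Flt_mono[OF Ep_Flt], assumption) linarith

lemma Y_Flt: assumes "u \<in> Flt K" shows "Y p a u \<in> Flt (K - a)"
proof -
  have *: "Em p (int l - a) (Ep p l u) \<in> Flt (K - a)" for l
    using Em_Flt[OF Ep_Flt[OF assms], of p "int l - a" p l] by simp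
  show ?thesis
    by (subst Y_sum[OF assms, of "nat K"], simp, intro Flt_sum *)
qed

lemma Y_zero: "u \<in> Flt K \<Longrightarrow> a > K \<Longrightarrow> Y p a u = 0"
  using Y_Flt[of u K p a] Flt_neg[of "K - a"] by simp

lemma N2_Flt: assumes "u \<in> Flt K" shows "N2 p p' a b u \<in> Flt (K - a - b)"
proof -
  have *: "Em p (int l - a) (Y p' b (Ep p l u)) \<in> Flt (K - a - b)" for l
    using Em_Flt[OF Y_Flt[OF Ep_Flt[OF assms, of p l], of p' b], of p "int l - a"] by (simp add: algebra_simps)
  show ?thesis
    by (subst N2_sum[OF assms, of "nat K"], simp, intro Flt_sum *)
qed

lemma N2_zero: assumes "u \<in> Flt K" "a > K \<or> b > K" shows "N2 p p' a b u = 0"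
proof -
  have "Em p (int l - a) (Y p' b (Ep p l u)) = 0" for l
  proof (cases "b > K")
    case True
    then have "Y p' b (Ep p l u) = 0" using Ep_Flt'[OF assms(1)] by (intro Y_zero)
    then show ?thesis by (simp add: lin_zero[OF lin_Em])
  next
    case False
    then have a: "a > K" using assms by simp
    show ?thesis
    proof (cases "int l > K")
      case True then show ?thesis using Ep_zero[OF assms(1)] by (simp add: lin_zero[OF lin_Em] lin_zero[OF lin_Y])
    qed (use a in \<open>simp add: Ei_neg\<close>)
  qed
  then show ?thesis unfolding N2_def by simp
qed

lemma N3_zero: assumes "u \<in> Flt K" "a > K \<or> b > K \<or> c > K" shows "N3 p p' p'' a b c u = 0"
proof -
  have "Em p (int l - a) (N2 p' p'' b c (Ep p l u)) = 0" for l
  proof (cases "b > K \<or> c > K")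
    case True
    then have "N2 p' p'' b c (Ep p l u) = 0" using Ep_Flt'[OF assms(1)] by (intro N2_zero)
    then show ?thesis by (simp add: lin_zero[OF lin_Em])
  next
    case False
    then have a: "a > K" using assms by simp
    show ?thesis
    proof (cases "int l > K")
      case True then show ?thesis using Ep_zero[OF assms(1)] by (simp add: lin_zero[OF lin_Em] lin_zero[OF lin_N2])
    qed (use a in \<open>simp add: Ei_neg\<close>)
  qed
  then show ?thesis unfolding N3_def by simp
qed

lemma Em_Em: "Em p r (Em p' s v) = Em p' s (Em p r v)"
  by (rule Ei_commute[OF lin_Em]) (auto intro!: Ei_commute[symmetric] lin_am am_am)
lemma Ep_Ep: "Ep p r (Ep p' s v) = Ep p' s (Ep p r v)"
  by (rule E_E_commute) (auto intro: lin_ap ap_ap)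

lemma N2_sym: "N2 p p' a b u = N2 p' p b a u"
proof -
  obtain K M where K: "u \<in> Flt K" "u \<in> Flt K" "K \<le> int M" "K \<ge> 0" by (rule common_Flt)
  have *: "N2 p p' a b u = (\<Sum>l\<le>M. \<Sum>l'\<le>M. Em p (int l - a) (Em p' (int l' - b) (Ep p' l' (Ep p l u))))"
    for p p' a b
    using N2_sum[OF K(1,3)] Y_sum[OF Ep_Flt'[OF K(1)] K(3)] by (simp add: lin_sum[OF lin_Em])
  show ?thesis
    unfolding * by (subst sum.swap) (simp add: Em_Em[of p] Ep_Ep[of p])
qed

lemma N3_sym23: "N3 p p' p'' a b c u = N3 p p'' p' a c b u"
  unfolding N3_def N2_sym[of p'] ..

lemma N3_sym12: "N3 p p' p'' a b c u = N3 p' p p'' b a c u"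
proof -
  obtain K M where K: "u \<in> Flt K" "u \<in> Flt K" "K \<le> int M" "K \<ge> 0" by (rule common_Flt)
  have *: "N3 p p' p'' a b c u = (\<Sum>l\<le>M. \<Sum>l'\<le>M. Em p (int l - a) (Em p' (int l' - b) (Y p'' c (Ep p' l' (Ep p l u)))))"
    for p p' a b
    using N3_sum[OF K(1,3)] N2_sum[OF Ep_Flt'[OF K(1)] K(3)] by (simp add: lin_sum[OF lin_Em])
  show ?thesis
    unfolding * by (subst sum.swap) (simp add: Em_Em[of p] Ep_Ep[of p])
qed

text \<open>An exponential of annihilation type passes a current; only its commutators with the creation part contribute.\<close>

lemma E_Y:
  assumes f: "exponentiable f" and fF: "\<And>n K u. u \<in> Flt K \<Longrightarrow> f n u \<in> Flt K"
    and fap: "\<And>m n v. f m (ap p n v) = ap p n (f m v)"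
    and fam: "\<And>n m v. n > 0 \<Longrightarrow> m > 0 \<Longrightarrow>
      f n (am p m v) = am p m (f n v) + (if m = n then scale (\<kappa> n) v else 0)"
    and C: "log_deriv C (Abs_fps (\<lambda>n. of_nat n * \<kappa> n))"
  shows "scale (fps_nth C 0) (E f l (Y p a u)) = (\<Sum>k\<le>l. scale (fps_nth C k) (Y p (a + int k) (E f (l - k) u)))"
proof -
  obtain K M where K: "u \<in> Flt K" "u \<in> Flt K" "K \<le> int M" "K \<ge> 0" by (rule common_Flt)
  have EF: "E f n u \<in> Flt K" for n
    using E_Flt_graded[OF f, where s = 0 and u = u and K = K and n = n] fF K by simp
  have lE: "lin (E f n)" for n by (intro lin_E exponentiable_lin[OF f])
  have EEp: "E f n (Ep p j v) = Ep p j (E f n v)" for n j v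
    by (rule E_E_commute) (auto intro: lin_ap exponentiable_lin[OF f] fap)
  have "scale (fps_nth C 0) (E f l (Y p a u)) = (\<Sum>j\<le>M. scale (fps_nth C 0) (E f l (Em p (int j - a) (Ep p j u))))"
    by (simp add: Y_sum[OF K(1,3)] lin_sum[OF lE] scale_sum_right)
  also have "\<dots> = (\<Sum>j\<le>M. \<Sum>k\<le>l. scale (fps_nth C k) (Em p (int j - a - int k) (Ep p j (E f (l - k) u))))"
    by (subst E_E_commutator[OF f am_exp fam C]) (auto simp: EEp)
  also have "\<dots> = (\<Sum>k\<le>l. \<Sum>j\<le>M. scale (fps_nth C k) (Em p (int j - (a + int k)) (Ep p j (E f (l - k) u))))"
    by (subst sum.swap) (simp add: algebra_simps)
  also have "\<dots> = (\<Sum>k\<le>l. scale (fps_nth C k) (Y p (a + int k) (E f (l - k) u)))"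
    by (simp add: Y_sum[OF EF K(3)] scale_sum_right)
  finally show ?thesis .
qed

lemma E_Y_lower:
  assumes f: "exponentiable f" and fF: "\<And>n K u. u \<in> Flt K \<Longrightarrow> f n u \<in> Flt (K + int n)"
    and fam: "\<And>m n v. f m (am p n v) = am p n (f m v)"
    and fap: "\<And>n m v. n > 0 \<Longrightarrow> m > 0 \<Longrightarrow>
      f n (ap p m v) = ap p m (f n v) + (if m = n then scale (\<kappa> n) v else 0)"
    and C: "log_deriv C (Abs_fps (\<lambda>n. of_nat n * \<kappa> n))"
  shows "scale (fps_nth C 0) (E f l (Y p a u)) = (\<Sum>k\<le>l. scale (fps_nth C k) (Y p (a - int k) (E f (l - k) u)))"
proof -
  obtain K where K: "u \<in> Flt K" "K \<ge> 0" by (metis Flt_exI)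
  define M where "M = nat K + l"
  have M: "K + int n \<le> int M" if "n \<le> l" for n using that K by (simp add: M_def)
  have EF: "E f n u \<in> Flt (K + int n)" for n
    using E_Flt_graded[OF f, where s = 1 and u = u and K = K and n = n] fF K by simp
  have lE: "lin (E f n)" for n by (intro lin_E exponentiable_lin[OF f])
  have EEm: "E f n (Em p j v) = Em p j (E f n v)" for n j v
    by (rule Ei_commute[OF lE]) (auto intro!: E_commute[symmetric] lin_am fam[symmetric])
  have "scale (fps_nth C 0) (E f l (Y p a u)) = (\<Sum>j\<le>M + l. scale (fps_nth C 0) (Em p (int j - a) (E f l (Ep p j u))))"
    using M[of 0] by (subst Y_sum[OF K(1), of "M + l"]) (simp_all add: lin_sum[OF lE] scale_sum_right EEm)
  also have "\<dots> = (\<Sum>j\<le>M + l. Em p (int j - a) (scale (fps_nth C 0) (E f l (Ei (ap p) (int j) u))))"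
    by (simp add: lin_scale[OF lin_Em] Ei_nat)
  also have "\<dots> = (\<Sum>j\<le>M + l. \<Sum>k\<le>l. scale (fps_nth C k) (Em p (int j - a) (Ei (ap p) (int j - int k) (E f (l - k) u))))"
    by (subst E_E_commutator[OF f ap_exp fap C]) (auto simp: lin_sum[OF lin_Em] lin_scale[OF lin_Em])
  also have "\<dots> = (\<Sum>k\<le>l. scale (fps_nth C k) (\<Sum>j\<le>M + l. Em p (int j - a) (Ei (ap p) (int j - int k) (E f (l - k) u))))"
    by (subst sum.swap) (simp add: scale_sum_right)
  also have "\<dots> = (\<Sum>k\<le>l. scale (fps_nth C k) (Y p (a - int k) (E f (l - k) u)))"
  proof (intro sum.cong refl arg_cong[where f = "scale _"])
    fix k assume k: "k \<in> {..l}"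
    have "(\<Sum>j\<le>M + l. Em p (int j - a) (Ei (ap p) (int j - int k) (E f (l - k) u))) =
      (\<Sum>j\<in>{k..M + l}. Em p (int j - a) (Ei (ap p) (int j - int k) (E f (l - k) u)))"
      by (rule sum.mono_neutral_right) (auto simp: Ei_neg lin_zero[OF lin_Em])
    also have "\<dots> = (\<Sum>j\<le>M + l - k. Em p (int j - (a - int k)) (Ep p j (E f (l - k) u)))"
      by (rule sum.reindex_bij_witness[of _ "\<lambda>j. j + k" "\<lambda>j. j - k"])
         (use k in \<open>auto simp: of_nat_diff algebra_simps simp flip: Ei_nat\<close>)
    also have "\<dots> = Y p (a - int k) (E f (l - k) u)"
      using k M[of "l - k"] by (intro Y_sum[symmetric, OF EF]) auto
    finally show "(\<Sum>j\<le>M + l. Em p (int j - a) (Ei (ap p) (int j - int k) (E f (l - k) u))) = Y p (a - int k) (E f (l - k) u)" .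
  qed
  finally show ?thesis .
qed

lemma Ep_Em: "Ep p l (Em p' r v) = (\<Sum>k\<le>l. scale (fps_nth (kap p p') k) (Em p' (r - int k) (Ep p (l - k) v)))"
proof -
  have "scale (fps_nth (kap p p') 0) (Ep p l (Em p' r v)) =
      (\<Sum>k\<le>l. scale (fps_nth (kap p p') k) (Em p' (r - int k) (Ep p (l - k) v)))"
    by (rule E_E_commutator[OF ap_exp am_exp ap_am kap(1)]) auto
  then show ?thesis by (simp add: kap(2))
qed

lemma Ep_Y: "Ep p l (Y p' b u) = (\<Sum>k\<le>l. scale (fps_nth (kap p p') k) (Y p' (b + int k) (Ep p (l - k) u)))"
proof -
  have "scale (fps_nth (kap p p') 0) (Ep p l (Y p' b u)) =
      (\<Sum>k\<le>l. scale (fps_nth (kap p p') k) (Y p' (b + int k) (Ep p (l - k) u)))"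
    by (rule E_Y[OF ap_exp _ ap_ap ap_am kap(1)]) (auto intro: Flt_mono[OF ap_Flt])
  then show ?thesis by (simp add: kap(2))
qed

lemma Ep_N2: "Ep p l (N2 p' p'' b c u) =
  (\<Sum>k\<le>l. \<Sum>j\<le>l - k. scale (fps_nth (kap p p') k * fps_nth (kap p p'') j)
      (N2 p' p'' (b + int k) (c + int j) (Ep p (l - k - j) u)))"
proof -
  obtain K M where K: "u \<in> Flt K" "u \<in> Flt K" "K \<le> int M" "K \<ge> 0" by (rule common_Flt)
  have "Ep p l (N2 p' p'' b c u) = (\<Sum>i\<le>M. \<Sum>k\<le>l. \<Sum>j\<le>l - k. scale (fps_nth (kap p p') k * fps_nth (kap p p'') j)
      (Em p' (int i - b - int k) (Y p'' (c + int j) (Ep p' i (Ep p (l - k - j) u)))))"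
    by (simp add: N2_sum[OF K(1,3)] lin_sum[OF lin_Ep] Ep_Em Ep_Y lin_sum[OF lin_Em] lin_scale[OF lin_Em]
        scale_sum_right Ep_Ep[of p _ p'])
  also have "\<dots> = (\<Sum>k\<le>l. \<Sum>j\<le>l - k. \<Sum>i\<le>M. scale (fps_nth (kap p p') k * fps_nth (kap p p'') j)
      (Em p' (int i - b - int k) (Y p'' (c + int j) (Ep p' i (Ep p (l - k - j) u)))))"
    by (rule trans[OF sum.swap], rule sum.cong[OF refl], rule sum.swap)
  finally show ?thesis
    by (simp add: N2_sum[OF Ep_Flt'[OF K(1)] K(3)] scale_sum_right algebra_simps)
qed

lemma Y_Y:
  "Y p a (Y p' b u) = Sum_any (\<lambda>k. scale (fps_nth (kap p p') k) (N2 p p' (a - int k) (b + int k) u))"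
proof -
  obtain K where K: "u \<in> Flt K" "K \<ge> 0" by (metis Flt_exI)
  obtain B where B: "K \<le> int B" "K - b \<le> int B"
  proof -
    obtain B where "\<bar>K\<bar> + \<bar>b\<bar> \<le> int B" using that[of "nat (\<bar>K\<bar> + \<bar>b\<bar>)"] by simp
    then show thesis by (intro that[of B]) linarith+
  qed
  let ?Z = "\<lambda>k j. scale (fps_nth (kap p p') k) (Em p (int (j + k) - a) (Y p' (b + int k) (Ep p j u)))"
  have Z1: "?Z k j = 0" if "j > B" for k j
    using that B Ep_zero[OF K(1), of j p] by (simp add: lin_zero[OF lin_Em] lin_zero[OF lin_Y])
  have Z2: "?Z k j = 0" if "k > B" for k j
    using that B Y_zero[OF Ep_Flt'[OF K(1)], of "b + int k" p' p j] by (simp add: lin_zero[OF lin_Em])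
  have Y: "Y p' b u \<in> Flt (K - b)" by (rule Y_Flt[OF K(1)])
  have "Y p a (Y p' b u) = (\<Sum>l\<le>B + B. Em p (int l - a) (Ep p l (Y p' b u)))"
    using B by (intro Y_sum[OF Y]) auto
  also have "\<dots> = (\<Sum>l\<le>B + B. \<Sum>k\<le>l. ?Z k (l - k))"
    by (simp add: Ep_Y lin_sum[OF lin_Em] lin_scale[OF lin_Em])
  also have "\<dots> = (\<Sum>k\<le>B + B. \<Sum>j\<le>B + B - k. ?Z k j)"
    by (subst sum_triangle_shift) simp
  also have "\<dots> = (\<Sum>k\<le>B. \<Sum>j\<le>B + B - k. ?Z k j)"
    by (rule sum_restrict, intro sum.neutral ballI Z2, simp_all)
  also have "\<dots> = (\<Sum>k\<le>B. \<Sum>j\<le>B. ?Z k j)"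
    by (rule sum.cong[OF refl], rule sum_restrict, rule Z1, simp_all)
  also have "\<dots> = (\<Sum>k\<le>B. scale (fps_nth (kap p p') k) (N2 p p' (a - int k) (b + int k) u))"
    using B by (simp add: N2_sum[OF K(1), of B] scale_sum_right algebra_simps)
  also have "\<dots> = Sum_any (\<lambda>k. scale (fps_nth (kap p p') k) (N2 p p' (a - int k) (b + int k) u))"
    using B by (intro Sum_any_atMost[symmetric]) (auto simp: N2_zero[OF K(1)])
  finally show ?thesis .
qed

lemma Y_N2:
  "Y p a (N2 p' p'' b c u) = Sum_any (\<lambda>k. scale (fps_nth (kap p p') k) (Sum_any (\<lambda>j. scale (fps_nth (kap p p'') j)
     (N3 p p' p'' (a - int k - int j) (b + int k) (c + int j) u))))"
proof -
  obtain K where K: "u \<in> Flt K" "K \<ge> 0" by (metis Flt_exI)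
  obtain B where B: "K \<le> int B" "K - b \<le> int B" "K - c \<le> int B" "K - b - c \<le> int B"
  proof -
    obtain B where "\<bar>K\<bar> + \<bar>b\<bar> + \<bar>c\<bar> \<le> int B" using that[of "nat (\<bar>K\<bar> + \<bar>b\<bar> + \<bar>c\<bar>)"] by simp
    then show thesis by (intro that[of B]) linarith+
  qed
  let ?L = "B + B + B"
  let ?Z = "\<lambda>k j i. scale (fps_nth (kap p p') k * fps_nth (kap p p'') j)
     (Em p (int (i + j + k) - a) (N2 p' p'' (b + int k) (c + int j) (Ep p i u)))"
  have Z1: "?Z k j i = 0" if "i > B" for k j i
    using that B Ep_zero[OF K(1), of i p] by (simp add: lin_zero[OF lin_Em] lin_zero[OF lin_N2])
  have Z2: "?Z k j i = 0" if "k > B \<or> j > B" for k j i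
    using that B N2_zero[OF Ep_Flt'[OF K(1)], of "b + int k" "c + int j" p' p'' p i]
    by (auto simp: lin_zero[OF lin_Em])
  have Y: "N2 p' p'' b c u \<in> Flt (K - b - c)" by (rule N2_Flt[OF K(1)])
  have "Y p a (N2 p' p'' b c u) = (\<Sum>l\<le>?L. Em p (int l - a) (Ep p l (N2 p' p'' b c u)))"
    using B by (intro Y_sum[OF Y]) auto
  also have "\<dots> = (\<Sum>l\<le>?L. \<Sum>k\<le>l. \<Sum>j\<le>l - k. ?Z k j (l - k - j))"
    by (simp add: Ep_N2 lin_sum[OF lin_Em] lin_scale[OF lin_Em])
  also have "\<dots> = (\<Sum>k\<le>?L. \<Sum>l\<le>?L - k. \<Sum>j\<le>l. ?Z k j (l - j))"
    by (subst sum_triangle_shift) simp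
  also have "\<dots> = (\<Sum>k\<le>?L. \<Sum>j\<le>?L - k. \<Sum>i\<le>?L - k - j. ?Z k j i)"
    by (subst sum_triangle_shift) simp
  also have "\<dots> = (\<Sum>k\<le>B. \<Sum>j\<le>?L - k. \<Sum>i\<le>?L - k - j. ?Z k j i)"
    by (rule sum_restrict, intro sum.neutral ballI Z2, simp_all)
  also have "\<dots> = (\<Sum>k\<le>B. \<Sum>j\<le>B. \<Sum>i\<le>?L - k - j. ?Z k j i)"
    by (rule sum.cong[OF refl], rule sum_restrict, intro sum.neutral ballI Z2, simp_all)
  also have "\<dots> = (\<Sum>k\<le>B. \<Sum>j\<le>B. \<Sum>i\<le>B. ?Z k j i)"
    by (rule sum.cong[OF refl], rule sum.cong[OF refl], rule sum_restrict, rule Z1, simp_all)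
  also have "\<dots> = (\<Sum>k\<le>B. \<Sum>j\<le>B. scale (fps_nth (kap p p') k * fps_nth (kap p p'') j) (N3 p p' p'' (a - int k - int j) (b + int k) (c + int j) u))"
    using B by (simp add: N3_sum[OF K(1), of B] scale_sum_right algebra_simps)
  also have "\<dots> = (\<Sum>k\<le>B. scale (fps_nth (kap p p') k) (Sum_any (\<lambda>j. scale (fps_nth (kap p p'') j)
     (N3 p p' p'' (a - int k - int j) (b + int k) (c + int j) u))))"
    using B by (intro sum.cong refl, subst Sum_any_atMost[of B]) (auto simp: N3_zero[OF K(1)] scale_sum_right)
  also have "\<dots> = Sum_any (\<lambda>k. scale (fps_nth (kap p p') k) (Sum_any (\<lambda>j. scale (fps_nth (kap p p'') j)
     (N3 p p' p'' (a - int k - int j) (b + int k) (c + int j) u))))"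
    using B by (intro Sum_any_atMost[symmetric]) (auto simp: N3_zero[OF K(1)])
  finally show ?thesis .
qed

text \<open>Wick's theorem for two currents: their product is the contraction, expanded in \<open>w/z\<close>, times the normally ordered
  product.\<close>

lemma Y_Y_ratio_mult:
  assumes "x \<le> 2" "y \<le> 2" "x \<noteq> y"
  shows "Y p (m x + h + \<alpha>) (Y p' (m y + \<beta>) u) =
    ratio_mult x y h (kap p p') (\<lambda>m. N2 p p' (m x + \<alpha>) (m y + \<beta>) u) m"
  unfolding Y_Y ratio_mult_def using assms by (simp add: sv_apply algebra_simps)

lemma bounded_idx_N3:
  assumes "arrangement x y w"
  shows "bounded_idx (\<lambda>m. N3 p p' p'' (m x + \<alpha>) (m y + \<beta>) (m w + \<gamma>) u)"
proof -
  obtain K where K: "u \<in> Flt K" by (metis Flt_exI)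
  define L where "L = \<bar>K\<bar> + \<bar>\<alpha>\<bar> + \<bar>\<beta>\<bar> + \<bar>\<gamma>\<bar>"
  have "m x \<le> L \<and> m y \<le> L \<and> m w \<le> L" if "N3 p p' p'' (m x + \<alpha>) (m y + \<beta>) (m w + \<gamma>) u \<noteq> 0" for m
  proof -
    have "m x + \<alpha> \<le> K" "m y + \<beta> \<le> K" "m w + \<gamma> \<le> K"
      using that N3_zero[OF K, of "m x + \<alpha>" "m y + \<beta>" "m w + \<gamma>" p p' p''] by linarith+
    then show ?thesis unfolding L_def by linarith
  qed
  then show ?thesis unfolding bounded_idx_def using assms
    by (intro exI[of _ L]) (elim arrangement_cases; simp)
qed

lemma Y_Y_Y_ratio_mult:
  assumes o: "arrangement x y w"
    and N_def: "N = (\<lambda>m. N3 p p' p'' (m x + \<alpha>) (m y + \<beta>) (m w + \<gamma>) u)"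
  shows "Y p (m x + h12 + h13 + \<alpha>) (Y p' (m y + h23 + \<beta>) (Y p'' (m w + \<gamma>) u)) =
    ratio_mult x y h12 (kap p p') (ratio_mult x w h13 (kap p p'') (ratio_mult y w h23 (kap p' p'') N)) m"
proof -
  have le: "x \<le> 2" "y \<le> 2" "w \<le> 2" "x \<noteq> y" "x \<noteq> w" "y \<noteq> w" using o by (auto simp: arrangement_def)
  have in_order: "in_order x y w x y" "in_order x y w x w" "in_order x y w y w" by (auto simp: in_order_def)
  have c: "cone_supported x y w N" unfolding N_def by (intro bounded_idx_cone bounded_idx_N3 o)
  define G where "G = ratio_mult x y h12 (kap p p') (ratio_mult x w h13 (kap p p'') N)"
  have G: "Y p (m x + h12 + h13 + \<alpha>) (N2 p' p'' (m y + \<beta>) (m w + \<gamma>) u) = G m" for m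
    unfolding Y_N2 G_def ratio_mult_def N_def using le by (simp add: sv_apply algebra_simps)
  obtain K where K: "u \<in> Flt K" by (metis Flt_exI)
  define B where "B = nat (K - (m w + \<gamma>))"
  have B: "N2 p' p'' b (m w + int k + \<gamma>) u = 0" if "k > B" for b k
    using that K by (intro N2_zero[OF K]) (auto simp: B_def)
  have e: "Y p' (m y + h23 + \<beta>) (Y p'' (m w + \<gamma>) u) =
     (\<Sum>k\<le>B. scale (fps_nth (kap p' p'') k) (N2 p' p'' (m y + h23 + \<beta> - int k) (m w + \<gamma> + int k) u))"
    unfolding Y_Y by (rule Sum_any_atMost) (use B in \<open>simp add: add_ac\<close>)
  have "Y p (m x + h12 + h13 + \<alpha>) (Y p' (m y + h23 + \<beta>) (Y p'' (m w + \<gamma>) u)) =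
     (\<Sum>k\<le>B. scale (fps_nth (kap p' p'') k) (Y p (m x + h12 + h13 + \<alpha>) (N2 p' p'' (m y + h23 + \<beta> - int k) (m w + \<gamma> + int k) u)))"
    unfolding e by (simp add: lin_sum[OF lin_Y] lin_scale[OF lin_Y])
  also have "\<dots> = (\<Sum>k\<le>B. scale (fps_nth (kap p' p'') k) (G (m + sv y (h23 - int k) + sv w (int k))))"
    unfolding G[symmetric] using le by (simp add: sv_apply algebra_simps)
  also have "\<dots> = ratio_mult y w h23 (kap p' p'') G m"
  proof (rule ratio_mult_atMost[symmetric])
    fix k assume k: "k > B"
    show "G (m + sv y (h23 - int k) + sv w (int k)) = 0"
      unfolding G[symmetric] using B[OF k] le by (simp add: sv_apply lin_zero[OF lin_Y] add_ac)
  qed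
  also have "\<dots> = ratio_mult x y h12 (kap p p') (ratio_mult x w h13 (kap p p'') (ratio_mult y w h23 (kap p' p'') N)) m"
    unfolding G_def
    by (simp add: ratio_mult_ratio_mult[OF _ o in_order(3) in_order(1)] ratio_mult_ratio_mult[OF _ o in_order(3) in_order(2)] c cone_ratio_mult[OF c o in_order(2)])
  finally show ?thesis .
qed

end

section \<open>Products over roots of unity and the linking condition\<close>

text \<open>Distinct numbers \<open>h r\<close> that all have the same power \<open>w\<close>, with exponent their number, are all the roots of the
  binomial with constant \<open>w\<close>.\<close>

lemma prod_linear_factors:
  fixes h :: "'a \<Rightarrow> complex"
  assumes S: "finite S" "inj_on h S" "card S > 0" and e: "\<And>r. r \<in> S \<Longrightarrow> h r ^ card S = w"
  shows "(\<Prod>r\<in>S. [:- h r, 1:]) = monom 1 (card S) - [:w:]"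
proof (rule poly_eqI_degree_lead_coeff[of _ "card S" _ "h ` S"])
  have d: "degree (\<Prod>r\<in>S. [:- h r, 1:]) = card S"
    by (subst degree_prod_eq_sum_degree) auto
  show "poly.coeff (\<Prod>r\<in>S. [:- h r, 1:]) (card S) = poly.coeff (monom 1 (card S) - [:w:]) (card S)"
    using S(3) lead_coeff_prod[of "\<lambda>r. [:- h r, 1:]" S] unfolding d
    by (cases "card S") simp_all
  show "degree (\<Prod>r\<in>S. [:- h r, 1:]) \<le> card S" by (simp add: d)
  show "degree (monom 1 (card S) - [:w:]) \<le> card S"
    by (rule degree_diff_le) (simp_all add: degree_monom_le)
  show "card S \<le> card (h ` S)" using S by (simp add: card_image)
  show "poly (\<Prod>r\<in>S. [:- h r, 1:]) z = poly (monom 1 (card S) - [:w:]) z" if "z \<in> h ` S" for z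
    using that S e by (auto simp: poly_prod poly_monom)
qed

lemma prod_fps_linear_factors:
  fixes h :: "'a \<Rightarrow> complex"
  assumes S: "finite S" "inj_on h S" "card S > 0" and e: "\<And>r. r \<in> S \<Longrightarrow> h r ^ card S = w"
  shows "(\<Prod>r\<in>S. 1 - fps_const (h r) * fps_X) = 1 - fps_const w * fps_X ^ card S"
proof -
  have "(\<Prod>r\<in>S. [:- h r, 1:]) = monom 1 (card S) - [:w:]" using assms by (rule prod_linear_factors)
  then have "(\<Prod>r\<in>S. reflect_poly [:- h r, 1:]) = reflect_poly (monom 1 (card S) - [:w:])"
    by (metis reflect_poly_prod)
  moreover have "reflect_poly [:- h r, 1:] = [:1, - h r:]" for r
    by (intro poly_eqI) (auto simp: coeff_reflect_poly coeff_pCons split: nat.splits)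
  moreover have "reflect_poly (monom 1 (card S) - [:w:]) = 1 - monom w (card S)"
  proof -
    have d: "degree (monom 1 (card S) - [:w:]) = card S"
      using S(3) by (subst diff_conv_add_uminus, subst degree_add_eq_left) (auto simp: degree_monom_eq)
    show ?thesis
      using S(3) by (intro poly_eqI) (auto simp: coeff_reflect_poly d coeff_pCons split: nat.splits)
  qed
  ultimately have "fps_of_poly (\<Prod>r\<in>S. [:1, - h r:]) = fps_of_poly (1 - monom w (card S))" by simp
  then show ?thesis
    by (simp add: fps_of_poly_prod fps_of_poly_linear' fps_of_poly_diff fps_of_poly_monom flip: fps_const_neg)
qed

lemma prod_linear_factors_0:
  fixes h :: "'a \<Rightarrow> complex"
  assumes "finite S" "inj_on h S" "card S > 0" and "\<And>r. r \<in> S \<Longrightarrow> h r ^ card S = w"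
  shows "(\<Prod>r\<in>S. - h r) = - w"
  using arg_cong[OF prod_linear_factors[OF assms], of "\<lambda>p. poly p 0"] assms(3)
  by (simp add: poly_prod poly_monom zero_power)

context twisted_cartan
begin

text \<open>\<open>\<mu>\<close> to an integer power, so that indices in the cyclic group can be subtracted.\<close>

definition rot :: "int \<Rightarrow> 'i \<Rightarrow> 'i" where "rot r = \<mu> ^^ nat (r mod int N)"
definition rot_entry :: "'i \<Rightarrow> 'i \<Rightarrow> int \<Rightarrow> int" where "rot_entry i j r = A i (rot r j)"

lemma \<mu>_pow_mod: "\<mu> ^^ n = \<mu> ^^ (n mod N)"
proof -
  have p: "\<mu> ^^ (N * k) = id" for k by (induction k) (simp_all add: funpow_add \<mu>_N)
  have "\<mu> ^^ n = \<mu> ^^ (N * (n div N) + n mod N)" by simp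
  then show ?thesis by (simp only: funpow_add p id_o)
qed

lemma rot_nat: "rot (int n) = \<mu> ^^ n"
  using \<mu>_pow_mod[of n] by (simp add: rot_def nat_mod_distrib)

lemma rot_add: "rot (r + s) j = rot r (rot s j)"
proof -
  define a b where "a = nat (r mod int N)" and "b = nat (s mod int N)"
  have ab: "r mod int N = int a" "s mod int N = int b" using N_pos by (simp_all add: a_def b_def)
  have "(r + s) mod int N = int ((a + b) mod N)"
    by (metis ab mod_add_eq of_nat_add of_nat_mod)
  then have "rot (r + s) = \<mu> ^^ ((a + b) mod N)" by (simp only: rot_def nat_int)
  then show ?thesis by (simp add: \<mu>_pow_mod[symmetric] funpow_add rot_def a_def b_def)
qed

lemma rot_0: "rot 0 j = j" by (simp add: rot_def)
lemma rot_minus: "rot (- r) (rot r j) = j" using rot_add[of "- r" r j] by (simp add: rot_0)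
lemma rot_minus': "rot r (rot (- r) j) = j" using rot_add[of r "- r" j] by (simp add: rot_0)
lemma rot_ZN: "r \<in> ZN \<Longrightarrow> rot r = \<mu> ^^ nat r" by (simp add: rot_def)
lemma A_rot: "A (rot r i) (rot r j) = A i j"
proof -
  have "A ((\<mu> ^^ n) i) ((\<mu> ^^ n) j) = A i j" for n by (induction n) (simp_all add: A_\<mu>)
  then show ?thesis by (simp add: rot_def)
qed

lemma A_sym: "A i j = A j i"
  using A_offdiag[of i j] A_offdiag[of j i] A_zero[of i j] by (cases "i = j") auto

lemma rot_entry_minus: "rot_entry i j (- r) = rot_entry j i r"
  unfolding rot_entry_def using A_rot[of r i "rot (- r) j"] A_sym by (simp add: rot_minus')
lemma rot_entry_shift: "rot_entry i j (r + s) = rot_entry i (rot s j) r" by (simp add: rot_entry_def rot_add)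
lemma rot_entry_mod: "rot_entry i j (r mod int N) = rot_entry i j r" by (simp add: rot_entry_def rot_def)
lemma rot_entry_values: "rot_entry i j r = 2 \<or> rot_entry i j r = 0 \<or> rot_entry i j r = - 1"
  using A_diag[of i] A_offdiag[of i "rot r j"] by (cases "i = rot r j") (auto simp: rot_entry_def)
lemma rot_entry_2: "rot_entry i j r = 2 \<longleftrightarrow> i = rot r j"
  using A_diag[of i] A_offdiag[of i "rot r j"] by (cases "i = rot r j") (auto simp: rot_entry_def)

lemma \<Gamma>p_iff: "r \<in> \<Gamma>p i j \<longleftrightarrow> r \<in> ZN \<and> rot_entry i j r = 2"
  using rot_entry_values[of i j r] by (auto simp: \<Gamma>p_def rot_entry_def rot_ZN)
lemma \<Gamma>m_iff: "r \<in> \<Gamma>m i j \<longleftrightarrow> r \<in> ZN \<and> rot_entry i j r = - 1"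
  using rot_entry_values[of i j r] by (auto simp: \<Gamma>m_def rot_entry_def rot_ZN)
lemma \<Gamma>_eq: "\<Gamma> i j = \<Gamma>p i j \<union> \<Gamma>m i j" by (auto simp: \<Gamma>_def \<Gamma>p_def \<Gamma>m_def)
lemma \<Gamma>_disjoint: "\<Gamma>p i j \<inter> \<Gamma>m i j = {}" by (auto simp: \<Gamma>p_def \<Gamma>m_def)
lemma finite_\<Gamma>: "finite (\<Gamma>p i j)" "finite (\<Gamma>m i j)"
  by (rule finite_subset[of _ ZN]; auto simp: \<Gamma>p_def \<Gamma>m_def)+

lemma ZN_split:
  fixes h :: "int \<Rightarrow> int \<Rightarrow> 'b::comm_monoid_mult"
  assumes "\<And>r. h 0 r = 1"
  shows "(\<Prod>r\<in>ZN. h (rot_entry i j r) r) = (\<Prod>r\<in>\<Gamma>p i j. h 2 r) * (\<Prod>r\<in>\<Gamma>m i j. h (- 1) r)"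
proof -
  have "(\<Prod>r\<in>ZN. h (rot_entry i j r) r) = (\<Prod>r\<in>\<Gamma>p i j \<union> \<Gamma>m i j. h (rot_entry i j r) r)"
    using rot_entry_values[of i j] assms by (intro prod.mono_neutral_right) (auto simp: \<Gamma>p_iff \<Gamma>m_iff, metis)
  also have "\<dots> = (\<Prod>r\<in>\<Gamma>p i j. h (rot_entry i j r) r) * (\<Prod>r\<in>\<Gamma>m i j. h (rot_entry i j r) r)"
    by (rule prod.union_disjoint[OF finite_\<Gamma> \<Gamma>_disjoint])
  also have "\<dots> = (\<Prod>r\<in>\<Gamma>p i j. h 2 r) * (\<Prod>r\<in>\<Gamma>m i j. h (- 1) r)"
    by (intro arg_cong2[where f = "(*)"] prod.cong) (auto simp: \<Gamma>p_iff \<Gamma>m_iff)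
  finally show ?thesis .
qed

lemma neg_bij: "bij_betw (\<lambda>r. (- r) mod int N) ZN ZN"
proof -
  have "(- ((- r) mod int N)) mod int N = r" if "r \<in> ZN" for r
    using that by (simp add: mod_minus_eq)
  then show ?thesis using N_pos
    by (intro bij_betw_byWitness[of _ "\<lambda>r. (- r) mod int N"]) auto
qed

lemma \<xi>_nonzero: "\<xi> \<noteq> 0" using \<xi>_N N_pos by (metis power_eq_0_iff zero_neq_one zero_power)

lemma \<xi>_powi_mod: "\<xi> powi (r mod int N) = \<xi> powi r"
proof -
  have "\<xi> powi r = \<xi> powi (int N * (r div int N) + r mod int N)" by simp
  also have "\<dots> = (\<xi> powi int N) powi (r div int N) * \<xi> powi (r mod int N)"
    by (simp only: power_int_add[OF disjI1[OF \<xi>_nonzero]] power_int_mult)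
  finally show ?thesis by (simp add: \<xi>_N)
qed

lemma \<xi>_powi_1: assumes "\<xi> powi r = 1" shows "r mod int N = 0"
proof (rule ccontr)
  assume "r mod int N \<noteq> 0"
  moreover have "0 \<le> r mod int N" "r mod int N < int N" using N_pos by auto
  ultimately have "0 < nat (r mod int N)" "nat (r mod int N) < N" by linarith+
  then have "\<xi> ^ nat (r mod int N) \<noteq> 1" by (rule \<xi>_primitive)
  moreover have "\<xi> ^ nat (r mod int N) = \<xi> powi (r mod int N)"
    using N_pos by (simp add: power_int_def)
  ultimately show False using assms by (simp add: \<xi>_powi_mod)
qed

lemma \<xi>_powi_eq: assumes "\<xi> powi r = \<xi> powi s" shows "r mod int N = s mod int N"
proof -
  have "\<xi> powi (r - s) = 1" using assms \<xi>_nonzero by (simp add: power_int_diff)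
  then have "(r - s) mod int N = 0" by (rule \<xi>_powi_1)
  then show ?thesis by (metis mod_eq_dvd_iff dvd_eq_mod_eq_0)
qed

lemma inj_\<xi>: assumes "S \<subseteq> ZN" shows "inj_on (\<lambda>r. \<xi> powi r) S"
proof (rule inj_onI)
  fix r s assume "r \<in> S" "s \<in> S" "\<xi> powi r = \<xi> powi s"
  then show "r = s" using \<xi>_powi_eq[of r s] assms by (auto simp: subset_iff)
qed

lemma inj_\<xi>_scaled: assumes "S \<subseteq> ZN" "c \<noteq> 0" shows "inj_on (\<lambda>r. \<xi> powi r * c) S" "inj_on (\<lambda>r. \<xi> powi (- r) * c) S"
  using inj_\<xi>[OF assms(1)] assms(2) by (auto simp: inj_on_def power_int_minus)

text \<open>Subgroups of the cyclic group of order \<open>N\<close>, as sets of representatives.  Under \<open>r \<mapsto> \<xi>\<^sup>r\<close> such a subgroup \<open>H\<close> is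
  the group of roots of unity of order \<open>card H\<close>; this turns products over \<open>\<Gamma>\<close> into binomials.\<close>

definition rot_subgroup :: "int set \<Rightarrow> bool" where
  "rot_subgroup H \<longleftrightarrow> H \<subseteq> ZN \<and> 0 \<in> H \<and> (\<forall>r\<in>H. \<forall>s\<in>H. (r + s) mod int N \<in> H) \<and> (\<forall>r\<in>H. (- r) mod int N \<in> H)"

lemma rot_subgroup_power: assumes H: "rot_subgroup H" and r: "r \<in> H" shows "(\<xi> powi r) ^ card H = 1"
proof -
  have b: "bij_betw (\<lambda>h. (h + r) mod int N) H H"
  proof (rule bij_betw_byWitness[of _ "\<lambda>h. (h + (- r) mod int N) mod int N"])
    show "\<forall>h\<in>H. ((h + r) mod int N + - r mod int N) mod int N = h"
      using H by (auto simp: rot_subgroup_def mod_simps)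
    show "\<forall>h\<in>H. ((h + - r mod int N) mod int N + r) mod int N = h"
      using H by (auto simp: rot_subgroup_def mod_simps)
  qed (use H r in \<open>auto simp: rot_subgroup_def\<close>)
  have "(\<Prod>h\<in>H. \<xi> powi h) = (\<Prod>h\<in>H. \<xi> powi ((h + r) mod int N))"
    by (rule prod.reindex_bij_betw[OF b, symmetric])
  also have "\<dots> = (\<Prod>h\<in>H. \<xi> powi h * \<xi> powi r)" by (simp add: \<xi>_powi_mod power_int_add \<xi>_nonzero)
  also have "\<dots> = (\<Prod>h\<in>H. \<xi> powi h) * (\<xi> powi r) ^ card H" by (simp add: prod.distrib)
  finally have "(\<Prod>h\<in>H. \<xi> powi h) = (\<Prod>h\<in>H. \<xi> powi h) * (\<xi> powi r) ^ card H" .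
  moreover have "(\<Prod>h\<in>H. \<xi> powi h) \<noteq> 0"
    by (cases "finite H") (simp_all add: \<xi>_nonzero)
  ultimately show ?thesis by simp
qed

lemma rot_subgroup_card_pos: "rot_subgroup H \<Longrightarrow> card H > 0"
  by (metis card_gt_0_iff empty_iff finite_atLeastLessThan_int finite_subset rot_subgroup_def)

lemma rot_subgroup_root: assumes H: "rot_subgroup H" and r: "(\<xi> powi r) ^ card H = 1" shows "r mod int N \<in> H"
proof -
  have "(\<Prod>h\<in>H. [:- (\<xi> powi h), 1:]) = monom 1 (card H) - [:1:]"
    using H by (intro prod_linear_factors inj_\<xi> rot_subgroup_card_pos rot_subgroup_power[OF H])
      (auto simp: rot_subgroup_def intro: finite_subset)
  from arg_cong[OF this, of "\<lambda>p. poly p (\<xi> powi r)"] r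
  have "(\<Prod>h\<in>H. \<xi> powi r - \<xi> powi h) = 0" by (simp add: poly_prod poly_monom)
  moreover have "finite H" using H by (auto simp: rot_subgroup_def intro: finite_subset)
  ultimately obtain h where "h \<in> H" "\<xi> powi r = \<xi> powi h" by auto
  then show ?thesis using \<xi>_powi_eq[of r h] H by (auto simp: rot_subgroup_def subset_iff)
qed

lemma rot_subgroup_dvd: assumes "rot_subgroup H" "rot_subgroup H'" "H \<subseteq> H'" shows "card H dvd card H'"
proof -
  interpret G: group "integer_mod_group N" by simp
  have s: "subgroup S (integer_mod_group N)" if S: "rot_subgroup S" for S
  proof (rule G.subgroupI)
    show "S \<subseteq> carrier (integer_mod_group N)" "S \<noteq> {}" using S N_pos by (auto simp: rot_subgroup_def carrier_integer_mod_group)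
    then show "inv\<^bsub>integer_mod_group N\<^esub> a \<in> S" if "a \<in> S" for a
      using that S by (subst inv_integer_mod_group) (auto simp: rot_subgroup_def)
    show "a \<otimes>\<^bsub>integer_mod_group N\<^esub> b \<in> S" if "a \<in> S" "b \<in> S" for a b
      using that S by (auto simp: rot_subgroup_def)
  qed
  interpret H': group "integer_mod_group N\<lparr>carrier := H'\<rparr>"
    by (rule G.subgroup_imp_group[OF s[OF assms(2)]])
  have "subgroup H (integer_mod_group N\<lparr>carrier := H'\<rparr>)"
    by (rule G.subgroup_incl[OF s[OF assms(1)] s[OF assms(2)] assms(3)])
  from H'.lagrange[OF this] show ?thesis by (simp add: order_def) (metis dvd_triv_left dvd_triv_right)
qed

lemma rot_subgroup_\<Gamma>m: assumes "A i j < 0" shows "rot_subgroup (\<Gamma>m i j)"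
proof -
  have s: "subgroup (\<Gamma>m i j) (integer_mod_group N)" using linking[OF assms] by (simp add: \<Gamma>m_def)
  have c: "\<Gamma>m i j \<subseteq> ZN" by (auto simp: \<Gamma>m_def)
  have "(- r) mod int N \<in> \<Gamma>m i j" if "r \<in> \<Gamma>m i j" for r
    using subgroup.m_inv_closed[OF s that] c that N_pos by (subst (asm) inv_integer_mod_group) (auto simp: carrier_integer_mod_group)
  then show ?thesis
    using subgroup.m_closed[OF s] subgroup.one_closed[OF s] c by (auto simp: rot_subgroup_def)
qed

lemma rot_subgroup_\<Gamma>p: "rot_subgroup (\<Gamma>p i i)"
proof -
  have "rot (r + s) i = i" if "rot r i = i" "rot s i = i" for r s using that by (simp add: rot_add)
  moreover have "rot (- r) i = i" if "rot r i = i" for r using rot_minus[of r i] that by simp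
  moreover have "r \<in> \<Gamma>p i i \<longleftrightarrow> r \<in> ZN \<and> rot r i = i" for r by (auto simp: \<Gamma>p_iff rot_entry_2)
  moreover have "rot (r mod int N) i = rot r i" for r by (simp add: rot_def)
  moreover have "\<Gamma>p i i \<subseteq> ZN" by (auto simp: \<Gamma>p_def)
  ultimately show ?thesis using N_pos rot_0[of i] unfolding rot_subgroup_def by simp
qed

lemma \<Gamma>p_sub: assumes "A i j < 0" shows "\<Gamma>p i i \<subseteq> \<Gamma>m i j"
proof
  fix r assume r: "r \<in> \<Gamma>p i i"
  then have "i = rot r i" by (simp add: \<Gamma>p_iff rot_entry_2)
  then have "rot_entry i j r = A i j" unfolding rot_entry_def by (metis A_rot)
  then show "r \<in> \<Gamma>m i j" using r assms rot_entry_values[of i j r] by (auto simp: \<Gamma>m_iff \<Gamma>p_iff)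
qed

lemma d_pos: "d i > 0" unfolding d_def by (rule rot_subgroup_card_pos[OF rot_subgroup_\<Gamma>p])

lemma d_dvd: "A i j < 0 \<Longrightarrow> d i dvd dd i j"
  unfolding d_def dd_def by (intro rot_subgroup_dvd rot_subgroup_\<Gamma>p rot_subgroup_\<Gamma>m \<Gamma>p_sub)

text \<open>For \<open>l\<close> in \<open>\<Gamma>m i i\<close> the linking condition applies to \<open>i\<close> and \<open>\<mu>\<^sup>l(i)\<close> and makes \<open>\<Gamma>m i i\<close> a coset of a subgroup \<open>H\<close>, so that
  all \<open>\<xi>\<^sup>r\<close> with \<open>r\<close> in this coset have the same power \<open>w\<close> with exponent \<open>card H\<close>.  The coset is stable under negation, hence \<open>w\<^sup>2 = 1\<close>;
  it does not contain 0, hence \<open>w = - 1\<close>.\<close>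

lemma \<Gamma>m_self:
  assumes "dd i i > 0"
  shows "d i dvd dd i i" "r \<in> \<Gamma>m i i \<Longrightarrow> (\<xi> powi r) ^ dd i i = - 1"
proof -
  obtain l where l: "l \<in> \<Gamma>m i i" using assms unfolding dd_def by (metis card_gt_0_iff ex_in_conv)
  define j where "j = rot l i"
  have neg: "A i j < 0" using l by (simp add: \<Gamma>m_iff rot_entry_def j_def)
  let ?H = "\<Gamma>m i j"
  have H: "rot_subgroup ?H" by (rule rot_subgroup_\<Gamma>m[OF neg])
  have mem: "(r - l) mod int N \<in> ?H \<longleftrightarrow> rot_entry i i r = - 1" for r
    using N_pos rot_entry_shift[of i i "r - l" l] by (simp add: \<Gamma>m_iff rot_entry_mod j_def)
  have c: "card ?H = dd i i"
    unfolding dd_def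
  proof (rule bij_betw_same_card, rule bij_betw_byWitness[of _ "\<lambda>r. (r - l) mod int N"])
    show "\<forall>a\<in>?H. ((a + l) mod int N - l) mod int N = a" by (auto simp: \<Gamma>m_iff mod_simps)
    show "\<forall>a\<in>\<Gamma>m i i. ((a - l) mod int N + l) mod int N = a" by (auto simp: \<Gamma>m_iff mod_simps)
    show "(\<lambda>a. (a + l) mod int N) ` ?H \<subseteq> \<Gamma>m i i"
      using N_pos by (auto simp: \<Gamma>m_iff rot_entry_mod rot_entry_shift j_def)
    show "(\<lambda>r. (r - l) mod int N) ` \<Gamma>m i i \<subseteq> ?H" using mem by (auto simp: \<Gamma>m_iff)
  qed
  define w where "w = (\<xi> powi l) ^ dd i i"
  have w: "(\<xi> powi r) ^ dd i i = w" if "rot_entry i i r = - 1" for r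
  proof -
    have "(\<xi> powi ((r - l) mod int N)) ^ dd i i = 1" using rot_subgroup_power[OF H, of "(r - l) mod int N"] mem[of r] that c by simp
    then show ?thesis using \<xi>_nonzero by (simp add: \<xi>_powi_mod power_int_diff power_divide w_def)
  qed
  have "rot_entry i i (- l) = - 1" using l by (simp add: rot_entry_minus \<Gamma>m_iff)
  then have "(\<xi> powi (- l)) ^ dd i i = w" by (rule w)
  then have "inverse w = w" by (simp add: w_def power_int_minus power_inverse)
  then have "w * w = 1" using \<xi>_nonzero by (metis right_inverse w_def power_not_zero power_int_not_zero)
  then have "w = 1 \<or> w = - 1" by (simp add: square_eq_1_iff)
  moreover have "w \<noteq> 1"
  proof
    assume "w = 1"
    then have "l mod int N \<in> ?H" by (intro rot_subgroup_root[OF H]) (simp add: c w_def)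
    then have "(- (l mod int N)) mod int N \<in> ?H" using H by (auto simp: rot_subgroup_def)
    then have "(0 - l) mod int N \<in> ?H" by (simp add: mod_simps)
    then have "rot_entry i i 0 = - 1" by (simp only: mem)
    then show False by (simp add: rot_entry_def rot_0 A_diag)
  qed
  ultimately have "w = - 1" by simp
  then show "d i dvd dd i i" "r \<in> \<Gamma>m i i \<Longrightarrow> (\<xi> powi r) ^ dd i i = - 1"
    using w[of r] d_dvd[OF neg] c by (auto simp: \<Gamma>m_iff dd_def)
qed

end

section \<open>The Heisenberg action and its contractions\<close>

text \<open>The degree in the Heisenberg grading, where \<open>\<alpha>\<^sub>i\<^sub>,\<^sub>-\<^sub>n\<close> has degree \<open>n\<close>; the variable \<open>(i, m)\<close> stands for \<open>n = m + 1\<close>.\<close>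

definition wt :: "('i \<times> nat \<Rightarrow>\<^sub>0 nat) \<Rightarrow> nat" where
  "wt m = (\<Sum>v\<in>Poly_Mapping.keys m. Poly_Mapping.lookup m v * Suc (snd v))"

lemma wt_superset: "finite S \<Longrightarrow> Poly_Mapping.keys m \<subseteq> S \<Longrightarrow> wt m = (\<Sum>v\<in>S. Poly_Mapping.lookup m v * Suc (snd v))"
  unfolding wt_def by (rule sum.mono_neutral_left) (auto simp: in_keys_iff)

lemma wt_add_single: "wt (m + Poly_Mapping.single v 1) = wt m + Suc (snd v)"
proof -
  let ?S = "insert v (Poly_Mapping.keys m)"
  have "wt (m + Poly_Mapping.single v 1) = (\<Sum>u\<in>?S. Poly_Mapping.lookup (m + Poly_Mapping.single v 1) u * Suc (snd u))"
    using keys_add[of m "Poly_Mapping.single v 1"] by (intro wt_superset) auto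
  also have "\<dots> = (\<Sum>u\<in>?S. Poly_Mapping.lookup m u * Suc (snd u) + (if u = v then Suc (snd v) else 0))"
    by (intro sum.cong refl) (auto simp: lookup_add lookup_single)
  also have "\<dots> = wt m + Suc (snd v)"
    unfolding sum.distrib by (subst wt_superset[of ?S m]) (auto simp: sum.delta)
  finally show ?thesis .
qed

context graded_module
begin

interpretation T: vector_space scaleT by (rule T_vector_space)

lemma scaleP_lookup: "Poly_Mapping.lookup (scaleP c f) m = scaleT c (Poly_Mapping.lookup f m)"
  by (auto simp: scaleP_def Poly_Mapping.map.rep_eq when_def)

lemma vector_space_scaleP: "vector_space scaleP"
  by unfold_locales
    (auto intro!: poly_mapping_eqI simp: scaleP_lookup lookup_add T.scale_right_distrib T.scale_left_distrib)

sublocale P: complex_space scaleP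
  by (intro complex_space.intro vector_space_scaleP)

sublocale TT: complex_space scaleT
  by (intro complex_space.intro T_vector_space)

lemma lookup_onT: "h 0 = 0 \<Longrightarrow> Poly_Mapping.lookup (onT h f) m = h (Poly_Mapping.lookup f m)"
  by (auto simp: onT_def Poly_Mapping.map.rep_eq when_def)

lemma lookup_mult_var:
  "Poly_Mapping.lookup (mult_var v f) m =
    (if Poly_Mapping.lookup m v > 0 then Poly_Mapping.lookup f (m - Poly_Mapping.single v 1) else 0)"
proof -
  have *: "Poly_Mapping.lookup (mult_var v f) m =
    (\<Sum>n\<in>Poly_Mapping.keys f. if n + Poly_Mapping.single v 1 = m then Poly_Mapping.lookup f n else 0)"
    by (simp add: mult_var_def lookup_sum lookup_single when_def)
  show ?thesis
  proof (cases "Poly_Mapping.lookup m v > 0")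
    case True
    have "n + Poly_Mapping.single v 1 = m \<longleftrightarrow> n = m - Poly_Mapping.single v 1" for n
    proof
      assume "n = m - Poly_Mapping.single v 1"
      then show "n + Poly_Mapping.single v 1 = m"
        using True by (intro poly_mapping_eqI) (auto simp: lookup_add lookup_minus lookup_single when_def)
    qed auto
    then show ?thesis unfolding * using True by (simp add: sum.delta in_keys_iff)
  next
    case False
    have "n + Poly_Mapping.single v 1 \<noteq> m" for n
    proof
      assume "n + Poly_Mapping.single v 1 = m"
      then have "Poly_Mapping.lookup m v = Poly_Mapping.lookup n v + 1" by (auto simp: lookup_add)
      then show False using False by simp
    qed
    then show ?thesis unfolding * using False by simp
  qed
qed

lemma lookup_deriv_var:
  "Poly_Mapping.lookup (deriv_var v f) m =
    scaleT (of_nat (Poly_Mapping.lookup m v + 1)) (Poly_Mapping.lookup f (m + Poly_Mapping.single v 1))"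
proof -
  have "Poly_Mapping.lookup (deriv_var v f) m =
    (\<Sum>n\<in>Poly_Mapping.keys f. if n - Poly_Mapping.single v 1 = m then scaleT (of_nat (Poly_Mapping.lookup n v)) (Poly_Mapping.lookup f n) else 0)"
    by (simp add: deriv_var_def lookup_sum lookup_single when_def)
  also have "\<dots> = (\<Sum>n\<in>Poly_Mapping.keys f. if n = m + Poly_Mapping.single v 1 then scaleT (of_nat (Poly_Mapping.lookup n v)) (Poly_Mapping.lookup f n) else 0)"
  proof (intro sum.cong refl)
    fix n
    show "(if n - Poly_Mapping.single v 1 = m then scaleT (of_nat (Poly_Mapping.lookup n v)) (Poly_Mapping.lookup f n) else 0) =
      (if n = m + Poly_Mapping.single v 1 then scaleT (of_nat (Poly_Mapping.lookup n v)) (Poly_Mapping.lookup f n) else 0)"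
    proof (cases "Poly_Mapping.lookup n v = 0")
      case False
      have "n - Poly_Mapping.single v 1 = m \<longleftrightarrow> n = m + Poly_Mapping.single v 1"
      proof
        assume "n - Poly_Mapping.single v 1 = m"
        then show "n = m + Poly_Mapping.single v 1"
          using False by (intro poly_mapping_eqI) (auto simp: lookup_add lookup_minus lookup_single when_def)
      qed auto
      then show ?thesis by simp
    qed simp
  qed
  finally show ?thesis by (auto simp: sum.delta in_keys_iff lookup_add)
qed

lemma lin_mult_var: "P.lin (mult_var v)"
  by (rule P.linI; rule poly_mapping_eqI) (auto simp: lookup_mult_var lookup_add scaleP_lookup)

lemma lin_deriv_var: "P.lin (deriv_var v)"
  by (rule P.linI; rule poly_mapping_eqI)
     (auto simp: lookup_deriv_var lookup_add scaleP_lookup T.scale_right_distrib mult.commute)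

lemma lin_onT: "TT.lin h \<Longrightarrow> P.lin (onT h)"
  by (rule P.linI; rule poly_mapping_eqI)
     (auto simp: lookup_onT lookup_add scaleP_lookup TT.lin_zero TT.lin_add TT.lin_scale)

lemma mult_mult: "mult_var u (mult_var v f) = mult_var v (mult_var u f)"
proof (rule poly_mapping_eqI)
  fix m
  have "m - Poly_Mapping.single u 1 - Poly_Mapping.single v 1 = m - Poly_Mapping.single v 1 - Poly_Mapping.single u (1::nat)"
    by (rule poly_mapping_eqI) (simp add: lookup_minus)
  then show "Poly_Mapping.lookup (mult_var u (mult_var v f)) m = Poly_Mapping.lookup (mult_var v (mult_var u f)) m"
    by (auto simp: lookup_mult_var lookup_minus lookup_single when_def)
qed

lemma deriv_deriv: "deriv_var u (deriv_var v f) = deriv_var v (deriv_var u f)"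
  by (rule poly_mapping_eqI)
     (auto simp: lookup_deriv_var lookup_add lookup_single when_def mult.commute add_ac)

lemma deriv_mult: "deriv_var u (mult_var v f) = mult_var v (deriv_var u f) + (if u = v then f else 0)"
proof (rule poly_mapping_eqI)
  fix m
  show "Poly_Mapping.lookup (deriv_var u (mult_var v f)) m =
    Poly_Mapping.lookup (mult_var v (deriv_var u f) + (if u = v then f else 0)) m"
  proof (cases "u = v")
    case True
    have 1: "m + Poly_Mapping.single v 1 - Poly_Mapping.single v 1 = m"
      by (rule poly_mapping_eqI) (simp add: lookup_minus lookup_add)
    have 2: "m - Poly_Mapping.single v 1 + Poly_Mapping.single v 1 = m" if "Poly_Mapping.lookup m v > 0"
      using that by (intro poly_mapping_eqI) (auto simp: lookup_minus lookup_add lookup_single when_def)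
    show ?thesis
      by (cases "Poly_Mapping.lookup m v > 0")
         (auto simp: True lookup_deriv_var lookup_mult_var lookup_add lookup_minus 1[simplified] 2[simplified] T.scale_left_distrib)
  next
    case False
    have "m + Poly_Mapping.single u 1 - Poly_Mapping.single v 1 = m - Poly_Mapping.single v 1 + Poly_Mapping.single u 1"
      if "Poly_Mapping.lookup m v > 0"
      using that by (intro poly_mapping_eqI) (auto simp: lookup_minus lookup_add lookup_single when_def)
    then show ?thesis
      using False by (auto simp: lookup_deriv_var lookup_mult_var lookup_add lookup_minus lookup_single when_def)
  qed
qed

lemma onT_mult: "h 0 = 0 \<Longrightarrow> onT h (mult_var v f) = mult_var v (onT h f)"
  by (rule poly_mapping_eqI) (simp add: lookup_onT lookup_mult_var)
lemma onT_deriv: "TT.lin h \<Longrightarrow> onT h (deriv_var v f) = deriv_var v (onT h f)"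
  by (rule poly_mapping_eqI) (simp add: lookup_onT lookup_deriv_var TT.lin_scale TT.lin_zero)
lemma onT_scaleP: "TT.lin h \<Longrightarrow> onT h (scaleP c f) = scaleP c (onT h f)"
  by (rule P.lin_scale[OF lin_onT])
lemma lin_\<alpha>op: "P.lin (\<alpha>op i m)"
proof -
  have "P.lin (\<lambda>f. \<Sum>j\<in>UNIV. scaleP (H1_scalar i j m) (deriv_var (j, nat m - 1) f))"
    by (intro P.lin_sum_fun P.lin_scale_fun lin_deriv_var)
  then show ?thesis using lin_mult_var[of "(i, nat (- m) - 1)"] by (auto simp: P.lin_def \<alpha>op_def)
qed

lemma \<alpha>op_neg: "n > 0 \<Longrightarrow> \<alpha>op i (- int n) f = mult_var (i, n - 1) f"
  by (simp add: \<alpha>op_def)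
lemma \<alpha>op_pos: "n > 0 \<Longrightarrow> \<alpha>op i (int n) f = (\<Sum>j\<in>UNIV. scaleP (H1_scalar i j (int n)) (deriv_var (j, n - 1) f))"
  by (simp add: \<alpha>op_def)

lemma \<alpha>op_comm_neg: "\<alpha>op i (- int n) (\<alpha>op j (- int m) f) = \<alpha>op j (- int m) (\<alpha>op i (- int n) f)"
  by (cases "n = 0"; cases "m = 0") (simp_all add: \<alpha>op_neg mult_mult \<alpha>op_def P.lin_zero[OF lin_mult_var])

lemma \<alpha>op_comm_pos: "\<alpha>op i (int n) (\<alpha>op j (int m) f) = \<alpha>op j (int m) (\<alpha>op i (int n) f)"
proof (cases "n = 0 \<or> m = 0")
  case True
  then show ?thesis using P.lin_zero[OF lin_\<alpha>op] by (auto simp: \<alpha>op_def[of _ 0])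
next
  case False
  have "\<alpha>op i (int n) (\<alpha>op j (int m) f) =
    (\<Sum>a\<in>UNIV. \<Sum>b\<in>UNIV. scaleP (H1_scalar i a (int n) * H1_scalar j b (int m)) (deriv_var (a, n - 1) (deriv_var (b, m - 1) f)))"
    using False by (simp add: \<alpha>op_pos P.lin_sum[OF lin_deriv_var] P.lin_scale[OF lin_deriv_var] P.scale_sum_right)
  also have "\<dots> = \<alpha>op j (int m) (\<alpha>op i (int n) f)"
    using False
    by (subst sum.swap)
       (simp add: \<alpha>op_pos P.lin_sum[OF lin_deriv_var] P.lin_scale[OF lin_deriv_var] P.scale_sum_right mult.commute,
        intro sum.cong refl arg_cong[where f = "scaleP _"] deriv_deriv)
  finally show ?thesis .
qed

lemma \<alpha>op_comm:
  assumes "n > 0" "m > 0"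
  shows "\<alpha>op i (int n) (\<alpha>op j (- int m) f) = \<alpha>op j (- int m) (\<alpha>op i (int n) f) +
    (if m = n then scaleP (H1_scalar i j (int n)) f else 0)"
proof -
  have e: "(a, n - 1) = (j, m - 1) \<longleftrightarrow> a = j \<and> m = n" for a using assms by auto
  have "\<alpha>op i (int n) (\<alpha>op j (- int m) f) = (\<Sum>a\<in>UNIV. scaleP (H1_scalar i a (int n)) (mult_var (j, m - 1) (deriv_var (a, n - 1) f))
     + (if a = j then (if m = n then scaleP (H1_scalar i j (int n)) f else 0) else 0))"
    using assms by (auto simp: \<alpha>op_pos \<alpha>op_neg deriv_mult P.scale_right_distrib e intro!: sum.cong)
  then show ?thesis using assms
    by (simp add: sum.distrib sum.delta \<alpha>op_pos \<alpha>op_neg P.lin_sum[OF lin_mult_var] P.lin_scale[OF lin_mult_var])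
qed

lemma onT_\<alpha>op: "TT.lin h \<Longrightarrow> onT h (\<alpha>op i m f) = \<alpha>op i m (onT h f)"
  by (auto simp: \<alpha>op_def onT_mult TT.lin_zero onT_deriv P.lin_sum[OF lin_onT] onT_scaleP P.lin_zero[OF lin_onT])

definition Flt :: "int \<Rightarrow> ('i, 't) poly_tensor set" where
  "Flt K = {f. \<forall>m. Poly_Mapping.lookup f m \<noteq> 0 \<longrightarrow> int (wt m) \<le> K}"

lemma mult_var_Flt: assumes "f \<in> Flt K" shows "mult_var v f \<in> Flt (K + int (Suc (snd v)))"
  unfolding Flt_def
proof (intro CollectI allI impI)
  fix m assume "Poly_Mapping.lookup (mult_var v f) m \<noteq> 0"
  then have pos: "Poly_Mapping.lookup m v > 0" and "Poly_Mapping.lookup f (m - Poly_Mapping.single v 1) \<noteq> 0"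
    by (auto simp: lookup_mult_var split: if_splits)
  then have "int (wt (m - Poly_Mapping.single v 1)) \<le> K" using assms by (auto simp: Flt_def)
  moreover have "m - Poly_Mapping.single v 1 + Poly_Mapping.single v 1 = m"
    using pos by (intro poly_mapping_eqI) (auto simp: lookup_minus lookup_add lookup_single when_def)
  ultimately show "int (wt m) \<le> K + int (Suc (snd v))"
    using wt_add_single[of "m - Poly_Mapping.single v 1" v] by simp
qed

lemma deriv_var_Flt: assumes "f \<in> Flt K" shows "deriv_var v f \<in> Flt (K - int (Suc (snd v)))"
  unfolding Flt_def
proof (intro CollectI allI impI)
  fix m assume "Poly_Mapping.lookup (deriv_var v f) m \<noteq> 0"
  then have "Poly_Mapping.lookup f (m + Poly_Mapping.single v 1) \<noteq> 0"
    by (auto simp: lookup_deriv_var)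
  then have "int (wt (m + Poly_Mapping.single v 1)) \<le> K" using assms by (auto simp: Flt_def)
  then show "int (wt m) \<le> K - int (Suc (snd v))"
    unfolding wt_add_single by simp
qed

lemma Flt_zero: "0 \<in> Flt K" by (simp add: Flt_def)
lemma Flt_plus: "u \<in> Flt K \<Longrightarrow> v \<in> Flt K \<Longrightarrow> u + v \<in> Flt K"
  by (auto simp: Flt_def lookup_add) (metis add_0)
lemma Flt_scaleP: "u \<in> Flt K \<Longrightarrow> scaleP c u \<in> Flt K"
  by (auto simp: Flt_def scaleP_lookup)
lemma Flt_SUM: "(\<And>i. i \<in> S \<Longrightarrow> h i \<in> Flt K) \<Longrightarrow> sum h S \<in> Flt K"
  by (induction S rule: infinite_finite_induct) (auto intro: Flt_zero Flt_plus)
lemma Flt_exists: "\<exists>K. u \<in> Flt K"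
proof -
  have "int (wt m) \<le> int (\<Sum>n\<in>Poly_Mapping.keys u. wt n)" if "Poly_Mapping.lookup u m \<noteq> 0" for m
    using that by (intro of_nat_mono member_le_sum) (auto simp: in_keys_iff)
  then show ?thesis by (intro exI[of _ "int (\<Sum>n\<in>Poly_Mapping.keys u. wt n)"]) (auto simp: Flt_def)
qed
lemma Flt_negative: "K < 0 \<Longrightarrow> u \<in> Flt K \<Longrightarrow> u = 0"
  by (rule poly_mapping_eqI) (force simp: Flt_def)

lemma \<alpha>op_neg_Flt: "f \<in> Flt K \<Longrightarrow> \<alpha>op i (- int n) f \<in> Flt (K + int n)"
  using mult_var_Flt[of f K "(i, n - 1)"] by (cases "n = 0") (auto simp: \<alpha>op_neg \<alpha>op_def[of _ 0] Flt_zero)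

lemma \<alpha>op_pos_Flt: "f \<in> Flt K \<Longrightarrow> \<alpha>op i (int n) f \<in> Flt (K - int n)"
  using deriv_var_Flt[of f K "(_, n - 1)"]
  by (cases "n = 0") (auto simp: \<alpha>op_pos \<alpha>op_def[of _ 0] Flt_zero intro!: Flt_SUM Flt_scaleP)

text \<open>The exponents of the two factors of \<open>X\<^sub>i(z)\<close>, with the powers of \<open>q\<^sup>1\<^sup>/\<^sup>2\<close> that shift the argument absorbed into the coefficients.\<close>

definition am :: "pm \<times> 'i \<Rightarrow> nat \<Rightarrow> ('i, 't) poly_tensor \<Rightarrow> ('i, 't) poly_tensor" where
  "am p n v = scaleP (of_int (sg (fst p)) / qint q (int n) * (rt q powi (- sg (fst p))) ^ n) (\<alpha>op (snd p) (- int n) v)"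

definition ap :: "pm \<times> 'i \<Rightarrow> nat \<Rightarrow> ('i, 't) poly_tensor \<Rightarrow> ('i, 't) poly_tensor" where
  "ap p n v = scaleP (- of_int (sg (fst p)) / qint q (int n) * (rt q powi (- sg (fst p))) ^ n) (\<alpha>op (snd p) (int n) v)"

definition lam :: "pm \<times> 'i \<Rightarrow> pm \<times> 'i \<Rightarrow> nat \<Rightarrow> complex" where
  "lam p p' n = (- of_int (sg (fst p)) / qint q (int n) * (rt q powi (- sg (fst p))) ^ n) *
     (of_int (sg (fst p')) / qint q (int n) * (rt q powi (- sg (fst p'))) ^ n) * H1_scalar (snd p) (snd p') (int n)"

lemma \<alpha>op_zero: "\<alpha>op i 0 = (\<lambda>_. 0)" by (simp add: \<alpha>op_def fun_eq_iff)

lemma lin_am: "P.lin (am p n)" unfolding am_def[abs_def] by (rule P.lin_scale_fun[OF lin_\<alpha>op])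
lemma lin_ap: "P.lin (ap p n)" unfolding ap_def[abs_def] by (rule P.lin_scale_fun[OF lin_\<alpha>op])

lemma am_am: "am p m (am p' n v) = am p' n (am p m v)"
  unfolding am_def P.lin_scale[OF lin_\<alpha>op] \<alpha>op_comm_neg[of "snd p" m "snd p'" n v]
  by (simp add: mult.commute)
lemma ap_ap: "ap p m (ap p' n v) = ap p' n (ap p m v)"
  unfolding ap_def P.lin_scale[OF lin_\<alpha>op] \<alpha>op_comm_pos[of "snd p" m "snd p'" n v]
  by (simp only: P.scale_scale mult.commute)

lemma exponentiable_am: "P.exponentiable (am p)"
  unfolding P.exponentiable_def using lin_am am_am by (auto simp: am_def[of p 0] fun_eq_iff \<alpha>op_zero)
lemma exponentiable_ap: "P.exponentiable (ap p)"
  unfolding P.exponentiable_def using lin_ap ap_ap by (auto simp: ap_def[of p 0] fun_eq_iff \<alpha>op_zero)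

text \<open>The contribution of one rotation to the contraction of two currents of signs \<open>s\<close> and \<open>t\<close>, where \<open>a\<close> is the
  entry of the Cartan matrix and \<open>b\<close> the power of \<open>\<xi>\<close>.\<close>

definition kap_factor :: "pm \<Rightarrow> pm \<Rightarrow> int \<Rightarrow> complex \<Rightarrow> complex fps" where
  "kap_factor s t a b = (let L = (\<lambda>c. 1 - fps_const c * fps_X) in
     if s = t then (if a = 2 then L b * L (b * q powi (- 2 * sg s)) else if a = - 1 then inverse (L (b * q powi (- sg s))) else 1)
     else (if a = 2 then inverse (L (b * q)) * inverse (L (b * inverse q)) else if a = - 1 then L b else 1))"

definition kap :: "pm \<times> 'i \<Rightarrow> pm \<times> 'i \<Rightarrow> complex fps" where
  "kap p p' = (\<Prod>r\<in>ZN. kap_factor (fst p) (fst p') (A (snd p) ((\<mu> ^^ nat r) (snd p'))) (\<xi> powi r))"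

lemma sum_simple: "(\<Sum>b\<in>UNIV. h b * simple j b) = h j"
proof -
  have "(\<Sum>b\<in>UNIV. h b * simple j b) = (\<Sum>b\<in>UNIV. if b = j then h b else 0)"
    by (rule sum.cong) (auto simp: simple_def)
  then show ?thesis by (simp add: sum.delta)
qed

lemma \<mu>Q_simple: "\<mu>Q (simple i) = simple (\<mu> i)"
proof
  fix j
  have "\<mu>Q (simple i) j = (\<Sum>a\<in>UNIV. simple (\<mu> a) j * simple i a)"
    by (simp add: \<mu>Q_def P.sum_fun_apply mult.commute)
  then show "\<mu>Q (simple i) j = simple (\<mu> i) j" by (simp only: sum_simple)
qed

lemma \<mu>Q_pow_simple: "(\<mu>Q ^^ n) (simple i) = simple ((\<mu> ^^ n) i)"
  by (induction n) (simp_all add: \<mu>Q_simple)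

lemma form_simple: "form (simple i) (simple j) = A i j"
  unfolding form_def sum_simple mult.commute[of "simple i _"] by (rule refl)

lemma A_values: "A i j = 2 \<or> A i j = 0 \<or> A i j = - 1"
  using A_diag[of i] A_offdiag[of i j] by (cases "i = j") auto
lemma q_pow_ne: "n > 0 \<Longrightarrow> q ^ n \<noteq> inverse q ^ n"
proof
  assume n: "n > 0" and "q ^ n = inverse q ^ n"
  then have "q ^ n * q ^ n = 1" by (metis power_mult_distrib power_one q_nonzero right_inverse)
  then have "q ^ (n + n) = 1" by (simp add: power_add)
  then show False using q_generic[of "n + n"] n by simp
qed

lemma qint_nonzero: assumes "n > 0" shows "qint q (int n) \<noteq> 0"
  using q_pow_ne[OF assms] q_pow_ne[of 1] by (simp add: qint_def power_int_minus power_inverse)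

lemma log_deriv_kap_factor:
  assumes a: "a = 2 \<or> a = 0 \<or> a = - 1" and b: "b \<noteq> 0"
  shows "log_deriv (kap_factor s t a b) (Abs_fps (\<lambda>n. if n = 0 then 0 else
     - of_int (sg s * sg t) * (rt q powi (- sg s)) ^ n * (rt q powi (- sg t)) ^ n * b ^ n * qint q (int n * a) / qint q (int n)))"
    and "fps_nth (kap_factor s t a b) 0 = 1"
proof -
  have r0: "rt q \<noteq> 0" using rt_square[of q] q_nonzero by auto
  have r1: "(rt q) ^ n * (rt q) ^ n = q ^ n" for n
    by (metis power_mult_distrib power2_eq_square rt_square)
  have r2: "inverse (rt q) ^ n * inverse (rt q) ^ n = inverse q ^ n" for n
    using r1[of n] by (metis inverse_mult_distrib power_inverse)
  have r3: "rt q ^ n * inverse (rt q) ^ n = 1" "inverse (rt q) ^ n * rt q ^ n = 1" for n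
    using r0 by (simp_all add: power_mult_distrib[symmetric])
  have q2: "qint q (int n * 2) / qint q (int n) = q ^ n + inverse q ^ n" if "n > 0" for n
  proof -
    have "q ^ n - inverse q ^ n \<noteq> 0" "q - inverse q \<noteq> 0" using q_pow_ne[OF that] q_pow_ne[of 1] by auto
    moreover have "qint q (int n * 2) = (q ^ n - inverse q ^ n) * (q ^ n + inverse q ^ n) / (q - inverse q)"
    proof -
      have "q powi (int n * 2) = q ^ n * q ^ n"
        by (simp only: mult_2_right power_int_add[OF disjI1[OF q_nonzero]] power_int_of_nat)
      then show ?thesis by (simp add: qint_def power_int_minus power_inverse algebra_simps)
    qed
    moreover have "qint q (int n) = (q ^ n - inverse q ^ n) / (q - inverse q)"
      by (simp add: qint_def power_int_minus power_inverse)
    moreover have "x * y / z / (x / z) = y" if "x \<noteq> 0" "z \<noteq> 0" for x y z :: complex using that by simp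
    ultimately show ?thesis by simp
  qed
  have q1: "qint q (int n * (- 1)) / qint q (int n) = - 1" if "n > 0" for n
  proof -
    have "qint q (int n * (- 1)) = - qint q (int n)" by (simp add: qint_def diff_divide_distrib)
    then show ?thesis using qint_nonzero[OF that] by simp
  qed
  have q0: "qint q 0 = 0" by (simp add: qint_def)
  have nz: "fps_nth (1 - fps_const c * fps_X) 0 \<noteq> 0" for c :: complex by simp
  have p2: "q powi (- 2) = inverse q * inverse q" "q powi 2 = q * q"
    by (simp_all add: power_int_minus power2_eq_square)
  have qi: "q ^ n * inverse q ^ n = 1" "inverse q ^ n * q ^ n = 1" for n
    using q_nonzero by (simp_all add: power_mult_distrib[symmetric])
  have L: "log_deriv f L \<Longrightarrow> L = L' \<Longrightarrow> log_deriv f L'" for f L L' by simp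
  show "log_deriv (kap_factor s t a b) (Abs_fps (\<lambda>n. if n = 0 then 0 else
     - of_int (sg s * sg t) * (rt q powi (- sg s)) ^ n * (rt q powi (- sg t)) ^ n * b ^ n * qint q (int n * a) / qint q (int n)))"
    using a
  proof (elim disjE)
    assume a: "a = 2"
    have e: "(if n = 0 then 0 else
     - of_int (sg s * sg t) * (rt q powi (- sg s)) ^ n * (rt q powi (- sg t)) ^ n * b ^ n * qint q (int n * a) / qint q (int n)) =
      (if n = 0 then 0 else - of_int (sg s * sg t) * ((rt q powi (- sg s)) ^ n * (rt q powi (- sg t)) ^ n) * b ^ n * (q ^ n + inverse q ^ n))" for n
      using q2[of n] a by (simp add: mult.assoc flip: times_divide_eq_right)
    show ?thesis
    proof (cases "s = t")
      case True
      then have k: "kap_factor s t a b = (1 - fps_const b * fps_X) * (1 - fps_const (b * q powi (- 2 * sg s)) * fps_X)"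
        using a by (simp add: kap_factor_def)
      show ?thesis unfolding k e
        by (rule L[OF log_deriv_mult[OF log_deriv_linear log_deriv_linear]], rule fps_ext)
           (cases s; simp add: True[symmetric] geo_def power_mult_distrib r1 r2 p2 distrib_left qi mult.assoc power_int_minus;
            simp add: field_simps q_nonzero power2_eq_square power_mult_distrib)
    next
      case False
      then have k: "kap_factor s t a b = inverse (1 - fps_const (b * q) * fps_X) * inverse (1 - fps_const (b * inverse q) * fps_X)"
        using a by (simp add: kap_factor_def)
      have st: "sg s * sg t = - 1" using False by (cases s; cases t) auto
      have rr: "(rt q powi (- sg s)) ^ n * (rt q powi (- sg t)) ^ n = 1" for n
        using False by (cases s; cases t) (auto simp: r3 power_int_minus)
      show ?thesis unfolding k e unfolding st rr
        by (rule L[OF log_deriv_mult[OF log_deriv_inverse[OF nz log_deriv_linear] log_deriv_inverse[OF nz log_deriv_linear]]], rule fps_ext)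
           (simp add: geo_def power_mult_distrib distrib_left)
    qed
  next
    assume a: "a = 0"
    then have "kap_factor s t a b = 1" by (simp add: kap_factor_def)
    then show ?thesis by (simp only:) (rule L[OF log_deriv_1], rule fps_ext, simp add: a q0)
  next
    assume a: "a = - 1"
    have e: "(if n = 0 then 0 else
     - of_int (sg s * sg t) * (rt q powi (- sg s)) ^ n * (rt q powi (- sg t)) ^ n * b ^ n * qint q (int n * a) / qint q (int n)) =
      (if n = 0 then 0 else of_int (sg s * sg t) * ((rt q powi (- sg s)) ^ n * (rt q powi (- sg t)) ^ n) * b ^ n)" for n
      using q1[of n] a by (simp add: mult.assoc flip: times_divide_eq_right)
    show ?thesis
    proof (cases "s = t")
      case True
      then have k: "kap_factor s t a b = inverse (1 - fps_const (b * q powi (- sg s)) * fps_X)"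
        using a by (simp add: kap_factor_def)
      show ?thesis unfolding k e
        by (rule L[OF log_deriv_inverse[OF nz log_deriv_linear]], rule fps_ext)
           (cases s; simp add: True[symmetric] geo_def power_mult_distrib r1 r2 power_int_minus mult.commute)
    next
      case False
      then have k: "kap_factor s t a b = 1 - fps_const b * fps_X"
        using a by (simp add: kap_factor_def)
      have st: "sg s * sg t = - 1" using False by (cases s; cases t) auto
      have rr: "(rt q powi (- sg s)) ^ n * (rt q powi (- sg t)) ^ n = 1" for n
        using False by (cases s; cases t) (auto simp: r3 power_int_minus)
      show ?thesis unfolding k e unfolding st rr
        by (rule L[OF log_deriv_linear], rule fps_ext) (simp add: geo_def)
    qed
  qed
  show "fps_nth (kap_factor s t a b) 0 = 1"
    using a by (auto simp: kap_factor_def Let_def)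
qed

lemma log_deriv_kap: "log_deriv (kap p p') (Abs_fps (\<lambda>n. of_nat n * lam p p' n))"
proof -
  let ?a = "\<lambda>r. A (snd p) ((\<mu> ^^ nat r) (snd p'))"
  let ?s = "sg (fst p)" and ?t = "sg (fst p')"
  have "log_deriv (kap p p') (\<Sum>r\<in>ZN. Abs_fps (\<lambda>n. if n = 0 then 0 else
     - of_int (?s * ?t) * (rt q powi (- ?s)) ^ n * (rt q powi (- ?t)) ^ n * (\<xi> powi r) ^ n * qint q (int n * ?a r) / qint q (int n)))"
    unfolding kap_def by (intro log_deriv_prod log_deriv_kap_factor(1) A_values) (simp add: \<xi>_nonzero)
  moreover have "(\<Sum>r\<in>ZN. Abs_fps (\<lambda>n. if n = 0 then 0 else
     - of_int (?s * ?t) * (rt q powi (- ?s)) ^ n * (rt q powi (- ?t)) ^ n * (\<xi> powi r) ^ n * qint q (int n * ?a r) / qint q (int n))) =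
     Abs_fps (\<lambda>n. of_nat n * lam p p' n)"
  proof (rule fps_ext)
    fix n
    have x: "(\<xi> powi r) ^ n = \<xi> powi (int n * r)" for r
      by (simp add: power_int_mult mult.commute[of "int n"])
    show "fps_nth (\<Sum>r\<in>ZN. Abs_fps (\<lambda>n. if n = 0 then 0 else
     - of_int (?s * ?t) * (rt q powi (- ?s)) ^ n * (rt q powi (- ?t)) ^ n * (\<xi> powi r) ^ n * qint q (int n * ?a r) / qint q (int n))) n =
      fps_nth (Abs_fps (\<lambda>n. of_nat n * lam p p' n)) n"
    proof (cases "n = 0")
      case False
      let ?c = "- of_int (?s * ?t) * (rt q powi (- ?s)) ^ n * (rt q powi (- ?t)) ^ n"
      have "of_nat n * lam p p' n = ?c * ((\<Sum>r\<in>ZN. (\<xi> powi r) ^ n * qint q (int n * ?a r)) / qint q (int n))"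
        using False qint_nonzero[of n]
        by (simp add: lam_def H1_scalar_def \<mu>Q_pow_simple form_simple x field_simps power2_eq_square)
      then show ?thesis using False by (simp add: fps_sum_nth sum_divide_distrib sum_distrib_left mult.assoc)
    qed (simp add: fps_sum_nth)
  qed
  ultimately show ?thesis by simp
qed

lemma kap_0: "fps_nth (kap p p') 0 = 1"
proof -
  have "fps_nth (prod f S) 0 = (\<Prod>r\<in>S. fps_nth (f r) 0)" for f :: "int \<Rightarrow> complex fps" and S
    by (induction S rule: infinite_finite_induct) auto
  then show ?thesis unfolding kap_def
    by (simp add: log_deriv_kap_factor(2)[OF A_values] \<xi>_nonzero)
qed

lemma ap_am:
  assumes "n > 0" "m > 0"
  shows "ap p n (am p' m v) = am p' m (ap p n v) + (if m = n then scaleP (lam p p' n) v else 0)"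
proof -
  define c where "c = - of_int (sg (fst p)) / qint q (int n) * (rt q powi (- sg (fst p))) ^ n"
  define c' where "c' = of_int (sg (fst p')) / qint q (int m) * (rt q powi (- sg (fst p'))) ^ m"
  have l: "lam p p' n = c * c' * H1_scalar (snd p) (snd p') (int n)" if "m = n"
    using that by (simp add: lam_def c_def c'_def)
  show ?thesis
    unfolding ap_def am_def c_def[symmetric] c'_def[symmetric] P.lin_scale[OF lin_\<alpha>op] \<alpha>op_comm[OF assms]
    by (simp add: P.scale_right_distrib l mult_ac)
qed

sublocale P: vertex scaleP am ap lam kap Flt
proof unfold_locales
  show "am p n u \<in> Flt (K + int n)" if "u \<in> Flt K" for u K p n
    unfolding am_def by (intro Flt_scaleP \<alpha>op_neg_Flt that)
  show "ap p n u \<in> Flt (K - int n)" if "u \<in> Flt K" for u K p n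
    unfolding ap_def by (intro Flt_scaleP \<alpha>op_pos_Flt that)
qed (auto simp: exponentiable_am exponentiable_ap am_am ap_ap ap_am log_deriv_kap kap_0 Flt_zero Flt_plus Flt_scaleP
      Flt_exists intro: Flt_negative, auto simp: Flt_def)

end

lemma (in complex_space) lin_if: "lin (\<lambda>v. if b then 0 else f v) \<longleftrightarrow> b \<or> lin f" by (auto simp: lin_def)

context graded_module
begin

section \<open>The invariant form and its orbit sums\<close>

lemma \<mu>Q_at: "\<mu>Q \<alpha> (\<mu> j) = \<alpha> j"
proof -
  have "\<mu>Q \<alpha> (\<mu> j) = (\<Sum>i\<in>UNIV. \<alpha> i * simple j i)"
    unfolding \<mu>Q_def P.sum_fun_apply
    using \<mu>_bij by (intro sum.cong refl) (auto simp: simple_def bij_def inj_eq)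
  then show ?thesis by (simp only: sum_simple)
qed

lemma \<mu>Q_eq: "\<mu>Q \<alpha> = (\<lambda>j. \<alpha> (inv_into UNIV \<mu> j))"
proof
  fix j
  show "\<mu>Q \<alpha> j = \<alpha> (inv_into UNIV \<mu> j)"
    using \<mu>Q_at[of \<alpha> "inv_into UNIV \<mu> j"] \<mu>_bij by (simp add: bij_def surj_f_inv_f)
qed

lemma \<mu>Q_add: "\<mu>Q (\<alpha> + \<beta>) = \<mu>Q \<alpha> + \<mu>Q \<beta>" by (auto simp: \<mu>Q_eq)
lemma \<mu>Q_uminus: "\<mu>Q (- \<alpha>) = - \<mu>Q \<alpha>" by (auto simp: \<mu>Q_eq)
lemma \<mu>Q_pow_add: "(\<mu>Q ^^ n) (\<alpha> + \<beta>) = (\<mu>Q ^^ n) \<alpha> + (\<mu>Q ^^ n) \<beta>"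
  by (induction n) (simp_all only: funpow.simps id_apply o_apply \<mu>Q_add)
lemma \<mu>Q_pow_uminus: "(\<mu>Q ^^ n) (- \<alpha>) = - (\<mu>Q ^^ n) \<alpha>"
  by (induction n) (simp_all only: funpow.simps id_apply o_apply \<mu>Q_uminus)

lemma \<mu>Q_pow_at: "(\<mu>Q ^^ n) \<alpha> ((\<mu> ^^ n) j) = \<alpha> j"
  by (induction n arbitrary: \<alpha> j) (simp_all add: \<mu>Q_at)
lemma \<mu>Q_N: "(\<mu>Q ^^ N) \<alpha> = \<alpha>"
  using \<mu>Q_pow_at[of N \<alpha>] by (auto simp: \<mu>_N)

lemma form_add_left: "form (\<alpha> + \<beta>) \<gamma> = form \<alpha> \<gamma> + form \<beta> \<gamma>"
  by (simp add: form_def algebra_simps sum.distrib)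
lemma form_add_right: "form \<gamma> (\<alpha> + \<beta>) = form \<gamma> \<alpha> + form \<gamma> \<beta>"
  by (simp add: form_def algebra_simps sum.distrib)
lemma form_0_left: "form 0 \<gamma> = 0" by (simp add: form_def)
lemma form_0_right: "form \<gamma> 0 = 0" by (simp add: form_def)
lemma form_uminus_left: "form (- \<alpha>) \<gamma> = - form \<alpha> \<gamma>"
  by (simp add: form_def sum_negf)
lemma form_uminus_right: "form \<gamma> (- \<alpha>) = - form \<gamma> \<alpha>"
  by (simp add: form_def sum_negf)
lemma form_sum_left: "form (sum h S) \<gamma> = (\<Sum>i\<in>S. form (h i) \<gamma>)"
  by (induction S rule: infinite_finite_induct) (simp_all only: sum.infinite sum.empty sum.insert form_0_left form_add_left simp_thms)
lemma form_sum_right: "form \<gamma> (sum h S) = (\<Sum>i\<in>S. form \<gamma> (h i))"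
  by (induction S rule: infinite_finite_induct) (simp_all only: sum.infinite sum.empty sum.insert form_0_right form_add_right simp_thms)

lemma form_\<mu>: "form (\<mu>Q \<alpha>) (\<mu>Q \<beta>) = form \<alpha> \<beta>"
proof -
  have r: "(\<Sum>i\<in>UNIV. h (\<mu> i)) = (\<Sum>i\<in>UNIV. h i)" for h :: "'i \<Rightarrow> int"
    using \<mu>_bij by (intro sum.reindex_bij_betw)
  show ?thesis
    unfolding form_def
    by (subst r[symmetric], subst (2) r[symmetric]) (simp add: \<mu>Q_at A_\<mu>)
qed

lemma form_\<mu>_pow: "form ((\<mu>Q ^^ n) \<alpha>) ((\<mu>Q ^^ n) \<beta>) = form \<alpha> \<beta>"
  by (induction n) (simp_all add: form_\<mu>)

lemma orbit_sum_add: "orbit_sum (\<alpha> + \<beta>) = orbit_sum \<alpha> + orbit_sum \<beta>"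
  by (simp add: orbit_sum_def \<mu>Q_pow_add sum.distrib)
lemma orbit_sum_uminus: "orbit_sum (- \<alpha>) = - orbit_sum \<alpha>"
  by (simp add: orbit_sum_def \<mu>Q_pow_uminus sum_negf)

lemma sum_cyclic:
  fixes f :: "nat \<Rightarrow> 'b::ab_group_add"
  assumes "f N = f 0" shows "(\<Sum>n<N. f (Suc n)) = (\<Sum>n<N. f n)"
proof -
  have "f 0 + (\<Sum>n<N. f (Suc n)) = (\<Sum>n<N. f n) + f N"
    by (metis sum.lessThan_Suc sum.lessThan_Suc_shift)
  then show ?thesis using assms by (simp add: add.commute)
qed

lemma orbit_sum_\<mu>: "orbit_sum (\<mu>Q \<alpha>) = orbit_sum \<alpha>"
  unfolding orbit_sum_def using sum_cyclic[of "\<lambda>n. (\<mu>Q ^^ n) \<alpha>"]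
  by (simp add: \<mu>Q_N funpow_swap1)

lemma form_orbit_sum: "form (orbit_sum \<alpha>) \<beta> = form \<alpha> (orbit_sum \<beta>)"
proof -
  let ?f = "\<lambda>n. form \<alpha> ((\<mu>Q ^^ n) \<beta>)"
  have "form ((\<mu>Q ^^ n) \<alpha>) \<beta> = ?f (N - n)" if "n < N" for n
  proof -
    have "form ((\<mu>Q ^^ n) \<alpha>) \<beta> = form ((\<mu>Q ^^ (N - n)) ((\<mu>Q ^^ n) \<alpha>)) ((\<mu>Q ^^ (N - n)) \<beta>)"
      by (rule form_\<mu>_pow[symmetric])
    also have "(\<mu>Q ^^ (N - n)) ((\<mu>Q ^^ n) \<alpha>) = \<alpha>"
      using that \<mu>Q_N[of \<alpha>] by (metis funpow_add comp_apply le_add_diff_inverse2 less_imp_le)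
    finally show ?thesis .
  qed
  then have "form (orbit_sum \<alpha>) \<beta> = (\<Sum>n<N. ?f (N - n))"
    by (simp add: orbit_sum_def form_sum_left)
  also have "\<dots> = (\<Sum>n<N. ?f (Suc (N - Suc n)))" by (intro sum.cong refl) (simp add: Suc_diff_Suc)
  also have "\<dots> = (\<Sum>n<N. ?f (Suc n))" by (rule sum.nat_diff_reindex)
  also have "\<dots> = (\<Sum>n<N. ?f n)" by (rule sum_cyclic) (simp add: \<mu>Q_N)
  finally show ?thesis by (simp add: orbit_sum_def form_sum_right)
qed

lemma weight_orbit_sum: "weight \<alpha> (orbit_sum \<beta>) = form (orbit_sum \<alpha>) \<beta>"
proof -
  have "orbit_sum (SOME \<beta>'. orbit_sum \<beta>' = orbit_sum \<beta>) = orbit_sum \<beta>"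
    by (rule someI[of "\<lambda>b. orbit_sum b = orbit_sum \<beta>"]) (rule refl)
  then show ?thesis unfolding weight_def form_orbit_sum by simp
qed

text \<open>The exponents with which the zero modes of two currents contribute to their product.\<close>

definition orbit_form :: "'i \<Rightarrow> 'i \<Rightarrow> int" where "orbit_form i j = form (orbit_sum (simple i)) (simple j)"

definition signed_root :: "pm \<Rightarrow> 'i \<Rightarrow> 'i \<Rightarrow> int" where "signed_root s i = (\<lambda>j. sg s * simple i j)"

lemma signed_root_Upper: "signed_root Upper i = simple i" by (simp add: signed_root_def)
lemma signed_root_Lower: "signed_root Lower i = - simple i" by (auto simp: signed_root_def)

lemma Q_orbE: assumes "\<gamma> \<in> Q_orb" obtains \<beta> where "\<gamma> = orbit_sum \<beta>"
  using assms by (auto simp: Q_orb_def)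
lemma Q_orbI: "orbit_sum \<beta> \<in> Q_orb" by (auto simp: Q_orb_def)
lemma Q_orb_add: "\<gamma> \<in> Q_orb \<Longrightarrow> \<delta> \<in> Q_orb \<Longrightarrow> \<gamma> + \<delta> \<in> Q_orb"
  by (metis Q_orbE Q_orbI orbit_sum_add)

lemma weight_add: "\<gamma> \<in> Q_orb \<Longrightarrow> weight \<alpha> (\<gamma> + orbit_sum \<beta>) = weight \<alpha> \<gamma> + form (orbit_sum \<alpha>) \<beta>"
  by (elim Q_orbE) (simp add: weight_orbit_sum form_add_right flip: orbit_sum_add)

lemma weight_signed_root: "\<gamma> \<in> Q_orb \<Longrightarrow> weight (simple i) (\<gamma> + orbit_sum (signed_root t j)) = weight (simple i) \<gamma> + sg t * orbit_form i j"
  by (cases t) (simp_all add: weight_add signed_root_Upper signed_root_Lower orbit_form_def form_uminus_right)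

lemma weight_add_left: "\<gamma> \<in> Q_orb \<Longrightarrow> weight (\<alpha> + \<beta>) \<gamma> = weight \<alpha> \<gamma> + weight \<beta> \<gamma>"
  by (elim Q_orbE) (simp add: weight_orbit_sum form_add_left orbit_sum_add)
lemma weight_uminus_left: "\<gamma> \<in> Q_orb \<Longrightarrow> weight (- \<alpha>) \<gamma> = - weight \<alpha> \<gamma>"
  by (elim Q_orbE) (simp add: weight_orbit_sum form_uminus_left orbit_sum_uminus)
lemma weight_0_left: "\<gamma> \<in> Q_orb \<Longrightarrow> weight 0 \<gamma> = 0"
  using weight_add_left[of \<gamma> 0 0] by simp
lemma weight_\<mu>: "\<gamma> \<in> Q_orb \<Longrightarrow> weight (\<mu>Q \<alpha>) \<gamma> = weight \<alpha> \<gamma>"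
  by (elim Q_orbE) (simp add: weight_orbit_sum orbit_sum_\<mu>)

lemma orbit_form_sum: "orbit_form i j = (\<Sum>r<N. A i ((\<mu> ^^ r) j))"
  unfolding orbit_form_def form_orbit_sum unfolding orbit_sum_def
  by (simp add: form_sum_right \<mu>Q_pow_simple form_simple)

lemma orbit_sum_\<mu>_pow: "orbit_sum (simple ((\<mu> ^^ n) i)) = orbit_sum (simple i)"
  by (induction n) (simp_all add: orbit_sum_\<mu> flip: \<mu>Q_simple)

lemma orbit_form_\<mu>: "orbit_form ((\<mu> ^^ n) i) j = orbit_form i j" "orbit_form i ((\<mu> ^^ n) j) = orbit_form i j"
  unfolding orbit_form_def form_orbit_sum[of "simple i"] by (simp_all add: orbit_sum_\<mu>_pow form_orbit_sum[symmetric])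

lemma orbit_form_rot_entry: "orbit_form i j = (\<Sum>r\<in>ZN. rot_entry i j r)"
proof -
  have "orbit_form i j = (\<Sum>n<N. rot_entry i j (int n))" by (simp add: orbit_form_sum rot_entry_def rot_nat)
  also have "\<dots> = (\<Sum>r\<in>ZN. rot_entry i j r)"
    by (rule sum.reindex_bij_witness[of _ nat int]) auto
  finally show ?thesis .
qed

lemma orbit_form_sym: "orbit_form i j = orbit_form j i"
proof -
  have "orbit_form i j = (\<Sum>r\<in>ZN. rot_entry i j ((- r) mod int N))"
    unfolding orbit_form_rot_entry by (rule sum.reindex_bij_betw[OF neg_bij, symmetric])
  then show ?thesis by (simp add: rot_entry_mod rot_entry_minus orbit_form_rot_entry)
qed

lemma orbit_form_card: "orbit_form i j = 2 * int (card (\<Gamma>p i j)) - int (dd i j)"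
proof -
  have "orbit_form i j = (\<Sum>r\<in>\<Gamma>p i j \<union> \<Gamma>m i j. rot_entry i j r)"
    unfolding orbit_form_rot_entry using rot_entry_values[of i j] by (intro sum.mono_neutral_right) (auto simp: \<Gamma>p_iff \<Gamma>m_iff, metis)
  also have "\<dots> = (\<Sum>r\<in>\<Gamma>p i j. rot_entry i j r) + (\<Sum>r\<in>\<Gamma>m i j. rot_entry i j r)"
    by (rule sum.union_disjoint[OF finite_\<Gamma> \<Gamma>_disjoint])
  also have "\<dots> = (\<Sum>r\<in>\<Gamma>p i j. 2) + (\<Sum>r\<in>\<Gamma>m i j. - 1)"
    by (intro arg_cong2[where f = "(+)"] sum.cong) (auto simp: \<Gamma>p_iff \<Gamma>m_iff)
  finally show ?thesis by (simp add: dd_def)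
qed

text \<open>If the norm is odd, some \<open>\<xi>\<^sup>r\<close> has a power \<open>- 1\<close>.\<close>

lemma odd_orbit_form_even_N: assumes "odd (orbit_form i i)" shows "even N"
proof (rule ccontr)
  assume N: "odd N"
  have D: "dd i i > 0" using assms by (cases "dd i i = 0") (auto simp: orbit_form_card)
  then obtain r where r: "r \<in> \<Gamma>m i i" unfolding dd_def by (metis card_gt_0_iff ex_in_conv)
  have "(- 1 :: complex) ^ N = ((\<xi> powi r) ^ dd i i) ^ N" using \<Gamma>m_self(2)[OF D r] by simp
  also have "\<dots> = (\<xi> ^ N) powi (r * int (dd i i))"
    by (simp only: power_int_of_nat[symmetric] power_int_mult[symmetric] mult_ac)
  finally show False using N by (simp add: \<xi>_N)
qed

section \<open>The grading of the module of the extension\<close>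

text \<open>The property that defines \<open>comp\<close>.\<close>

definition is_decomposition :: "(('i \<Rightarrow> int) \<Rightarrow> 't) \<Rightarrow> 't \<Rightarrow> bool" where
  "is_decomposition f t \<longleftrightarrow> (\<forall>\<gamma>\<in>Q_orb. f \<gamma> \<in> T \<gamma>) \<and> (\<forall>\<gamma>. \<gamma> \<notin> Q_orb \<longrightarrow> f \<gamma> = 0) \<and>
     finite {\<gamma>. f \<gamma> \<noteq> 0} \<and> t = (\<Sum>\<gamma> | f \<gamma> \<noteq> 0. f \<gamma>)"

lemma is_decomposition_comp: "is_decomposition (\<lambda>\<gamma>. comp \<gamma> t) t"
  unfolding comp_def[abs_def] is_decomposition_def[symmetric]
  by (rule theI'[of "\<lambda>f. is_decomposition f t"]) (use T_direct_sum in \<open>simp only: is_decomposition_def\<close>)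

lemma comp_eqI: "is_decomposition f t \<Longrightarrow> comp \<gamma> t = f \<gamma>"
  using is_decomposition_comp[of t] T_direct_sum[of t] unfolding is_decomposition_def[symmetric] by metis

lemma comp_mem: "\<gamma> \<in> Q_orb \<Longrightarrow> comp \<gamma> t \<in> T \<gamma>" using is_decomposition_comp[of t] by (auto simp: is_decomposition_def)
lemma comp_out: "\<gamma> \<notin> Q_orb \<Longrightarrow> comp \<gamma> t = 0" using is_decomposition_comp[of t] by (auto simp: is_decomposition_def)
lemma finite_comp: "finite {\<gamma>. comp \<gamma> t \<noteq> 0}" using is_decomposition_comp[of t] by (auto simp: is_decomposition_def)
lemma sum_comp: "finite S \<Longrightarrow> {\<gamma>. comp \<gamma> t \<noteq> 0} \<subseteq> S \<Longrightarrow> (\<Sum>\<gamma>\<in>S. comp \<gamma> t) = t"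
proof -
  assume "finite S" "{\<gamma>. comp \<gamma> t \<noteq> 0} \<subseteq> S"
  then have "(\<Sum>\<gamma>\<in>S. comp \<gamma> t) = (\<Sum>\<gamma> | comp \<gamma> t \<noteq> 0. comp \<gamma> t)"
    by (intro sum.mono_neutral_right) auto
  then show ?thesis using is_decomposition_comp[of t] by (simp add: is_decomposition_def)
qed

lemma T_0: "\<gamma> \<in> Q_orb \<Longrightarrow> 0 \<in> T \<gamma>"
  and T_add: "\<gamma> \<in> Q_orb \<Longrightarrow> t \<in> T \<gamma> \<Longrightarrow> u \<in> T \<gamma> \<Longrightarrow> t + u \<in> T \<gamma>"
  and T_scale: "\<gamma> \<in> Q_orb \<Longrightarrow> t \<in> T \<gamma> \<Longrightarrow> scaleT c t \<in> T \<gamma>"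
  using T_subspace[of \<gamma>] by (auto simp: TT.subspace_def)

lemma is_decompositionI:
  assumes "\<And>\<gamma>. \<gamma> \<in> Q_orb \<Longrightarrow> f \<gamma> \<in> T \<gamma>" "\<And>\<gamma>. \<gamma> \<notin> Q_orb \<Longrightarrow> f \<gamma> = 0" "finite S" "{\<gamma>. f \<gamma> \<noteq> 0} \<subseteq> S"
    "t = (\<Sum>\<gamma>\<in>S. f \<gamma>)"
  shows "is_decomposition f t"
proof -
  have "(\<Sum>\<gamma>\<in>S. f \<gamma>) = (\<Sum>\<gamma> | f \<gamma> \<noteq> 0. f \<gamma>)" using assms by (intro sum.mono_neutral_right) auto
  then show ?thesis using assms finite_subset[OF assms(4,3)] by (auto simp: is_decomposition_def)
qed

lemma lin_comp_T: "TT.lin (comp \<gamma>)"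
proof (rule TT.linI)
  fix t u
  let ?S = "{\<gamma>. comp \<gamma> t \<noteq> 0} \<union> {\<gamma>. comp \<gamma> u \<noteq> 0}"
  have "is_decomposition (\<lambda>\<gamma>. comp \<gamma> t + comp \<gamma> u) (t + u)"
    by (rule is_decompositionI[of _ ?S]) (auto simp: comp_mem T_add comp_out finite_comp sum.distrib sum_comp)
  then show "comp \<gamma> (t + u) = comp \<gamma> t + comp \<gamma> u" by (rule comp_eqI)
next
  fix c t
  have "is_decomposition (\<lambda>\<gamma>. scaleT c (comp \<gamma> t)) (scaleT c t)"
    by (rule is_decompositionI[of _ "{\<gamma>. comp \<gamma> t \<noteq> 0}"])
       (auto simp: comp_mem T_scale comp_out finite_comp sum_comp simp flip: TT.scale_sum_right)
  then show "comp \<gamma> (scaleT c t) = scaleT c (comp \<gamma> t)" by (rule comp_eqI)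
qed

lemma comp_hom: "\<gamma> \<in> Q_orb \<Longrightarrow> t \<in> T \<gamma> \<Longrightarrow> comp \<gamma>' t = (if \<gamma>' = \<gamma> then t else 0)"
  by (rule comp_eqI, rule is_decompositionI[of _ "{\<gamma>}"]) (auto simp: T_0)

lemma pow_orbit_superset:
  "finite S \<Longrightarrow> {\<gamma>. comp \<gamma> t \<noteq> 0} \<subseteq> S \<Longrightarrow> pow_orbit c \<alpha> t = (\<Sum>\<gamma>\<in>S. scaleT (c powi weight \<alpha> \<gamma>) (comp \<gamma> t))"
  unfolding pow_orbit_def by (rule sum.mono_neutral_left) auto

lemma lin_pow_orbit: "TT.lin (pow_orbit c \<alpha>)"
proof (rule TT.linI)
  fix t u
  let ?S = "{\<gamma>. comp \<gamma> t \<noteq> 0} \<union> {\<gamma>. comp \<gamma> u \<noteq> 0}"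
  have "finite ?S" "{\<gamma>. comp \<gamma> (t + u) \<noteq> 0} \<subseteq> ?S" by (auto simp: finite_comp TT.lin_add[OF lin_comp_T])
  then show "pow_orbit c \<alpha> (t + u) = pow_orbit c \<alpha> t + pow_orbit c \<alpha> u"
    by (simp add: pow_orbit_superset[of ?S] TT.lin_add[OF lin_comp_T] TT.scale_right_distrib sum.distrib)
next
  fix a t
  let ?S = "{\<gamma>. comp \<gamma> t \<noteq> 0}"
  have "finite ?S" "{\<gamma>. comp \<gamma> (scaleT a t) \<noteq> 0} \<subseteq> ?S" by (auto simp: finite_comp TT.lin_scale[OF lin_comp_T])
  then show "pow_orbit c \<alpha> (scaleT a t) = scaleT a (pow_orbit c \<alpha> t)"
    by (simp add: pow_orbit_superset[of ?S] TT.lin_scale[OF lin_comp_T] TT.scale_sum_right mult.commute)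
qed

lemma pow_orbit_hom: "\<gamma> \<in> Q_orb \<Longrightarrow> t \<in> T \<gamma> \<Longrightarrow> pow_orbit c \<alpha> t = scaleT (c powi weight \<alpha> \<gamma>) t"
  by (subst pow_orbit_superset[of "{\<gamma>}"]) (auto simp: comp_hom)

definition homog :: "('i \<Rightarrow> int) \<Rightarrow> ('i, 't) poly_tensor \<Rightarrow> bool" where
  "homog \<gamma> f \<longleftrightarrow> \<gamma> \<in> Q_orb \<and> (\<forall>m. Poly_Mapping.lookup f m \<in> T \<gamma>)"

lemma hom_orb: "homog \<gamma> f \<Longrightarrow> \<gamma> \<in> Q_orb" by (simp add: homog_def)
lemma hom_0: "\<gamma> \<in> Q_orb \<Longrightarrow> homog \<gamma> 0" by (simp add: homog_def T_0)
lemma hom_add: "homog \<gamma> f \<Longrightarrow> homog \<gamma> g' \<Longrightarrow> homog \<gamma> (f + g')" by (simp add: homog_def lookup_add T_add)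
lemma hom_scaleP: "homog \<gamma> f \<Longrightarrow> homog \<gamma> (scaleP c f)" by (simp add: homog_def scaleP_lookup T_scale)
lemma hom_sum: "\<gamma> \<in> Q_orb \<Longrightarrow> (\<And>i. i \<in> S \<Longrightarrow> homog \<gamma> (h i)) \<Longrightarrow> homog \<gamma> (sum h S)"
  by (induction S rule: infinite_finite_induct) (auto intro: hom_0 hom_add)
lemma hom_mult_var: "homog \<gamma> f \<Longrightarrow> homog \<gamma> (mult_var v f)" by (simp add: homog_def lookup_mult_var T_0)
lemma hom_deriv_var: "homog \<gamma> f \<Longrightarrow> homog \<gamma> (deriv_var v f)" by (simp add: homog_def lookup_deriv_var T_scale)
lemma hom_\<alpha>op: "homog \<gamma> f \<Longrightarrow> homog \<gamma> (\<alpha>op i m f)"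
  using hom_orb[of \<gamma> f] by (auto simp: \<alpha>op_def intro!: hom_mult_var hom_sum hom_scaleP hom_deriv_var hom_0)

lemma hom_E: assumes "\<And>n v. homog \<gamma> v \<Longrightarrow> homog \<gamma> (f n v)" "homog \<gamma> v" shows "homog \<gamma> (opser_exp_coeff scaleP f n v)"
proof -
  have "homog \<gamma> (opser_pow f p n v)" for p n
    using assms hom_orb[OF assms(2)] by (induction p arbitrary: n) (auto intro!: hom_sum hom_0)
  then show ?thesis unfolding opser_exp_coeff_def
    using hom_orb[OF assms(2)] by (intro hom_sum hom_scaleP)
qed

lemma hom_Ep: "homog \<gamma> v \<Longrightarrow> homog \<gamma> (P.E (ap p) n v)"
  by (rule hom_E) (unfold ap_def, intro hom_scaleP hom_\<alpha>op)
lemma hom_Em: "homog \<gamma> v \<Longrightarrow> homog \<gamma> (P.Em p n v)"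
  unfolding P.Ei_def using hom_orb[of \<gamma> v]
  by (auto intro!: hom_E hom_0) (auto simp: am_def intro!: hom_scaleP hom_\<alpha>op)
lemma hom_Y: assumes "homog \<gamma> v" shows "homog \<gamma> (P.Y p a v)"
proof -
  obtain K where "v \<in> Flt K" using Flt_exists by blast
  then have *: "P.Y p a v = (\<Sum>l\<le>nat K. P.Em p (int l - a) (P.E (ap p) l v))" by (rule P.Y_sum) simp
  show ?thesis unfolding * by (intro hom_sum hom_orb[OF assms] hom_Em hom_Ep assms)
qed

lemma onT_comp_hom: "homog \<gamma> f \<Longrightarrow> onT (comp \<gamma>') f = (if \<gamma>' = \<gamma> then f else 0)"
  by (rule poly_mapping_eqI) (auto simp: lookup_onT TT.lin_zero[OF lin_comp_T] homog_def comp_hom)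

lemma onT_pow_hom: "homog \<gamma> f \<Longrightarrow> onT (pow_orbit c \<alpha>) f = scaleP (c powi weight \<alpha> \<gamma>) f"
  by (rule poly_mapping_eqI) (auto simp: lookup_onT TT.lin_zero[OF lin_pow_orbit] homog_def scaleP_lookup pow_orbit_hom)

lemma hom_decomp:
  obtains S where "finite S" "S \<subseteq> Q_orb" "f = (\<Sum>\<gamma>\<in>S. onT (comp \<gamma>) f)"
    "\<And>\<gamma>. \<gamma> \<in> S \<Longrightarrow> homog \<gamma> (onT (comp \<gamma>) f)"
proof
  let ?S = "\<Union>m\<in>Poly_Mapping.keys f. {\<gamma>. comp \<gamma> (Poly_Mapping.lookup f m) \<noteq> 0}"
  show fS: "finite ?S" by (auto simp: finite_comp)
  show "?S \<subseteq> Q_orb" using comp_out by blast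
  then show "homog \<gamma> (onT (comp \<gamma>) f)" if "\<gamma> \<in> ?S" for \<gamma>
    using that by (auto simp: homog_def lookup_onT TT.lin_zero[OF lin_comp_T] comp_mem)
  show "f = (\<Sum>\<gamma>\<in>?S. onT (comp \<gamma>) f)"
  proof (rule poly_mapping_eqI)
    fix m
    have "(\<Sum>\<gamma>\<in>?S. comp \<gamma> (Poly_Mapping.lookup f m)) = Poly_Mapping.lookup f m"
    proof (cases "m \<in> Poly_Mapping.keys f")
      case True then show ?thesis using fS by (intro sum_comp) auto
    next
      case False then show ?thesis by (simp add: in_keys_iff TT.lin_zero[OF lin_comp_T])
    qed
    then show "Poly_Mapping.lookup f m = Poly_Mapping.lookup (\<Sum>\<gamma>\<in>?S. onT (comp \<gamma>) f) m"
      by (simp add: lookup_sum lookup_onT TT.lin_zero[OF lin_comp_T])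
  qed
qed

text \<open>Every vector is a finite sum of homogeneous ones, so additive maps may be compared on those.\<close>

lemma lin_ext_hom:
  fixes h1 h2 :: "('i, 't) poly_tensor \<Rightarrow> 'f::ab_group_add"
  assumes "\<And>u v. h1 (u + v) = h1 u + h1 v" "\<And>u v. h2 (u + v) = h2 u + h2 v"
    and "\<And>\<gamma> f. homog \<gamma> f \<Longrightarrow> h1 f = h2 f"
  shows "h1 f = h2 f"
proof -
  have z: "h1 0 = 0" "h2 0 = 0" using assms(1)[of 0 0] assms(2)[of 0 0] by auto
  have s: "h1 (sum F' S) = (\<Sum>i\<in>S. h1 (F' i))" "h2 (sum F' S) = (\<Sum>i\<in>S. h2 (F' i))"
    for F' and S :: "('i \<Rightarrow> int) set"
    by (induction S rule: infinite_finite_induct) (simp_all add: z assms)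
  obtain S where S: "f = (\<Sum>\<gamma>\<in>S. onT (comp \<gamma>) f)" "\<And>\<gamma>. \<gamma> \<in> S \<Longrightarrow> homog \<gamma> (onT (comp \<gamma>) f)"
    by (rule hom_decomp[of f]) blast
  have "(\<Sum>\<gamma>\<in>S. h1 (onT (comp \<gamma>) f)) = (\<Sum>\<gamma>\<in>S. h2 (onT (comp \<gamma>) f))"
    by (intro sum.cong refl) (rule assms(3)[OF S(2)])
  then show ?thesis unfolding s[symmetric] S(1)[symmetric] .
qed

section \<open>The operators of the central extension\<close>

definition e_op :: "pm \<Rightarrow> 'i \<Rightarrow> ('i, 't) poly_tensor \<Rightarrow> ('i, 't) poly_tensor" where
  "e_op s i = onT (act (e (signed_root s i)))"

lemma lin_act: "a \<in> carrier Qh \<Longrightarrow> TT.lin (act a)" using act_linear TT.lin_iff by blast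
lemma act_0: "a \<in> carrier Qh \<Longrightarrow> act a 0 = 0" by (rule TT.lin_zero[OF lin_act])
lemma lin_e_op: "P.lin (e_op s i)" unfolding e_op_def by (rule lin_onT[OF lin_act[OF sec_carrier]])
lemma e_op_\<alpha>op: "e_op s i (\<alpha>op j m f) = \<alpha>op j m (e_op s i f)"
  unfolding e_op_def by (rule onT_\<alpha>op[OF lin_act[OF sec_carrier]])

lemma e_op_am: "e_op s i (am p n v) = am p n (e_op s i v)" by (simp add: am_def P.lin_scale[OF lin_e_op] e_op_\<alpha>op)
lemma e_op_ap: "e_op s i (ap p n v) = ap p n (e_op s i v)" unfolding ap_def P.lin_scale[OF lin_e_op] e_op_\<alpha>op ..
lemma e_op_Em: "e_op s i (P.Em p n v) = P.Em p n (e_op s i v)" by (rule P.Ei_commute) (rule lin_e_op, rule e_op_am)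
lemma e_op_Ep: "e_op s i (P.E (ap p) n v) = P.E (ap p) n (e_op s i v)" by (rule P.E_commute) (rule lin_e_op, rule e_op_ap)
lemma e_op_Flt: assumes "v \<in> Flt K" shows "e_op s i v \<in> Flt K"
proof -
  have "Poly_Mapping.lookup v m \<noteq> 0" if "act (e (signed_root s i)) (Poly_Mapping.lookup v m) \<noteq> 0" for m
    using that act_0[OF sec_carrier] by metis
  then show ?thesis using assms unfolding Flt_def e_op_def
    by (auto simp: lookup_onT act_0 sec_carrier)
qed
lemma e_op_Y: "e_op s i (P.Y p a v) = P.Y p a (e_op s i v)"
proof -
  obtain K where K: "v \<in> Flt K" using Flt_exists by blast
  have K': "K \<le> int (nat K)" by simp
  show ?thesis unfolding P.Y_sum[OF K K'] P.Y_sum[OF e_op_Flt[OF K] K']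
    by (simp add: P.lin_sum[OF lin_e_op] e_op_Em e_op_Ep)
qed

lemma hom_e_op: assumes "homog \<gamma> f" shows "homog (\<gamma> + orbit_sum (signed_root s i)) (e_op s i f)"
proof -
  obtain \<beta> where \<beta>: "\<gamma> = orbit_sum \<beta>" using hom_orb[OF assms] by (rule Q_orbE)
  have "act (e (signed_root s i)) t \<in> T (orbit_sum (signed_root s i + \<beta>))" if "t \<in> T \<gamma>" for t
    using act_degree[OF sec_carrier, of t \<beta> "signed_root s i"] that \<beta> by (simp add: sec_bar)
  then show ?thesis using assms
    by (auto simp: homog_def e_op_def lookup_onT act_0 sec_carrier \<beta> orbit_sum_add add.commute Q_orbI simp flip: orbit_sum_add)
qed

text \<open>The commutator of \<open>e\<^bsub>\<plusminus>\<alpha>\<^sub>i\<^esub>\<close> and \<open>e\<^bsub>\<plusminus>\<alpha>\<^sub>j\<^esub>\<close>; it depends on the signs only through their product.\<close>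

definition cocycle :: "pm \<Rightarrow> 'i \<Rightarrow> pm \<Rightarrow> 'i \<Rightarrow> complex" where
  "cocycle s i t j = (C (simple i) (simple j)) powi (sg s * sg t)"

lemma C_uminus: "C (- \<alpha>) \<beta> = inverse (C \<alpha> \<beta>)" "C \<alpha> (- \<beta>) = inverse (C \<alpha> \<beta>)"
proof -
  have p: "(\<Prod>n\<in>S. inverse (h n)) = inverse (\<Prod>n\<in>S. h n)" for h :: "nat \<Rightarrow> complex" and S
    by (induction S rule: infinite_finite_induct) auto
  show "C (- \<alpha>) \<beta> = inverse (C \<alpha> \<beta>)" "C \<alpha> (- \<beta>) = inverse (C \<alpha> \<beta>)"
    unfolding C_def form_uminus_left \<mu>Q_pow_uminus form_uminus_right power_int_minus p by (rule refl)+
qed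

lemma C_signed_root: "C (signed_root s i) (signed_root t j) = cocycle s i t j"
  by (cases s; cases t) (simp_all add: cocycle_def signed_root_Upper signed_root_Lower C_uminus power_int_minus)

lemma \<xi>'_nonzero: "\<xi>' \<noteq> 0" by (simp add: \<xi>'_def \<xi>_nonzero)

lemma \<xi>'_group_iff: "z \<in> carrier \<xi>'_group \<longleftrightarrow> (\<exists>n. z = \<xi>' powi n)"
  by (auto simp: \<xi>'_group_def)
lemma \<xi>'_group_mult: "z \<in> carrier \<xi>'_group \<Longrightarrow> w \<in> carrier \<xi>'_group \<Longrightarrow> z * w \<in> carrier \<xi>'_group"
  unfolding \<xi>'_group_iff using \<xi>'_nonzero by (metis power_int_add)
lemma \<xi>'_group_powi: "z \<in> carrier \<xi>'_group \<Longrightarrow> z powi n \<in> carrier \<xi>'_group"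
  unfolding \<xi>'_group_iff by (metis power_int_mult)
lemma \<xi>'_group_1: "1 \<in> carrier \<xi>'_group"
  unfolding \<xi>'_group_iff by (metis power_int_0_right)

lemma half_power: assumes "N = 2 * M" shows "\<xi> ^ M = - 1"
proof -
  have M0: "0 < M" "M < N" using N_pos assms by auto
  have "(\<xi> ^ M) ^ 2 = 1" using \<xi>_N assms by (simp add: power_mult[symmetric] mult.commute)
  then have "\<xi> ^ M = 1 \<or> \<xi> ^ M = - 1" by (simp add: power2_eq_1_iff)
  then show ?thesis using \<xi>_primitive[OF M0] by simp
qed

lemma \<xi>'_group_minus_1: "- 1 \<in> carrier \<xi>'_group"
proof (cases "even N")
  case True
  then obtain M where M: "N = 2 * M" by blast
  have "- 1 = \<xi>' powi int M" using half_power[OF M] True by (simp add: \<xi>'_def)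
  then show ?thesis unfolding \<xi>'_group_iff by blast
next
  case False
  have "- 1 = \<xi>' powi int N" using False \<xi>_N by (simp add: \<xi>'_def power_mult_distrib)
  then show ?thesis unfolding \<xi>'_group_iff by blast
qed

lemma C_carrier: "C \<alpha> \<beta> \<in> carrier \<xi>'_group"
proof -
  have "\<xi>' powi 1 \<in> carrier \<xi>'_group" unfolding \<xi>'_group_iff by blast
  from \<xi>'_group_mult[OF \<xi>'_group_powi[OF \<xi>'_group_minus_1, of "int N"] this]
  have x: "\<xi> \<in> carrier \<xi>'_group" by (simp add: \<xi>'_def mult.assoc[symmetric] power_mult_distrib[symmetric])
  have "- (\<xi> powi (- int n)) \<in> carrier \<xi>'_group" for n
    using \<xi>'_group_mult[OF \<xi>'_group_minus_1 \<xi>'_group_powi[OF x]] by simp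
  then have c: "(- (\<xi> powi (- int n))) powi m \<in> carrier \<xi>'_group" for n m by (rule \<xi>'_group_powi)
  have p: "prod h S \<in> carrier \<xi>'_group" if "\<And>n. h n \<in> carrier \<xi>'_group" for h and S :: "nat set"
    by (induction S rule: infinite_finite_induct) (auto intro: \<xi>'_group_1 \<xi>'_group_mult that)
  show ?thesis unfolding C_def by (rule p, rule c)
qed

lemma e_op_e_op: "e_op s i (e_op t j f) = scaleP (cocycle s i t j) (e_op t j (e_op s i f))"
proof -
  interpret Qh: group Qh by (rule Qh_group)
  let ?a = "e (signed_root s i)" and ?b = "e (signed_root t j)"
  have c: "?a \<in> carrier Qh" "?b \<in> carrier Qh" by (rule sec_carrier)+
  have "?a \<otimes>\<^bsub>Qh\<^esub> ?b = (?a \<otimes>\<^bsub>Qh\<^esub> ?b \<otimes>\<^bsub>Qh\<^esub> inv\<^bsub>Qh\<^esub> ?a \<otimes>\<^bsub>Qh\<^esub> inv\<^bsub>Qh\<^esub> ?b) \<otimes>\<^bsub>Qh\<^esub> (?b \<otimes>\<^bsub>Qh\<^esub> ?a)"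
    using c by (simp add: Qh.m_assoc Qh.inv_solve_left' flip: Qh.m_assoc) (simp add: Qh.m_assoc Qh.l_inv)
  also have "\<dots> = \<iota> (C (bar ?a) (bar ?b)) \<otimes>\<^bsub>Qh\<^esub> (?b \<otimes>\<^bsub>Qh\<^esub> ?a)" by (simp only: commutator[OF c])
  finally have ab: "?a \<otimes>\<^bsub>Qh\<^esub> ?b = \<iota> (cocycle s i t j) \<otimes>\<^bsub>Qh\<^esub> (?b \<otimes>\<^bsub>Qh\<^esub> ?a)"
    by (simp add: sec_bar C_signed_root)
  have half_norm: "cocycle s i t j \<in> carrier \<xi>'_group"
    unfolding C_signed_root[symmetric] by (rule C_carrier)
  have i: "\<iota> (cocycle s i t j) \<in> carrier Qh" using \<iota>_hom half_norm by (auto simp: hom_def)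
  have "act ?a (act ?b u) = scaleT (cocycle s i t j) (act ?b (act ?a u))" for u
    using act_mult[OF c, of u] act_mult[OF c(2,1), of u] act_mult[OF i, of "?b \<otimes>\<^bsub>Qh\<^esub> ?a" u] act_scalar[OF half_norm] c
    by (simp add: ab)
  then show ?thesis
    by (intro poly_mapping_eqI) (simp add: e_op_def lookup_onT act_0 sec_carrier scaleP_lookup)
qed

lemma e_op_inverse: "e_op Upper i (e_op Lower i f) = f" and e_op_inverse': "e_op Lower i (e_op Upper i f) = f"
proof -
  interpret Qh: group Qh by (rule Qh_group)
  have "act (e (simple i)) (act (e (- simple i)) t) = t" "act (e (- simple i)) (act (e (simple i)) t) = t" for t
    using act_mult[OF sec_carrier sec_carrier, of "simple i" "- simple i" t]
      act_mult[OF sec_carrier sec_carrier, of "- simple i" "simple i" t]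
    by (simp_all add: sec_inv Qh.r_inv Qh.l_inv sec_carrier act_one)
  then show "e_op Upper i (e_op Lower i f) = f" "e_op Lower i (e_op Upper i f) = f"
    by (intro poly_mapping_eqI; simp add: e_op_def signed_root_Upper signed_root_Lower lookup_onT act_0 sec_carrier)+
qed

lemma act_orbit:
  assumes t: "t \<in> T (orbit_sum \<beta>)"
  shows "act (e (simple ((\<mu> ^^ n) i))) t =
    scaleT ((rt \<xi> powi (- 2 * form (orbit_sum (simple i)) \<beta> - orbit_form i i)) ^ n) (act (e (simple i)) t)"
proof (induction n)
  case (Suc n)
  let ?j = "(\<mu> ^^ n) i"
  have "act (e (simple ((\<mu> ^^ Suc n) i))) t = act (\<mu>h (e (simple ?j))) t" by (simp add: sec_\<mu>)
  also have "\<dots> = scaleT (rt \<xi> powi (- 2 * form (orbit_sum (simple ?j)) \<beta> - form (orbit_sum (simple ?j)) (simple ?j))) (act (e (simple ?j)) t)"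
    using act_\<mu>h[OF sec_carrier t, of "simple ?j"] by (simp add: sec_bar)
  also have "form (orbit_sum (simple ?j)) (simple ?j) = orbit_form i i" using orbit_form_\<mu> by (simp add: orbit_form_def)
  finally show ?case by (simp add: Suc orbit_sum_\<mu>_pow)
qed simp

text \<open>A rotation that fixes \<open>i\<close> acts on \<open>e\<^bsub>\<alpha>\<^sub>i\<^esub>\<close> trivially as well as by the prescribed root of unity, hence
  this root of unity is 1 in every degree that occurs.\<close>

lemma phase:
  assumes t: "t \<in> T \<gamma>" "t \<noteq> 0" "\<gamma> \<in> Q_orb" and n: "(\<mu> ^^ n) i = i"
  shows "(rt \<xi> powi (2 * weight (simple i) \<gamma> + orbit_form i i)) ^ n = 1"
proof -
  interpret Qh: group Qh by (rule Qh_group)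
  obtain \<beta> where \<beta>: "\<gamma> = orbit_sum \<beta>" using t(3) by (rule Q_orbE)
  let ?c = "(rt \<xi> powi (- 2 * form (orbit_sum (simple i)) \<beta> - orbit_form i i)) ^ n"
  have "act (e (- simple i)) (act (e (simple i)) t) = t"
    using act_mult[OF sec_carrier sec_carrier, of "- simple i" "simple i" t]
    by (simp add: sec_inv Qh.l_inv sec_carrier act_one)
  then have "act (e (simple i)) t \<noteq> 0" using t(2) act_0[OF sec_carrier] by metis
  moreover have "act (e (simple i)) t = scaleT ?c (act (e (simple i)) t)"
    using act_orbit[of t \<beta> n i] t(1) n \<beta> by simp
  ultimately have "?c = 1" by (metis TT.scale_cancel_right TT.scale_one)
  moreover have "- 2 * form (orbit_sum (simple i)) \<beta> - orbit_form i i = - (2 * weight (simple i) \<gamma> + orbit_form i i)"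
    by (simp add: \<beta> weight_orbit_sum)
  ultimately have "inverse ((rt \<xi> powi (2 * weight (simple i) \<gamma> + orbit_form i i)) ^ n) = 1"
    by (simp only: power_int_minus power_inverse)
  then show ?thesis by (metis inverse_eq_1_iff)
qed

text \<open>If the norm were odd, \<open>N = 2 M\<close> would be even.  By \<open>phase\<close> for the full rotation an odd power of
  \<open>rt \<xi>\<close> has \<open>N\<close>-th power 1; but \<open>(rt \<xi>)\<^sup>N = \<xi>\<^sup>M = - 1\<close>, which is a contradiction.\<close>

lemma even_orbit_form:
  assumes "(t :: 't) \<noteq> 0" shows "even (orbit_form i i)"
proof (rule ccontr)
  assume o: "odd (orbit_form i i)"
  then obtain M where M: "N = 2 * M" using odd_orbit_form_even_N by blast
  have "\<exists>\<gamma>. comp \<gamma> t \<noteq> 0" using sum_comp[of "{}" t] assms by auto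
  then obtain \<gamma> where \<gamma>: "comp \<gamma> t \<noteq> 0" by blast
  then have "\<gamma> \<in> Q_orb" using comp_out by blast
  then have "(rt \<xi> powi (2 * weight (simple i) \<gamma> + orbit_form i i)) ^ N = 1"
    using \<gamma> by (intro phase[of "comp \<gamma> t"]) (auto simp: comp_mem \<mu>_N)
  moreover have "\<xi> ^ M = - 1" by (rule half_power[OF M])
  moreover have "rt \<xi> ^ N = \<xi> ^ M" unfolding M power_mult by (simp add: rt_square)
  moreover have "(rt \<xi> powi z) ^ N = (rt \<xi> ^ N) powi z" for z
    by (metis power_int_mult power_int_of_nat mult.commute)
  ultimately show False using o by (simp add: power_int_minus_left_odd)
qed

section \<open>Vertex operators on homogeneous vectors\<close>

lemma E_minus_eq: "E_minus s i r v = P.Em (s, i) (int r) v"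
proof -
  have f: "am (s, i) = (\<lambda>n v. scaleP ((rt q powi (- sg s)) ^ n) ((if n = 0 then 0
               else scaleP (of_int (sg s) / qint q (int n)) (\<alpha>op i (- int n) v))))"
    by (auto simp: am_def fun_eq_iff \<alpha>op_zero mult.commute)
  have pw: "rt q powi (- sg s * int r) = (rt q powi (- sg s)) ^ r"
    by (simp only: power_int_mult power_int_of_nat)
  have l: "P.lin (\<lambda>v. if n = 0 then 0 else scaleP (of_int (sg s) / qint q (int n)) (\<alpha>op i (- int n) v))" for n
    unfolding P.lin_if by (intro disjI2 P.lin_scale_fun lin_\<alpha>op)
  show ?thesis
    unfolding P.Ei_nat f E_minus_def pw
    by (subst P.E_scaled[OF l]) (rule refl)
qed

lemma E_plus_eq: "E_plus s i r v = P.E (ap (s, i)) r v"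
proof -
  have f: "ap (s, i) = (\<lambda>n v. scaleP ((rt q powi (- sg s)) ^ n) ((if n = 0 then 0
               else scaleP (- of_int (sg s) / qint q (int n)) (\<alpha>op i (int n) v))))"
    by (auto simp: ap_def fun_eq_iff \<alpha>op_zero mult.commute)
  have pw: "rt q powi (- sg s * int r) = (rt q powi (- sg s)) ^ r"
    by (simp only: power_int_mult power_int_of_nat)
  have l: "P.lin (\<lambda>v. if n = 0 then 0 else scaleP (- of_int (sg s) / qint q (int n)) (\<alpha>op i (int n) v))" for n
    unfolding P.lin_if by (intro disjI2 P.lin_scale_fun lin_\<alpha>op)
  show ?thesis
    unfolding f E_plus_def pw
    by (subst P.E_scaled[OF l]) (rule refl)
qed

definition half_norm :: "'i \<Rightarrow> int" where "half_norm i = orbit_form i i div 2"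

lemma onT_Flt: "h 0 = 0 \<Longrightarrow> f \<in> Flt K \<Longrightarrow> onT h f \<in> Flt K"
  unfolding Flt_def mem_Collect_eq by (metis lookup_onT)

lemma finite_components: "finite {\<gamma>. onT (comp \<gamma>) f \<noteq> 0}"
proof -
  obtain S where S: "finite S" "f = (\<Sum>\<gamma>\<in>S. onT (comp \<gamma>) f)" "\<And>\<gamma>. \<gamma> \<in> S \<Longrightarrow> homog \<gamma> (onT (comp \<gamma>) f)"
    by (rule hom_decomp[of f]) blast
  have "onT (comp \<gamma>) f = 0" if "\<gamma> \<notin> S" for \<gamma>
  proof -
    have "onT (comp \<gamma>) f = (\<Sum>\<gamma>'\<in>S. onT (comp \<gamma>) (onT (comp \<gamma>') f))"
      by (subst S(2)) (rule P.lin_sum[OF lin_onT[OF lin_comp_T]])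
    also have "\<dots> = 0"
    proof (rule sum.neutral, rule ballI)
      fix \<gamma>' assume "\<gamma>' \<in> S"
      with that show "onT (comp \<gamma>) (onT (comp \<gamma>') f) = 0" using onT_comp_hom[OF S(3)] by auto
    qed
    finally show ?thesis .
  qed
  then show ?thesis by (intro finite_subset[OF _ S(1)]) auto
qed

text \<open>The sum over \<open>r\<close> and \<open>l\<close> in the definition is resolved by the condition on the exponents, which fixes \<open>r\<close>.\<close>

lemma X_decomp:
  assumes e: "even (orbit_form i i)" and S: "finite S" "{\<gamma>. onT (comp \<gamma>) f \<noteq> 0} \<subseteq> S"
  shows "X s i m f = (\<Sum>\<gamma>\<in>S. P.Y (s, i) (m + sg s * weight (simple i) \<gamma> + half_norm i) (e_op s i (onT (comp \<gamma>) f)))"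
proof -
  let ?a = "\<lambda>\<gamma>. m + sg s * weight (simple i) \<gamma> + half_norm i"
  let ?S = "\<lambda>(\<gamma>, r, l).
        if 2 * int r - 2 * int l + 2 * sg s * weight (simple i) \<gamma> + form (orbit_sum (simple i)) (simple i) = - 2 * m
        then E_minus s i r (E_plus s i l (onT (act (e (\<lambda>j. sg s * simple i j))) (onT (comp \<gamma>) f))) else 0"
  have c: "form (orbit_sum (simple i)) (simple i) = 2 * half_norm i" using e by (simp add: half_norm_def orbit_form_def)
  obtain K where K: "K \<ge> 0" "f \<in> Flt K" by (rule P.Flt_exI)
  have Kc: "e_op s i (onT (comp \<gamma>) f) \<in> Flt K" for \<gamma>
    by (intro e_op_Flt onT_Flt K TT.lin_zero[OF lin_comp_T])
  let ?L = "SIGMA \<gamma>:S. {l. l \<le> nat K \<and> int l \<ge> ?a \<gamma>}"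
  let ?g = "\<lambda>(\<gamma>, l). (\<gamma>, nat (int l - ?a \<gamma>), l)"
  let ?t = "\<lambda>\<gamma> l. P.Em (s, i) (int l - ?a \<gamma>) (P.E (ap (s, i)) l (e_op s i (onT (comp \<gamma>) f)))"
  have Seq: "?S (\<gamma>, r, l) = (if int r = int l - ?a \<gamma> then ?t \<gamma> l else 0)" for \<gamma> r l
  proof -
    have "2 * int r - 2 * int l + 2 * sg s * weight (simple i) \<gamma> + 2 * half_norm i = - 2 * m \<longleftrightarrow> int r = int l - ?a \<gamma>"
      by (auto simp: algebra_simps)
    moreover have "E_minus s i r (E_plus s i l (onT (act (e (\<lambda>j. sg s * simple i j))) (onT (comp \<gamma>) f))) = ?t \<gamma> l"
      if "int r = int l - ?a \<gamma>"
      unfolding that[symmetric] by (simp add: E_minus_eq E_plus_eq e_op_def signed_root_def)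
    ultimately show ?thesis by (simp add: c)
  qed
  have fin: "finite ?L" by (rule finite_subset[of _ "S \<times> {..nat K}"]) (use S(1) in auto)
  have "X s i m f = Sum_any ?S" by (simp add: X_def Let_def)
  also have "\<dots> = sum ?S (?g ` ?L)"
  proof (rule Sum_any.expand_superset)
    show "finite (?g ` ?L)" using fin by simp
    show "{x. ?S x \<noteq> 0} \<subseteq> ?g ` ?L"
    proof
      fix x assume "x \<in> {x. ?S x \<noteq> 0}"
      moreover obtain \<gamma> r l where x: "x = (\<gamma>, r, l)" by (cases x)
      ultimately have nz: "?S (\<gamma>, r, l) \<noteq> 0" by simp
      then have r: "int r = int l - ?a \<gamma>" unfolding Seq by (auto split: if_splits)
      have "P.E (ap (s, i)) l (e_op s i (onT (comp \<gamma>) f)) \<noteq> 0"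
        using nz unfolding Seq by (auto split: if_splits simp: P.lin_zero[OF P.lin_Em])
      then have "int l \<le> K" "onT (comp \<gamma>) f \<noteq> 0"
        using P.Ep_zero[OF Kc, of l "(s, i)"] by (force, auto simp: P.lin_zero[OF lin_e_op] P.lin_zero[OF P.lin_Ep])
      then show "x \<in> ?g ` ?L" unfolding x using r S(2) by (intro image_eqI[of _ _ "(\<gamma>, l)"]) auto
    qed
  qed
  also have "\<dots> = (\<Sum>z\<in>?L. ?S (?g z))"
    by (subst sum.reindex) (auto simp: inj_on_def)
  also have "\<dots> = (\<Sum>(\<gamma>, l)\<in>?L. ?t \<gamma> l)"
  proof (rule sum.cong[OF refl])
    fix z assume z: "z \<in> ?L"
    obtain \<gamma> l where zl: "z = (\<gamma>, l)" by (cases z)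
    have "?S (\<gamma>, nat (int l - ?a \<gamma>), l) = ?t \<gamma> l" unfolding Seq using z zl by simp
    then show "?S (?g z) = (case z of (\<gamma>, l) \<Rightarrow> ?t \<gamma> l)" unfolding zl by simp
  qed
  also have "\<dots> = (\<Sum>\<gamma>\<in>S. \<Sum>l | l \<le> nat K \<and> int l \<ge> ?a \<gamma>. ?t \<gamma> l)"
    using S(1) by (subst sum.Sigma) (auto intro: finite_subset[of _ "{..nat K}"])
  also have "\<dots> = (\<Sum>\<gamma>\<in>S. P.Y (s, i) (?a \<gamma>) (e_op s i (onT (comp \<gamma>) f)))"
  proof (rule sum.cong[OF refl])
    fix \<gamma>
    have "(\<Sum>l | l \<le> nat K \<and> int l \<ge> ?a \<gamma>. ?t \<gamma> l) = (\<Sum>l\<le>nat K. ?t \<gamma> l)"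
      by (rule sum.mono_neutral_left) (auto, metis P.Ei_neg diff_less_0_iff_less not_le)
    also have "\<dots> = P.Y (s, i) (?a \<gamma>) (e_op s i (onT (comp \<gamma>) f))"
      using P.Y_sum[OF Kc, of "nat K"] K(1) by simp
    finally show "(\<Sum>l | l \<le> nat K \<and> int l \<ge> ?a \<gamma>. ?t \<gamma> l) = P.Y (s, i) (?a \<gamma>) (e_op s i (onT (comp \<gamma>) f))" .
  qed
  finally show ?thesis .
qed

lemma lin_X: assumes e: "even (orbit_form i i)" shows "P.lin (X s i m)"
proof (rule P.linI)
  fix u v :: "('i, 't) poly_tensor"
  let ?S = "{\<gamma>. onT (comp \<gamma>) u \<noteq> 0} \<union> {\<gamma>. onT (comp \<gamma>) v \<noteq> 0}"
  have S: "finite ?S" "{\<gamma>. onT (comp \<gamma>) u \<noteq> 0} \<subseteq> ?S" "{\<gamma>. onT (comp \<gamma>) v \<noteq> 0} \<subseteq> ?S" "{\<gamma>. onT (comp \<gamma>) (u + v) \<noteq> 0} \<subseteq> ?S"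
    using finite_components by (auto simp: P.lin_add[OF lin_onT[OF lin_comp_T]])
  show "X s i m (u + v) = X s i m u + X s i m v"
    unfolding X_decomp[OF e S(1,2)] X_decomp[OF e S(1,3)] X_decomp[OF e S(1,4)]
    by (simp add: P.lin_add[OF lin_onT[OF lin_comp_T]] P.lin_add[OF lin_e_op] P.lin_add[OF P.lin_Y] sum.distrib)
  fix c
  have S': "{\<gamma>. onT (comp \<gamma>) (scaleP c u) \<noteq> 0} \<subseteq> {\<gamma>. onT (comp \<gamma>) u \<noteq> 0}"
    by (auto simp: P.lin_scale[OF lin_onT[OF lin_comp_T]])
  show "X s i m (scaleP c u) = scaleP c (X s i m u)"
    unfolding X_decomp[OF e finite_components S'] unfolding X_decomp[OF e finite_components order_refl]
    by (simp only: P.lin_scale[OF lin_onT[OF lin_comp_T]] P.lin_scale[OF lin_e_op] P.lin_scale[OF P.lin_Y] P.scale_sum_right)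
qed

lemma X_hom:
  assumes f: "homog \<gamma> f" and e: "even (orbit_form i i)"
  shows "X s i m f = P.Y (s, i) (m + sg s * weight (simple i) \<gamma> + half_norm i) (e_op s i f)"
proof -
  have "{\<gamma>'. onT (comp \<gamma>') f \<noteq> 0} \<subseteq> {\<gamma>}" by (auto simp: onT_comp_hom[OF f])
  from X_decomp[OF e _ this] show ?thesis by (simp add: onT_comp_hom[OF f])
qed

lemma hom_X: "homog \<gamma> f \<Longrightarrow> even (orbit_form i i) \<Longrightarrow> homog (\<gamma> + orbit_sum (signed_root s i)) (X s i m f)"
  by (simp add: X_hom hom_Y hom_e_op)

definition phi_exp :: "pm \<Rightarrow> 'i \<Rightarrow> nat \<Rightarrow> ('i, 't) poly_tensor \<Rightarrow> ('i, 't) poly_tensor" where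
  "phi_exp s i n v = (if n = 0 then 0 else scaleP (of_int (sg s) * (q - inverse q)) (\<alpha>op i (sg s * int n) v))"

lemma \<Phi>_hom: assumes "homog \<gamma> f"
  shows "\<Phi> s i m f = (if sg s * m < 0 then 0 else
    scaleP (q powi (sg s * weight (simple i) \<gamma>)) (P.E (phi_exp s i) (nat (sg s * m)) f))"
proof -
  have "homog \<gamma> (P.E (phi_exp s i) n f)" for n
    using assms hom_orb[OF assms] by (intro hom_E) (auto simp: phi_exp_def intro: hom_scaleP hom_\<alpha>op hom_0)
  then show ?thesis
    unfolding \<Phi>_def phi_exp_def[symmetric] by (simp add: phi_exp_def[abs_def, symmetric] onT_pow_hom power_int_mult)
qed

end

context graded_module
begin

lemma kap_rot_entry: "kap (s, i) (t, j) = (\<Prod>r\<in>ZN. kap_factor s t (rot_entry i j r) (\<xi> powi r))"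
  unfolding kap_def by (intro prod.cong) (auto simp: rot_entry_def rot_ZN)

lemma kap_swap: "kap (t, j) (s, i) = (\<Prod>r\<in>ZN. kap_factor t s (rot_entry i j r) (\<xi> powi (- r)))"
proof -
  have "kap (t, j) (s, i) = (\<Prod>r\<in>ZN. kap_factor t s (rot_entry j i ((- r) mod int N)) (\<xi> powi ((- r) mod int N)))"
    unfolding kap_rot_entry by (rule prod.reindex_bij_betw[OF neg_bij, symmetric])
  then show ?thesis by (simp add: rot_entry_mod \<xi>_powi_mod rot_entry_minus)
qed

abbreviation one_minus :: "complex \<Rightarrow> complex fps" where "one_minus c \<equiv> 1 - fps_const c * fps_X"

lemma kap_factor_0: "kap_factor s t 0 b = 1" by (simp add: kap_factor_def)

lemma kap_same: "kap (s, i) (s, j) = (\<Prod>r\<in>\<Gamma>p i j. one_minus (\<xi> powi r) * one_minus (\<xi> powi r * q powi (- 2 * sg s))) *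
    (\<Prod>r\<in>\<Gamma>m i j. inverse (one_minus (\<xi> powi r * q powi (- sg s))))"
  unfolding kap_rot_entry by (subst ZN_split[where h = "\<lambda>a r. kap_factor s s a (\<xi> powi r)"]) (simp_all add: kap_factor_0, simp add: kap_factor_def)
lemma kap_same': "kap (s, j) (s, i) = (\<Prod>r\<in>\<Gamma>p i j. one_minus (\<xi> powi (- r)) * one_minus (\<xi> powi (- r) * q powi (- 2 * sg s))) *
    (\<Prod>r\<in>\<Gamma>m i j. inverse (one_minus (\<xi> powi (- r) * q powi (- sg s))))"
  unfolding kap_swap by (subst ZN_split[where h = "\<lambda>a r. kap_factor s s a (\<xi> powi (- r))"]) (simp_all add: kap_factor_0, simp add: kap_factor_def)
lemma kap_opp: "s \<noteq> t \<Longrightarrow> kap (s, i) (t, j) = (\<Prod>r\<in>\<Gamma>p i j. inverse (one_minus (\<xi> powi r * q)) * inverse (one_minus (\<xi> powi r * inverse q))) *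
    (\<Prod>r\<in>\<Gamma>m i j. one_minus (\<xi> powi r))"
  unfolding kap_rot_entry by (subst ZN_split[where h = "\<lambda>a r. kap_factor s t a (\<xi> powi r)"]) (simp_all add: kap_factor_0, simp add: kap_factor_def)
lemma kap_opp': "s \<noteq> t \<Longrightarrow> kap (t, j) (s, i) = (\<Prod>r\<in>\<Gamma>p i j. inverse (one_minus (\<xi> powi (- r) * q)) * inverse (one_minus (\<xi> powi (- r) * inverse q))) *
    (\<Prod>r\<in>\<Gamma>m i j. one_minus (\<xi> powi (- r)))"
  unfolding kap_swap by (subst ZN_split[where h = "\<lambda>a r. kap_factor t s a (\<xi> powi (- r))"]) (simp_all add: kap_factor_0, simp add: kap_factor_def)

text \<open>The commutator map in terms of the two kinds of rotations: this is the constant by which the two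
  expansions of a product of currents of the same sign differ.\<close>

lemma C_prod: "C (simple i) (simple j) = (\<Prod>r\<in>\<Gamma>p i j. \<xi> powi (- 2 * r)) * (\<Prod>r\<in>\<Gamma>m i j. - (\<xi> powi r))"
proof -
  have "C (simple i) (simple j) = (\<Prod>n<N. (- (\<xi> powi (- int n))) powi rot_entry i j (int n))"
    by (simp add: C_def \<mu>Q_pow_simple form_simple rot_entry_def rot_nat)
  also have "\<dots> = (\<Prod>r\<in>ZN. (- (\<xi> powi (- r))) powi rot_entry i j r)"
    by (rule prod.reindex_bij_witness[of _ nat int]) auto
  also have "\<dots> = (\<Prod>r\<in>\<Gamma>p i j. (- (\<xi> powi (- r))) powi 2) * (\<Prod>r\<in>\<Gamma>m i j. (- (\<xi> powi (- r))) powi (- 1))"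
    by (subst ZN_split[where h = "\<lambda>a r. (- (\<xi> powi (- r))) powi a"]) simp_all
  also have "(\<lambda>r. (- (\<xi> powi (- r))) powi 2) = (\<lambda>r. \<xi> powi (- 2 * r))"
  proof
    fix r
    have "\<xi> powi (- 2 * r) = (\<xi> powi (- r)) powi 2"
      by (simp only: power_int_mult[symmetric]) (simp add: mult.commute)
    then show "(- (\<xi> powi (- r))) powi 2 = \<xi> powi (- 2 * r)" by simp
  qed
  also have "(\<lambda>r. (- (\<xi> powi (- r))) powi (- 1)) = (\<lambda>r. - (\<xi> powi r))"
    by (simp add: fun_eq_iff power_int_minus)
  finally show ?thesis .
qed

section \<open>Products of currents\<close>

lemma cocycle_same: "cocycle s i s j = C (simple i) (simple j)"
  by (cases s) (simp_all add: cocycle_def)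

text \<open>The power of \<open>z\<close> in front of the contraction comes from the zero modes: the first current acts on a vector whose
  degree has been shifted by the second.\<close>

lemma X_X:
  assumes f: "homog \<gamma> f" and e: "\<And>i. even (orbit_form i i)" and xy: "x' \<le> 2" "y' \<le> 2" "x' \<noteq> y'"
  shows "X s i (m x') (X t j (m y') f) = P.ratio_mult x' y' (sg s * sg t * orbit_form i j) (kap (s, i) (t, j))
    (\<lambda>m. P.N2 (s, i) (t, j) (m x' + (sg s * weight (simple i) \<gamma> + half_norm i)) (m y' + (sg t * weight (simple j) \<gamma> + half_norm j)) (e_op s i (e_op t j f))) m"
proof -
  have "X s i (m x') (X t j (m y') f) =
    P.Y (s, i) (m x' + sg s * sg t * orbit_form i j + (sg s * weight (simple i) \<gamma> + half_norm i))
      (P.Y (t, j) (m y' + (sg t * weight (simple j) \<gamma> + half_norm j)) (e_op s i (e_op t j f)))"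
    by (subst X_hom[OF hom_X[OF f e] e]) (simp add: weight_signed_root[OF hom_orb[OF f]] X_hom[OF f e] e_op_Y algebra_simps)
  then show ?thesis by (simp only: P.Y_Y_ratio_mult[OF xy])
qed

lemma X_X_X:
  assumes f: "homog \<gamma> f" and e: "\<And>i. even (orbit_form i i)" and o: "arrangement x' y' z'"
  shows "X s i (m x') (X s j (m y') (X s l (m z') f)) = P.ratio_mult x' y' (orbit_form i j) (kap (s, i) (s, j))
    (P.ratio_mult x' z' (orbit_form i l) (kap (s, i) (s, l)) (P.ratio_mult y' z' (orbit_form j l) (kap (s, j) (s, l))
    (\<lambda>m. P.N3 (s, i) (s, j) (s, l) (m x' + (sg s * weight (simple i) \<gamma> + half_norm i)) (m y' + (sg s * weight (simple j) \<gamma> + half_norm j))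
       (m z' + (sg s * weight (simple l) \<gamma> + half_norm l)) (e_op s i (e_op s j (e_op s l f)))))) m"
proof -
  have ss: "sg s * (sg s * z) = z" for z by (cases s) auto
  note g = hom_orb[OF f]
  have w1: "weight (simple i') (\<gamma> + orbit_sum (signed_root s l)) = weight (simple i') \<gamma> + sg s * orbit_form i' l" for i'
    by (rule weight_signed_root[OF g])
  have w2: "weight (simple i') (\<gamma> + orbit_sum (signed_root s l) + orbit_sum (signed_root s j)) = weight (simple i') \<gamma> + sg s * orbit_form i' l + sg s * orbit_form i' j" for i'
    by (subst weight_signed_root) (simp_all add: w1 Q_orb_add g Q_orbI)
  have "X s i (m x') (X s j (m y') (X s l (m z') f)) =
    P.Y (s, i) (m x' + orbit_form i j + orbit_form i l + (sg s * weight (simple i) \<gamma> + half_norm i))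
      (P.Y (s, j) (m y' + orbit_form j l + (sg s * weight (simple j) \<gamma> + half_norm j))
      (P.Y (s, l) (m z' + (sg s * weight (simple l) \<gamma> + half_norm l)) (e_op s i (e_op s j (e_op s l f)))))"
    by (subst X_hom[OF hom_X[OF hom_X[OF f e] e] e], subst X_hom[OF hom_X[OF f e] e], subst X_hom[OF f e])
       (simp only: e_op_Y w1 w2 distrib_left ss, simp add: add_ac)
  then show ?thesis by (simp only: P.Y_Y_Y_ratio_mult[OF o refl])
qed

lemma ratio_finite_N2:
  assumes "x' \<le> 2" "y' \<le> 2" "x' \<noteq> y'"
  shows "ratio_finite x' y' (\<lambda>m. P.N2 p p' (m x' + a) (m y' + b) u)"
proof -
  obtain K where K: "K \<ge> 0" "u \<in> Flt K" by (rule P.Flt_exI)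
  show ?thesis unfolding ratio_finite_def
  proof (intro allI exI impI)
    fix m and l :: nat assume "l > nat (K + \<bar>m y'\<bar> + \<bar>b\<bar>)"
    then have "m y' + int l + b > K" by linarith
    then show "P.N2 p p' ((m + sv x' (- int l) + sv y' (int l)) x' + a) ((m + sv x' (- int l) + sv y' (int l)) y' + b) u = 0"
      using assms by (intro P.N2_zero[OF K(2)]) (simp add: sv_apply)
  qed
qed

lemma ratio_finite_N2':
  assumes "x' \<le> 2" "y' \<le> 2" "x' \<noteq> y'"
  shows "ratio_finite y' x' (\<lambda>m. P.N2 p p' (m x' + a) (m y' + b) u)"
  unfolding P.N2_sym[of p p'] using assms by (intro ratio_finite_N2) auto

end

context graded_module
begin

section \<open>Quadratic relations\<close>

definition linear_form :: "complex \<Rightarrow> complex \<Rightarrow> nat \<Rightarrow> nat \<Rightarrow> poly3" where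
  "linear_form u v a b = cst u * zv a - cst v * zv b"

lemma ratio_mult_forms:
  assumes "a \<le> 2" "b \<le> 2" "ratio_finite a b (D :: idx \<Rightarrow> ('i, 't) poly_tensor)" "h' = h + int (card S)"
  shows "P.pact (\<Prod>k\<in>S. linear_form (u k) (v k) a b) (P.ratio_mult a b h f D) =
    P.ratio_mult a b h' ((\<Prod>k\<in>S. fps_const (u k) - fps_const (v k) * fps_X) * f) D"
  unfolding linear_form_def assms(4) by (rule P.ratio_mult_linear_forms[OF assms(1-3)])

lemma prod_fps_const: "(\<Prod>r\<in>S. fps_const (c r)) = fps_const (\<Prod>r\<in>S. c r)" for c :: "'a \<Rightarrow> complex"
  by (induction S rule: infinite_finite_induct) auto

lemma one_minus_inverse: "one_minus c * inverse (one_minus c) = 1"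
proof -
  have "fps_nth (one_minus c) 0 \<noteq> 0" by simp
  from inverse_mult_eq_1[OF this] show ?thesis by (simp add: mult.commute)
qed

text \<open>Both sides become the same polynomial applied to a normally ordered product.  Factors for entries \<open>- 1\<close> cancel the
  denominators of the contraction; a factor for an entry 2 completes the two numerators of the contraction to
  a product of three linear forms that is the same for both orders up to a constant.\<close>

lemma quadratic_relation:
  assumes f: "homog \<gamma> f" and e: "\<And>i. even (orbit_form i i)"
  shows "P.pact (F s i j (zv 0) (zv 1)) (\<lambda>m. X s i (m 0) (X s j (m 1) f)) =
    P.pact (G s i j (zv 0) (zv 1)) (\<lambda>m. X s j (m 1) (X s i (m 0) f))"
proof -
  let ?a = "sg s * weight (simple i) \<gamma> + half_norm i" and ?b = "sg s * weight (simple j) \<gamma> + half_norm j"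
  define u where "u = e_op s i (e_op s j f)"
  define u' where "u' = e_op s j (e_op s i f)"
  define N0 where "N0 = (\<lambda>m :: idx. P.N2 (s, i) (s, j) (m 0 + ?a) (m 1 + ?b) u)"
  define N1 where "N1 = (\<lambda>m :: idx. P.N2 (s, i) (s, j) (m 0 + ?a) (m 1 + ?b) u')"
  have u_eq: "u = scaleP (C (simple i) (simple j)) u'"
    unfolding u_def u'_def e_op_e_op[of s i s j] cocycle_same ..
  have N01: "N0 = P.scf (C (simple i) (simple j)) N1"
    by (simp add: N0_def N1_def fun_eq_iff P.scf_def u_eq P.lin_scale[OF P.lin_N2])
  have ratio_finite: "ratio_finite 0 1 N0" "ratio_finite 0 1 N1" "ratio_finite 1 0 N1"
    unfolding N0_def N1_def by (rule ratio_finite_N2 ratio_finite_N2'; simp)+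
  have ss: "sg s * sg s = 1" by (cases s) auto
  let ?\<Gamma>p = "\<Gamma>p i j" and ?\<Gamma>m = "\<Gamma>m i j"
  let ?Q = "q powi (2 * sg s)" and ?Q' = "q powi (- 2 * sg s)"
  have QQ: "?Q * ?Q' = 1" "?Q' * ?Q = 1" using q_nonzero by (simp_all add: power_int_add[symmetric])
  have xx: "\<xi> powi r * \<xi> powi (- r) = 1" "\<xi> powi (- r) * \<xi> powi r = 1" for r
    using \<xi>_nonzero by (simp_all add: power_int_add[symmetric])
  define n where "n = int (card ?\<Gamma>p)"
  have BBn: "orbit_form i j + int (card ?\<Gamma>m) = 2 * n" by (simp add: orbit_form_card n_def dd_def)
  have L: "(\<lambda>m. X s i (m 0) (X s j (m 1) f)) = P.ratio_mult 0 1 (orbit_form i j) (kap (s, i) (s, j)) N0"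
    by (rule ext, subst X_X[OF f e]) (simp_all add: ss N0_def u_def)
  have R: "(\<lambda>m. X s j (m 1) (X s i (m 0) f)) = P.ratio_mult 1 0 (orbit_form i j) (kap (s, j) (s, i)) N1"
    by (rule ext, subst X_X[OF f e]) (simp_all add: ss N1_def u'_def orbit_form_sym[of j] P.N2_sym[of "(s, j)"])
  define P1 where "P1 = (\<Prod>r\<in>?\<Gamma>p. linear_form 1 (\<xi> powi r * ?Q) 0 1)"
  define P2 where "P2 = (\<Prod>r\<in>?\<Gamma>p. linear_form 1 (\<xi> powi r) 0 1)"
  define P3 where "P3 = (\<Prod>r\<in>?\<Gamma>p. linear_form 1 (\<xi> powi r * ?Q') 0 1)"
  define R1 where "R1 = (\<Prod>r\<in>?\<Gamma>p. linear_form (- (\<xi> powi r)) (- ?Q) 1 0)"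
  define R2 where "R2 = (\<Prod>r\<in>?\<Gamma>p. linear_form 1 (\<xi> powi (- r)) 1 0)"
  define R3 where "R3 = (\<Prod>r\<in>?\<Gamma>p. linear_form 1 (\<xi> powi (- r) * ?Q') 1 0)"
  have F: "F s i j (zv 0) (zv 1) = P1 * (\<Prod>r\<in>?\<Gamma>m. linear_form 1 (\<xi> powi r * q powi (- sg s)) 0 1)"
    unfolding F_def \<Gamma>_eq prod.union_disjoint[OF finite_\<Gamma> \<Gamma>_disjoint] P1_def
    by (intro arg_cong2[where f = "(*)"] prod.cong) (auto simp: \<Gamma>p_iff \<Gamma>m_iff rot_entry_def rot_ZN linear_form_def cst_1 mult.commute)
  have G: "G s i j (zv 0) (zv 1) = R1 * (\<Prod>r\<in>?\<Gamma>m. linear_form (- (\<xi> powi r)) (- (q powi (- sg s))) 1 0)"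
    unfolding G_def \<Gamma>_eq prod.union_disjoint[OF finite_\<Gamma> \<Gamma>_disjoint] R1_def
    by (intro arg_cong2[where f = "(*)"] prod.cong) (auto simp: \<Gamma>p_iff \<Gamma>m_iff rot_entry_def rot_ZN linear_form_def cst_minus mult.commute)
  have le: "(0::nat) \<le> 2" "(1::nat) \<le> 2" by auto
  have LHS: "P.pact (F s i j (zv 0) (zv 1)) (P.ratio_mult 0 1 (orbit_form i j) (kap (s, i) (s, j)) N0) = P.pact (P1 * (P2 * P3)) N0"
  proof -
    have inv: "(\<Prod>r\<in>?\<Gamma>m. one_minus (\<xi> powi r * q powi (- sg s))) * kap (s, i) (s, j) =
      (\<Prod>r\<in>?\<Gamma>p. one_minus (\<xi> powi r)) * (\<Prod>r\<in>?\<Gamma>p. one_minus (\<xi> powi r * ?Q'))"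
    proof -
      have "(\<Prod>r\<in>?\<Gamma>m. one_minus (\<xi> powi r * q powi (- sg s))) * (\<Prod>r\<in>?\<Gamma>m. inverse (one_minus (\<xi> powi r * q powi (- sg s)))) = 1"
        unfolding prod.distrib[symmetric] one_minus_inverse by simp
      then show ?thesis unfolding kap_same prod.distrib by (simp add: mult_ac)
    qed
    have "P.pact (F s i j (zv 0) (zv 1)) (P.ratio_mult 0 1 (orbit_form i j) (kap (s, i) (s, j)) N0) =
      P.ratio_mult 0 1 (3 * n) ((\<Prod>r\<in>?\<Gamma>p. one_minus (\<xi> powi r * ?Q)) * ((\<Prod>r\<in>?\<Gamma>p. one_minus (\<xi> powi r)) * (\<Prod>r\<in>?\<Gamma>p. one_minus (\<xi> powi r * ?Q')))) N0"
      unfolding F P.pact_mult P1_def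
      by (subst ratio_mult_forms[OF le ratio_finite(1) BBn[symmetric]], subst ratio_mult_forms[OF le ratio_finite(1)])
         (simp_all add: n_def inv)
    also have "\<dots> = P.pact (P1 * (P2 * P3)) (P.ratio_mult 0 1 0 1 N0)"
      unfolding P.pact_mult P1_def P2_def P3_def
      by (subst ratio_mult_forms[OF le ratio_finite(1) refl], subst ratio_mult_forms[OF le ratio_finite(1) refl], subst ratio_mult_forms[OF le ratio_finite(1) refl])
         (simp add: n_def)
    finally show ?thesis by (simp only: P.ratio_mult_id)
  qed
  have RHS: "P.pact (G s i j (zv 0) (zv 1)) (P.ratio_mult 1 0 (orbit_form i j) (kap (s, j) (s, i)) N1) =
     P.pact (R1 * (R2 * R3)) (P.scf (\<Prod>r\<in>?\<Gamma>m. - (\<xi> powi r)) N1)"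
  proof -
    have c: "fps_const (- (\<xi> powi r)) - fps_const (- (q powi (- sg s))) * fps_X =
        fps_const (- (\<xi> powi r)) * one_minus (\<xi> powi (- r) * q powi (- sg s))" for r
    proof -
      have "fps_const (- (\<xi> powi r)) * fps_const (\<xi> powi (- r) * q powi (- sg s)) = fps_const (- (q powi (- sg s)))"
        unfolding fps_const_mult by (simp add: mult.assoc[symmetric] xx)
      then show ?thesis by (simp only: right_diff_distrib mult.assoc[symmetric] mult_1_right)
    qed
    have inv: "(\<Prod>r\<in>?\<Gamma>m. fps_const (- (\<xi> powi r)) - fps_const (- (q powi (- sg s))) * fps_X) * kap (s, j) (s, i) =
      fps_const (\<Prod>r\<in>?\<Gamma>m. - (\<xi> powi r)) * ((\<Prod>r\<in>?\<Gamma>p. one_minus (\<xi> powi (- r))) * (\<Prod>r\<in>?\<Gamma>p. one_minus (\<xi> powi (- r) * ?Q')))"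
    proof -
      have "(\<Prod>r\<in>?\<Gamma>m. one_minus (\<xi> powi (- r) * q powi (- sg s))) * (\<Prod>r\<in>?\<Gamma>m. inverse (one_minus (\<xi> powi (- r) * q powi (- sg s)))) = 1"
        unfolding prod.distrib[symmetric] one_minus_inverse by simp
      then show ?thesis unfolding kap_same' prod.distrib c prod_fps_const by (simp add: mult_ac)
    qed
    have "P.pact (G s i j (zv 0) (zv 1)) (P.ratio_mult 1 0 (orbit_form i j) (kap (s, j) (s, i)) N1) =
      P.ratio_mult 1 0 (3 * n) ((\<Prod>r\<in>?\<Gamma>p. fps_const (- (\<xi> powi r)) - fps_const (- ?Q) * fps_X) * (fps_const (\<Prod>r\<in>?\<Gamma>m. - (\<xi> powi r)) *
        ((\<Prod>r\<in>?\<Gamma>p. one_minus (\<xi> powi (- r))) * (\<Prod>r\<in>?\<Gamma>p. one_minus (\<xi> powi (- r) * ?Q'))))) N1"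
      unfolding G P.pact_mult R1_def
      by (subst ratio_mult_forms[OF le(2,1) ratio_finite(3) BBn[symmetric]], subst ratio_mult_forms[OF le(2,1) ratio_finite(3), of "3 * n"], simp add: n_def, simp only: inv)
    also have "\<dots> = P.scf (\<Prod>r\<in>?\<Gamma>m. - (\<xi> powi r)) (P.ratio_mult 1 0 (3 * n) ((\<Prod>r\<in>?\<Gamma>p. fps_const (- (\<xi> powi r)) - fps_const (- ?Q) * fps_X) *
        ((\<Prod>r\<in>?\<Gamma>p. one_minus (\<xi> powi (- r))) * (\<Prod>r\<in>?\<Gamma>p. one_minus (\<xi> powi (- r) * ?Q')))) N1)"
      by (subst P.ratio_mult_f_const[OF ratio_finite(3), symmetric]) (simp add: mult_ac)
    also have "P.ratio_mult 1 0 (3 * n) ((\<Prod>r\<in>?\<Gamma>p. fps_const (- (\<xi> powi r)) - fps_const (- ?Q) * fps_X) *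
        ((\<Prod>r\<in>?\<Gamma>p. one_minus (\<xi> powi (- r))) * (\<Prod>r\<in>?\<Gamma>p. one_minus (\<xi> powi (- r) * ?Q')))) N1 =
        P.pact (R1 * (R2 * R3)) (P.ratio_mult 1 0 0 1 N1)"
      unfolding P.pact_mult R1_def R2_def R3_def
      by (subst ratio_mult_forms[OF le(2,1) ratio_finite(3) refl], subst ratio_mult_forms[OF le(2,1) ratio_finite(3) refl], subst ratio_mult_forms[OF le(2,1) ratio_finite(3) refl])
         (simp add: n_def)
    finally show ?thesis by (simp only: P.ratio_mult_id P.pact_cst[symmetric] P.pact_mult_right mult.commute)
  qed
  have "R1 * (R2 * R3) = cst (\<Prod>r\<in>?\<Gamma>p. \<xi> powi (- 2 * r)) * (P1 * (P2 * P3))"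
  proof -
    have one: "linear_form (- (\<xi> powi r)) (- ?Q) 1 0 * (linear_form 1 (\<xi> powi (- r)) 1 0 * linear_form 1 (\<xi> powi (- r) * ?Q') 1 0) =
      cst (\<xi> powi (- 2 * r)) * (linear_form 1 (\<xi> powi r * ?Q) 0 1 * (linear_form 1 (\<xi> powi r) 0 1 * linear_form 1 (\<xi> powi r * ?Q') 0 1))" for r
    proof -
      \<comment> \<open>Exchanging the variables inverts the constant of a linear form, so the shifts by \<open>q\<close> to the power \<open>2\<close> and \<open>- 2\<close> trade places.\<close>
      have 1: "linear_form (- (\<xi> powi r)) (- ?Q) 1 0 = cst ?Q * linear_form 1 (\<xi> powi r * ?Q') 0 1"
      proof -
        have "cst ?Q * cst (\<xi> powi r * ?Q') = cst (\<xi> powi r)"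
          unfolding cst_mult[symmetric] mult.left_commute[of ?Q] QQ by simp
        then show ?thesis by (simp add: linear_form_def cst_1 cst_minus right_diff_distrib mult.assoc[symmetric])
      qed
      have 2: "linear_form 1 (\<xi> powi (- r)) 1 0 = cst (- (\<xi> powi (- r))) * linear_form 1 (\<xi> powi r) 0 1"
      proof -
        have "cst (\<xi> powi (- r)) * cst (\<xi> powi r) = 1" unfolding cst_mult[symmetric] xx by (rule cst_1)
        then show ?thesis by (simp add: linear_form_def cst_1 cst_minus right_diff_distrib mult.assoc[symmetric])
      qed
      have 3: "linear_form 1 (\<xi> powi (- r) * ?Q') 1 0 = cst (- (\<xi> powi (- r) * ?Q')) * linear_form 1 (\<xi> powi r * ?Q) 0 1"
      proof -
        have "cst (\<xi> powi (- r) * ?Q') * cst (\<xi> powi r * ?Q) = cst ((\<xi> powi (- r) * \<xi> powi r) * (?Q' * ?Q))"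
          unfolding cst_mult[symmetric] by (simp only: mult_ac)
        then have "cst (\<xi> powi (- r) * ?Q') * cst (\<xi> powi r * ?Q) = 1" unfolding xx QQ by (simp add: cst_1)
        then show ?thesis by (simp add: linear_form_def cst_1 cst_minus right_diff_distrib mult.assoc[symmetric])
      qed
      have "\<xi> powi (- 2 * r) = (\<xi> powi (- r)) * (\<xi> powi (- r))"
        using \<xi>_nonzero by (simp add: power_int_add[symmetric])
      note x2 = this
      have 4: "cst ?Q * cst (- (\<xi> powi (- r))) * cst (- (\<xi> powi (- r) * ?Q')) = cst (\<xi> powi (- 2 * r))"
      proof -
        have "?Q * (- (\<xi> powi (- r))) * (- (\<xi> powi (- r) * ?Q')) = (\<xi> powi (- r) * \<xi> powi (- r)) * (?Q * ?Q')"
          by (simp only: mult_minus_left mult_minus_right minus_minus mult_ac)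
        then have "?Q * (- (\<xi> powi (- r))) * (- (\<xi> powi (- r) * ?Q')) = \<xi> powi (- 2 * r)"
          by (simp only: QQ mult_1_right x2)
        then show ?thesis by (simp only: cst_mult[symmetric])
      qed
      show ?thesis unfolding 1 2 3 4[symmetric] by (simp only: mult_ac)
    qed
    show ?thesis
      unfolding R1_def R2_def R3_def P1_def P2_def P3_def cst_prod[symmetric] prod.distrib[symmetric] one ..
  qed
  then have "P.pact (R1 * (R2 * R3)) (P.scf (\<Prod>r\<in>?\<Gamma>m. - (\<xi> powi r)) N1) = P.pact (P1 * (P2 * P3)) N0"
    unfolding N01 C_prod P.pact_cst[symmetric] P.pact_mult_right by (simp add: cst_mult mult_ac)
  then show ?thesis unfolding L R LHS RHS by simp
qed

section \<open>Contractions in closed form\<close>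

lemma \<Gamma>p_products: assumes "c \<noteq> 0"
  shows "(\<Prod>r\<in>\<Gamma>p i i. one_minus (\<xi> powi r * c)) = 1 - fps_const (c ^ d i) * fps_X ^ d i"
  unfolding d_def
proof (rule prod_fps_linear_factors)
  show "inj_on (\<lambda>r. \<xi> powi r * c) (\<Gamma>p i i)" by (rule inj_\<xi>_scaled) (auto simp: \<Gamma>p_def assms)
  show "(\<xi> powi r * c) ^ card (\<Gamma>p i i) = c ^ card (\<Gamma>p i i)" if "r \<in> \<Gamma>p i i" for r
    using rot_subgroup_power[OF rot_subgroup_\<Gamma>p that] by (simp add: power_mult_distrib)
  show "card (\<Gamma>p i i) > 0" by (rule rot_subgroup_card_pos[OF rot_subgroup_\<Gamma>p])
qed (rule finite_\<Gamma>)

lemma \<Gamma>m_products_self: assumes "c \<noteq> 0" "dd i i > 0"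
  shows "(\<Prod>r\<in>\<Gamma>m i i. one_minus (\<xi> powi r * c)) = 1 + fps_const (c ^ dd i i) * fps_X ^ dd i i"
proof -
  have "(\<Prod>r\<in>\<Gamma>m i i. one_minus (\<xi> powi r * c)) = 1 - fps_const (- (c ^ card (\<Gamma>m i i))) * fps_X ^ card (\<Gamma>m i i)"
  proof (rule prod_fps_linear_factors)
    show "inj_on (\<lambda>r. \<xi> powi r * c) (\<Gamma>m i i)" by (rule inj_\<xi>_scaled) (auto simp: \<Gamma>m_def assms)
    show "(\<xi> powi r * c) ^ card (\<Gamma>m i i) = - (c ^ card (\<Gamma>m i i))" if "r \<in> \<Gamma>m i i" for r
      using \<Gamma>m_self(2)[OF assms(2) that] by (simp add: power_mult_distrib dd_def)
    show "card (\<Gamma>m i i) > 0" using assms(2) by (simp add: dd_def)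
  qed (rule finite_\<Gamma>)
  then show ?thesis by (simp add: dd_def flip: fps_const_neg)
qed

lemma \<Gamma>m_products: assumes "c \<noteq> 0" "A i j < 0"
  shows "(\<Prod>r\<in>\<Gamma>m i j. one_minus (\<xi> powi r * c)) = 1 - fps_const (c ^ dd i j) * fps_X ^ dd i j"
    "(\<Prod>r\<in>\<Gamma>m i j. one_minus (\<xi> powi (- r) * c)) = 1 - fps_const (c ^ dd i j) * fps_X ^ dd i j"
    "(\<Prod>r\<in>\<Gamma>m i j. - (\<xi> powi r)) = - 1"
proof -
  note H = rot_subgroup_\<Gamma>m[OF assms(2)]
  have p: "(\<xi> powi r) ^ card (\<Gamma>m i j) = 1" "(\<xi> powi (- r)) ^ card (\<Gamma>m i j) = 1" if "r \<in> \<Gamma>m i j" for r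
    using rot_subgroup_power[OF H that] by (simp_all add: power_int_minus power_inverse)
  have i: "inj_on (\<lambda>r. \<xi> powi r * c) (\<Gamma>m i j)" "inj_on (\<lambda>r. \<xi> powi (- r) * c) (\<Gamma>m i j)" "inj_on (\<lambda>r. \<xi> powi r) (\<Gamma>m i j)"
    using assms by (auto intro!: inj_\<xi>_scaled inj_\<xi> simp: \<Gamma>m_def)
  note c = rot_subgroup_card_pos[OF H]
  show "(\<Prod>r\<in>\<Gamma>m i j. one_minus (\<xi> powi r * c)) = 1 - fps_const (c ^ dd i j) * fps_X ^ dd i j"
    unfolding dd_def by (rule prod_fps_linear_factors[OF finite_\<Gamma>(2) i(1) c]) (simp add: p power_mult_distrib)
  show "(\<Prod>r\<in>\<Gamma>m i j. one_minus (\<xi> powi (- r) * c)) = 1 - fps_const (c ^ dd i j) * fps_X ^ dd i j"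
    unfolding dd_def by (rule prod_fps_linear_factors[OF finite_\<Gamma>(2) i(2) c]) (simp add: p power_mult_distrib)
  show "(\<Prod>r\<in>\<Gamma>m i j. - (\<xi> powi r)) = - 1"
    by (rule prod_linear_factors_0[OF finite_\<Gamma>(2) i(3) c]) (rule p)
qed

lemma prod_inverse_fps: "(\<Prod>r\<in>S. inverse (h r)) = inverse (\<Prod>r\<in>S. h r)" for h :: "int \<Rightarrow> complex fps"
  by (induction S rule: infinite_finite_induct) (auto simp: fps_inverse_mult)

lemma kap_self: "kap (s, i) (s, i) = (1 - fps_X ^ d i) * (1 - fps_const (q powi (- 2 * sg s * int (d i))) * fps_X ^ d i) *
   (if dd i i > 0 then inverse (1 - fps_const (- (q powi (- sg s * int (dd i i)))) * fps_X ^ dd i i) else 1)"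
proof -
  have q0: "q powi n \<noteq> 0" for n using q_nonzero by simp
  have m: "(\<Prod>r\<in>\<Gamma>m i i. one_minus (\<xi> powi r * q powi (- sg s))) = (if dd i i > 0 then 1 - fps_const (- (q powi (- sg s * int (dd i i)))) * fps_X ^ dd i i else 1)"
  proof (cases "dd i i > 0")
    case True then show ?thesis using \<Gamma>m_products_self[OF q0 True] by (simp only: if_True powi_power fps_const_neg[symmetric] mult_minus_left diff_minus_eq_add)
  next
    case False
    then have "\<Gamma>m i i = {}" using finite_\<Gamma>(2) by (simp add: dd_def)
    then show ?thesis using False by simp
  qed
  have 1: "(\<Prod>r\<in>\<Gamma>p i i. one_minus (\<xi> powi r)) = 1 - fps_X ^ d i" using \<Gamma>p_products[of 1 i] by simp
  show ?thesis unfolding kap_same prod.distrib prod_inverse_fps m 1 \<Gamma>p_products[OF q0] powi_power by auto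
qed

lemma \<Gamma>p_empty: assumes "i \<notin> orbit j" shows "\<Gamma>p i j = {}"
  using assms by (auto simp: \<Gamma>p_iff rot_entry_2 rot_ZN orbit_def)

lemma kap_distinct: assumes "i \<notin> orbit j" "A i j < 0"
  shows "kap (s, i) (s, j) = inverse (1 - fps_const (q powi (- sg s * int (dd i j))) * fps_X ^ dd i j)"
    "kap (s, j) (s, i) = inverse (1 - fps_const (q powi (- sg s * int (dd i j))) * fps_X ^ dd i j)"
proof -
  have q0: "q powi n \<noteq> 0" for n using q_nonzero by simp
  show "kap (s, i) (s, j) = inverse (1 - fps_const (q powi (- sg s * int (dd i j))) * fps_X ^ dd i j)"
    unfolding kap_same \<Gamma>p_empty[OF assms(1)] prod_inverse_fps \<Gamma>m_products[OF q0 assms(2)] powi_power by simp_all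
  show "kap (s, j) (s, i) = inverse (1 - fps_const (q powi (- sg s * int (dd i j))) * fps_X ^ dd i j)"
    unfolding kap_same'[of s j i] \<Gamma>p_empty[OF assms(1)] prod_inverse_fps \<Gamma>m_products[OF q0 assms(2)] powi_power by simp_all
qed

lemma orbit_form_self: "orbit_form i i = 2 * int (d i) - int (dd i i)" by (simp add: orbit_form_card d_def)
lemma orbit_form_distinct: "i \<notin> orbit j \<Longrightarrow> orbit_form i j = - int (dd i j)" by (simp add: orbit_form_card \<Gamma>p_empty)

text \<open>The binomials in \<open>z\<^sup>d\<close> that cancel against the denominators in \<open>p2\<close> and \<open>p3\<close>.\<close>

definition serre_denominator :: "'i \<Rightarrow> pm \<Rightarrow> nat \<Rightarrow> nat \<Rightarrow> poly3" where
  "serre_denominator i s a b = (zv a ^ d i - zv b ^ d i) * (zv a ^ d i - cst (q powi (- 2 * sg s * int (d i))) * zv b ^ d i)"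

lemma K_self:
  assumes "a \<le> 2" "b \<le> 2" "ratio_finite a b (D :: idx \<Rightarrow> ('i, 't) poly_tensor)"
  shows "P.ratio_mult a b (orbit_form i i) (kap (s, i) (s, i)) D =
    P.pact (serre_denominator i s a b) (if dd i i > 0 then P.inv_binomial a b (dd i i) (- (q powi (- sg s * int (dd i i)))) D else D)"
proof -
  let ?g = "if dd i i > 0 then inverse (1 - fps_const (- (q powi (- sg s * int (dd i i)))) * fps_X ^ dd i i) else 1"
  have g: "(if dd i i > 0 then P.inv_binomial a b (dd i i) (- (q powi (- sg s * int (dd i i)))) D else D) =
    P.ratio_mult a b (- int (dd i i)) ?g D"
    by (auto simp: P.inv_binomial_def P.ratio_mult_id)
  have v: "serre_denominator i s a b = (cst 1 * zv a ^ d i - cst 1 * zv b ^ d i) * (cst 1 * zv a ^ d i - cst (q powi (- 2 * sg s * int (d i))) * zv b ^ d i)"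
    by (simp add: serre_denominator_def cst_1)
  show ?thesis
    unfolding g v P.pact_mult P.ratio_mult_linear_form[OF assms] kap_self
    by (simp add: orbit_form_self mult.assoc algebra_simps)
qed

end

section \<open>The Serre relations\<close>

lemma geometric_dvd:
  fixes x y :: "'a::comm_ring_1"
  assumes "n dvd m"
  shows "(x ^ n - y ^ n) dvd (x ^ m - y ^ m)"
proof -
  obtain k where "m = n * k" using assms by blast
  moreover have "x ^ n - y ^ n dvd (x ^ n) ^ k - (y ^ n) ^ k"
    by (cases k) (auto simp: power_diff_sumr2 simp del: power_Suc)
  ultimately show ?thesis by (simp add: power_mult)
qed

lemma permutes_01: "{\<sigma>. \<sigma> permutes {0, 1 :: nat}} = {id, Transposition.transpose 0 1}"
proof
  show "{\<sigma>. \<sigma> permutes {0, 1 :: nat}} \<subseteq> {id, Transposition.transpose 0 1}"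
  proof
    fix \<sigma> assume "\<sigma> \<in> {\<sigma>. \<sigma> permutes {0, 1 :: nat}}"
    then have p: "\<sigma> permutes {0, 1}" by simp
    then have v: "\<sigma> 0 \<in> {0, 1}" "\<sigma> 1 \<in> {0, 1}" "\<sigma> 0 \<noteq> \<sigma> 1"
      using permutes_in_image[OF p] permutes_inj[OF p] by (auto simp: inj_eq)
    have o: "\<sigma> t = t" if "t \<noteq> 0" "t \<noteq> 1" for t using permutes_not_in[OF p] that by auto
    show "\<sigma> \<in> {id, Transposition.transpose 0 1}"
    proof (cases "\<sigma> 0 = 0")
      case True
      then have "\<sigma> t = id t" for t using v o[of t] by (cases "t = 0"; cases "t = 1") auto
      then show ?thesis by auto
    next
      case False
      then have "\<sigma> t = Transposition.transpose 0 1 t" for t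
        using v o[of t] by (cases "t = 0"; cases "t = 1") (auto simp: Transposition.transpose_def)
      then show ?thesis by auto
    qed
  qed
qed (auto simp: permutes_id permutes_swap_id)

lemma sum_permutes_01:
  "(\<Sum>\<sigma>\<in>{\<sigma>. \<sigma> permutes {0, 1 :: nat}}. h \<sigma>) = h id + h (Transposition.transpose 0 1)"
proof -
  have "id \<noteq> Transposition.transpose 0 (1 :: nat)" by (metis id_apply transpose_apply_first zero_neq_one)
  then show ?thesis unfolding permutes_01 by simp
qed

lemma sum_permutes_012:
  fixes h :: "(nat \<Rightarrow> nat) \<Rightarrow> 'v::ab_group_add"
  assumes "\<And>\<sigma>. h \<sigma> = k (\<sigma> 0) (\<sigma> 1) (\<sigma> 2)"
  shows "(\<Sum>\<sigma>\<in>{\<sigma>. \<sigma> permutes {0, 1, 2 :: nat}}. h \<sigma>) =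
    k 0 1 2 + k 1 0 2 + k 0 2 1 + k 2 1 0 + k 1 2 0 + k 2 0 1"
proof -
  have e: "{0, 1, 2 :: nat} = insert 0 (insert 1 (insert 2 {}))" by simp
  have "(\<Sum>\<sigma>\<in>{\<sigma>. \<sigma> permutes {0, 1, 2 :: nat}}. h \<sigma>) =
    (\<Sum>b\<in>{0,1,2}. \<Sum>b'\<in>{1,2}. \<Sum>b''\<in>{2}. h (Transposition.transpose 0 b \<circ> (Transposition.transpose 1 b' \<circ> (Transposition.transpose 2 b'' \<circ> id))))"
    by (subst e, subst sum_over_permutations_insert, simp, simp, subst sum_over_permutations_insert, simp, simp,
        subst sum_over_permutations_insert, simp, simp) (simp add: o_def id_def)
  also have "\<dots> = k 0 1 2 + k 1 0 2 + k 0 2 1 + k 2 1 0 + k 1 2 0 + k 2 0 1"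
    by (simp add: assms Transposition.transpose_def add_ac)
  finally show ?thesis .
qed

context graded_module
begin

text \<open>The quotients in \<open>p3\<close> are exact and, multiplied by the numerators of the contraction, become binomials in
  \<open>z\<^sup>D\<close>; so only the variables \<open>z\<^sup>D\<close> remain in the relation.\<close>

lemma cubic_factor:
  assumes D: "dd i i > 0" and ab: "a \<le> 2" "b \<le> 2" "a \<noteq> b"
    and r_def: "r = ((zv a ^ dd i i - zv b ^ dd i i) * (zv a ^ dd i i - cst (q powi (- sg s * 2 * int (dd i i))) * zv b ^ dd i i)) div
            ((zv a ^ d i - zv b ^ d i) * (zv a ^ d i - cst (q powi (- sg s * 2 * int (d i))) * zv b ^ d i))"
  shows "r * serre_denominator i s a b = (zv a ^ dd i i - zv b ^ dd i i) * (zv a ^ dd i i - cst (q powi (- 2 * sg s * int (dd i i))) * zv b ^ dd i i)"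
proof -
  have dv: "d i dvd dd i i" by (rule \<Gamma>m_self(1)[OF D])
  have c: "cst (q powi (- 2 * sg s * int n)) = cst (q powi (- 2 * sg s)) ^ n" for n
    by (simp add: cst_power[symmetric] powi_power)
  have "serre_denominator i s a b dvd (zv a ^ dd i i - zv b ^ dd i i) * (zv a ^ dd i i - cst (q powi (- 2 * sg s * int (dd i i))) * zv b ^ dd i i)"
    unfolding serre_denominator_def c power_mult_distrib[symmetric] by (intro mult_dvd_mono geometric_dvd dv)
  moreover have "r = ((zv a ^ dd i i - zv b ^ dd i i) * (zv a ^ dd i i - cst (q powi (- 2 * sg s * int (dd i i))) * zv b ^ dd i i)) div serre_denominator i s a b"
    unfolding r_def serre_denominator_def by (simp add: mult.commute[of "sg s" 2])
  ultimately show ?thesis by simp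
qed

text \<open>After multiplication by a nonzero constant, the discriminant of \<open>z\<^sub>0\<^sup>D\<close>, \<open>z\<^sub>1\<^sup>D\<close>, \<open>z\<^sub>2\<^sup>D\<close> can be taken out of all six
  terms and turns the sum over permutations into the alternating sum of \<open>cubic_serre\<close>.\<close>

lemma cubic_serre_relation:
  assumes f: "homog \<gamma> f" and e: "\<And>i. even (orbit_form i i)" and D: "dd i i > 0"
  shows "(\<Sum>\<sigma>\<in>{\<sigma>. \<sigma> permutes {0, 1, 2}}.
     P.pact (p3 s i (zv (\<sigma> 0)) (zv (\<sigma> 1)) (zv (\<sigma> 2)))
       (\<lambda>m. X s i (m (\<sigma> 0)) (X s i (m (\<sigma> 1)) (X s i (m (\<sigma> 2)) f)))) = 0"
proof -
  let ?D = "dd i i"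
  define Q where "Q = q powi (sg s * int ?D)"
  define R where "R = rt q powi (sg s * int ?D)"
  have r0: "rt q \<noteq> 0" using rt_square[of q] q_nonzero by auto
  have R0: "R \<noteq> 0" and Q0: "Q \<noteq> 0" using r0 q_nonzero by (simp_all add: R_def Q_def)
  have RQ: "R * R = Q"
  proof -
    have "R * R = (rt q * rt q) powi (sg s * int ?D)" unfolding R_def by (rule power_int_mult_distrib[symmetric])
    then show ?thesis using rt_square[of q] by (simp add: Q_def power2_eq_square)
  qed
  let ?a = "sg s * weight (simple i) \<gamma> + half_norm i"
  let ?u = "e_op s i (e_op s i (e_op s i f))"
  define N0 where "N0 = (\<lambda>m :: idx. P.N3 (s, i) (s, i) (s, i) (m 0 + ?a) (m 1 + ?a) (m 2 + ?a) ?u)"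
  have bN: "bounded_idx N0" unfolding N0_def by (rule P.bounded_idx_N3) (simp add: arrangement_def)
  have Nsym: "(\<lambda>m :: idx. P.N3 (s, i) (s, i) (s, i) (m a + ?a) (m b + ?a) (m c + ?a) ?u) = N0" if "arrangement a b c" for a b c
    using that unfolding N0_def
    by (elim arrangement_cases; simp) (metis P.N3_sym12 P.N3_sym23)+
  define U where "U = (\<lambda>a b. P.inv_binomial a b ?D (- inverse Q))"
  have Qi: "- (q powi (- sg s * int ?D)) = - inverse Q" by (simp add: Q_def power_int_minus)
  define z where "z = (\<lambda>t. zv t ^ ?D :: poly3)"
  let ?L = "\<lambda>a b c. cst (rt q powi (- sg s * 3 * int ?D)) * z a - cst (rt q powi int ?D + rt q powi (- int ?D)) * z b
        + cst (rt q powi (sg s * 3 * int ?D)) * z c"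
  let ?n = "\<lambda>a b. (z a - z b) * (z a - cst (q powi (- 2 * sg s * int ?D)) * z b)"
  have W: "P.pact (p3 s i (zv a) (zv b) (zv c)) (\<lambda>m. X s i (m a) (X s i (m b) (X s i (m c) f))) =
    P.pact (?L a b c * (?n a b * ?n a c * ?n b c)) (U a b (U a c (U b c N0)))" if o: "arrangement a b c" for a b c
  proof -
    have le: "a \<le> 2" "b \<le> 2" "c \<le> 2" "a \<noteq> b" "a \<noteq> c" "b \<noteq> c" using o by (auto simp: arrangement_def)
    have p: "in_order a b c a b" "in_order a b c a c" "in_order a b c b c" by (auto simp: in_order_def)
    note cl = bounded_idx_cone[OF bN o]
    have cU: "cone_supported a b c (U x' y' M)" if "cone_supported a b c M" "in_order a b c x' y'" for x' y' M
      using that o unfolding U_def by (intro P.cone_inv_binomial)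
    have l: "ratio_finite x' y' M" if "cone_supported a b c M" "in_order a b c x' y'" for x' y' and M :: "idx \<Rightarrow> ('i, 't) poly_tensor" by (rule cone_ratio_finite[OF that(1) o that(2)])
    have pU: "U x' y' (P.pact R' M) = P.pact R' (U x' y' M)" if "cone_supported a b c M" "in_order a b c x' y'" for x' y' R' M
      unfolding U_def by (rule P.inv_binomial_pact'[OF l[OF that]])
    have K: "P.ratio_mult x' y' (orbit_form i i) (kap (s, i) (s, i)) M = P.pact (serre_denominator i s x' y') (U x' y' M)"
      if "cone_supported a b c M" "in_order a b c x' y'" for x' y' M
    proof -
      have "x' \<le> 2" "y' \<le> 2" using that(2) le by (auto simp: in_order_def)
      from K_self[OF this l[OF that], of i s] show ?thesis using D by (simp only: if_True U_def Qi)
    qed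
    have "(\<lambda>m. X s i (m a) (X s i (m b) (X s i (m c) f))) =
       P.ratio_mult a b (orbit_form i i) (kap (s, i) (s, i)) (P.ratio_mult a c (orbit_form i i) (kap (s, i) (s, i)) (P.ratio_mult b c (orbit_form i i) (kap (s, i) (s, i)) N0))"
      by (rule ext, subst X_X_X[OF f e o]) (simp only: Nsym[OF o])
    also have "\<dots> = P.pact (serre_denominator i s a b * serre_denominator i s a c * serre_denominator i s b c) (U a b (U a c (U b c N0)))"
      by (simp add: K cl cU p P.cone_pact pU P.pact_mult)
    finally have W: "(\<lambda>m. X s i (m a) (X s i (m b) (X s i (m c) f))) = P.pact (serre_denominator i s a b * serre_denominator i s a c * serre_denominator i s b c) (U a b (U a c (U b c N0)))" .
    let ?r = "\<lambda>za zb. ((za ^ ?D - zb ^ ?D) * (za ^ ?D - cst (q powi (- sg s * 2 * int ?D)) * zb ^ ?D)) div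
            ((za ^ d i - zb ^ d i) * (za ^ d i - cst (q powi (- sg s * 2 * int (d i))) * zb ^ d i))"
    have "p3 s i (zv a) (zv b) (zv c) * (serre_denominator i s a b * serre_denominator i s a c * serre_denominator i s b c) =
      ?L a b c * ((?r (zv a) (zv b) * serre_denominator i s a b) * (?r (zv a) (zv c) * serre_denominator i s a c) * (?r (zv b) (zv c) * serre_denominator i s b c))"
      unfolding p3_def Let_def z_def by (simp only: mult_ac)
    also have "\<dots> = ?L a b c * (?n a b * ?n a c * ?n b c)"
      unfolding cubic_factor[OF D le(1,2,4) refl] cubic_factor[OF D le(1,3,5) refl] cubic_factor[OF D le(2,3,6) refl] z_def ..
    finally show ?thesis unfolding W P.pact_mult_right by (simp only:)
  qed
  let ?P = "\<lambda>a b c. cubP (cst Q) (z a) (z b) (z c) * (cst Q ^ 2 * z a - z c)"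
  \<comment> \<open>As \<open>R\<^sup>2 = Q\<close>, multiplication by \<open>R\<^sup>3\<close> turns the half-integral powers into powers of \<open>Q\<close>.\<close>
  have L: "cst (R ^ 3) * ?L a b c = z a - (cst Q ^ 2 + cst Q) * z b + cst Q ^ 3 * z c" for a b c
  proof -
    have s: "rt q powi int ?D + rt q powi (- int ?D) = R + inverse R"
      by (cases s) (simp_all add: R_def power_int_minus)
    have p: "rt q powi (- sg s * 3 * int ?D) = inverse R ^ 3" "rt q powi (sg s * 3 * int ?D) = R ^ 3"
    proof -
      show "rt q powi (sg s * 3 * int ?D) = R ^ 3"
        unfolding R_def power_int_of_nat[symmetric] power_int_mult[symmetric] by (simp add: mult_ac)
      then show "rt q powi (- sg s * 3 * int ?D) = inverse R ^ 3"
        by (simp add: power_int_minus power_inverse)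
    qed
    have c1: "cst (R ^ 3) * cst (inverse R ^ 3) = 1" using R0 by (simp add: cst_mult[symmetric] cst_1 power_mult_distrib[symmetric])
    have "R ^ 3 * (R + inverse R) = Q ^ 2 + Q" using R0 RQ[symmetric] by (simp add: power2_eq_square power3_eq_cube algebra_simps)
    then have c2: "cst (R ^ 3) * cst (R + inverse R) = cst Q ^ 2 + cst Q" by (simp add: cst_mult[symmetric] cst_add[symmetric] cst_power[symmetric])
    have "R ^ 3 * R ^ 3 = Q ^ 3" using RQ[symmetric] by (simp add: power3_eq_cube algebra_simps)
    then have c3: "cst (R ^ 3) * cst (R ^ 3) = cst Q ^ 3" by (simp add: cst_mult[symmetric] cst_power[symmetric])
    show ?thesis unfolding s p by (simp add: distrib_left right_diff_distrib mult.assoc[symmetric] c1 c2 c3)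
  qed
  have n: "cst (Q ^ 2) * ?n a b = (z a - z b) * (cst Q ^ 2 * z a - z b)" for a b
  proof -
    have "q powi (- 2 * sg s * int ?D) = inverse Q ^ 2"
      unfolding Q_def power_int_minus[symmetric] powi_power by (simp add: mult_ac)
    then have "cst (Q ^ 2) * cst (q powi (- 2 * sg s * int ?D)) = 1"
      using Q0 by (simp add: cst_mult[symmetric] cst_1 power_mult_distrib[symmetric])
    then show ?thesis by (simp add: cst_power right_diff_distrib left_diff_distrib mult_ac flip: mult.assoc)
  qed
  let ?c = "cst (R ^ 3) * (cst (Q ^ 2) * cst (Q ^ 2) * cst (Q ^ 2))"
  let ?v = "(z 0 - z 1) * (z 0 - z 2) * (z 1 - z 2)"
  have full: "?c * (?L a b c * (?n a b * ?n a c * ?n b c)) = ((z a - z b) * (z a - z c) * (z b - z c)) * ?P a b c" for a b c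
  proof -
    have "?c * (?L a b c * (?n a b * ?n a c * ?n b c)) = (cst (R ^ 3) * ?L a b c) * ((cst (Q ^ 2) * ?n a b) * (cst (Q ^ 2) * ?n a c) * (cst (Q ^ 2) * ?n b c))"
      by (simp only: mult_ac)
    then show ?thesis unfolding L n cubP_def by (simp only: mult_ac)
  qed
  let ?t = "\<lambda>a b c. U a b (U a c (U b c N0))"
  let ?S = "\<lambda>a b c. P.pact (p3 s i (zv a) (zv b) (zv c)) (\<lambda>m. X s i (m a) (X s i (m b) (X s i (m c) f)))"
  have o: "arrangement 0 1 2" "arrangement 1 0 2" "arrangement 0 2 1" "arrangement 2 1 0" "arrangement 1 2 0" "arrangement 2 0 1" by (auto simp: arrangement_def)
  have cS: "P.pact ?c (?S a b c) = P.pact ((z a - z b) * (z a - z c) * (z b - z c)) (P.pact (?P a b c) (?t a b c))" if "arrangement a b c" for a b c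
    unfolding W[OF that] P.pact_mult_right full ..
  have sg: "(z 1 - z 0) * (z 1 - z 2) * (z 0 - z 2) = - ?v" "(z 0 - z 2) * (z 0 - z 1) * (z 2 - z 1) = - ?v"
    "(z 2 - z 1) * (z 2 - z 0) * (z 1 - z 0) = - ?v" "(z 1 - z 2) * (z 1 - z 0) * (z 2 - z 0) = ?v" "(z 2 - z 0) * (z 2 - z 1) * (z 0 - z 1) = ?v"
    by (simp_all add: algebra_simps)
  have "P.pact ?c (?S 0 1 2 + ?S 1 0 2 + ?S 0 2 1 + ?S 2 1 0 + ?S 1 2 0 + ?S 2 0 1) =
    P.pact ?v (P.pact (?P 0 1 2) (?t 0 1 2) - P.pact (?P 1 0 2) (?t 1 0 2) - P.pact (?P 0 2 1) (?t 0 2 1)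
    - P.pact (?P 2 1 0) (?t 2 1 0) + P.pact (?P 1 2 0) (?t 1 2 0) + P.pact (?P 2 0 1) (?t 2 0 1))"
    unfolding P.pact_add_right cS[OF o(1)] cS[OF o(2)] cS[OF o(3)] cS[OF o(4)] cS[OF o(5)] cS[OF o(6)] sg P.pact_diff_right P.pact_minus
    by (simp only: diff_conv_add_uminus)
  also have "\<dots> = P.pact ?v 0"
    using P.cubic_serre[OF bN D Q0] unfolding U_def z_def by (simp only:)
  also have "\<dots> = P.pact ?c 0" by (simp only: P.pact_0_right)
  finally have "?S 0 1 2 + ?S 1 0 2 + ?S 0 2 1 + ?S 2 1 0 + ?S 1 2 0 + ?S 2 0 1 = 0"
    unfolding cst_mult[symmetric] by (rule P.pact_cst_cancel[rotated]) (use R0 Q0 in simp)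
  then show ?thesis by (rule trans[OF sum_permutes_012[where k = ?S, OF refl]])
qed

lemma quadratic_factor:
  assumes "A i j < 0" and ab: "a \<le> 2" "b \<le> 2" "a \<noteq> b"
  shows "((cst (q powi (sg s * 2 * int (dd i j))) * zv a ^ dd i j - zv b ^ dd i j) div
      (cst (q powi (sg s * 2 * int (d i))) * zv a ^ d i - zv b ^ d i)) * serre_denominator i s a b =
    cst (q powi (- 2 * sg s * int (d i))) * ((zv a ^ d i - zv b ^ d i) * (cst (q powi (sg s * 2 * int (dd i j))) * zv a ^ dd i j - zv b ^ dd i j))"
proof -
  let ?n = "cst (q powi (sg s * 2 * int (dd i j))) * zv a ^ dd i j - zv b ^ dd i j"
  let ?d = "cst (q powi (sg s * 2 * int (d i))) * zv a ^ d i - zv b ^ d i"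
  have c: "cst (q powi (sg s * 2 * int n)) = cst (q powi (sg s * 2)) ^ n" for n
    by (simp add: cst_power[symmetric] powi_power)
  have "?d dvd ?n"
    unfolding c by (simp only: power_mult_distrib[symmetric] geometric_dvd[OF d_dvd[OF assms(1)]])
  then have "?n div ?d * ?d = ?n" by simp
  moreover have "serre_denominator i s a b = cst (q powi (- 2 * sg s * int (d i))) * ((zv a ^ d i - zv b ^ d i) * ?d)"
  proof -
    have "cst (q powi (- 2 * sg s * int (d i))) * cst (q powi (sg s * 2 * int (d i))) = 1"
      using q_nonzero by (simp add: cst_mult[symmetric] cst_1 power_int_add[symmetric])
    then show ?thesis
      by (simp add: serre_denominator_def right_diff_distrib mult.left_commute[of "cst (q powi _)"] mult.assoc[symmetric])
         (simp add: algebra_simps)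
  qed
  ultimately show ?thesis by (simp only: mult_ac)
qed

text \<open>The exchange of \<open>e\<^sub>i\<close> and \<open>e\<^sub>j\<close> contributes the sign \<open>- 1\<close>, which turns the middle coefficient \<open>- [2]\<close> of the relation into
  the \<open>q\<^sup>2 + 1\<close> of \<open>quadratic_serre\<close>, up to the factor \<open>q\<close>.\<close>

lemma quadratic_serre_relation:
  assumes f: "homog \<gamma> f" and e: "\<And>i. even (orbit_form i i)" and neg: "A i j < 0" and orb: "i \<notin> orbit j"
  shows "(\<Sum>\<sigma>\<in>{\<sigma>. \<sigma> permutes {0, 1}}.
     P.pact (p2 s i j (zv (\<sigma> 0)) (zv (\<sigma> 1)))
       (\<lambda>m. X s i (m (\<sigma> 0)) (X s i (m (\<sigma> 1)) (X s j (m 2) f))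
          - scaleP (qint (q ^ dd i j) 2) (X s i (m (\<sigma> 0)) (X s j (m 2) (X s i (m (\<sigma> 1)) f)))
          + X s j (m 2) (X s i (m (\<sigma> 0)) (X s i (m (\<sigma> 1)) f)))) = 0"
proof -
  let ?W = "\<lambda>a b. (\<lambda>m. X s i (m a) (X s i (m b) (X s j (m 2) f))
          - scaleP (qint (q ^ dd i j) 2) (X s i (m a) (X s j (m 2) (X s i (m b) f)))
          + X s j (m 2) (X s i (m a) (X s i (m b) f)))"
  let ?S = "\<lambda>a b. P.pact (p2 s i j (zv a) (zv b)) (?W a b)"
  let ?M = "dd i j" and ?D = "dd i i"
  define Q where "Q = q powi (sg s * int ?M)"
  have Q0: "Q \<noteq> 0" using q_nonzero by (simp add: Q_def)
  have M: "?M > 0" using rot_subgroup_card_pos[OF rot_subgroup_\<Gamma>m[OF neg]] by (simp add: dd_def)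
  have Qi: "q powi (- sg s * int ?M) = inverse Q" by (simp add: Q_def power_int_minus)
  have q2: "qint (q ^ ?M) 2 = Q + inverse Q"
  proof -
    define b where "b = q ^ ?M"
    have b0: "b \<noteq> 0" using q_nonzero by (simp add: b_def)
    have "b - inverse b \<noteq> 0" using q_pow_ne[OF M] by (simp add: b_def power_inverse)
    moreover have "b powi 2 - b powi (- 2) = (b + inverse b) * (b - inverse b)"
      using b0 by (simp add: power_int_minus power2_eq_square algebra_simps)
    ultimately have "qint b 2 = b + inverse b" by (simp add: qint_def)
    then show ?thesis by (cases s) (simp_all add: b_def Q_def power_int_minus)
  qed
  let ?a = "sg s * weight (simple i) \<gamma> + half_norm i" and ?b = "sg s * weight (simple j) \<gamma> + half_norm j"
  let ?u = "e_op s i (e_op s i (e_op s j f))"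
  define N0 where "N0 = (\<lambda>m :: idx. P.N3 (s, i) (s, i) (s, j) (m 0 + ?a) (m 1 + ?a) (m 2 + ?b) ?u)"
  have bN: "bounded_idx N0" unfolding N0_def by (rule P.bounded_idx_N3) (simp add: arrangement_def)
  have C1: "C (simple i) (simple j) = - 1"
    unfolding C_prod \<Gamma>p_empty[OF orb] using \<Gamma>m_products(3)[OF _ neg, of 1] by simp
  have comm: "e_op s j (e_op s i g') = - e_op s i (e_op s j g')" for g'
    using e_op_e_op[of s i s j g'] by (simp add: cocycle_same C1)
  have u2: "e_op s i (e_op s j (e_op s i f)) = - ?u" by (simp only: comm P.lin_minus[OF lin_e_op])
  have u3: "e_op s j (e_op s i (e_op s i f)) = ?u" by (simp only: comm P.lin_minus[OF lin_e_op] minus_minus)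
  define U where "U = (\<lambda>a b. P.inv_binomial a b ?M (inverse Q))"
  have BBs: "orbit_form i j = - int ?M" "orbit_form j i = - int ?M" using orbit_form_distinct[OF orb] orbit_form_sym[of j i] by auto
  have KU: "P.ratio_mult a b (orbit_form i j) (kap (s, i) (s, j)) = U a b" "P.ratio_mult a b (orbit_form j i) (kap (s, j) (s, i)) = U a b" for a b
    unfolding U_def P.inv_binomial_def BBs kap_distinct[OF orb neg] Qi by (rule refl)+
  define \<rho> where "\<rho> = (\<lambda>a b. p2 s i j (zv a) (zv b) * (serre_denominator i s a b) )"
  \<comment> \<open>If \<open>dd i i = 0\<close>, the first factor of \<open>p2\<close> is \<open>1 + 1\<close> and cancels no denominator, whence the 2.\<close>
  define c0 where "c0 = cst ((if ?D > 0 then 1 else 2) * q powi (- 2 * sg s * int (d i)))"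
  define V where "V = (\<lambda>a b. P.pact (cst Q) (U a 2 (U b 2 N0)) + P.pact (cst Q ^ 2 + 1) (U a 2 (U 2 b N0))
     + P.pact (cst Q) (U 2 a (U 2 b N0)))"
  let ?z = "\<lambda>t. zv t ^ ?M :: poly3"
  have main: "P.pact (cst Q) (?S a b) =
      P.pact (c0 * (zv a ^ d i - zv b ^ d i)) (P.pact (cst Q ^ 2 * ?z a - ?z b) (V a b))"
    if ab: "(a, b) = (0, 1) \<or> (a, b) = (1, 0)" for a b
  proof -
    have le: "a \<le> 2" "b \<le> 2" "a \<noteq> b" using ab by auto
    have o: "arrangement a b 2" "arrangement a 2 b" "arrangement 2 a b" using ab by (auto simp: arrangement_def)
    have cN: "cone_supported a' b' c' N0" if "arrangement a' b' c'" for a' b' c' by (rule bounded_idx_cone[OF bN that])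
    have cU: "cone_supported a' b' c' (U x' y' L)" if "cone_supported a' b' c' L" "arrangement a' b' c'" "in_order a' b' c' x' y'" for a' b' c' x' y' L
      using that unfolding U_def by (rule P.cone_inv_binomial)
    let ?K = "P.ratio_mult a b (orbit_form i i) (kap (s, i) (s, i))"
    let ?p = "p2 s i j (zv a) (zv b)"
    let ?r = "c0 * ((zv a ^ d i - zv b ^ d i) * (cst Q ^ 2 * ?z a - ?z b))"
    have K: "P.pact ?p (?K L) = P.pact ?r L" if "ratio_finite a b L" for L
    proof -
      let ?R = "(cst (q powi (sg s * 2 * int ?M)) * zv a ^ ?M - zv b ^ ?M) div (cst (q powi (sg s * 2 * int (d i))) * zv a ^ d i - zv b ^ d i)"
      have p: "?p = ?R * (zv a ^ ?D + cst (q powi (- sg s * int ?D)) * zv b ^ ?D)" by (simp only: p2_def mult.commute)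
      have QQ: "cst (q powi (sg s * 2 * int ?M)) = cst Q ^ 2"
        unfolding cst_power[symmetric] Q_def powi_power by (simp add: mult_ac)
      have V: "P.pact (zv a ^ ?D + cst (q powi (- sg s * int ?D)) * zv b ^ ?D) (?K L) = P.pact (cst (if ?D > 0 then 1 else 2) * serre_denominator i s a b) L"
      proof (cases "?D > 0")
        case True
        have "P.pact (zv a ^ ?D - cst (- (q powi (- sg s * int ?D))) * zv b ^ ?D) (P.inv_binomial a b ?D (- (q powi (- sg s * int ?D))) L) = L"
          by (rule P.inv_binomial_inverse[OF le(1,2) that True])
        then show ?thesis
          unfolding K_self[OF le(1,2) that] using True
          by (simp add: cst_minus cst_1 P.pact_commute[of _ "serre_denominator i s a b"])
      next
        case False
        then show ?thesis unfolding K_self[OF le(1,2) that] by (simp add: P.pact_mult_right cst_1 cst_numeral)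
      qed
      have "P.pact ?p (?K L) = P.pact ?R (P.pact (zv a ^ ?D + cst (q powi (- sg s * int ?D)) * zv b ^ ?D) (?K L))"
        unfolding p by (rule P.pact_mult)
      also have "\<dots> = P.pact (cst (if ?D > 0 then 1 else 2) * (?R * serre_denominator i s a b)) L"
        unfolding V P.pact_mult_right by (simp only: mult.left_commute)
      also have "cst (if ?D > 0 then 1 else 2) * (?R * serre_denominator i s a b) = ?r"
      proof -
        have "cst (if ?D > 0 then 1 else 2) * (?R * serre_denominator i s a b) = cst (if ?D > 0 then 1 else 2) *
          (cst (q powi (- 2 * sg s * int (d i))) * ((zv a ^ d i - zv b ^ d i) * (cst (q powi (sg s * 2 * int ?M)) * ?z a - ?z b)))"
          by (rule arg_cong[OF quadratic_factor[OF neg le]])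
        then show ?thesis unfolding QQ c0_def cst_mult by (simp only: mult_ac)
      qed
      finally show ?thesis .
    qed
    have W1: "(\<lambda>m. X s i (m a) (X s i (m b) (X s j (m 2) f))) = ?K (U a 2 (U b 2 N0))"
      using ab unfolding N0_def
      by (intro ext, subst X_X_X[OF f e o(1)], unfold KU) (auto simp: P.N3_sym12[of _ _ "(s, j)"])
    have W2: "(\<lambda>m. X s i (m a) (X s j (m 2) (X s i (m b) f))) = U a 2 (?K (U 2 b (- N0)))"
    proof -
      have "(\<lambda>m. P.N3 (s, i) (s, j) (s, i) (m a + ?a) (m 2 + ?b) (m b + ?a) (e_op s i (e_op s j (e_op s i f)))) = - N0"
        using ab unfolding N0_def u2
        by (auto simp: fun_eq_iff P.lin_minus[OF P.lin_N3] P.N3_sym23[of _ "(s, j)"]) (metis P.N3_sym12)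
      then show ?thesis by (intro ext, subst X_X_X[OF f e o(2)], unfold KU) simp
    qed
    have W3: "(\<lambda>m. X s j (m 2) (X s i (m a) (X s i (m b) f))) = U 2 a (U 2 b (?K N0))"
    proof -
      have "(\<lambda>m. P.N3 (s, j) (s, i) (s, i) (m 2 + ?b) (m a + ?a) (m b + ?a) (e_op s j (e_op s i (e_op s i f)))) = N0"
        using ab unfolding N0_def u3 P.N3_sym12[of "(s, j)"] P.N3_sym23[of _ "(s, j)"]
        by (auto simp: fun_eq_iff) (metis P.N3_sym12)
      then show ?thesis by (intro ext, subst X_X_X[OF f e o(3)], unfold KU) simp
    qed
    have lfU: "ratio_finite x' y' L" if "cone_supported a' b' c' L" "arrangement a' b' c'" "in_order a' b' c' x' y'" for a' b' c' x' y' and L :: "idx \<Rightarrow> ('i, 't) poly_tensor"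
      by (rule cone_ratio_finite[OF that])
    have pU: "U x' y' (P.pact R' L) = P.pact R' (U x' y' L)" if "cone_supported a' b' c' L" "arrangement a' b' c'" "in_order a' b' c' x' y'" for a' b' c' x' y' R' L
      unfolding U_def by (rule P.inv_binomial_pact'[OF lfU[OF that]])
    have in_order: "in_order a 2 b a b" "in_order a 2 b a 2" "in_order a 2 b 2 b" "in_order 2 a b a b" "in_order 2 a b 2 a" "in_order 2 a b 2 b" "in_order a b 2 a b" "in_order a b 2 a 2" "in_order a b 2 b 2"
      by (auto simp: in_order_def)
    have cK: "cone_supported a' b' c' (?K L)" if "cone_supported a' b' c' L" "arrangement a' b' c'" "in_order a' b' c' a b" for a' b' c' L
      using that by (rule P.cone_ratio_mult)
    have m1: "- N0 = P.pact (cst (- 1)) N0" by (simp add: P.pact_cst P.scf_def fun_eq_iff)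
    have P1: "P.pact ?p (?K (U a 2 (U b 2 N0))) = P.pact ?r (U a 2 (U b 2 N0))"
      by (rule K, rule lfU[OF _ o(1) in_order(7)]) (intro cU cN o in_order)
    have P2: "P.pact ?p (U a 2 (?K (U 2 b (- N0)))) = - P.pact ?r (U a 2 (U 2 b N0))"
    proof -
      have c: "cone_supported a 2 b (- N0)" unfolding m1 by (intro P.cone_pact cN o)
      note c1 = cU[OF c o(2) in_order(3)] cU[OF cN[OF o(2)] o(2) in_order(3)]
      have "P.pact ?p (U a 2 (?K (U 2 b (- N0)))) = U a 2 (P.pact ?r (U 2 b (- N0)))"
        by (simp add: pU[OF cK[OF c1(1) o(2) in_order(1)] o(2) in_order(2), symmetric] K lfU[OF c1(1) o(2) in_order(1)])
      also have "\<dots> = P.pact (cst (- 1)) (P.pact ?r (U a 2 (U 2 b N0)))"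
        unfolding m1 by (simp add: pU[OF cN[OF o(2)] o(2) in_order(3)] pU[OF c1(2) o(2) in_order(2)] pU[OF P.cone_pact[OF c1(2)] o(2) in_order(2)])
          (rule P.pact_commute)
      also have "\<dots> = - P.pact ?r (U a 2 (U 2 b N0))" by (simp add: P.pact_cst P.scf_def fun_eq_iff)
      finally show ?thesis .
    qed
    have P3: "P.pact ?p (U 2 a (U 2 b (?K N0))) = P.pact ?r (U 2 a (U 2 b N0))"
    proof -
      note c = cN[OF o(3)]
      note c1 = cK[OF c o(3) in_order(4)]
      have "P.pact ?p (U 2 a (U 2 b (?K N0))) = U 2 a (U 2 b (P.pact ?p (?K N0)))"
        by (simp add: pU[OF c1 o(3) in_order(6)] pU[OF cU[OF c1 o(3) in_order(6)] o(3) in_order(5)])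
      also have "\<dots> = P.pact ?r (U 2 a (U 2 b N0))"
        unfolding K[OF lfU[OF c o(3) in_order(4)]] by (simp add: pU[OF c o(3) in_order(6)] pU[OF cU[OF c o(3) in_order(6)] o(3) in_order(5)])
      finally show ?thesis .
    qed
    have "?W a b =
      (\<lambda>m. X s i (m a) (X s i (m b) (X s j (m 2) f))) - P.pact (cst (Q + inverse Q)) (\<lambda>m. X s i (m a) (X s j (m 2) (X s i (m b) f)))
      + (\<lambda>m. X s j (m 2) (X s i (m a) (X s i (m b) f)))"
      by (simp add: fun_eq_iff P.pact_cst P.scf_def q2)
    moreover have "P.pact ?p (?K (U a 2 (U b 2 N0)) - P.pact (cst (Q + inverse Q)) (U a 2 (?K (U 2 b (- N0)))) + U 2 a (U 2 b (?K N0))) =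
      P.pact ?r (U a 2 (U b 2 N0)) + P.pact (cst (Q + inverse Q)) (P.pact ?r (U a 2 (U 2 b N0))) + P.pact ?r (U 2 a (U 2 b N0))"
      unfolding P.pact_add_right P.pact_diff_right P1 P3 P.pact_commute[of ?p "cst (Q + inverse Q)"] P2 P.pact_minus_right by simp
    moreover have "P.pact (cst Q) (P.pact ?r (U a 2 (U b 2 N0)) + P.pact (cst (Q + inverse Q)) (P.pact ?r (U a 2 (U 2 b N0))) + P.pact ?r (U 2 a (U 2 b N0))) = P.pact ?r (V a b)"
    proof -
      have "cst Q * cst (Q + inverse Q) = cst Q ^ 2 + 1"
        unfolding cst_mult[symmetric] cst_power[symmetric] cst_1[symmetric] cst_add[symmetric] using Q0 by (simp add: distrib_left power2_eq_square)
      then show ?thesis unfolding V_def P.pact_add_right P.pact_mult_right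
        by (simp only: mult.assoc[symmetric]) (simp only: mult_ac)
    qed
    ultimately show ?thesis unfolding W1 W2 W3 by (simp add: P.pact_mult_right mult.assoc)
  qed
  have "P.pact (cst Q) (?S 0 1 + ?S 1 0) = P.pact (c0 * (zv 0 ^ d i - zv 1 ^ d i)) (P.pact (cst Q ^ 2 * ?z 0 - ?z 1) (V 0 1) - P.pact (cst Q ^ 2 * ?z 1 - ?z 0) (V 1 0))"
  proof -
    have "c0 * (zv 1 ^ d i - zv 0 ^ d i) = - (c0 * (zv 0 ^ d i - zv 1 ^ d i))" by (simp add: algebra_simps)
    then have "P.pact (cst Q) (?S 1 0) = - P.pact (c0 * (zv 0 ^ d i - zv 1 ^ d i)) (P.pact (cst Q ^ 2 * ?z 1 - ?z 0) (V 1 0))"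
      using main[OF disjI2[OF refl]] by (simp only: P.pact_minus)
    then show ?thesis using main[OF disjI1[OF refl]] by (simp only: P.pact_add_right P.pact_diff_right diff_conv_add_uminus P.pact_minus_right)
  qed
  also have "\<dots> = P.pact (cst Q) 0"
    using P.quadratic_serre[OF bN M Q0] unfolding V_def U_def by (simp only: P.pact_0_right)
  finally have "?S 0 1 + ?S 1 0 = 0" by (rule P.pact_cst_cancel[OF Q0])
  then show ?thesis unfolding sum_permutes_01 by simp
qed

end

section \<open>The Cartan currents\<close>

lemma fps_prod_nth_zero: "fps_nth (prod h S) 0 = (\<Prod>r\<in>S. fps_nth (h r) 0)" for h :: "'a \<Rightarrow> complex fps"
  by (induction S rule: infinite_finite_induct) auto

lemma prod_power_int: "c \<noteq> 0 \<Longrightarrow> (\<Prod>r\<in>S. c powi h r) = c powi (\<Sum>r\<in>S. h r)" for c :: complex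
  by (induction S rule: infinite_finite_induct) (auto simp: power_int_add)

lemma field_cancel: "w \<noteq> 0 \<Longrightarrow> b \<noteq> 0 \<Longrightarrow> w * (a / b * r) * (b / (n * w) * l) = a * r * l / n" for w :: complex
  by (cases "n = 0") (simp_all add: field_simps)

context graded_module
begin

lemma q_diff_ne: "q - inverse q \<noteq> 0" using q_pow_ne[of 1] by simp

text \<open>The coefficients of the logarithmic derivative of \<open>g\<^sub>i\<^sub>j\<close>.\<close>

definition log_g :: "'i \<Rightarrow> 'i \<Rightarrow> nat \<Rightarrow> complex" where
  "log_g i j n = (\<Sum>r\<in>ZN. (\<xi> powi r) ^ n * ((q powi rot_entry i j r) ^ n - (q powi (- rot_entry i j r)) ^ n))"

lemma g_factor:
  "(fps_const (q powi a) - fps_const b * fps_X) / (1 - fps_const (b * q powi a) * fps_X) =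
   fps_const (q powi a) * (one_minus (b * q powi (- a)) * inverse (one_minus (b * q powi a)))"
proof -
  have q0: "q powi a \<noteq> 0" using q_nonzero by simp
  have "fps_const (q powi a) - fps_const b * fps_X = fps_const (q powi a) * one_minus (b * q powi (- a))"
    using q0 by (simp add: right_diff_distrib mult.assoc[symmetric] power_int_minus)
  then show ?thesis by (simp add: fps_divide_unit mult.assoc)
qed

lemma g_eq: "g i j = (\<Prod>r\<in>\<Gamma> i j. fps_const (q powi rot_entry i j r) * (one_minus (\<xi> powi r * q powi (- rot_entry i j r)) * inverse (one_minus (\<xi> powi r * q powi rot_entry i j r))))"
  unfolding g_def by (rule prod.cong[OF refl]) (simp add: g_factor rot_entry_def rot_ZN \<Gamma>_def)

lemma log_deriv_g: "log_deriv (g i j) (Abs_fps (log_g i j))"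
proof -
  have "log_deriv (g i j) (\<Sum>r\<in>\<Gamma> i j. - geo (\<xi> powi r * q powi (- rot_entry i j r)) + - (- geo (\<xi> powi r * q powi rot_entry i j r)))"
    unfolding g_eq
    by (intro log_deriv_prod log_deriv_const log_deriv_mult log_deriv_inverse log_deriv_linear) simp
  also have "(\<Sum>r\<in>\<Gamma> i j. - geo (\<xi> powi r * q powi (- rot_entry i j r)) + - (- geo (\<xi> powi r * q powi rot_entry i j r))) =
    Abs_fps (log_g i j)"
  proof (rule fps_ext)
    fix n
    have "(\<Sum>r\<in>\<Gamma> i j. (\<xi> powi r) ^ n * ((q powi rot_entry i j r) ^ n - (q powi (- rot_entry i j r)) ^ n)) = log_g i j n"
      unfolding log_g_def
      by (rule sum.mono_neutral_left) (auto simp: \<Gamma>_def rot_entry_def rot_ZN)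
    then show "fps_nth (\<Sum>r\<in>\<Gamma> i j. - geo (\<xi> powi r * q powi (- rot_entry i j r)) + - (- geo (\<xi> powi r * q powi rot_entry i j r))) n
      = fps_nth (Abs_fps (log_g i j)) n"
      by (cases "n = 0") (auto simp: fps_sum_nth geo_def log_g_def power_mult_distrib right_diff_distrib)
  qed
  finally show ?thesis .
qed

lemma g_0: "fps_nth (g i j) 0 = q powi orbit_form i j"
proof -
  have "fps_nth (g i j) 0 = (\<Prod>r\<in>\<Gamma> i j. q powi rot_entry i j r)"
    unfolding g_eq by (simp add: fps_prod_nth_zero)
  also have "\<dots> = (\<Prod>r\<in>ZN. q powi rot_entry i j r)"
    by (rule prod.mono_neutral_left) (auto simp: \<Gamma>_def rot_entry_def rot_ZN)
  also have "\<dots> = q powi (\<Sum>r\<in>ZN. rot_entry i j r)"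
    by (rule prod_power_int[OF q_nonzero])
  finally show ?thesis by (simp add: orbit_form_rot_entry)
qed

lemma fps_pm_g:
  "log_deriv (fps_pm t (g i j)) (Abs_fps (\<lambda>n. of_int (sg t) * log_g i j n))"
  "fps_nth (fps_pm t (g i j)) 0 = q powi (sg t * orbit_form i j)"
proof -
  have g0: "fps_nth (g i j) 0 \<noteq> 0" using q_nonzero by (simp add: g_0)
  have m: "- Abs_fps (log_g i j) = Abs_fps (\<lambda>n. - log_g i j n)" by (rule fps_ext) simp
  show "log_deriv (fps_pm t (g i j)) (Abs_fps (\<lambda>n. of_int (sg t) * log_g i j n))"
    by (cases t) (use log_deriv_g[of i j] log_deriv_inverse[OF g0 log_deriv_g] in \<open>simp_all add: m\<close>)
  show "fps_nth (fps_pm t (g i j)) 0 = q powi (sg t * orbit_form i j)"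
    by (cases t) (simp_all add: g_0 power_int_minus)
qed

text \<open>The Heisenberg commutators are defined through the same sums over rotations as the structure series; this is the link between
  the two.\<close>

lemma H1_log_g: "n > 0 \<Longrightarrow> H1_scalar i j (int n) = qint q (int n) / (of_nat n * (q - inverse q)) * log_g i j n"
proof -
  assume n: "n > 0"
  have "(\<Sum>r\<in>ZN. \<xi> powi (int n * r) * qint q (int n * form (simple i) ((\<mu>Q ^^ nat r) (simple j)))) =
    (\<Sum>r\<in>ZN. (\<xi> powi r) ^ n * ((q powi rot_entry i j r) ^ n - (q powi (- rot_entry i j r)) ^ n) / (q - inverse q))"
  proof (rule sum.cong[OF refl])
    fix r assume "r \<in> ZN"
    then have "form (simple i) ((\<mu>Q ^^ nat r) (simple j)) = rot_entry i j r"
      by (simp add: \<mu>Q_pow_simple form_simple rot_entry_def rot_ZN)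
    moreover have "c powi (int n * a) = (c powi a) ^ n" for c :: complex and a
      by (metis mult.commute power_int_mult power_int_of_nat)
    ultimately show "\<xi> powi (int n * r) * qint q (int n * form (simple i) ((\<mu>Q ^^ nat r) (simple j))) =
      (\<xi> powi r) ^ n * ((q powi rot_entry i j r) ^ n - (q powi (- rot_entry i j r)) ^ n) / (q - inverse q)"
      by (simp add: qint_def flip: mult_minus_right)
  qed
  also have "\<dots> = log_g i j n / (q - inverse q)" by (simp add: log_g_def sum_divide_distrib)
  finally show ?thesis by (simp add: H1_scalar_def)
qed

lemmas lin_\<alpha>op_simps = P.lin_scale[OF lin_\<alpha>op] P.lin_minus[OF lin_\<alpha>op] P.lin_zero[OF lin_\<alpha>op]

lemma phi_exp_eq: "phi_exp s i n v = scaleP (of_int (sg s) * (q - inverse q)) (\<alpha>op i (sg s * int n) v)"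
  by (simp add: phi_exp_def \<alpha>op_zero)

lemma lin_phi_exp: "P.lin (phi_exp s i n)" unfolding phi_exp_eq[abs_def] by (intro P.lin_scale_fun lin_\<alpha>op)

lemma phi_exp_phi_exp: "phi_exp s i m (phi_exp s j n v) = phi_exp s j n (phi_exp s i m v)"
  using \<alpha>op_comm_pos[of i m j n v] \<alpha>op_comm_neg[of i m j n v]
  by (cases s) (simp_all add: phi_exp_eq lin_\<alpha>op_simps)

lemma exponentiable_phi_exp: "P.exponentiable (phi_exp s i)"
  using lin_phi_exp phi_exp_phi_exp by (auto simp: P.exponentiable_def fun_eq_iff phi_exp_def)

lemma hom_phi_exp: "homog \<gamma> v \<Longrightarrow> homog \<gamma> (phi_exp s i n v)"
  by (auto simp: phi_exp_def intro: hom_scaleP hom_\<alpha>op hom_0 hom_orb)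

lemma e_op_phi_exp: "e_op s i (phi_exp t j n v) = phi_exp t j n (e_op s i v)"
  by (simp add: phi_exp_eq P.lin_scale[OF lin_e_op] e_op_\<alpha>op)

lemma e_op_Ei_phi_exp: "e_op s i (P.Ei (phi_exp t j) n v) = P.Ei (phi_exp t j) n (e_op s i v)"
  by (rule P.Ei_commute) (auto intro: lin_e_op e_op_phi_exp)

lemma phi_exp_Flt: "u \<in> Flt K \<Longrightarrow> phi_exp Upper i n u \<in> Flt K" "u \<in> Flt K \<Longrightarrow> phi_exp Lower i n u \<in> Flt (K + int n)"
  using P.Flt_mono[OF \<alpha>op_pos_Flt[of u K i n], of K] \<alpha>op_neg_Flt[of u K i n]
  by (auto simp: phi_exp_def P.Flt_0 intro: P.Flt_scale)

lemma \<Phi>_zero: "sg s * m < 0 \<Longrightarrow> \<Phi> s i m f = 0" by (simp add: \<Phi>_def)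

lemma \<Phi>_Ei:
  assumes "homog \<gamma> f"
  shows "\<Phi> s i m f = scaleP (q powi (sg s * weight (simple i) \<gamma>)) (P.Ei (phi_exp s i) (sg s * m) f)"
  by (simp add: \<Phi>_hom[OF assms] P.Ei_def)

lemma hom_\<Phi>: assumes "homog \<gamma> f" shows "homog \<gamma> (\<Phi> s i m f)"
  using assms hom_orb[OF assms]
  by (auto simp: \<Phi>_Ei[OF assms] P.Ei_def intro!: hom_scaleP hom_0 hom_E hom_phi_exp)

lemma lin_Ei_phi_exp: "P.lin (P.Ei (phi_exp s i) r)" by (intro P.lin_Ei lin_phi_exp)

lemma \<Phi>_eq: "\<Phi> s i m f = onT (pow_orbit (q powi sg s) (simple i)) (P.Ei (phi_exp s i) (sg s * m) f)"
  by (auto simp: \<Phi>_def P.Ei_def phi_exp_def[abs_def] P.lin_zero[OF lin_onT[OF lin_pow_orbit]])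

lemma lin_\<Phi>: "P.lin (\<Phi> s i m)"
  unfolding \<Phi>_eq[abs_def] by (rule P.lin_comp[OF lin_onT[OF lin_pow_orbit] lin_Ei_phi_exp])

lemma \<Phi>_\<Phi>: assumes "homog \<gamma> f" shows "\<Phi> s i m (\<Phi> s j n f) = \<Phi> s j n (\<Phi> s i m f)"
proof -
  have "P.Ei (phi_exp s i) a (P.Ei (phi_exp s j) b f) = P.Ei (phi_exp s j) b (P.Ei (phi_exp s i) a f)" for a b
  proof -
    have "phi_exp s j k (P.Ei (phi_exp s i) a v) = P.Ei (phi_exp s i) a (phi_exp s j k v)" for k v
      by (rule P.Ei_commute[where h = "phi_exp s j k" and f = "phi_exp s i", OF lin_phi_exp]) (rule phi_exp_phi_exp)
    then show ?thesis
      by (intro P.Ei_commute[where h = "P.Ei (phi_exp s i) a" and f = "phi_exp s j", OF lin_Ei_phi_exp]) (rule sym)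
  qed
  then show ?thesis
    unfolding \<Phi>_Ei[OF hom_\<Phi>[OF assms]] unfolding \<Phi>_Ei[OF assms]
    by (simp add: P.lin_scale[OF lin_Ei_phi_exp] mult.commute)
qed

text \<open>The commutators contribute \<open>- (q\<^sup>n - q\<^sup>-\<^sup>n)\<close> times the logarithmic derivative of \<open>g\<^sub>i\<^sub>j\<close>, the difference of those of the two factors on
  the right, whose arguments are scaled by \<open>q\<^sup>\<plusminus>\<^sup>1\<close>.\<close>

lemma heisenberg_relation:
  assumes f: "homog \<gamma> f"
  shows "\<Phi> Upper i m (\<Phi> Lower j n f) =
    (\<Sum>l\<le>nat m. scaleP (\<Sum>r\<le>l. fps_nth (inverse (g i j)) r * fps_nth (g i j) (l - r) * q powi (int r - int (l - r)))
       (\<Phi> Lower j (n + int l) (\<Phi> Upper i (m - int l) f)))"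
proof (cases "m < 0")
  case True
  then show ?thesis by (simp add: \<Phi>_zero P.lin_zero[OF lin_\<Phi>])
next
  case False
  define C where "C = Abs_fps (\<lambda>n. q ^ n * fps_nth (inverse (g i j)) n) * Abs_fps (\<lambda>n. inverse q ^ n * fps_nth (g i j) n)"
  have g0: "fps_nth (g i j) 0 \<noteq> 0" using q_nonzero by (simp add: g_0)
  have C: "log_deriv C (Abs_fps (\<lambda>n. q ^ n * fps_nth (- Abs_fps (log_g i j)) n) + Abs_fps (\<lambda>n. inverse q ^ n * fps_nth (Abs_fps (log_g i j)) n))"
    unfolding C_def by (intro log_deriv_mult log_deriv_scaled log_deriv_inverse g0 log_deriv_g)
  have Ck: "fps_nth C l = (\<Sum>r\<le>l. fps_nth (inverse (g i j)) r * fps_nth (g i j) (l - r) * q powi (int r - int (l - r)))" for l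
    using q_nonzero unfolding C_def fps_mult_nth atMost_atLeast0
    by (intro sum.cong refl) (simp add: power_int_diff power_inverse divide_inverse mult_ac del: of_nat_diff)
  have C0: "fps_nth C 0 = 1" using g0 by (simp add: C_def)
  let ?\<kappa> = "\<lambda>n. - ((q - inverse q)\<^sup>2 * H1_scalar i j (int n))"
  have c: "phi_exp Upper i n (phi_exp Lower j m v) = phi_exp Lower j m (phi_exp Upper i n v) + (if m = n then scaleP (?\<kappa> n) v else 0)"
    if "n > 0" "m > 0" for n m v
    using that \<alpha>op_comm[OF that, of i j v]
    by (simp add: phi_exp_eq lin_\<alpha>op_simps P.scale_right_distrib P.scale_right_diff_distrib power2_eq_square minus_diff_eq[of q "inverse q", symmetric] mult_ac del: minus_diff_eq)
  have L: "fps_nth (Abs_fps (\<lambda>n. q ^ n * fps_nth (- Abs_fps (log_g i j)) n) + Abs_fps (\<lambda>n. inverse q ^ n * fps_nth (Abs_fps (log_g i j)) n)) n = of_nat n * ?\<kappa> n"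
    if "n > 0" for n
  proof -
    have "qint q (int n) * (q - inverse q) = q ^ n - inverse q ^ n"
      using q_diff_ne by (simp add: qint_def power_int_minus power_inverse)
    moreover have "of_nat n * ?\<kappa> n = - (qint q (int n) * (q - inverse q)) * log_g i j n"
      using that q_diff_ne by (simp add: H1_log_g power2_eq_square)
    ultimately have "of_nat n * ?\<kappa> n = - (q ^ n - inverse q ^ n) * log_g i j n" by simp
    then show ?thesis by (simp only: fps_add_nth fps_nth_Abs_fps fps_neg_nth) (simp add: algebra_simps)
  qed
  have main: "P.E (phi_exp Upper i) (nat m) (P.Ei (phi_exp Lower j) (- n) f) =
    (\<Sum>l\<le>nat m. scaleP (fps_nth C l) (P.Ei (phi_exp Lower j) (- n - int l) (P.E (phi_exp Upper i) (nat m - l) f)))"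
  proof -
    have "scaleP (fps_nth C 0) (P.E (phi_exp Upper i) (nat m) (P.Ei (phi_exp Lower j) (- n) f)) =
      (\<Sum>l\<le>nat m. scaleP (fps_nth C l) (P.Ei (phi_exp Lower j) (- n - int l) (P.E (phi_exp Upper i) (nat m - l) f)))"
      by (rule P.E_E_commutator[OF exponentiable_phi_exp exponentiable_phi_exp c C L]) (simp_all add: log_g_def)
    then show ?thesis by (simp add: C0)
  qed
  have Em: "P.Ei (phi_exp Upper i) m = P.E (phi_exp Upper i) (nat m)" using False by (simp add: P.Ei_def fun_eq_iff)
  have El: "P.Ei (phi_exp Upper i) (m - int l) v = P.E (phi_exp Upper i) (nat m - l) v" if "l \<le> nat m" for l v
  proof -
    have "nat (m - int l) = nat m - l" "\<not> m - int l < 0" using that False by auto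
    then show ?thesis by (simp add: P.Ei_def)
  qed
  show ?thesis
    unfolding \<Phi>_Ei[OF hom_\<Phi>[OF f]] unfolding \<Phi>_Ei[OF f]
    by (simp add: P.lin_scale[OF lin_Ei_phi_exp] P.lin_scale[OF P.lin_E[OF lin_phi_exp]] Em main P.scale_sum_right El Ck mult_ac)
qed

lemma phi_exp_Upper_am:
  assumes "n > 0" "m > 0"
  shows "phi_exp Upper i n (am (t, j) m v) = am (t, j) m (phi_exp Upper i n v) +
    (if m = n then scaleP (of_int (sg t) * (rt q powi (- sg t)) ^ n * log_g i j n / of_nat n) v else 0)"
proof -
  have q1: "qint q (int n) \<noteq> 0" using assms by (simp add: qint_nonzero)
  have "(q - inverse q) * (of_int (sg t) / qint q (int n) * (rt q powi (- sg t)) ^ n) * H1_scalar i j (int n) =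
    of_int (sg t) * (rt q powi (- sg t)) ^ n * log_g i j n / of_nat n"
    unfolding H1_log_g[OF assms(1)] by (rule field_cancel[OF q_diff_ne q1])
  then show ?thesis
    using assms \<alpha>op_comm[OF assms, of i j v]
    by (auto simp: phi_exp_eq am_def lin_\<alpha>op_simps P.scale_right_distrib mult_ac)
qed

lemma phi_exp_Lower_ap:
  assumes "n > 0" "m > 0"
  shows "phi_exp Lower i n (ap (t, j) m v) = ap (t, j) m (phi_exp Lower i n v) +
    (if m = n then scaleP (- of_int (sg t) * (rt q powi (- sg t)) ^ n * log_g j i n / of_nat n) v else 0)"
proof -
  have q1: "qint q (int n) \<noteq> 0" using assms by (simp add: qint_nonzero)
  have e: "(q - inverse q) * (of_int (sg t) / qint q (int n) * (rt q powi (- sg t)) ^ n) * H1_scalar j i (int n) =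
    of_int (sg t) * (rt q powi (- sg t)) ^ n * log_g j i n / of_nat n"
    unfolding H1_log_g[OF assms(1)] by (rule field_cancel[OF q_diff_ne q1])
  have *: "\<alpha>op i (- int n) (\<alpha>op j (int m) v) = \<alpha>op j (int m) (\<alpha>op i (- int n) v) - (if m = n then scaleP (H1_scalar j i (int n)) v else 0)"
    using \<alpha>op_comm[OF assms(2,1), of j i v] by auto
  define k where "k m = - of_int (sg t) / qint q (int m) * (rt q powi (- sg t)) ^ m" for m
  define p where "p = - (q - inverse q)"
  have c: "- of_int (sg t) * (rt q powi (- sg t)) ^ n * log_g j i n / of_nat n = - (p * k n * H1_scalar j i (int n))"
    by (simp only: mult_minus_left e[symmetric] minus_divide_left[symmetric] p_def k_def) (simp add: algebra_simps)
  have ap: "ap (t, j) m v = scaleP (k m) (\<alpha>op j (int m) v)" for m v by (simp add: ap_def k_def)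
  have phi_exp: "phi_exp Lower i n v = scaleP p (\<alpha>op i (- int n) v)" for v by (simp add: phi_exp_eq p_def)
  show ?thesis
    unfolding c using *
    by (auto simp: ap phi_exp lin_\<alpha>op_simps P.scale_right_diff_distrib mult_ac)
qed

lemma phi_exp_Upper_ap: "phi_exp Upper i m (ap p n v) = ap p n (phi_exp Upper i m v)"
  using \<alpha>op_comm_pos[of i m "snd p" n v] by (simp add: phi_exp_eq ap_def lin_\<alpha>op_simps mult_ac)

lemma phi_exp_Lower_am: "phi_exp Lower i m (am p n v) = am p n (phi_exp Lower i m v)"
  using \<alpha>op_comm_neg[of i m "snd p" n v] by (simp add: phi_exp_eq am_def lin_\<alpha>op_simps mult_ac)

text \<open>The constant term of \<open>g\<^sub>i\<^sub>j\<close> is what the zero mode of \<open>\<Phi>\<^sub>i\<close> picks up when the current shifts the degree, and the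
  argument \<open>q\<close> to the power \<open>\<mp>1/2\<close> comes from the shifted arguments in the current.\<close>

lemma \<Phi>_X:
  assumes f: "homog \<gamma> f" and e: "even (orbit_form j j)"
    and C0: "fps_nth h 0 = q powi (sg s * sg t * orbit_form i j)"
    and C: "\<And>l b u. scaleP (fps_nth h 0) (P.E (phi_exp s i) l (P.Y (t, j) b u)) =
      (\<Sum>k\<le>l. scaleP (fps_nth h k) (P.Y (t, j) (b + sg s * int k) (P.E (phi_exp s i) (l - k) u)))"
  shows "\<Phi> s i m (X t j n f) =
    (\<Sum>l\<le>nat (sg s * m). scaleP (fps_nth h l) (X t j (n + sg s * int l) (\<Phi> s i (m - sg s * int l) f)))"
proof (cases "sg s * m < 0")
  case True
  then show ?thesis by (simp add: \<Phi>_zero P.lin_zero[OF lin_X[OF e]])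
next
  case False
  define a where "a = sg t * weight (simple j) \<gamma> + half_norm j"
  define w where "w = sg s * weight (simple i) \<gamma>"
  let ?M = "nat (sg s * m)"
  have X: "X t j n' v = P.Y (t, j) (n' + a) (e_op t j v)" if "homog \<gamma> v" for n' v
    using X_hom[OF that e] by (simp add: a_def add.assoc)
  have X\<Phi>: "X t j n' (\<Phi> s i m' f) = scaleP (q powi w) (P.Y (t, j) (n' + a) (P.Ei (phi_exp s i) (sg s * m') (e_op t j f)))" for n' m'
    unfolding X[OF hom_\<Phi>[OF f]] unfolding \<Phi>_Ei[OF f]
    by (simp add: P.lin_scale[OF lin_e_op] P.lin_scale[OF P.lin_Y] e_op_Ei_phi_exp w_def)
  have w: "sg s * weight (simple i) (\<gamma> + orbit_sum (signed_root t j)) = w + sg s * sg t * orbit_form i j"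
    by (simp add: weight_signed_root[OF hom_orb[OF f]] w_def distrib_left)
  have El: "P.Ei (phi_exp s i) (sg s * (m - sg s * int l)) v = P.E (phi_exp s i) (?M - l) v" if "l \<le> ?M" for l v
  proof -
    have "sg s * (m - sg s * int l) = int (?M - l)" using that False by (cases s) auto
    then show ?thesis by (simp only: P.Ei_nat)
  qed
  have "\<Phi> s i m (X t j n f) = scaleP (q powi (w + sg s * sg t * orbit_form i j)) (P.E (phi_exp s i) ?M (P.Y (t, j) (n + a) (e_op t j f)))"
    using False unfolding \<Phi>_Ei[OF hom_X[OF f e]] w unfolding X[OF f] by (simp add: P.Ei_def)
  also have "\<dots> = scaleP (q powi w) (scaleP (fps_nth h 0) (P.E (phi_exp s i) ?M (P.Y (t, j) (n + a) (e_op t j f))))"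
    unfolding C0 using q_nonzero by (simp add: power_int_add)
  also have "\<dots> = (\<Sum>l\<le>?M. scaleP (fps_nth h l) (X t j (n + sg s * int l) (\<Phi> s i (m - sg s * int l) f)))"
    unfolding C P.scale_sum_right
    by (rule sum.cong[OF refl]) (simp only: atMost_iff X\<Phi> El P.scale_scale mult.commute, simp add: add_ac)
  finally show ?thesis .
qed

lemma \<Phi>_Upper_X:
  assumes f: "homog \<gamma> f" and e: "even (orbit_form j j)"
  shows "\<Phi> Upper i m (X t j n f) =
    (\<Sum>l\<le>nat m. scaleP (fps_nth (fps_pm t (g i j)) l * rt q powi (- sg t * int l))
       (X t j (n + int l) (\<Phi> Upper i (m - int l) f)))"
proof -
  define c where "c = rt q powi (- sg t)"
  define C where "C = Abs_fps (\<lambda>n. c ^ n * fps_nth (fps_pm t (g i j)) n)"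
  have C: "log_deriv C (Abs_fps (\<lambda>n. of_nat n * (of_int (sg t) * c ^ n * log_g i j n / of_nat n)))"
  proof -
    have "Abs_fps (\<lambda>n. c ^ n * fps_nth (Abs_fps (\<lambda>n. of_int (sg t) * log_g i j n)) n) = Abs_fps (\<lambda>n. of_nat n * (of_int (sg t) * c ^ n * log_g i j n / of_nat n))"
      by (rule fps_ext) (auto simp: log_g_def)
    then show ?thesis using log_deriv_scaled[OF fps_pm_g(1)[of t i j], of c] by (simp only: C_def)
  qed
  have "scaleP (fps_nth C 0) (P.E (phi_exp Upper i) l (P.Y (t, j) b u)) =
    (\<Sum>k\<le>l. scaleP (fps_nth C k) (P.Y (t, j) (b + sg Upper * int k) (P.E (phi_exp Upper i) (l - k) u)))" for l b u
    unfolding sg.simps mult_1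
    by (rule P.E_Y[OF exponentiable_phi_exp phi_exp_Flt(1) phi_exp_Upper_ap _ C]) (simp_all add: phi_exp_Upper_am c_def)
  from \<Phi>_X[OF f e _ this] show ?thesis
    by (simp add: C_def c_def powi_power fps_pm_g mult.commute)
qed

lemma \<Phi>_Lower_X:
  assumes f: "homog \<gamma> f" and e: "even (orbit_form j j)"
  shows "\<Phi> Lower i m (X t j n f) =
    (\<Sum>l\<le>nat (- m). scaleP (fps_nth (inverse (fps_pm t (g j i))) l * rt q powi (- sg t * int l))
       (X t j (n - int l) (\<Phi> Lower i (m + int l) f)))"
proof -
  define c where "c = rt q powi (- sg t)"
  define C where "C = Abs_fps (\<lambda>n. c ^ n * fps_nth (inverse (fps_pm t (g j i))) n)"
  have g0: "fps_nth (fps_pm t (g j i)) 0 \<noteq> 0" using q_nonzero by (simp add: fps_pm_g)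
  have C: "log_deriv C (Abs_fps (\<lambda>n. of_nat n * (- of_int (sg t) * c ^ n * log_g j i n / of_nat n)))"
  proof -
    have "Abs_fps (\<lambda>n. c ^ n * fps_nth (- Abs_fps (\<lambda>n. of_int (sg t) * log_g j i n)) n) = Abs_fps (\<lambda>n. of_nat n * (- of_int (sg t) * c ^ n * log_g j i n / of_nat n))"
      by (rule fps_ext) (auto simp: log_g_def)
    then show ?thesis using log_deriv_scaled[OF log_deriv_inverse[OF g0 fps_pm_g(1)], of c] by (simp only: C_def)
  qed
  have E: "scaleP (fps_nth C 0) (P.E (phi_exp Lower i) l (P.Y (t, j) b u)) =
    (\<Sum>k\<le>l. scaleP (fps_nth C k) (P.Y (t, j) (b + sg Lower * int k) (P.E (phi_exp Lower i) (l - k) u)))" for l b u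
    unfolding sg.simps mult_minus1 diff_conv_add_uminus[symmetric]
    by (rule P.E_Y_lower[OF exponentiable_phi_exp phi_exp_Flt(2) phi_exp_Lower_am _ C]) (simp_all add: phi_exp_Lower_ap c_def)
  have C0: "fps_nth C 0 = q powi (sg Lower * sg t * orbit_form i j)"
    by (simp add: C_def fps_pm_g power_int_minus orbit_form_sym[of j i])
  show ?thesis using \<Phi>_X[OF f e C0 E] by (simp add: C_def c_def powi_power mult.commute)
qed

end

lemma powi_nat_power: "0 \<le> r \<Longrightarrow> (c powi a) ^ nat r = c powi (a * r)" for c :: complex
  by (simp only: powi_power int_nat_eq if_True)

context graded_module
begin

section \<open>Rotation symmetry of the Fock space\<close>

lemma ZN_shift:
  assumes "\<And>r. h (r mod int N) = h r"
  shows "(\<Sum>r\<in>ZN. h (r + p)) = (\<Sum>r\<in>ZN. h r :: 'z::comm_monoid_add)"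
proof (rule sum.reindex_bij_witness[of _ "\<lambda>r. (r - p) mod int N" "\<lambda>r. (r + p) mod int N"])
  show "h ((r + p) mod int N) = h (r + p)" for r by (rule assms)
qed (use N_pos in \<open>auto simp: mod_diff_left_eq mod_add_left_eq\<close>)

lemma log_g_shift_right: "log_g i (rot p j) n = (\<xi> powi (- p)) ^ n * log_g i j n"
proof -
  let ?h = "\<lambda>r. (\<xi> powi r) ^ n * ((q powi rot_entry i j r) ^ n - (q powi (- rot_entry i j r)) ^ n)"
  have "log_g i (rot p j) n = (\<Sum>r\<in>ZN. (\<xi> powi (- p)) ^ n * ?h (r + p))"
    unfolding log_g_def using \<xi>_nonzero
    by (intro sum.cong refl) (simp add: rot_entry_shift[symmetric] power_int_add power_int_minus power_mult_distrib power_inverse)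
  also have "\<dots> = (\<xi> powi (- p)) ^ n * (\<Sum>r\<in>ZN. ?h r)"
    unfolding sum_distrib_left[symmetric] by (subst ZN_shift) (simp_all add: \<xi>_powi_mod rot_entry_mod)
  finally show ?thesis by (simp add: log_g_def)
qed

lemma rot_entry_shift_left: "rot_entry (rot p i) j r = rot_entry i j (r - p)"
  using A_rot[of p i "rot (r - p) j"] rot_add[of p "r - p" j] by (simp add: rot_entry_def)

lemma log_g_shift_left: "log_g (rot p i) j n = (\<xi> powi p) ^ n * log_g i j n"
proof -
  let ?h = "\<lambda>r. (\<xi> powi r) ^ n * ((q powi rot_entry i j r) ^ n - (q powi (- rot_entry i j r)) ^ n)"
  have "log_g (rot p i) j n = (\<Sum>r\<in>ZN. (\<xi> powi p) ^ n * ?h (r + (- p)))"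
    unfolding log_g_def using \<xi>_nonzero
    by (intro sum.cong refl) (simp add: rot_entry_shift_left power_int_diff power_mult_distrib power_divide)
  also have "\<dots> = (\<xi> powi p) ^ n * (\<Sum>r\<in>ZN. ?h r)"
    unfolding sum_distrib_left[symmetric] by (subst ZN_shift) (simp_all add: \<xi>_powi_mod rot_entry_mod)
  finally show ?thesis by (simp add: log_g_def)
qed

lemma H1_shift:
  assumes "n > 0"
  shows "H1_scalar i (rot p j) (int n) = (\<xi> powi (- p)) ^ n * H1_scalar i j (int n)"
    and "H1_scalar (rot p i) j (int n) = (\<xi> powi p) ^ n * H1_scalar i j (int n)"
  by (simp_all add: H1_log_g[OF assms] log_g_shift_left log_g_shift_right)

lemma \<alpha>op_pos_shift: "\<alpha>op (rot p i) (int n) f = scaleP ((\<xi> powi p) ^ n) (\<alpha>op i (int n) f)"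
  by (cases "n = 0") (simp_all add: \<alpha>op_zero \<alpha>op_pos H1_shift P.scale_sum_right)

lemma ap_shift: "ap (s, rot p i) n v = scaleP ((\<xi> powi p) ^ n) (ap (s, i) n v)"
  by (simp add: ap_def \<alpha>op_pos_shift mult.commute)

lemma Ep_shift: "P.E (ap (s, rot p i)) l v = scaleP ((\<xi> powi p) ^ l) (P.E (ap (s, i)) l v)"
proof -
  have "ap (s, rot p i) = (\<lambda>n v. scaleP ((\<xi> powi p) ^ n) (ap (s, i) n v))" by (intro ext) (rule ap_shift)
  then show ?thesis using P.E_scaled[where f = "ap (s, i)" and c = "\<xi> powi p", OF lin_ap] by simp
qed

lemma simple_rot: "weight (simple (rot p i)) \<gamma> = weight (simple i) \<gamma>" if "\<gamma> \<in> Q_orb"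
proof -
  have "weight (simple ((\<mu> ^^ n) i)) \<gamma> = weight (simple i) \<gamma>" for n
    by (induction n) (use weight_\<mu>[OF that] in \<open>simp_all add: \<mu>Q_simple[symmetric]\<close>)
  then show ?thesis by (simp add: rot_def)
qed

lemma half_norm_rot: "half_norm (rot p i) = half_norm i" by (simp add: half_norm_def rot_def orbit_form_\<mu>)

lemma rt_\<xi>_even: "rt \<xi> powi (2 * a) = \<xi> powi a"
  by (simp add: power_int_mult rt_square)

text \<open>The normalisation of the section on simple roots enters here.\<close>

lemma e_op_rot_Upper:
  assumes f: "homog \<gamma> f" and e: "even (orbit_form i i)"
  shows "e_op Upper (rot p i) f = scaleP (\<xi> powi (- p * (weight (simple i) \<gamma> + half_norm i))) (e_op Upper i f)"
proof -
  obtain \<beta> where \<beta>: "\<gamma> = orbit_sum \<beta>" using hom_orb[OF f] by (rule Q_orbE)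
  define n where "n = nat (p mod int N)"
  have n: "int n = p mod int N" using N_pos by (simp add: n_def)
  have "- 2 * form (orbit_sum (simple i)) \<beta> - orbit_form i i = 2 * (- (weight (simple i) \<gamma> + half_norm i))"
    using e by (simp add: \<beta> weight_orbit_sum half_norm_def)
  then have "rt \<xi> powi (- 2 * form (orbit_sum (simple i)) \<beta> - orbit_form i i) = \<xi> powi (- (weight (simple i) \<gamma> + half_norm i))"
    by (simp only: rt_\<xi>_even)
  moreover have "(\<xi> powi a) ^ n = \<xi> powi (p * a)" for a
  proof -
    have "(\<xi> powi a) ^ n = (\<xi> powi (p mod int N)) powi a"
      unfolding n[symmetric] power_int_of_nat[symmetric] power_int_mult[symmetric] by (simp add: mult.commute)
    then show ?thesis by (simp add: \<xi>_powi_mod power_int_mult)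
  qed
  ultimately have "act (e (simple (rot p i))) t = scaleT (\<xi> powi (- p * (weight (simple i) \<gamma> + half_norm i))) (act (e (simple i)) t)"
    if "t \<in> T \<gamma>" for t
    using act_orbit[of t \<beta> n i] that by (simp add: rot_def n_def[symmetric] \<beta>[symmetric] algebra_simps)
  then show ?thesis
    using f by (intro poly_mapping_eqI) (simp add: e_op_def signed_root_Upper lookup_onT act_0 sec_carrier scaleP_lookup homog_def)
qed

lemma e_op_rot:
  assumes f: "homog \<gamma> f" and e: "even (orbit_form i i)"
  shows "e_op s (rot p i) f = scaleP (\<xi> powi (- p * (sg s * weight (simple i) \<gamma> + half_norm i))) (e_op s i f)"
proof (cases s)
  case Upper then show ?thesis using e_op_rot_Upper[OF f e] by simp
next
  case Lower
  let ?g = "e_op Lower (rot p i) f"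
  define c where "c = \<xi> powi (- p * (weight (simple i) \<gamma> - half_norm i))"
  have \<gamma>: "\<gamma> \<in> Q_orb" by (rule hom_orb[OF f])
  have g: "homog (\<gamma> + orbit_sum (signed_root Lower (rot p i))) ?g" by (rule hom_e_op[OF f])
  have w: "weight (simple i) (\<gamma> + orbit_sum (signed_root Lower (rot p i))) + half_norm i = weight (simple i) \<gamma> - half_norm i"
  proof -
    have "orbit_form i (rot p i) = 2 * half_norm i" using e by (simp add: rot_def orbit_form_\<mu> half_norm_def)
    then show ?thesis by (simp add: weight_signed_root[OF \<gamma>])
  qed
  have "f = scaleP c (e_op Upper i ?g)"
    using e_op_rot_Upper[OF g e, of p, unfolded w] by (simp add: e_op_inverse c_def)
  then have "e_op Lower i f = scaleP c ?g" by (metis P.lin_scale[OF lin_e_op] e_op_inverse')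
  moreover have "inverse c * c = 1" using \<xi>_nonzero by (simp add: c_def)
  ultimately have "?g = scaleP (inverse c) (e_op Lower i f)" by simp
  moreover have "inverse c = \<xi> powi (- p * (sg Lower * weight (simple i) \<gamma> + half_norm i))"
    unfolding c_def power_int_minus[symmetric] by (simp add: algebra_simps)
  ultimately show ?thesis using Lower by simp
qed

end

context fock_space
begin

interpretation FF: vector_space scaleF
  using \<pi>_linear by (simp add: Vector_Spaces.linear_def)

lemma \<pi>_add: "\<pi> (u + v) = \<pi> u + \<pi> v" and \<pi>_scale: "\<pi> (scaleP c v) = scaleF c (\<pi> v)"
  using \<pi>_linear by (simp_all add: Vector_Spaces.linear_def module_hom_def module_hom_axioms_def)

lemma \<pi>_0: "\<pi> 0 = 0" using \<pi>_add[of 0 0] by simp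
lemma \<pi>_diff: "\<pi> (u - v) = \<pi> u - \<pi> v" using \<pi>_add[of "u - v" v] by (simp add: algebra_simps)
lemma \<pi>_sum: "\<pi> (sum h S) = (\<Sum>i\<in>S. \<pi> (h i))"
  by (induction S rule: infinite_finite_induct) (auto simp: \<pi>_0 \<pi>_add)

text \<open>Linear operators that descend to the Fock space.\<close>

definition keeps :: "(('i, 't) poly_tensor \<Rightarrow> ('i, 't) poly_tensor) \<Rightarrow> bool" where
  "keeps h \<longleftrightarrow> P.lin h \<and> (\<forall>u. \<pi> u = 0 \<longrightarrow> \<pi> (h u) = 0)"

lemma keeps_lin: "keeps h \<Longrightarrow> P.lin h" by (simp add: keeps_def)

lemma keeps_eq: "keeps h \<Longrightarrow> \<pi> u = \<pi> v \<Longrightarrow> \<pi> (h u) = \<pi> (h v)"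
  using P.lin_diff[of h u v] by (auto simp: keeps_def \<pi>_diff dest!: spec[of _ "u - v"])

lemma keeps_scaled: "keeps h \<Longrightarrow> \<pi> u = scaleF c (\<pi> v) \<Longrightarrow> \<pi> (h u) = scaleF c (\<pi> (h v))"
  using keeps_eq[of h u "scaleP c v"] P.lin_scale[of h c v] by (simp add: \<pi>_scale keeps_lin)

lemma keeps_id: "keeps (\<lambda>v. v)" by (simp add: keeps_def P.lin_id)
lemma keeps_comp: "keeps h \<Longrightarrow> keeps h' \<Longrightarrow> keeps (\<lambda>v. h (h' v))"
  using P.lin_comp[of h h'] by (auto simp: keeps_def)
lemma keeps_scale: "keeps h \<Longrightarrow> keeps (\<lambda>v. scaleP c (h v))"
  using P.lin_scale_fun[of h c] by (auto simp: keeps_def \<pi>_scale)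
lemma keeps_sum: "(\<And>i. i \<in> S \<Longrightarrow> keeps (h i)) \<Longrightarrow> keeps (\<lambda>v. \<Sum>i\<in>S. h i v)"
  using P.lin_sum_fun[of S h] by (auto simp: keeps_def \<pi>_sum)
lemma keeps_0: "keeps (\<lambda>_. 0)" by (simp add: keeps_def \<pi>_0 P.lin_0)

lemma \<pi>_H0: "\<pi> (mult_var (\<mu> i, n) f) = scaleF (\<xi> powi (- int (n + 1))) (\<pi> (mult_var (i, n) f))"
proof -
  have "mult_var (\<mu> i, n) f - scaleP (\<xi> powi (- int (n + 1))) (mult_var (i, n) f) \<in> H0_space"
    unfolding H0_space_def by (rule P.span_base) blast
  then have "\<pi> (mult_var (\<mu> i, n) f - scaleP (\<xi> powi (- int (n + 1))) (mult_var (i, n) f)) = 0"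
    using \<pi>_kernel by blast
  then show ?thesis by (simp add: \<pi>_diff \<pi>_scale)
qed

text \<open>It suffices that the operator respects the relations that span the kernel of the projection.\<close>

lemma keepsI:
  assumes h: "P.lin h"
    and k: "\<And>i n f. \<pi> (h (mult_var (\<mu> i, n) f)) = scaleF (\<xi> powi (- int (n + 1))) (\<pi> (h (mult_var (i, n) f)))"
  shows "keeps h"
proof -
  have "H0_space \<subseteq> {v. \<pi> (h v) = 0}"
    unfolding H0_space_def
  proof (rule P.span_minimal)
    show "{mult_var (\<mu> i, n) f - scaleP (\<xi> powi (- int (n + 1))) (mult_var (i, n) f) | i n f. True} \<subseteq> {v. \<pi> (h v) = 0}"
      by (auto simp: P.lin_diff[OF h] P.lin_scale[OF h] \<pi>_diff \<pi>_scale k)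
    show "P.subspace {v. \<pi> (h v) = 0}"
      by (auto simp: P.subspace_def P.lin_zero[OF h] P.lin_add[OF h] P.lin_scale[OF h] \<pi>_0 \<pi>_add \<pi>_scale)
  qed
  then show ?thesis using h \<pi>_kernel by (auto simp: keeps_def)
qed

lemma keeps_mult_var: "keeps (mult_var v)"
  by (rule keepsI[OF lin_mult_var]) (simp only: mult_mult[of v] \<pi>_H0)

lemma keeps_onT: "TT.lin h \<Longrightarrow> keeps (onT h)"
  by (rule keepsI[OF lin_onT]) (simp_all only: onT_mult[OF TT.lin_zero] \<pi>_H0)

lemma rot_1: "rot 1 i = \<mu> i" using rot_nat[of 1] by simp

lemma keeps_\<alpha>op: "keeps (\<alpha>op j m)"
proof (cases "m > 0")
  case True
  then obtain n where n: "m = int n" "n > 0" by (metis pos_int_cases)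
  show ?thesis
  proof (rule keepsI[OF lin_\<alpha>op])
    fix i p f
    have v: "mult_var (i', p) f = \<alpha>op i' (- int (Suc p)) f" for i' by (simp add: \<alpha>op_neg del: of_nat_Suc)
    have h: "H1_scalar j (\<mu> i) (int n) = \<xi> powi (- int n) * H1_scalar j i (int n)"
      using H1_shift(1)[OF n(2), of j 1 i] by (simp add: rot_1 power_int_minus power_inverse)
    have "\<alpha>op j m (mult_var (i', p) f) = mult_var (i', p) (\<alpha>op j m f) + (if Suc p = n then scaleP (H1_scalar j i' (int n)) f else 0)" for i'
      unfolding v n(1) \<alpha>op_comm[OF n(2) zero_less_Suc] by (simp add: \<alpha>op_neg del: of_nat_Suc)
    then show "\<pi> (\<alpha>op j m (mult_var (\<mu> i, p) f)) = scaleF (\<xi> powi (- int (p + 1))) (\<pi> (\<alpha>op j m (mult_var (i, p) f)))"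
      by (auto simp: \<pi>_add \<pi>_H0 h \<pi>_scale \<pi>_0 FF.scale_right_distrib)
  qed
next
  case False
  then have "\<alpha>op j m = (if m = 0 then (\<lambda>_. 0) else mult_var (j, nat (- m) - 1))"
    by (auto simp: \<alpha>op_def fun_eq_iff)
  then show ?thesis by (simp add: keeps_0 keeps_mult_var)
qed

lemma keeps_am: "keeps (am p n)" unfolding am_def[abs_def] by (rule keeps_scale[OF keeps_\<alpha>op])
lemma keeps_ap: "keeps (ap p n)" unfolding ap_def[abs_def] by (rule keeps_scale[OF keeps_\<alpha>op])
lemma keeps_phi_exp: "keeps (phi_exp s i n)" unfolding phi_exp_eq[abs_def] by (rule keeps_scale[OF keeps_\<alpha>op])
lemma keeps_e_op: "keeps (e_op s i)" unfolding e_op_def by (rule keeps_onT[OF lin_act[OF sec_carrier]])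

lemma keeps_opser_pow: "(\<And>n. keeps (f n)) \<Longrightarrow> keeps (opser_pow f p n)"
proof (induction p arbitrary: n)
  case 0
  have "opser_pow f 0 n = (if n = 0 then (\<lambda>v. v) else (\<lambda>_. 0))" by (auto simp: fun_eq_iff)
  then show ?case by (simp add: keeps_id keeps_0)
next
  case (Suc p)
  have "opser_pow f (Suc p) n = (\<lambda>v. \<Sum>r\<le>n. f r (opser_pow f p (n - r) v))" by (auto simp: fun_eq_iff)
  moreover have "keeps (\<lambda>v. \<Sum>r\<le>n. f r (opser_pow f p (n - r) v))"
    by (rule keeps_sum, rule keeps_comp) (use Suc in auto)
  ultimately show ?case by simp
qed

lemma keeps_E: "(\<And>n. keeps (f n)) \<Longrightarrow> keeps (P.E f n)"
  unfolding opser_exp_coeff_def[abs_def] by (rule keeps_sum, rule keeps_scale, rule keeps_opser_pow)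

lemma keeps_Ei: "(\<And>n. keeps (f n)) \<Longrightarrow> keeps (P.Ei f n)"
  unfolding P.Ei_def[abs_def] using keeps_E[of f] keeps_0 by (cases "n < 0") simp_all

lemma keeps_Y: "keeps (P.Y p a)"
  unfolding keeps_def
proof (intro conjI allI impI P.lin_Y)
  fix u assume u: "\<pi> u = 0"
  obtain K where K: "K \<ge> 0" "u \<in> Flt K" by (rule P.Flt_exI)
  have Y: "P.Y p a u = (\<Sum>l\<le>nat K. P.Em p (int l - a) (P.Ep p l u))" using K by (intro P.Y_sum[OF K(2)]) simp
  have "\<pi> (P.Em p (int l - a) (P.Ep p l u)) = 0" for l
  proof -
    have "keeps (\<lambda>v. P.Em p (int l - a) (P.Ep p l v))"
      by (rule keeps_comp[OF keeps_Ei[OF keeps_am] keeps_E[OF keeps_ap]])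
    then show ?thesis using u by (auto simp: keeps_def)
  qed
  then show "\<pi> (P.Y p a u) = 0" by (simp add: Y \<pi>_sum)
qed

lemma keeps_X: assumes e: "even (orbit_form i i)" shows "keeps (X s i m)"
  unfolding keeps_def
proof (intro conjI allI impI lin_X[OF e])
  fix u assume u: "\<pi> u = 0"
  have "\<pi> (P.Y p a (e_op s i (onT (comp \<gamma>) u))) = 0" for p a \<gamma>
  proof -
    have "keeps (\<lambda>v. P.Y p a (e_op s i (onT (comp \<gamma>) v)))"
      by (rule keeps_comp[OF keeps_Y keeps_comp[OF keeps_e_op keeps_onT[OF lin_comp_T]]])
    then show ?thesis using u by (auto simp: keeps_def)
  qed
  then show "\<pi> (X s i m u) = 0" by (simp add: X_decomp[OF e finite_components order_refl] \<pi>_sum)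
qed

text \<open>Scaling the coefficients of an exponent amounts to scaling the variable of the series, also if the former
  holds only after projection.\<close>

lemma E_similar:
  assumes f: "\<And>n. keeps (f n)" and s: "\<And>n v. \<pi> (f n v) = scaleF (c ^ n) (\<pi> (f' n v))"
  shows "\<pi> (P.E f n v) = scaleF (c ^ n) (\<pi> (P.E f' n v))"
proof -
  have "\<pi> (opser_pow f p n v) = scaleF (c ^ n) (\<pi> (opser_pow f' p n v))" for p n
  proof (induction p arbitrary: n)
    case (Suc p)
    have "\<pi> (f r (opser_pow f p (n - r) v)) = scaleF (c ^ n) (\<pi> (f' r (opser_pow f' p (n - r) v)))" if "r \<le> n" for r
      using keeps_scaled[OF f Suc.IH, of r "n - r"] that by (simp add: s power_add[symmetric])
    then show ?case by (simp add: \<pi>_sum FF.scale_sum_right)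
  qed (simp add: \<pi>_0)
  then show ?thesis by (simp add: opser_exp_coeff_def \<pi>_sum \<pi>_scale FF.scale_sum_right mult.commute)
qed

lemma \<pi>_\<alpha>op_neg: "\<pi> (\<alpha>op (rot p i) (- int n) v) = scaleF ((\<xi> powi (- p)) ^ n) (\<pi> (\<alpha>op i (- int n) v))"
proof (cases "n = 0")
  case False
  have "\<pi> (\<alpha>op ((\<mu> ^^ r) i) (- int n) v) = scaleF ((inverse \<xi> ^ n) ^ r) (\<pi> (\<alpha>op i (- int n) v))" for r
  proof (induction r)
    case (Suc r)
    have "\<pi> (\<alpha>op (\<mu> j) (- int n) v) = scaleF (inverse \<xi> ^ n) (\<pi> (\<alpha>op j (- int n) v))" for j
      using \<pi>_H0[of j "n - 1" v] False by (simp add: \<alpha>op_neg power_int_minus power_inverse)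
    then show ?case using Suc by simp
  qed simp
  moreover have "(inverse \<xi> ^ n) ^ nat (p mod int N) = (\<xi> powi (- p)) ^ n"
  proof -
    have "(inverse \<xi> ^ n) ^ nat (p mod int N) = ((\<xi> powi (- 1)) ^ nat (p mod int N)) ^ n"
      by (simp add: power_int_minus power_mult[symmetric] mult.commute)
    also have "(\<xi> powi (- 1)) ^ nat (p mod int N) = inverse (\<xi> powi (p mod int N))"
      using N_pos by (subst powi_nat_power) (simp_all add: power_int_minus)
    finally show ?thesis by (simp add: \<xi>_powi_mod power_int_minus)
  qed
  ultimately show ?thesis by (simp add: rot_def)
qed (simp add: \<alpha>op_zero \<pi>_0)

lemma Em_similar: "\<pi> (P.Em (s, rot p i) r v) = scaleF (\<xi> powi (- p * r)) (\<pi> (P.Em (s, i) r v))"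
proof (cases "r < 0")
  case False
  have "\<pi> (am (s, rot p i) n v) = scaleF ((\<xi> powi (- p)) ^ n) (\<pi> (am (s, i) n v))" for n v
    by (simp add: am_def \<pi>_scale \<pi>_\<alpha>op_neg mult.commute)
  then have "\<pi> (P.E (am (s, rot p i)) n v) = scaleF ((\<xi> powi (- p)) ^ n) (\<pi> (P.E (am (s, i)) n v))" for n
    by (rule E_similar[OF keeps_am])
  moreover have "(\<xi> powi (- p)) ^ nat r = \<xi> powi (- p * r)"
    using False by (intro powi_nat_power) simp
  ultimately show ?thesis using False by (simp add: P.Ei_def)
qed (simp add: P.Ei_neg \<pi>_0)

lemma Y_similar: "\<pi> (P.Y (s, rot p i) a u) = scaleF (\<xi> powi (p * a)) (\<pi> (P.Y (s, i) a u))"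
proof -
  obtain K where K: "K \<ge> 0" "u \<in> Flt K" by (rule P.Flt_exI)
  have Y: "P.Y p a u = (\<Sum>l\<le>nat K. P.Em p (int l - a) (P.Ep p l u))" for p using K by (intro P.Y_sum[OF K(2)]) simp
  have "\<xi> powi (- p * (int l - a)) * (\<xi> powi p) ^ l = \<xi> powi (p * a)" for l
  proof -
    have "(\<xi> powi p) ^ l = \<xi> powi (p * int l)" by (rule powi_power)
    then show ?thesis using \<xi>_nonzero by (simp add: power_int_add[symmetric] algebra_simps)
  qed
  then show ?thesis
    unfolding Y by (simp add: \<pi>_sum FF.scale_sum_right Ep_shift P.lin_scale[OF P.lin_Em] \<pi>_scale Em_similar mult.commute)
qed

text \<open>The power of \<open>\<xi>\<close> from the exponentials is complemented by that from \<open>e\<^sub>i\<close> to exactly \<open>\<xi>\<^sup>m\<close>.\<close>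

lemma X_similar:
  assumes f: "homog \<gamma> f" and e: "\<And>i. even (orbit_form i i)"
  shows "\<pi> (X s (rot p i) m f) = scaleF (\<xi> powi (p * m)) (\<pi> (X s i m f))"
proof -
  have "\<xi> powi (p * (m + sg s * weight (simple i) \<gamma> + half_norm i)) * \<xi> powi (- p * (sg s * weight (simple i) \<gamma> + half_norm i)) = \<xi> powi (p * m)"
    using \<xi>_nonzero by (simp add: power_int_add[symmetric] algebra_simps)
  then show ?thesis
    unfolding X_hom[OF f e] simple_rot[OF hom_orb[OF f]] half_norm_rot e_op_rot[OF f e]
    by (simp add: P.lin_scale[OF P.lin_Y] \<pi>_scale Y_similar mult.commute)
qed

lemma \<Phi>_similar:
  assumes f: "homog \<gamma> f"
  shows "\<pi> (\<Phi> s (rot p i) m f) = scaleF (\<xi> powi (p * m)) (\<pi> (\<Phi> s i m f))"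
proof (cases "sg s * m < 0")
  case False
  have "\<pi> (phi_exp s (rot p i) n v) = scaleF ((\<xi> powi (sg s * p)) ^ n) (\<pi> (phi_exp s i n v))" for n v
    by (cases s) (simp_all add: phi_exp_eq \<pi>_scale \<pi>_\<alpha>op_neg \<alpha>op_pos_shift lin_\<alpha>op_simps mult.commute)
  then have "\<pi> (P.E (phi_exp s (rot p i)) n f) = scaleF ((\<xi> powi (sg s * p)) ^ n) (\<pi> (P.E (phi_exp s i) n f))" for n
    by (rule E_similar[OF keeps_phi_exp])
  moreover have "(\<xi> powi (sg s * p)) ^ nat (sg s * m) = \<xi> powi (p * m)"
  proof -
    have "(\<xi> powi (sg s * p)) ^ nat (sg s * m) = \<xi> powi ((sg s * p) * (sg s * m))"
      using False by (intro powi_nat_power) simp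
    then show ?thesis by (cases s) simp_all
  qed
  ultimately show ?thesis
    using False by (simp add: \<Phi>_hom[OF f] simple_rot[OF hom_orb[OF f]] \<pi>_scale mult.commute)
qed (simp add: \<Phi>_zero \<pi>_0)

end

context complex_space
begin

section \<open>The commutator of opposite currents\<close>

lemma exponentiable_scaled: "exponentiable f \<Longrightarrow> exponentiable (\<lambda>n v. scale (c ^ n) (f n v))"
  unfolding exponentiable_def by (auto simp: lin_scale lin_scale_fun mult.commute)

lemma E_scaled_mult:
  assumes f: "exponentiable f" and g: "exponentiable g" and c: "\<And>m n v. f m (g n v) = g n (f m v)"
  shows "(\<Sum>l\<le>n. scale (b ^ l) (E f l (E g (n - l) v))) = E (\<lambda>n v. scale (b ^ n) (f n v) + g n v) n v"
proof -
  have "(\<Sum>l\<le>n. E (\<lambda>n v. scale (b ^ n) (f n v)) l (E g (n - l) v)) = E (\<lambda>n v. scale (b ^ n) (f n v) + g n v) n v"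
    by (rule E_mult[OF exponentiable_scaled[OF f] g]) (simp add: c lin_scale[OF exponentiable_lin[OF g]])
  then show ?thesis by (simp add: E_scaled[OF exponentiable_lin[OF f]])
qed

text \<open>A sum along an antidiagonal of the product of two exponentials is a coefficient of the product with the
  variable of the first one scaled, that is, of the restriction to \<open>z = b w\<close>.\<close>

lemma Ei_collapse:
  assumes f: "exponentiable f" and g: "exponentiable g" and c: "\<And>m n v. f m (g n v) = g n (f m v)"
    and S: "finite S" "{a..b'} \<subseteq> S" and b: "b \<noteq> 0"
  shows "(\<Sum>p\<in>S. scale (b powi p) (Ei f (p - a) (Ei g (b' - p) v))) =
    scale (b powi a) (Ei (\<lambda>n v. scale (b ^ n) (f n v) + g n v) (b' - a) v)"
proof -
  have "(\<Sum>p\<in>S. scale (b powi p) (Ei f (p - a) (Ei g (b' - p) v))) =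
    (\<Sum>p\<in>{a..b'}. scale (b powi p) (Ei f (p - a) (Ei g (b' - p) v)))"
  proof (rule sum.mono_neutral_right[OF S])
    show "\<forall>p\<in>S - {a..b'}. scale (b powi p) (Ei f (p - a) (Ei g (b' - p) v)) = 0"
    proof
      fix p assume "p \<in> S - {a..b'}"
      then consider "p < a" | "b' < p" by fastforce
      then show "scale (b powi p) (Ei f (p - a) (Ei g (b' - p) v)) = 0"
        by cases (simp_all add: Ei_neg lin_zero[OF lin_Ei[OF exponentiable_lin[OF f]]])
    qed
  qed
  also have "\<dots> = scale (b powi a) (Ei (\<lambda>n v. scale (b ^ n) (f n v) + g n v) (b' - a) v)"
  proof (cases "a \<le> b'")
    case True
    define n where "n = nat (b' - a)"
    have n: "b' = a + int n" using True by (simp add: n_def)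
    have "(\<Sum>p\<in>{a..b'}. scale (b powi p) (Ei f (p - a) (Ei g (b' - p) v))) =
      (\<Sum>l\<le>n. scale (b powi (a + int l)) (Ei f (int l) (Ei g (int n - int l) v)))"
      by (rule sum.reindex_bij_witness[of _ "\<lambda>l. a + int l" "\<lambda>p. nat (p - a)"]) (auto simp: n diff_diff_eq2 add.commute)
    also have "\<dots> = scale (b powi a) (\<Sum>l\<le>n. scale (b ^ l) (E f l (E g (n - l) v)))"
      unfolding scale_sum_right
      by (intro sum.cong refl) (use b in \<open>simp add: power_int_add Ei_nat flip: of_nat_diff\<close>)
    finally show ?thesis unfolding E_scaled_mult[OF f g c] by (simp add: n Ei_nat)
  qed (simp add: Ei_neg)
  finally show ?thesis .
qed

lemma Sum_any_int:
  assumes "\<And>p. p \<notin> {- B..B} \<Longrightarrow> h p = 0"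
  shows "Sum_any (\<lambda>l. scale (fps_nth C l) (h (a + int l))) =
    (\<Sum>p\<in>{- B..B}. scale (if p < a then 0 else fps_nth C (nat (p - a))) (h p))"
proof -
  let ?S = "{p \<in> {- B..B}. a \<le> p}"
  let ?t = "\<lambda>l. scale (fps_nth C l) (h (a + int l))"
  have "Sum_any ?t = sum ?t ((\<lambda>p. nat (p - a)) ` ?S)"
  proof (rule Sum_any.expand_superset)
    show "{l. ?t l \<noteq> 0} \<subseteq> (\<lambda>p. nat (p - a)) ` ?S"
    proof
      fix l assume "l \<in> {l. ?t l \<noteq> 0}"
      then have "a + int l \<in> {- B..B}" using assms[of "a + int l"] by fastforce
      then show "l \<in> (\<lambda>p. nat (p - a)) ` ?S" by (intro image_eqI[of _ _ "a + int l"]) auto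
    qed
    show "finite ((\<lambda>p. nat (p - a)) ` ?S)" by (rule finite_imageI, rule finite_subset[of _ "{- B..B}"]) auto
  qed
  also have "\<dots> = (\<Sum>p\<in>?S. scale (fps_nth C (nat (p - a))) (h p))"
    by (subst sum.reindex) (auto simp: inj_on_def)
  also have "\<dots> = (\<Sum>p\<in>?S. scale (if p < a then 0 else fps_nth C (nat (p - a))) (h p))"
    by (rule sum.cong) auto
  also have "\<dots> = (\<Sum>p\<in>{- B..B}. scale (if p < a then 0 else fps_nth C (nat (p - a))) (h p))"
    by (rule sum.mono_neutral_left) auto
  finally show ?thesis .
qed

end

lemma inverse_binomial_nth:
  assumes "b > 0"
  shows "fps_nth (inverse (1 - fps_const (c :: complex) * fps_X ^ b)) n = (if b dvd n then c ^ (n div b) else 0)"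
proof -
  let ?f = "Abs_fps (\<lambda>n. if b dvd n then c ^ (n div b) else 0)"
  have "(1 - fps_const c * fps_X ^ b) * ?f = 1"
  proof (rule fps_ext)
    fix n
    have "fps_nth ((1 - fps_const c * fps_X ^ b) * ?f) n = fps_nth ?f n - c * (if n < b then 0 else fps_nth ?f (n - b))"
      by (simp add: left_diff_distrib mult.assoc fps_X_power_mult_nth)
    also have "\<dots> = (if n = 0 then 1 else 0)"
    proof (cases "n < b")
      case True
      then show ?thesis using assms by (auto dest: nat_dvd_not_less)
    next
      case False
      then have "b dvd n - b \<longleftrightarrow> b dvd n" "(n - b) div b = n div b - 1" "n div b > 0"
        using assms by (auto simp: dvd_minus_self div_greater_zero_iff le_div_geq)
      then show ?thesis using False assms by (auto simp: power_Suc[symmetric] simp del: power_Suc)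
    qed
    finally show "fps_nth ((1 - fps_const c * fps_X ^ b) * ?f) n = fps_nth 1 n" by simp
  qed
  then have "inverse (1 - fps_const c * fps_X ^ b) = ?f" by (rule fps_inverse_unique)
  then show ?thesis by simp
qed

context graded_module
begin

text \<open>The contraction of opposite currents is this series, times \<open>1 + X\<^sup>D\<close> if \<open>D = dd i i > 0\<close>.  Its coefficient at \<open>X\<^sup>n\<close>
  is the quantum integer \<open>[n/d + 1]\<close> with base \<open>q\<^sup>d\<close>, for \<open>n\<close> divisible by \<open>d\<close>.\<close>

definition inv_denominator :: "'i \<Rightarrow> complex fps" where
  "inv_denominator i = inverse (1 - fps_const (q ^ d i) * fps_X ^ d i) * inverse (1 - fps_const (inverse q ^ d i) * fps_X ^ d i)"

definition bracket :: "'i \<Rightarrow> int \<Rightarrow> complex" where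
  "bracket i n = (q powi (n + int (d i)) - q powi (- (n + int (d i)))) / (q ^ d i - inverse q ^ d i)"

lemma q_d_ne: "q ^ d i - inverse q ^ d i \<noteq> 0" using q_pow_ne[OF d_pos] by simp

lemma inv_denominator_nth: "fps_nth (inv_denominator i) n = (if d i dvd n then bracket i (int n) else 0)"
proof -
  define Q where "Q = q ^ d i"
  define R where "R = inverse q ^ d i"
  have QR: "Q * R = 1" using q_nonzero by (simp add: Q_def R_def power_mult_distrib[symmetric])
  define L where "L c = 1 - fps_const c * fps_X ^ d i" for c :: complex
  have i: "L c * inverse (L c) = 1" for c
  proof -
    have "fps_nth (L c) 0 \<noteq> 0" using d_pos[of i] by (simp add: L_def)
    then show ?thesis by (rule inverse_mult_eq_1')
  qed
  have "fps_const (Q - R) = fps_const Q * L R - fps_const R * L Q"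
    using QR by (simp add: L_def right_diff_distrib mult.assoc[symmetric] mult.commute[of R])
  then have "fps_const (Q - R) * inv_denominator i = (fps_const Q * L R - fps_const R * L Q) * (inverse (L Q) * inverse (L R))"
    by (simp add: inv_denominator_def L_def Q_def R_def)
  also have "\<dots> = fps_const Q * inverse (L Q) * (L R * inverse (L R)) - fps_const R * inverse (L R) * (L Q * inverse (L Q))"
    by (simp add: algebra_simps)
  finally have "fps_nth (fps_const (Q - R) * inv_denominator i) n = fps_nth (fps_const Q * inverse (L Q) - fps_const R * inverse (L R)) n"
    by (simp only: i mult_1_right)
  then have e: "(Q - R) * fps_nth (inv_denominator i) n = (if d i dvd n then Q * Q ^ (n div d i) - R * R ^ (n div d i) else 0)"
    by (simp add: L_def inverse_binomial_nth[OF d_pos])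
  have p: "q powi (int n + int (d i)) = Q * Q ^ (n div d i)" "q powi (- (int n + int (d i))) = R * R ^ (n div d i)" if "d i dvd n"
  proof -
    have "Q * Q ^ (n div d i) = q ^ (n + d i)" "R * R ^ (n div d i) = inverse q ^ (n + d i)"
      using that by (simp_all add: Q_def R_def power_mult[symmetric] power_add)
    then show "q powi (int n + int (d i)) = Q * Q ^ (n div d i)" "q powi (- (int n + int (d i))) = R * R ^ (n div d i)"
      by (simp_all only: of_nat_add[symmetric] power_int_minus power_int_of_nat power_inverse)
  qed
  have "Q - R \<noteq> 0" using q_d_ne by (simp add: Q_def R_def)
  then have "fps_nth (inv_denominator i) n = (if d i dvd n then Q * Q ^ (n div d i) - R * R ^ (n div d i) else 0) / (Q - R)"
    using e by (simp add: field_simps)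
  then show ?thesis unfolding bracket_def using p by (simp add: Q_def R_def)
qed

definition pos_bracket :: "'i \<Rightarrow> int \<Rightarrow> complex" where
  "pos_bracket i n = (if n \<ge> 0 \<and> int (d i) dvd n then bracket i n else 0)"

text \<open>Quantum integers are odd, so the two one-sided series of the expansions at \<open>0\<close> and \<open>\<infinity>\<close> fit together to a two-sided
  one; this is the formal delta function.\<close>

lemma pos_bracket_difference: "pos_bracket i n - pos_bracket i (- n - 2 * int (d i)) = (if int (d i) dvd n then bracket i n else 0)"
proof -
  let ?d = "int (d i)"
  have d: "?d > 0" using d_pos[of i] by simp
  have dv: "?d dvd - n - 2 * ?d \<longleftrightarrow> ?d dvd n"
  proof -
    have "- n - 2 * ?d = - (n + 2 * ?d)" by simp
    then show ?thesis by (simp only: dvd_minus_iff dvd_add_times_triv_right_iff)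
  qed
  have "bracket i (- n - 2 * ?d) = - bracket i n"
    by (simp add: bracket_def minus_divide_left algebra_simps)
  moreover have "bracket i n = 0" if n: "n < 0" "- n - 2 * ?d < 0" "?d dvd n"
  proof -
    obtain t where t: "n = ?d * t" using n(3) by (elim dvdE)
    have "t < 0" using n(1) d unfolding t by (simp add: mult_less_0_iff)
    moreover have "?d * (t + 2) > 0" using n(2) unfolding t by (simp add: algebra_simps)
    then have "t + 2 > 0" using d by (simp add: zero_less_mult_iff)
    ultimately have "t = - 1" by simp
    then show ?thesis by (simp add: bracket_def t)
  qed
  ultimately show ?thesis using d unfolding pos_bracket_def dv by auto
qed

text \<open>The denominator in the definition of \<open>\<epsilon>\<close>.\<close>

definition eps_denominator :: "'i \<Rightarrow> complex" where
  "eps_denominator i = (if dd i i > 0 then rt q ^ dd i i + inverse (rt q ^ dd i i) else 1)"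

definition kap_coeff :: "'i \<Rightarrow> int \<Rightarrow> complex" where
  "kap_coeff i n = (if n < 0 then 0 else fps_nth (kap (Upper, i) (Lower, i)) (nat n))"

lemma kap_opposite:
  assumes "s \<noteq> t" shows "kap (s, i) (t, i) = (if dd i i > 0 then 1 + fps_X ^ dd i i else 1) * inv_denominator i"
proof -
  have "(\<Prod>r\<in>\<Gamma>m i i. one_minus (\<xi> powi r)) = (if dd i i > 0 then 1 + fps_X ^ dd i i else 1)"
    using \<Gamma>m_products_self[of 1 i] by (auto simp: dd_def finite_\<Gamma>)
  moreover have "(\<Prod>r\<in>\<Gamma>p i i. inverse (one_minus (\<xi> powi r * q)) * inverse (one_minus (\<xi> powi r * inverse q))) = inv_denominator i"
    using q_nonzero by (simp add: prod.distrib prod_inverse_fps \<Gamma>p_products inv_denominator_def)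
  ultimately show ?thesis unfolding kap_opp[OF assms] by (simp add: mult.commute)
qed

lemma d_dvd_dd: "d i dvd dd i i" using \<Gamma>m_self(1)[of i] by (cases "dd i i = 0") auto

lemma kap_coeff_pos_bracket: "kap_coeff i n = pos_bracket i n + (if dd i i > 0 then pos_bracket i (n - int (dd i i)) else 0)"
proof (cases "n < 0")
  case False
  then obtain l where l: "n = int l" by (metis nonneg_int_cases not_less)
  have "fps_nth (fps_X ^ b * inv_denominator i) l = pos_bracket i (int l - int b)" if "d i dvd b" for b
  proof (cases "l < b")
    case True then show ?thesis by (simp add: fps_X_power_mult_nth pos_bracket_def)
  next
    case False
    then have "int l - int b = int (l - b)" by simp
    then show ?thesis using False by (simp add: fps_X_power_mult_nth pos_bracket_def inv_denominator_nth del: of_nat_diff)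
  qed
  from this[of 0] this[OF d_dvd_dd] show ?thesis
    by (simp add: kap_coeff_def l kap_opposite distrib_right)
qed (simp add: kap_coeff_def pos_bracket_def)

lemma two_half_norm: "even (orbit_form i i) \<Longrightarrow> 2 * half_norm i = 2 * int (d i) - int (dd i i)"
  using orbit_form_self[of i] by (simp add: half_norm_def)

text \<open>The argument \<open>p\<close> is the exponent of \<open>z/w\<close> in the normally ordered product, and \<open>w\<close> the weight of the vector.\<close>

lemma kap_coeff_difference:
  assumes e: "even (orbit_form i i)"
  shows "kap_coeff i (p - half_norm i + w) - kap_coeff i (- p - half_norm i - w) =
    (if int (d i) dvd p - half_norm i + w then eps_denominator i / (q ^ d i - inverse q ^ d i) * (q powi (w + p) - q powi (- w - p)) else 0)"
proof -
  define n where "n = p - half_norm i + w"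
  let ?d = "int (d i)" and ?D = "int (dd i i)"
  \<comment> \<open>Since \<open>half_norm i = d - D/2\<close>, this is \<open>D/2\<close>.\<close>
  define h where "h = ?d - half_norm i"
  have D: "?D = 2 * h" using two_half_norm[OF e] by (simp add: h_def)
  have m: "- p - half_norm i - w = - n - 2 * ?d + ?D" using two_half_norm[OF e] by (simp add: n_def)
  have dv: "?d dvd n - ?D \<longleftrightarrow> ?d dvd n" using d_dvd_dd[of i]
    by (metis dvd_diff_left_iff int_dvd_int_iff)
  have "kap_coeff i n - kap_coeff i (- n - 2 * ?d + ?D) =
    (pos_bracket i n - pos_bracket i (- n - 2 * ?d)) + (if dd i i > 0 then pos_bracket i (n - ?D) - pos_bracket i (- (n - ?D) - 2 * ?d) else 0)"
    by (auto simp: kap_coeff_pos_bracket algebra_simps)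
  also have "\<dots> = (if ?d dvd n then bracket i n + (if dd i i > 0 then bracket i (n - ?D) else 0) else 0)"
    unfolding pos_bracket_difference dv by simp
  also have "bracket i n + (if dd i i > 0 then bracket i (n - ?D) else 0) =
     eps_denominator i / (q ^ d i - inverse q ^ d i) * (q powi (w + p) - q powi (- w - p))"
  proof (cases "dd i i > 0")
    case False
    then have "h = 0" using D by simp
    then have "n + ?d = w + p" by (simp add: n_def h_def)
    then show ?thesis using False by (simp add: eps_denominator_def bracket_def)
  next
    case True
    have r: "rt q ^ dd i i = q powi h"
    proof -
      have "rt q ^ dd i i = rt q powi (2 * h)" by (simp only: power_int_of_nat[symmetric] D)
      then show ?thesis by (simp add: power_int_mult rt_square)
    qed
    have a: "n + ?d = (w + p) + h" "n - ?D + ?d = (w + p) - h" using D by (simp_all add: n_def h_def)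
    have "(q powi h + inverse (q powi h)) * (q powi (w + p) - q powi (- w - p)) =
      (q powi (w + p + h) - q powi (- (w + p + h))) + (q powi (w + p - h) - q powi (- (w + p - h)))"
    proof -
      have "- w - p = - (w + p)" by simp
      then show ?thesis using q_nonzero
        by (simp add: power_int_add power_int_diff power_int_minus field_simps)
    qed
    then have "bracket i n + bracket i (n - ?D) =
      ((q powi h + inverse (q powi h)) * (q powi (w + p) - q powi (- w - p))) / (q ^ d i - inverse q ^ d i)"
      unfolding bracket_def a by (simp only: add_divide_distrib)
    then show ?thesis using True by (simp only: eps_denominator_def r if_True times_divide_eq_left)
  qed
  finally show ?thesis unfolding m n_def by (simp only: if_distrib)
qed

text \<open>At \<open>z = q w\<close> the creation exponents of the opposite currents cancel and the annihilation exponents add up to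
  that of \<open>\<Phi>\<^sup>+\<close>; at \<open>z = q\<^sup>-\<^sup>1 w\<close> it is the other way round.\<close>

lemma am_collapse:
  "scaleP (q ^ n) (am (Upper, i) n v) + am (Lower, i) n v = 0"
  "scaleP (inverse q ^ n) (am (Upper, i) n v) + am (Lower, i) n v = scaleP (inverse (rt q) ^ n) (phi_exp Lower i n v)"
  "scaleP (q ^ n) (ap (Upper, i) n v) + ap (Lower, i) n v = 0"
  "scaleP (inverse q ^ n) (ap (Upper, i) n v) + ap (Lower, i) n v = scaleP (inverse (rt q) ^ n) (phi_exp Upper i n v)"
proof -
  define r where "r = rt q"
  have rq: "q = r * r" using rt_square[of q] by (simp add: r_def power2_eq_square)
  have r0: "r \<noteq> 0" using q_nonzero rq by auto
  have s: "rt q powi (- sg Upper) = inverse r" "rt q powi (- sg Lower) = r" by (simp_all add: r_def power_int_minus)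
  have a: "q ^ n * inverse r ^ n = r ^ n" using r0 by (simp add: rq power_mult_distrib field_simps)
  have lin: "scaleP x' u + scaleP y' u = scaleP (x' + y') u" for x' y' u by (simp add: P.scale_left_distrib)
  show "scaleP (q ^ n) (am (Upper, i) n v) + am (Lower, i) n v = 0"
    "scaleP (q ^ n) (ap (Upper, i) n v) + ap (Lower, i) n v = 0"
    unfolding am_def ap_def fst_conv snd_conv s P.scale_scale lin by (simp_all add: a)
  show "scaleP (inverse q ^ n) (am (Upper, i) n v) + am (Lower, i) n v = scaleP (inverse (rt q) ^ n) (phi_exp Lower i n v)"
    "scaleP (inverse q ^ n) (ap (Upper, i) n v) + ap (Lower, i) n v = scaleP (inverse (rt q) ^ n) (phi_exp Upper i n v)"
  proof -
    have b: "(r ^ n - inverse q ^ n * inverse r ^ n) / qint q (int n) = inverse r ^ n * (q - inverse q)" if "n > 0"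
    proof -
      have Q: "qint q (int n) \<noteq> 0" using that by (rule qint_nonzero)
      have "r ^ n - inverse q ^ n * inverse r ^ n = inverse r ^ n * (q ^ n - inverse q ^ n)"
        using a by (simp add: right_diff_distrib mult.commute)
      also have "q ^ n - inverse q ^ n = (q - inverse q) * qint q (int n)"
        using q_diff_ne by (simp add: qint_def power_int_minus power_inverse)
      finally show ?thesis using Q by simp
    qed
    have "inverse q ^ n * (of_int (sg Upper) / qint q (int n) * inverse r ^ n) + of_int (sg Lower) / qint q (int n) * r ^ n =
        inverse r ^ n * (of_int (sg Lower) * (q - inverse q))"
      "inverse q ^ n * (- of_int (sg Upper) / qint q (int n) * inverse r ^ n) + - of_int (sg Lower) / qint q (int n) * r ^ n =
        inverse r ^ n * (of_int (sg Upper) * (q - inverse q))" if "n > 0"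
    proof -
      have "inverse r ^ n * (of_int (sg Lower) * (q - inverse q)) = - ((r ^ n - inverse q ^ n * inverse r ^ n) / qint q (int n))"
        "inverse r ^ n * (of_int (sg Upper) * (q - inverse q)) = (r ^ n - inverse q ^ n * inverse r ^ n) / qint q (int n)"
        unfolding b[OF that] by (simp_all add: algebra_simps)
      then show "inverse q ^ n * (of_int (sg Upper) / qint q (int n) * inverse r ^ n) + of_int (sg Lower) / qint q (int n) * r ^ n =
        inverse r ^ n * (of_int (sg Lower) * (q - inverse q))"
      "inverse q ^ n * (- of_int (sg Upper) / qint q (int n) * inverse r ^ n) + - of_int (sg Lower) / qint q (int n) * r ^ n =
        inverse r ^ n * (of_int (sg Upper) * (q - inverse q))" by (simp_all add: diff_divide_distrib)
    qed
    note bm = this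
    show "scaleP (inverse q ^ n) (am (Upper, i) n v) + am (Lower, i) n v = scaleP (inverse (rt q) ^ n) (phi_exp Lower i n v)"
      "scaleP (inverse q ^ n) (ap (Upper, i) n v) + ap (Lower, i) n v = scaleP (inverse (rt q) ^ n) (phi_exp Upper i n v)"
      unfolding am_def ap_def phi_exp_eq fst_conv snd_conv s P.scale_scale lin
      using bm by (cases "n = 0"; simp add: \<alpha>op_zero r_def[symmetric] del: sg.simps; simp)+
  qed
qed

lemma N2_collapse:
  assumes K: "f \<in> Flt K" "K \<le> int M" and B: "B \<ge> int M + \<bar>m\<bar> + \<bar>n\<bar>" and b: "b \<noteq> 0"
  shows "(\<Sum>p\<in>{- B..B}. scaleP (b powi p) (P.N2 (Upper, i) (Lower, i) (m - p) (n + p) f)) =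
    scaleP (b powi m) (\<Sum>l\<le>M. P.Ei (\<lambda>n v. scaleP (b ^ n) (am (Upper, i) n v) + am (Lower, i) n v) (int l - m - n)
      (P.E (\<lambda>n v. scaleP (inverse b ^ n) (ap (Upper, i) n v) + ap (Lower, i) n v) l f))"
proof -
  let ?s = "(Upper, i)" and ?t = "(Lower, i)"
  let ?h = "\<lambda>n v. scaleP (b ^ n) (am ?s n v) + am ?t n v"
  let ?w = "\<lambda>l l'. P.Ep ?t l' (P.Ep ?s l f)"
  have K': "P.Ep ?s l f \<in> Flt K" for l by (rule P.Flt_mono[OF P.Ep_Flt[OF K(1)]]) simp
  have N: "P.N2 ?s ?t a b' f = (\<Sum>l\<le>M. \<Sum>l'\<le>M. P.Em ?s (int l - a) (P.Em ?t (int l' - b') (?w l l')))" for a b'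
    unfolding P.N2_sum[OF K] P.Y_sum[OF K' K(2)] by (simp only: P.lin_sum[OF P.lin_Em])
  have lin_h: "P.lin (P.Ei ?h r)" for r
    by (intro P.lin_Ei P.lin_add_fun P.lin_scale_fun lin_am)
  have "(\<Sum>p\<in>{- B..B}. scaleP (b powi p) (P.N2 ?s ?t (m - p) (n + p) f)) =
    (\<Sum>l\<le>M. \<Sum>l'\<le>M. \<Sum>p\<in>{- B..B}. scaleP (b powi p) (P.Em ?s (p - (m - int l)) (P.Em ?t (int l' - n - p) (?w l l'))))"
    unfolding N P.scale_sum_right
    by (subst sum.swap, intro sum.cong refl, subst sum.swap, intro sum.cong refl) (simp add: algebra_simps)
  also have "\<dots> = (\<Sum>l\<le>M. \<Sum>l'\<le>M. scaleP (b powi (m - int l)) (P.Ei ?h (int (l + l') - m - n) (?w l l')))"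
  proof (intro sum.cong refl)
    fix l l' assume l: "l \<in> {..M}" "l' \<in> {..M}"
    have "(\<Sum>p\<in>{- B..B}. scaleP (b powi p) (P.Em ?s (p - (m - int l)) (P.Em ?t (int l' - n - p) (?w l l')))) =
      scaleP (b powi (m - int l)) (P.Ei ?h (int l' - n - (m - int l)) (?w l l'))"
      by (rule P.Ei_collapse[OF exponentiable_am exponentiable_am am_am _ _ b]) (use l B in auto)
    also have "int l' - n - (m - int l) = int (l + l') - m - n" by simp
    finally show "(\<Sum>p\<in>{- B..B}. scaleP (b powi p) (P.Em ?s (p - (m - int l)) (P.Em ?t (int l' - n - p) (?w l l')))) =
      scaleP (b powi (m - int l)) (P.Ei ?h (int (l + l') - m - n) (?w l l'))" .
  qed
  also have "\<dots> = (\<Sum>l\<le>M. \<Sum>l'\<le>M - l. scaleP (b powi (m - int l)) (P.Ei ?h (int (l + l') - m - n) (?w l l')))"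
  proof (rule sum.cong[OF refl], rule sum.mono_neutral_right)
    fix l show "\<forall>l'\<in>{..M} - {..M - l}. scaleP (b powi (m - int l)) (P.Ei ?h (int (l + l') - m - n) (?w l l')) = 0"
    proof
      fix l' assume "l' \<in> {..M} - {..M - l}"
      then have "int l' > K - int l" using K(2) by auto
      then have "?w l l' = 0" by (intro P.Ep_zero[OF P.Ep_Flt[OF K(1)]])
      then show "scaleP (b powi (m - int l)) (P.Ei ?h (int (l + l') - m - n) (?w l l')) = 0"
        by (simp add: P.lin_zero[OF lin_h])
    qed
  qed auto
  also have "\<dots> = (\<Sum>L\<le>M. \<Sum>l\<le>L. scaleP (b powi (m - int l)) (P.Ei ?h (int (l + (L - l)) - m - n) (?w l (L - l))))"
    by (rule sum_triangle_diagonal)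
  also have "\<dots> = (\<Sum>L\<le>M. scaleP (b powi m) (P.Ei ?h (int L - m - n) (\<Sum>l\<le>L. scaleP (inverse b ^ l) (P.Ep ?s l (P.Ep ?t (L - l) f)))))"
  proof (rule sum.cong[OF refl])
    fix L
    have "scaleP (b powi (m - int l)) (P.Ei ?h (int (l + (L - l)) - m - n) (?w l (L - l))) =
      scaleP (b powi m) (P.Ei ?h (int L - m - n) (scaleP (inverse b ^ l) (P.Ep ?s l (P.Ep ?t (L - l) f))))" if "l \<le> L" for l
      using that b by (simp add: P.lin_scale[OF lin_h] P.Ep_Ep[of ?t] power_int_diff power_inverse divide_inverse)
    then show "(\<Sum>l\<le>L. scaleP (b powi (m - int l)) (P.Ei ?h (int (l + (L - l)) - m - n) (?w l (L - l)))) =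
      scaleP (b powi m) (P.Ei ?h (int L - m - n) (\<Sum>l\<le>L. scaleP (inverse b ^ l) (P.Ep ?s l (P.Ep ?t (L - l) f))))"
      by (simp add: P.lin_sum[OF lin_h] P.scale_sum_right)
  qed
  finally show ?thesis
    unfolding P.E_scaled_mult[OF exponentiable_ap exponentiable_ap ap_ap] by (simp only: P.scale_sum_right)
qed

lemma rt_q_nonzero: "rt q \<noteq> 0" using rt_square[of q] q_nonzero by auto

lemma inverse_rt_powi: "q powi m * inverse (rt q) powi (m + n) = rt q powi (m - n)"
  "inverse q powi m * inverse (rt q) powi (- m - n) = rt q powi (n - m)"
proof -
  have "q powi m = rt q powi (2 * m)" by (simp add: power_int_mult rt_square)
  then show "q powi m * inverse (rt q) powi (m + n) = rt q powi (m - n)"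
    "inverse q powi m * inverse (rt q) powi (- m - n) = rt q powi (n - m)"
    using rt_q_nonzero by (simp_all add: power_int_inverse power_int_minus[symmetric] power_int_add[symmetric])
qed

lemma collapse_to_\<Phi>:
  assumes K: "f \<in> Flt K" "K \<le> int M" "\<bar>m + n\<bar> \<le> int M" and B: "B \<ge> int M + \<bar>m\<bar> + \<bar>n\<bar>"
  shows "(\<Sum>p\<in>{- B..B}. scaleP (q powi p) (P.N2 (Upper, i) (Lower, i) (m - p) (n + p) f)) =
      scaleP (rt q powi (m - n)) (P.Ei (phi_exp Upper i) (m + n) f)"
    and "(\<Sum>p\<in>{- B..B}. scaleP (inverse q powi p) (P.N2 (Upper, i) (Lower, i) (m - p) (n + p) f)) =
      scaleP (rt q powi (n - m)) (P.Ei (phi_exp Lower i) (- m - n) f)"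
proof -
  have E0: "P.Ei (\<lambda>_ _. 0) r v = (if r = 0 then v else 0)" for r v by (auto simp: P.Ei_def P.E_zero)
  have sc: "P.E (\<lambda>n v. scaleP (inverse (rt q) ^ n) (phi_exp s i n v)) l v = scaleP (inverse (rt q) ^ l) (P.E (phi_exp s i) l v)" for s l v
    by (rule P.E_scaled[OF lin_phi_exp])
  have iq: "inverse q \<noteq> 0" using q_nonzero by simp
  show "(\<Sum>p\<in>{- B..B}. scaleP (q powi p) (P.N2 (Upper, i) (Lower, i) (m - p) (n + p) f)) =
      scaleP (rt q powi (m - n)) (P.Ei (phi_exp Upper i) (m + n) f)"
  proof -
    have "(\<Sum>l\<le>M. P.Ei (\<lambda>_ _. 0) (int l - m - n) (scaleP (inverse (rt q) ^ l) (P.E (phi_exp Upper i) l f))) =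
      scaleP (inverse (rt q) powi (m + n)) (P.Ei (phi_exp Upper i) (m + n) f)"
    proof (cases "m + n < 0")
      case True
      then have "int l - m - n \<noteq> 0" for l by auto
      then show ?thesis using True by (simp add: E0 P.Ei_neg)
    next
      case False
      then obtain L where L: "m + n = int L" by (metis nonneg_int_cases not_less)
      have eq: "int l - m = n \<longleftrightarrow> l = L" for l using L by auto
      have "L \<le> M" using K(3) L by simp
      then show ?thesis by (simp add: E0 eq L P.Ei_nat)
    qed
    then show ?thesis
      unfolding N2_collapse[OF K(1,2) B q_nonzero] am_collapse sc by (simp add: inverse_rt_powi)
  qed
  show "(\<Sum>p\<in>{- B..B}. scaleP (inverse q powi p) (P.N2 (Upper, i) (Lower, i) (m - p) (n + p) f)) =
      scaleP (rt q powi (n - m)) (P.Ei (phi_exp Lower i) (- m - n) f)"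
  proof -
    have s: "P.Ei (\<lambda>n v. scaleP (inverse (rt q) ^ n) (phi_exp Lower i n v)) r v = scaleP (inverse (rt q) powi r) (P.Ei (phi_exp Lower i) r v)" for r v
    proof (cases "r < 0")
      case False
      then obtain l where "r = int l" by (metis nonneg_int_cases not_less)
      then show ?thesis by (simp add: P.Ei_nat sc)
    qed (simp add: P.Ei_neg)
    have z: "P.E (\<lambda>n v. 0) l v = (if l = 0 then v else 0)" for l and v :: "('i, 't) poly_tensor" by (rule P.E_zero)
    have "(\<Sum>l\<le>M. P.Ei (\<lambda>n v. scaleP (inverse (rt q) ^ n) (phi_exp Lower i n v)) (int l - m - n) (P.E (\<lambda>n v. 0) l f)) =
      (\<Sum>l\<le>M. if l = 0 then scaleP (inverse (rt q) powi (- m - n)) (P.Ei (phi_exp Lower i) (- m - n) f) else 0)"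
      by (rule sum.cong[OF refl]) (auto simp: z s P.lin_zero[OF lin_Ei_phi_exp])
    also have "\<dots> = scaleP (inverse (rt q) powi (- m - n)) (P.Ei (phi_exp Lower i) (- m - n) f)" by simp
    finally show ?thesis
      unfolding N2_collapse[OF K(1,2) B iq] inverse_inverse_eq am_collapse by (simp add: inverse_rt_powi)
  qed
qed

text \<open>The rotation by \<open>N/d\<close> generates the stabiliser of \<open>i\<close>, and \<open>\<xi>\<close> to the power \<open>N/d\<close> is a primitive root of unity of order \<open>d\<close>.\<close>

lemma rotation:
  obtains r where "r \<in> ZN" "rot r i = i" "\<And>a. \<xi> powi (r * a) = 1 \<Longrightarrow> int (d i) dvd a"
    "\<And>a. int (d i) dvd a \<Longrightarrow> \<xi> powi (r * a) = 1"
proof -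
  have "rot_subgroup ZN" using N_pos by (auto simp: rot_subgroup_def)
  then have "d i dvd card ZN"
    unfolding d_def by (rule rot_subgroup_dvd[OF rot_subgroup_\<Gamma>p]) (auto simp: \<Gamma>p_def)
  then obtain M where M: "N = d i * M" by (auto elim: dvdE)
  have M': "int N = int M * int (d i)" using arg_cong[OF M, of int] by (simp only: of_nat_mult mult.commute)
  have M0: "M > 0" using N_pos M by (cases M) auto
  define r where "r = int M mod int N"
  have "(\<xi> powi int M) ^ card (\<Gamma>p i i) = 1"
    using \<xi>_N by (simp add: d_def[symmetric] power_mult[symmetric] M[symmetric] mult.commute[of M])
  then have "r \<in> \<Gamma>p i i" unfolding r_def by (rule rot_subgroup_root[OF rot_subgroup_\<Gamma>p])
  then have r: "r \<in> ZN" "rot r i = i" by (auto simp: \<Gamma>p_iff rot_entry_2)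
  have p: "\<xi> powi (r * a) = \<xi> powi (int M * a)" for a
    by (simp add: power_int_mult r_def \<xi>_powi_mod)
  show thesis
  proof (rule that[OF r])
    fix a assume "\<xi> powi (r * a) = 1"
    then have "(int M * a) mod int N = 0" unfolding p by (rule \<xi>_powi_1)
    then have "int M * int (d i) dvd int M * a" by (simp only: M'[symmetric] mod_eq_0_iff_dvd)
    then show "int (d i) dvd a" using M0 by simp
  next
    fix a assume "int (d i) dvd a"
    then obtain b where "a = int (d i) * b" by (elim dvdE)
    then have "int M * a = int N * b" by (simp only: M' mult_ac)
    then show "\<xi> powi (r * a) = 1" unfolding p using \<xi>_N by (simp add: power_int_mult)
  qed
qed

lemma sum_over_rotations:
  "(\<Sum>r\<in>\<Gamma>p (rot r0 j) j. \<xi> powi (- r * n)) = \<xi> powi (- r0 * n) * (\<Sum>r\<in>\<Gamma>p j j. \<xi> powi (- r * n))"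
proof -
  have m: "\<xi> powi (- (a mod int N) * n) = \<xi> powi (- a * n)" for a
  proof -
    have "\<xi> powi (- (a mod int N) * n) = (\<xi> powi (a mod int N)) powi (- n)" by (simp add: power_int_mult[symmetric])
    then show ?thesis by (simp add: \<xi>_powi_mod power_int_mult[symmetric])
  qed
  have "(\<Sum>r\<in>\<Gamma>p (rot r0 j) j. \<xi> powi (- r * n)) = (\<Sum>r\<in>\<Gamma>p j j. \<xi> powi (- (r + r0) * n))"
  proof (rule sum.reindex_bij_witness[of _ "\<lambda>r. (r + r0) mod int N" "\<lambda>r. (r - r0) mod int N"])
    fix r assume r: "r \<in> \<Gamma>p (rot r0 j) j"
    then have rN: "r mod int N = r" by (auto simp: \<Gamma>p_iff)
    show w: "((r - r0) mod int N + r0) mod int N = r" using rN by (simp add: mod_simps)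
    show "(r - r0) mod int N \<in> \<Gamma>p j j" using r N_pos by (simp add: \<Gamma>p_iff rot_entry_mod rot_entry_shift_left)
    have "\<xi> powi (- ((r - r0) mod int N + r0) * n) = \<xi> powi (- (((r - r0) mod int N + r0) mod int N) * n)"
      by (rule m[symmetric])
    then show "\<xi> powi (- ((r - r0) mod int N + r0) * n) = \<xi> powi (- r * n)" unfolding w .
  next
    fix r assume r: "r \<in> \<Gamma>p j j"
    then have rN: "r mod int N = r" by (auto simp: \<Gamma>p_iff)
    show "((r + r0) mod int N - r0) mod int N = r" using rN by (simp add: mod_simps)
    show "(r + r0) mod int N \<in> \<Gamma>p (rot r0 j) j" using r N_pos by (simp add: \<Gamma>p_iff rot_entry_mod rot_entry_shift_left)
  qed
  also have "\<dots> = \<xi> powi (- r0 * n) * (\<Sum>r\<in>\<Gamma>p j j. \<xi> powi (- r * n))"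
    using \<xi>_nonzero by (simp add: sum_distrib_left power_int_add[symmetric] algebra_simps)
  finally show ?thesis .
qed

lemma sum_over_stabilizer:
  "(\<Sum>r\<in>\<Gamma>p i i. \<xi> powi (- r * n)) = (if int (d i) dvd n then of_nat (d i) else 0)"
proof (cases "int (d i) dvd n")
  case True
  then obtain b where b: "n = int (d i) * b" by (elim dvdE)
  have "\<xi> powi (- r * n) = 1" if "r \<in> \<Gamma>p i i" for r
  proof -
    have "\<xi> powi (- r * n) = ((\<xi> powi r) ^ d i) powi (- b)"
      unfolding b power_int_of_nat[symmetric] power_int_mult[symmetric] by (simp add: mult_ac)
    then show ?thesis using rot_subgroup_power[OF rot_subgroup_\<Gamma>p that] by (simp add: d_def)
  qed
  then have "(\<Sum>r\<in>\<Gamma>p i i. \<xi> powi (- r * n)) = (\<Sum>r\<in>\<Gamma>p i i. 1)" by (rule sum.cong[OF refl])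
  then show ?thesis using True by (simp add: d_def)
next
  case False
  obtain r where r: "r \<in> ZN" "rot r i = i" "\<And>a. \<xi> powi (r * a) = 1 \<Longrightarrow> int (d i) dvd a" by (rule rotation[of i]) blast
  let ?S = "\<Sum>a\<in>\<Gamma>p i i. \<xi> powi (- a * n)"
  have "?S = \<xi> powi (- r * n) * ?S" using sum_over_rotations[where ?r0.0 = r and j = i and n = n] r(2) by simp
  then have "(1 - \<xi> powi (- r * n)) * ?S = 0" by (simp add: algebra_simps)
  moreover have "\<xi> powi (- r * n) \<noteq> 1" using r(3)[of "- n"] False by auto
  ultimately show ?thesis using False by simp
qed

lemma weight_divisible:
  assumes f: "homog \<gamma> f" "f \<noteq> 0" and e: "even (orbit_form i i)"
  shows "int (d i) dvd weight (simple i) \<gamma> + half_norm i"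
proof -
  obtain m where m: "Poly_Mapping.lookup f m \<noteq> 0" using f(2) by (metis lookup_zero poly_mapping_eqI)
  obtain r where r: "r \<in> ZN" "rot r i = i" "\<And>a. \<xi> powi (r * a) = 1 \<Longrightarrow> int (d i) dvd a" by (rule rotation[of i]) blast
  have rn: "int (nat r) = r" "(\<mu> ^^ nat r) i = i" using r(1,2) by (auto simp: rot_ZN)
  have "(rt \<xi> powi (2 * weight (simple i) \<gamma> + orbit_form i i)) ^ nat r = 1"
    by (rule phase[OF _ m hom_orb[OF f(1)] rn(2)]) (use f in \<open>simp add: homog_def\<close>)
  moreover have "2 * weight (simple i) \<gamma> + orbit_form i i = 2 * (weight (simple i) \<gamma> + half_norm i)" using e by (simp add: half_norm_def)
  ultimately have "\<xi> powi (r * (weight (simple i) \<gamma> + half_norm i)) = 1"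
    by (simp only: rt_\<xi>_even powi_power rn mult.commute)
  then show ?thesis by (rule r(3))
qed

end

context fock_space
begin

interpretation FF: vector_space scaleF
  using \<pi>_linear by (simp add: Vector_Spaces.linear_def)

text \<open>Modulo the kernel of the projection the current of \<open>i\<close> is invariant under the rotations that fix \<open>i\<close>, so it only contains
  powers of \<open>z\<^sup>d\<close>.\<close>

lemma N2_\<pi>_zero:
  assumes "\<not> int (d i) dvd a"
  shows "\<pi> (P.N2 (s, i) p a b u) = 0"
proof -
  obtain r where r: "rot r i = i" "\<And>a. \<xi> powi (r * a) = 1 \<Longrightarrow> int (d i) dvd a" by (rule rotation[of i]) blast
  have Ep: "P.E (ap (s, i)) l v = 0" if "\<not> int (d i) dvd int l" for l v
  proof -
    have "P.E (ap (s, i)) l v = scaleP (\<xi> powi (r * int l)) (P.E (ap (s, i)) l v)"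
      using Ep_shift[of s r i l v] r(1) by (simp add: powi_power)
    moreover have "\<xi> powi (r * int l) \<noteq> 1" using r(2) that by blast
    ultimately show ?thesis by (metis P.scale_cancel_right P.scale_one)
  qed
  have Em: "\<pi> (P.Em (s, i) c v) = 0" if "\<not> int (d i) dvd c" for c v
  proof -
    have "\<pi> (P.Em (s, i) c v) = scaleF (\<xi> powi (r * (- c))) (\<pi> (P.Em (s, i) c v))"
      using Em_similar[of s r i c v] r(1) by simp
    moreover have "\<xi> powi (r * (- c)) \<noteq> 1" using r(2)[of "- c"] that by auto
    ultimately show ?thesis by (metis FF.scale_cancel_right FF.scale_one)
  qed
  obtain K where K: "K \<ge> 0" "u \<in> Flt K" by (rule P.Flt_exI)
  have "P.N2 (s, i) p a b u = (\<Sum>l\<le>nat K. P.Em (s, i) (int l - a) (P.Y p b (P.Ep (s, i) l u)))"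
    using K by (intro P.N2_sum[OF K(2)]) simp
  moreover have "\<pi> (P.Em (s, i) (int l - a) (P.Y p b (P.Ep (s, i) l u))) = 0" for l
  proof (cases "int (d i) dvd int l")
    case True
    then have "\<not> int (d i) dvd int l - a" using assms by (metis dvd_diff_right_iff)
    then show ?thesis by (rule Em)
  next
    case False
    then show ?thesis by (simp add: Ep P.lin_zero[OF P.lin_Y] P.lin_zero[OF P.lin_Em] \<pi>_0)
  qed
  ultimately show ?thesis by (simp add: \<pi>_sum)
qed

text \<open>The divisibilities by \<open>d\<close> of the weight and of the indices of the normally ordered product, which hold in the Fock space only, make
  the delta function of \<open>z\<^sup>d\<close> and \<open>q\<^sup>d w\<^sup>d\<close> act as that of \<open>z\<close> and \<open>q w\<close>.\<close>

lemma commutator_same: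
  assumes f: "homog \<gamma> f" and e: "\<And>i. even (orbit_form i i)"
  shows "\<pi> (X Upper i m (X Lower i n f) - X Lower i n (X Upper i m f)) =
    scaleF (if int (d i) dvd n then eps_denominator i / (q ^ d i - inverse q ^ d i) else 0)
      (scaleF (rt q powi (m - n)) (\<pi> (\<Phi> Upper i (m + n) f)) - scaleF (rt q powi (n - m)) (\<pi> (\<Phi> Lower i (m + n) f)))"
proof (cases "f = 0")
  case True
  then show ?thesis
    by (simp add: P.lin_zero[OF lin_X[OF e]] P.lin_zero[OF lin_\<Phi>] \<pi>_0)
next
  case False
  define w where "w = weight (simple i) \<gamma>"
  let ?d = "int (d i)"
  obtain K where K: "K \<ge> 0" "f \<in> Flt K" by (rule P.Flt_exI)
  \<comment> \<open>\<open>N2\<close> at degrees \<open>m - p\<close>, \<open>n + p\<close> vanishes for \<open>p\<close> outside \<open>[- B, B]\<close>, so that the sums over \<open>p\<close> may be taken over this interval.\<close>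
  define M where "M = nat (K + \<bar>m + n\<bar>)"
  define B where "B = int M + \<bar>m\<bar> + \<bar>n\<bar>"
  have M: "K \<le> int M" "\<bar>m + n\<bar> \<le> int M" using K by (auto simp: M_def)
  define h where "h p = P.N2 (Upper, i) (Lower, i) (m - p) (n + p) f" for p
  have h0: "h p = 0" if "p \<notin> {- B..B}" for p
    unfolding h_def by (rule P.N2_zero[OF K(2)]) (use that M B_def in auto)
  define m' where "m' = (\<lambda>t::nat. if t = 0 then m else n)"
  have idx: "(m' + sv 0 a + sv 1 b) 0 = m + a" "(m' + sv 0 a + sv 1 b) 1 = n + b"
     "(m' + sv 1 b + sv 0 a) 0 = m + a" "(m' + sv 1 b + sv 0 a) 1 = n + b" for a b
    by (simp_all add: m'_def sv_def)
  have BBc: "orbit_form i i = 2 * half_norm i" using e by (simp add: half_norm_def)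
  have XY: "X Upper i m (X Lower i n f) = (\<Sum>p\<in>{- B..B}. scaleP (kap_coeff i (p - half_norm i + w)) (h p))"
  proof -
    have "X Upper i m (X Lower i n f) = P.ratio_mult 0 1 (- (2 * half_norm i)) (kap (Upper, i) (Lower, i))
       (\<lambda>m. P.N2 (Upper, i) (Lower, i) (m 0 + (w + half_norm i)) (m 1 + (- w + half_norm i)) f) m'"
      using X_X[OF f e, of 0 1 Upper i m' Lower i] by (simp add: e_op_inverse w_def BBc m'_def)
    also have "\<dots> = Sum_any (\<lambda>l. scaleP (fps_nth (kap (Upper, i) (Lower, i)) l) (h ((half_norm i - w) + int l)))"
      unfolding P.ratio_mult_def idx h_def by (simp add: algebra_simps)
    also have "\<dots> = (\<Sum>p\<in>{- B..B}. scaleP (if p < half_norm i - w then 0 else fps_nth (kap (Upper, i) (Lower, i)) (nat (p - (half_norm i - w)))) (h p))"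
      by (rule P.Sum_any_int[OF h0])
    also have "\<dots> = (\<Sum>p\<in>{- B..B}. scaleP (kap_coeff i (p - half_norm i + w)) (h p))"
      by (intro sum.cong refl) (auto simp: kap_coeff_def algebra_simps)
    finally show ?thesis .
  qed
  have YX: "X Lower i n (X Upper i m f) = (\<Sum>p\<in>{- B..B}. scaleP (kap_coeff i (- p - half_norm i - w)) (h p))"
  proof -
    have "X Lower i n (X Upper i m f) = P.ratio_mult 1 0 (- (2 * half_norm i)) (kap (Lower, i) (Upper, i))
       (\<lambda>m. P.N2 (Lower, i) (Upper, i) (m 1 + (- w + half_norm i)) (m 0 + (w + half_norm i)) f) m'"
      using X_X[OF f e, of 1 0 Lower i m' Upper i] by (simp add: e_op_inverse' w_def BBc m'_def)
    also have "\<dots> = Sum_any (\<lambda>l. scaleP (fps_nth (kap (Upper, i) (Lower, i)) l) (h (- ((half_norm i + w) + int l))))"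
      unfolding P.ratio_mult_def idx h_def P.N2_sym[of "(Lower, i)"]
      by (simp add: kap_opposite algebra_simps)
    also have "\<dots> = (\<Sum>p\<in>{- B..B}. scaleP (if p < half_norm i + w then 0 else fps_nth (kap (Upper, i) (Lower, i)) (nat (p - (half_norm i + w)))) (h (- p)))"
      by (rule P.Sum_any_int) (rule h0, auto)
    also have "\<dots> = (\<Sum>p\<in>{- B..B}. scaleP (kap_coeff i (p - half_norm i - w)) (h (- p)))"
      by (intro sum.cong refl) (auto simp: kap_coeff_def algebra_simps)
    also have "\<dots> = (\<Sum>p\<in>{- B..B}. scaleP (kap_coeff i (- p - half_norm i - w)) (h p))"
      by (rule sum.reindex_bij_witness[of _ uminus uminus]) auto
    finally show ?thesis .
  qed
  \<comment> \<open>The sums over \<open>p\<close> with coefficients \<open>q\<^sup>p\<close> and \<open>q\<^sup>-\<^sup>p\<close> are the values at \<open>z = q w\<close> and \<open>z = q\<^sup>-\<^sup>1 w\<close>.\<close>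
  define c where "c = (if ?d dvd n then eps_denominator i / (q ^ d i - inverse q ^ d i) else 0)"
  have co: "scaleF (kap_coeff i (p - half_norm i + w) - kap_coeff i (- p - half_norm i - w)) (\<pi> (h p)) =
    scaleF (c * (q powi w * q powi p - q powi (- w) * inverse q powi p)) (\<pi> (h p))" for p
  proof (cases "\<pi> (h p) = 0")
    case nz: False
    have "?d dvd n + p"
    proof (rule ccontr)
      assume "\<not> ?d dvd n + p"
      then have "\<pi> (P.N2 (Lower, i) (Upper, i) (n + p) (m - p) f) = 0" by (rule N2_\<pi>_zero)
      then show False using nz by (simp add: h_def P.N2_sym[of "(Lower, i)"])
    qed
    moreover have "?d dvd p - half_norm i + w \<longleftrightarrow> ?d dvd p"
    proof -
      have "?d dvd w + half_norm i" unfolding w_def by (rule weight_divisible[OF f False e])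
      moreover have "?d dvd 2 * half_norm i" using two_half_norm[OF e] d_dvd_dd[of i] by simp
      ultimately have "?d dvd (w + half_norm i) - 2 * half_norm i" by (rule dvd_diff)
      then have "?d dvd w - half_norm i" by (simp add: algebra_simps)
      then have "?d dvd p + (w - half_norm i) \<longleftrightarrow> ?d dvd p" by (rule dvd_add_left_iff)
      then show ?thesis by (simp add: algebra_simps)
    qed
    ultimately have "?d dvd p - half_norm i + w \<longleftrightarrow> ?d dvd n" by (metis dvd_add_left_iff dvd_add_right_iff)
    then have "kap_coeff i (p - half_norm i + w) - kap_coeff i (- p - half_norm i - w) = c * (q powi (w + p) - q powi (- w - p))"
      unfolding kap_coeff_difference[OF e] c_def by simp
    also have "q powi (w + p) = q powi w * q powi p" using q_nonzero by (simp add: power_int_add)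
    also have "q powi (- w - p) = q powi (- w) * inverse q powi p"
      using q_nonzero by (simp add: power_int_diff power_int_inverse divide_inverse)
    finally show ?thesis by simp
  qed simp
  have "\<pi> (X Upper i m (X Lower i n f) - X Lower i n (X Upper i m f)) =
    (\<Sum>p\<in>{- B..B}. scaleF (kap_coeff i (p - half_norm i + w) - kap_coeff i (- p - half_norm i - w)) (\<pi> (h p)))"
    unfolding XY YX by (simp add: \<pi>_diff \<pi>_sum \<pi>_scale sum_subtractf FF.scale_left_diff_distrib)
  also have "\<dots> = scaleF c (scaleF (q powi w) (\<pi> (\<Sum>p\<in>{- B..B}. scaleP (q powi p) (h p)))
      - scaleF (q powi (- w)) (\<pi> (\<Sum>p\<in>{- B..B}. scaleP (inverse q powi p) (h p))))"
    unfolding co by (simp add: \<pi>_sum \<pi>_scale FF.scale_sum_right FF.scale_left_diff_distrib FF.scale_right_diff_distrib right_diff_distrib sum_subtractf mult.assoc)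
  also have "(\<Sum>p\<in>{- B..B}. scaleP (q powi p) (h p)) = scaleP (rt q powi (m - n)) (P.Ei (phi_exp Upper i) (m + n) f)"
    unfolding h_def by (rule collapse_to_\<Phi>(1)[OF K(2) M]) (simp add: B_def)
  also have "(\<Sum>p\<in>{- B..B}. scaleP (inverse q powi p) (h p)) = scaleP (rt q powi (n - m)) (P.Ei (phi_exp Lower i) (- m - n) f)"
    unfolding h_def by (rule collapse_to_\<Phi>(2)[OF K(2) M]) (simp add: B_def)
  finally show ?thesis
    unfolding \<Phi>_Ei[OF f] c_def w_def by (simp add: \<pi>_scale mult.commute)
qed

end

context graded_module
begin

text \<open>The contractions are polynomials, so the two expansions agree, up to the constant from the commutator map.\<close>

lemma commutator_distinct:
  assumes f: "homog \<gamma> f" and e: "\<And>i. even (orbit_form i i)" and o: "\<Gamma>p i j = {}"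
  shows "X Upper i m (X Lower j n f) = X Lower j n (X Upper i m f)"
proof -
  let ?S = "\<Gamma>m i j"
  let ?a = "weight (simple i) \<gamma> + half_norm i" and ?b = "- weight (simple j) \<gamma> + half_norm j"
  define N where "N = (\<lambda>m :: idx. P.N2 (Upper, i) (Lower, j) (m 0 + ?a) (m 1 + ?b) (e_op Lower j (e_op Upper i f)))"
  define m' where "m' = (\<lambda>t::nat. if t = 0 then m else n)"
  define C0 where "C0 = (\<Prod>r\<in>?S. - (\<xi> powi (- r)))"
  have B: "- orbit_form i j = 0 + int (card ?S)" using orbit_form_card[of i j] o by (simp add: dd_def)
  have B': "- orbit_form j i = 0 + int (card ?S)" using B orbit_form_sym[of j i] by simp
  have l: "ratio_finite 0 1 N" "ratio_finite 1 0 N" unfolding N_def by (rule ratio_finite_N2; simp) (rule ratio_finite_N2'; simp)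
  have c: "cocycle Upper i Lower j = C0"
    by (simp add: cocycle_def C_prod o C0_def power_int_minus prod_inversef[symmetric])
  have evs: "e_op Upper i (e_op Lower j f) = scaleP C0 (e_op Lower j (e_op Upper i f))" by (simp only: e_op_e_op[of Upper i Lower j] c)
  have "X Upper i m (X Lower j n f) = P.ratio_mult 0 1 (- orbit_form i j) (kap (Upper, i) (Lower, j)) (P.scf C0 N) m'"
  proof -
    have "(\<lambda>m :: idx. P.N2 (Upper, i) (Lower, j) (m 0 + ?a) (m 1 + ?b) (e_op Upper i (e_op Lower j f))) = P.scf C0 N"
      by (rule ext) (simp add: N_def P.scf_def evs P.lin_scale[OF P.lin_N2])
    then show ?thesis
      using X_X[OF f e, of 0 1 Upper i m' Lower j] by (simp add: m'_def)
  qed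
  also have "kap (Upper, i) (Lower, j) = (\<Prod>r\<in>?S. fps_const 1 - fps_const (\<xi> powi r) * fps_X) * 1"
    using kap_opp[of Upper Lower i j] by (simp add: o)
  also have "P.ratio_mult 0 1 (- orbit_form i j) \<dots> (P.scf C0 N) = P.scf C0 (P.pact (\<Prod>r\<in>?S. linear_form 1 (\<xi> powi r) 0 1) N)"
    unfolding P.ratio_mult_scf using ratio_mult_forms[OF _ _ l(1) B, where f = 1 and u = "\<lambda>_. 1" and v = "\<lambda>r. \<xi> powi r"] by (simp only: P.ratio_mult_id)
  also have "\<dots> = P.pact (\<Prod>r\<in>?S. linear_form 1 (\<xi> powi (- r)) 1 0) N"
  proof -
    have "(\<Prod>r\<in>?S. linear_form 1 (\<xi> powi (- r)) 1 0) = cst C0 * (\<Prod>r\<in>?S. linear_form 1 (\<xi> powi r) 0 1)"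
    proof -
      have "linear_form 1 (\<xi> powi (- r)) 1 0 = cst (- (\<xi> powi (- r))) * linear_form 1 (\<xi> powi r) 0 1" for r
      proof -
        have "cst (\<xi> powi (- r)) * cst (\<xi> powi r) = 1" using \<xi>_nonzero by (simp add: cst_mult[symmetric] power_int_minus cst_1)
        then show ?thesis by (simp add: linear_form_def cst_minus cst_1 right_diff_distrib mult.assoc[symmetric])
      qed
      moreover have "(\<Prod>r\<in>?S. cst (- (\<xi> powi (- r)))) = cst C0"
        unfolding C0_def by (rule cst_prod)
      ultimately show ?thesis by (simp add: prod.distrib)
    qed
    then show ?thesis by (simp add: P.pact_mult P.pact_cst)
  qed
  also have "\<dots> = P.ratio_mult 1 0 (- orbit_form j i) ((\<Prod>r\<in>?S. fps_const 1 - fps_const (\<xi> powi (- r)) * fps_X) * 1) N"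
    using ratio_mult_forms[OF _ _ l(2) B', where f = 1 and u = "\<lambda>_. 1" and v = "\<lambda>r. \<xi> powi (- r)"] by (simp only: P.ratio_mult_id)
  also have "(\<Prod>r\<in>?S. fps_const 1 - fps_const (\<xi> powi (- r)) * fps_X) * 1 = kap (Lower, j) (Upper, i)"
    using kap_opp'[of Upper Lower j i] by (simp add: o)
  also have "P.ratio_mult 1 0 (- orbit_form j i) (kap (Lower, j) (Upper, i)) N m' = X Lower j n (X Upper i m f)"
    using X_X[OF f e, of 1 0 Lower j m' Upper i] by (simp add: m'_def N_def P.N2_sym[of "(Lower, j)"])
  finally show ?thesis .
qed

end

section \<open>The action of the quotient algebra\<close>

lemma poly_mapping_sum_single: "(\<Sum>w\<in>Poly_Mapping.keys u. Poly_Mapping.single w (Poly_Mapping.lookup u w)) = u"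
  by (rule poly_mapping_eqI) (auto simp: lookup_sum lookup_single when_def in_keys_iff)

lemma free_alg_mult:
  "u * v = (\<Sum>a\<in>Poly_Mapping.keys u. \<Sum>b\<in>Poly_Mapping.keys v.
     Poly_Mapping.single (a + b) (Poly_Mapping.lookup u a * Poly_Mapping.lookup v b))"
  for u v :: "'a free_alg"
proof -
  have "u * v = (\<Sum>a\<in>Poly_Mapping.keys u. Poly_Mapping.single a (Poly_Mapping.lookup u a)) *
     (\<Sum>b\<in>Poly_Mapping.keys v. Poly_Mapping.single b (Poly_Mapping.lookup v b))"
    by (simp only: poly_mapping_sum_single)
  then show ?thesis by (simp only: sum_product mult_single)
qed

lemma ring_free_ring: "ring (free_ring :: 'a free_alg ring)"
proof (rule ringI)
  show "abelian_group (free_ring :: 'a free_alg ring)"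
  proof (rule abelian_groupI)
    fix u assume "u \<in> carrier (free_ring :: 'a free_alg ring)"
    show "\<exists>y\<in>carrier free_ring. y \<oplus>\<^bsub>free_ring\<^esub> u = \<zero>\<^bsub>free_ring\<^esub>"
      by (rule bexI[of _ "- u"]) (simp_all add: free_ring_def)
  qed (simp_all add: free_ring_def add_ac)
  show "Group.monoid (free_ring :: 'a free_alg ring)"
    by (rule monoidI) (simp_all add: free_ring_def mult.assoc)
qed (simp_all add: free_ring_def distrib_left distrib_right)

context fock_space
begin

interpretation FF: vector_space scaleF
  using \<pi>_linear by (simp add: Vector_Spaces.linear_def)

lemma trivial_or_even: "(\<forall>u v :: ('i, 't) poly_tensor. u = v) \<or> (\<forall>i. even (orbit_form i i))"
proof (cases "\<exists>t :: 't. t \<noteq> 0")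
  case True then show ?thesis using even_orbit_form by blast
next
  case False
  then have "u = v" for u v :: "('i, 't) poly_tensor" by (intro poly_mapping_eqI) metis
  then show ?thesis by blast
qed

lemma lin_X_always: "P.lin (X s i m)"
  using trivial_or_even
proof
  assume t: "\<forall>u v :: ('i, 't) poly_tensor. u = v"
  show ?thesis by (rule P.linI) (rule t[rule_format])+
qed (use lin_X in blast)

lemma keeps_X_always: "keeps (X s i m)"
  using trivial_or_even
proof
  assume t: "\<forall>u v :: ('i, 't) poly_tensor. u = v"
  have "\<pi> (X s i m u) = 0" for u using \<pi>_0 t[rule_format, of "X s i m u" 0] by simp
  then show ?thesis by (simp add: keeps_def lin_X_always)
qed (use keeps_X in blast)

fun gen_op :: "'i gens \<Rightarrow> ('i, 't) poly_tensor \<Rightarrow> ('i, 't) poly_tensor" where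
  "gen_op (gK \<alpha>) v = onT (pow_orbit q \<alpha>) v"
| "gen_op (gH s i n) v = \<alpha>op i (sg s * int (Suc n)) v"
| "gen_op (gX s i m) v = scaleP (\<epsilon> i) (X s i m v)"
| "gen_op (gC s) v = scaleP (rt q powi sg s) v"

fun word_op :: "'i gens list \<Rightarrow> ('i, 't) poly_tensor \<Rightarrow> ('i, 't) poly_tensor" where
  "word_op [] v = v"
| "word_op (y # ys) v = gen_op y (word_op ys v)"

definition \<Psi> :: "'i gens free_alg \<Rightarrow> ('i, 't) poly_tensor \<Rightarrow> ('i, 't) poly_tensor" where
  "\<Psi> u v = (\<Sum>w\<in>Poly_Mapping.keys u. scaleP (Poly_Mapping.lookup u w) (word_op (letters w) v))"

lemma keeps_gen_op: "keeps (gen_op y)"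
proof (cases y)
  case (gK \<alpha>)
  have "gen_op y = onT (pow_orbit q \<alpha>)" by (simp add: gK fun_eq_iff)
  then show ?thesis by (simp add: keeps_onT lin_pow_orbit)
next
  case (gH s i n)
  have "gen_op y = \<alpha>op i (sg s * int (Suc n))" by (simp add: gH fun_eq_iff)
  then show ?thesis by (simp add: keeps_\<alpha>op)
next
  case (gX s i m)
  have "gen_op y = (\<lambda>v. scaleP (\<epsilon> i) (X s i m v))" by (simp add: gX fun_eq_iff)
  then show ?thesis using keeps_scale[OF keeps_X_always] by simp
next
  case (gC s)
  have "gen_op y = (\<lambda>v. scaleP (rt q powi sg s) v)" by (simp add: gC fun_eq_iff)
  then show ?thesis using keeps_scale[OF keeps_id] by simp
qed

lemma keeps_word_op: "keeps (word_op ys)"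
proof (induction ys)
  case Nil
  have "word_op [] = (\<lambda>v. v)" by (simp add: fun_eq_iff)
  then show ?case by (simp add: keeps_id)
next
  case (Cons y ys)
  have "word_op (y # ys) = (\<lambda>v. gen_op y (word_op ys v))" by (simp add: fun_eq_iff)
  then show ?case using keeps_comp[OF keeps_gen_op Cons] by simp
qed

lemma word_op_append: "word_op (ys @ zs) v = word_op ys (word_op zs v)"
  by (induction ys) auto

lemma keeps_\<Psi>: "keeps (\<Psi> u)"
  unfolding \<Psi>_def[abs_def] by (rule keeps_sum, rule keeps_scale, rule keeps_word_op)

lemma lin_\<Psi>: "P.lin (\<Psi> u)" by (rule keeps_lin[OF keeps_\<Psi>])

lemma \<Psi>_superset:
  "finite S \<Longrightarrow> Poly_Mapping.keys u \<subseteq> S \<Longrightarrow> \<Psi> u v = (\<Sum>w\<in>S. scaleP (Poly_Mapping.lookup u w) (word_op (letters w) v))"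
  unfolding \<Psi>_def by (rule sum.mono_neutral_left) (auto simp: in_keys_iff)

lemma \<Psi>_add: "\<Psi> (u + u') v = \<Psi> u v + \<Psi> u' v"
proof -
  let ?S = "Poly_Mapping.keys u \<union> Poly_Mapping.keys u'"
  have "\<Psi> (u + u') v = (\<Sum>w\<in>?S. scaleP (Poly_Mapping.lookup (u + u') w) (word_op (letters w) v))"
    by (rule \<Psi>_superset) (use keys_add[of u u'] in auto)
  moreover have "\<Psi> u v = (\<Sum>w\<in>?S. scaleP (Poly_Mapping.lookup u w) (word_op (letters w) v))"
    "\<Psi> u' v = (\<Sum>w\<in>?S. scaleP (Poly_Mapping.lookup u' w) (word_op (letters w) v))"
    by (rule \<Psi>_superset; auto)+
  ultimately show ?thesis by (simp add: lookup_add P.scale_left_distrib sum.distrib)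
qed

lemma \<Psi>_0: "\<Psi> 0 v = 0" by (simp add: \<Psi>_def)
lemma \<Psi>_diff: "\<Psi> (u - u') v = \<Psi> u v - \<Psi> u' v"
  using \<Psi>_add[of "u - u'" u' v] by (simp add: algebra_simps)
lemma \<Psi>_sum: "\<Psi> (sum h S) v = (\<Sum>a\<in>S. \<Psi> (h a) v)"
  by (induction S rule: infinite_finite_induct) (auto simp: \<Psi>_0 \<Psi>_add)
lemma \<Psi>_single: "\<Psi> (Poly_Mapping.single w c) v = scaleP c (word_op (letters w) v)"
  using \<Psi>_superset[of "{w}" "Poly_Mapping.single w c" v] by (simp add: keys_single)
lemma \<Psi>_sc: "\<Psi> (sc c) v = scaleP c v"
  by (simp add: sc_def \<Psi>_single zero_word_def)
lemma \<Psi>_gen: "\<Psi> (gen y) v = gen_op y v"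
  by (simp add: gen_def \<Psi>_single)
lemma \<Psi>_1: "\<Psi> 1 v = v"
  by (simp add: \<Psi>_single zero_word_def flip: single_one)

lemma \<Psi>_mult: "\<Psi> (u * u') v = \<Psi> u (\<Psi> u' v)"
proof -
  have "\<Psi> (u * u') v = (\<Sum>a\<in>Poly_Mapping.keys u. \<Sum>b\<in>Poly_Mapping.keys u'.
     scaleP (Poly_Mapping.lookup u a * Poly_Mapping.lookup u' b) (word_op (letters a) (word_op (letters b) v)))"
    unfolding free_alg_mult \<Psi>_sum \<Psi>_single by (simp add: plus_word_def word_op_append)
  also have "\<dots> = \<Psi> u (\<Psi> u' v)"
    by (simp add: \<Psi>_def P.lin_sum[OF keeps_lin[OF keeps_word_op]] P.lin_scale[OF keeps_lin[OF keeps_word_op]] P.scale_sum_right)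
  finally show ?thesis .
qed

lemmas \<Psi>_simps = \<Psi>_add \<Psi>_0 \<Psi>_diff \<Psi>_sum \<Psi>_sc \<Psi>_gen \<Psi>_1 \<Psi>_mult

lemma \<Psi>_k: "\<Psi> (k \<alpha>) v = onT (pow_orbit q \<alpha>) v" by (simp add: k_def \<Psi>_gen)
lemma \<Psi>_x: "\<Psi> (x s i m) v = scaleP (\<epsilon> i) (X s i m v)" by (simp add: x_def \<Psi>_gen)
lemma \<Psi>_qc: "\<Psi> (qc s) v = scaleP (rt q powi sg s) v" by (simp add: qc_def \<Psi>_gen)

lemma \<Psi>_qch: "\<Psi> (qch n) v = scaleP (rt q powi n) v"
proof -
  have p: "\<Psi> (qc s ^ l) v = scaleP ((rt q powi sg s) ^ l) v" for s l
    by (induction l) (simp_all add: \<Psi>_simps \<Psi>_qc)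
  show ?thesis
  proof (cases "n \<ge> 0")
    case True
    then show ?thesis by (simp add: qch_def p powi_nat_power[of n, where a = 1, simplified])
  next
    case False
    then have "(rt q powi (- 1)) ^ nat (- n) = rt q powi n" by (subst powi_nat_power) simp_all
    then show ?thesis using False by (simp add: qch_def p)
  qed
qed

lemma \<Psi>_fps_exp:
  assumes "\<And>r v. \<Psi> (fps_nth h r) v = f r v"
  shows "\<Psi> (fps_exp_coeff h n) v = P.E f n v"
proof -
  have "\<Psi> (fps_nth (h ^ p) n) v = opser_pow f p n v" for p n
  proof (induction p arbitrary: n)
    case (Suc p)
    then show ?case by (simp add: fps_mult_nth \<Psi>_simps assms atMost_atLeast0)
  qed (simp add: \<Psi>_1 \<Psi>_0)
  then show ?thesis by (simp add: fps_exp_coeff_def opser_exp_coeff_def \<Psi>_simps)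
qed

lemma pow_orbit_signed_root: "pow_orbit q (\<lambda>j. sg s * simple i j) t = pow_orbit (q powi sg s) (simple i) t"
  unfolding pow_orbit_def
proof (rule sum.cong[OF refl])
  fix \<gamma> assume "\<gamma> \<in> {\<gamma>. comp \<gamma> t \<noteq> 0}"
  then have \<gamma>: "\<gamma> \<in> Q_orb" using comp_out by blast
  have "weight (\<lambda>j. sg s * simple i j) \<gamma> = sg s * weight (simple i) \<gamma>"
    using weight_uminus_left[OF \<gamma>, of "simple i"] by (cases s) (simp_all add: fun_Compl_def)
  then show "scaleT (q powi weight (\<lambda>j. sg s * simple i j) \<gamma>) (comp \<gamma> t) = scaleT ((q powi sg s) powi weight (simple i) \<gamma>) (comp \<gamma> t)"
    by (simp add: power_int_mult)
qed

lemma \<Psi>_\<phi>: "\<Psi> (\<phi> s i m) v = \<Phi> s i m v"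
proof (cases "sg s * m < 0")
  case False
  let ?f = "\<lambda>n v. if n = 0 then 0 else scaleP (of_int (sg s) * (q - inverse q)) (\<alpha>op i (sg s * int n) v)"
  have "\<Psi> (fps_exp_coeff (Abs_fps (\<lambda>n. if n = 0 then 0 else sc (of_int (sg s) * (q - inverse q)) * gen (gH s i (n - 1)))) l) v = P.E ?f l v" for l
    by (rule \<Psi>_fps_exp) (simp add: \<Psi>_simps)
  moreover have "onT (pow_orbit q (\<lambda>j. sg s * simple i j)) = onT (pow_orbit (q powi sg s) (simple i))"
    by (simp add: pow_orbit_signed_root[abs_def])
  ultimately show ?thesis using False by (simp add: \<phi>_def \<Phi>_def \<Psi>_mult \<Psi>_k)
qed (simp add: \<phi>_def \<Phi>_def \<Psi>_0)

lemma \<Psi>_poly_act: "\<Psi> (poly_act R D m) v = P.pact R (\<lambda>m. \<Psi> (D m) v) m'"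
  if "\<And>t. t \<le> 2 \<Longrightarrow> m t = m' t"
    and "\<And>m m'. (\<And>t. t \<le> 2 \<Longrightarrow> m t = m' t) \<Longrightarrow> D m = D m'"
proof -
  have "D (\<lambda>t. m t + int (if t = 0 then a else if t = 1 then b else c)) = D (m' + (sv 0 (int a) + sv 1 (int b) + sv 2 (int c)))" for a b c
    by (rule that(2)) (use that(1) in \<open>auto simp: sv_def min_def\<close>)
  then show ?thesis unfolding poly_act_def P.pact_nested by (simp add: \<Psi>_simps)
qed

lemma d_rot: "d (rot r i) = d i" and dd_rot: "dd (rot r i) (rot r i) = dd i i"
proof -
  have "rot_entry (rot r i) (rot r i) b = rot_entry i i b" for b
    by (simp add: rot_entry_shift_left rot_entry_shift[symmetric])
  then have "\<Gamma>p (rot r i) (rot r i) = \<Gamma>p i i" "\<Gamma>m (rot r i) (rot r i) = \<Gamma>m i i"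
    by (auto simp: \<Gamma>p_iff \<Gamma>m_iff)
  then show "d (rot r i) = d i" "dd (rot r i) (rot r i) = dd i i" by (simp_all add: d_def dd_def)
qed

lemma \<epsilon>_rot: "\<epsilon> (rot r i) = \<epsilon> i" by (simp add: \<epsilon>_def d_rot dd_rot)

lemma \<epsilon>_square: "\<epsilon> i * \<epsilon> i * (eps_denominator i / (q ^ d i - inverse q ^ d i)) = of_nat (d i) / (q - inverse q)"
proof -
  have D: "qint q (int (d i)) = (q ^ d i - inverse q ^ d i) / (q - inverse q)"
    by (simp add: qint_def power_int_minus power_inverse)
  have "\<epsilon> i * \<epsilon> i * eps_denominator i = of_nat (d i) * qint q (int (d i))"
  proof (cases "dd i i > 0")
    case True
    define b where "b = rt q ^ dd i i"
    have b0: "b \<noteq> 0" using rt_q_nonzero by (simp add: b_def)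
    have b2: "b * b = q ^ dd i i"
      unfolding b_def power_mult_distrib[symmetric] using rt_square[of q] by (simp add: power2_eq_square)
    have "b * b \<noteq> 1" unfolding b2 using q_generic[OF True] by simp
    then have n1: "b - inverse b \<noteq> 0" using b0 by (auto simp: field_simps)
    have "(b * b) * (b * b) \<noteq> 1"
      unfolding b2 power_add[symmetric] using q_generic[of "dd i i + dd i i"] True by simp
    moreover have "(b * b) * (b * b) = 1" if "b + inverse b = 0"
    proof -
      have "b * b + 1 = b * (b + inverse b)" using b0 by (simp add: distrib_left)
      then have "b * b = - 1" using that by (simp add: eq_neg_iff_add_eq_0)
      then show ?thesis by simp
    qed
    ultimately have n2: "b + inverse b \<noteq> 0" by blast
    have "qint b 2 = b + inverse b"
    proof -
      have "b powi 2 - b powi (- 2) = (b + inverse b) * (b - inverse b)"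
        using b0 by (simp add: power_int_minus power2_eq_square algebra_simps)
      then show ?thesis using n1 by (simp add: qint_def)
    qed
    then show ?thesis
      using True rt_square[of "of_nat (d i) * qint q (int (d i)) / qint b 2"] n2
      by (simp add: \<epsilon>_def eps_denominator_def b_def[symmetric] power2_eq_square)
  next
    case False
    then show ?thesis
      using rt_square[of "of_nat (d i) * qint q (int (d i))"]
      by (simp add: \<epsilon>_def eps_denominator_def power2_eq_square)
  qed
  then show ?thesis using q_d_ne[of i] q_diff_ne unfolding D
    by (simp add: field_simps)
qed

text \<open>If \<open>i\<close> lies in the orbit of \<open>j\<close>, rotation symmetry reduces the claim to \<open>i = j\<close>.\<close>

lemma commutator_general:
  assumes f: "homog \<gamma> f" and e: "\<And>i. even (orbit_form i i)"
  shows "scaleF (\<epsilon> i * \<epsilon> j) (\<pi> (X Upper i m (X Lower j n f) - X Lower j n (X Upper i m f))) =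
    scaleF (1 / (q - inverse q)) (\<Sum>r\<in>{r \<in> ZN. i = (\<mu> ^^ nat r) j}. scaleF (\<xi> powi (- r * n))
      (scaleF (rt q powi (m - n)) (\<pi> (\<Phi> Upper i (m + n) f)) - scaleF (rt q powi (n - m)) (\<pi> (\<Phi> Lower i (m + n) f))))"
proof -
  let ?R = "{r \<in> ZN. i = (\<mu> ^^ nat r) j}"
  have R: "?R = \<Gamma>p i j" by (auto simp: \<Gamma>p_iff rot_entry_2 rot_ZN)
  show ?thesis
  proof (cases "\<Gamma>p i j = {}")
    case True
    then show ?thesis unfolding R commutator_distinct[OF f e True] by (simp add: \<pi>_0)
  next
    case False
    then obtain r0 where "r0 \<in> \<Gamma>p i j" by blast
    then have r0: "r0 \<in> ZN" "i = rot r0 j" by (auto simp: \<Gamma>p_iff rot_entry_2)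
    let ?Z = "\<lambda>i. scaleF (rt q powi (m - n)) (\<pi> (\<Phi> Upper i (m + n) f)) - scaleF (rt q powi (n - m)) (\<pi> (\<Phi> Lower i (m + n) f))"
    have Z: "?Z i = scaleF (\<xi> powi (r0 * (m + n))) (?Z j)"
      unfolding r0(2) \<Phi>_similar[OF f] by (simp add: FF.scale_right_diff_distrib mult.commute)
    have "\<pi> (X Upper i m (X Lower j n f) - X Lower j n (X Upper i m f)) =
      scaleF (\<xi> powi (r0 * m)) (\<pi> (X Upper j m (X Lower j n f) - X Lower j n (X Upper j m f)))"
      unfolding \<pi>_diff r0(2) X_similar[OF hom_X[OF f e] e] keeps_scaled[OF keeps_X[OF e] X_similar[OF f e]]
      by (simp add: FF.scale_right_diff_distrib)
    also have "\<dots> = scaleF (\<xi> powi (r0 * m) * (if int (d j) dvd n then eps_denominator j / (q ^ d j - inverse q ^ d j) else 0)) (?Z j)"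
      unfolding commutator_same[OF f e] by simp
    finally have L: "\<pi> (X Upper i m (X Lower j n f) - X Lower j n (X Upper i m f)) = \<dots>" .
    have S: "(\<Sum>r\<in>?R. \<xi> powi (- r * n)) = \<xi> powi (- r0 * n) * (if int (d j) dvd n then of_nat (d j) else 0)"
      unfolding R unfolding r0(2) sum_over_rotations sum_over_stabilizer ..
    have p: "\<xi> powi (- r0 * n) * \<xi> powi (r0 * (m + n)) = \<xi> powi (r0 * m)"
      using \<xi>_nonzero by (simp add: power_int_add[symmetric] algebra_simps)
    have "scaleF (\<epsilon> i * \<epsilon> j) (\<pi> (X Upper i m (X Lower j n f) - X Lower j n (X Upper i m f))) =
      scaleF (\<xi> powi (r0 * m) * (if int (d j) dvd n then of_nat (d j) / (q - inverse q) else 0)) (?Z j)"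
      unfolding L unfolding r0(2) \<epsilon>_rot \<epsilon>_square[symmetric] by (simp add: mult_ac)
    also have "\<dots> = scaleF (1 / (q - inverse q)) (scaleF (\<xi> powi (- r0 * n) * (if int (d j) dvd n then of_nat (d j) else 0)) (?Z i))"
      unfolding Z p[symmetric] by (simp add: mult_ac)
    finally show ?thesis unfolding S[symmetric] by (simp add: FF.scale_sum_left)
  qed
qed

lemma pact_scale: "P.pact R (\<lambda>m. scaleP c (D m)) m = scaleP c (P.pact R D m)"
proof -
  have "(\<lambda>m. scaleP c (D m)) = P.pact (cst c) D" by (simp add: P.pact_cst P.scf_def fun_eq_iff)
  moreover have "P.pact R (P.pact (cst c) D) m = scaleP c (P.pact R D m)"
    unfolding P.pact_commute[of R "cst c"] by (simp add: P.pact_cst P.scf_def)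
  ultimately show ?thesis by simp
qed

lemma \<Psi>_xx: "\<Psi> (x s i m * x t j n) v = scaleP (\<epsilon> i * \<epsilon> j) (X s i m (X t j n v))"
  by (simp add: \<Psi>_simps \<Psi>_x P.lin_scale[OF lin_X_always] mult.commute)

lemma \<Psi>_xxx: "\<Psi> (x s i m * x t j n * x r l p) v = scaleP (\<epsilon> i * \<epsilon> j * \<epsilon> l) (X s i m (X t j n (X r l p v)))"
  by (simp add: \<Psi>_simps \<Psi>_x P.lin_scale[OF lin_X_always] mult_ac)

lemma sum_permutes_3_small: "\<sigma> permutes {0, 1, 2 :: nat} \<Longrightarrow> \<sigma> 0 \<le> 2 \<and> \<sigma> 1 \<le> 2 \<and> \<sigma> 2 \<le> 2"
  using permutes_in_image[of \<sigma> "{0, 1, 2}" 0] permutes_in_image[of \<sigma> "{0, 1, 2}" 1] permutes_in_image[of \<sigma> "{0, 1, 2}" 2] by auto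

lemma sum_permutes_2_small: "\<sigma> permutes {0, 1 :: nat} \<Longrightarrow> \<sigma> 0 \<le> 2 \<and> \<sigma> 1 \<le> 2"
  using permutes_in_image[of \<sigma> "{0, 1}" 0] permutes_in_image[of \<sigma> "{0, 1}" 1] by auto

text \<open>Each relation for currents is the corresponding result above, with the constants \<open>\<epsilon>\<close> taken out.\<close>

lemma defrel_homog:
  assumes r: "defrel u v" and f: "homog \<gamma> f" and e: "\<And>i. even (orbit_form i i)"
  shows "\<pi> (\<Psi> u f) = \<pi> (\<Psi> v f)"
  using r
proof cases
  case (Q0_x s i m)
  have "\<pi> (X s (\<mu> i) m f) = scaleF (\<xi> powi m) (\<pi> (X s i m f))" using X_similar[OF f e, of s 1 i m] by (simp add: rot_1)
  moreover have "\<epsilon> (\<mu> i) = \<epsilon> i" using \<epsilon>_rot[of 1 i] by (simp add: rot_1)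
  ultimately show ?thesis unfolding Q0_x by (simp add: \<Psi>_simps \<Psi>_x \<pi>_scale mult.commute)
next
  case (Q0_\<phi> s i m)
  then show ?thesis using \<Phi>_similar[OF f, of s 1 i m] by (simp add: \<Psi>_simps \<Psi>_\<phi> rot_1 \<pi>_scale)
next
  case (Q0_k \<alpha>)
  then show ?thesis by (simp add: \<Psi>_k onT_pow_hom[OF f] weight_\<mu>[OF hom_orb[OF f]])
next
  case Q1_ul
  then show ?thesis using rt_q_nonzero by (simp add: \<Psi>_simps \<Psi>_qc power_int_minus)
next
  case Q1_lu
  then show ?thesis using rt_q_nonzero by (simp add: \<Psi>_simps \<Psi>_qc power_int_minus)
next
  case (Q1_central s y)
  then show ?thesis by (simp add: \<Psi>_simps \<Psi>_qc P.lin_scale[OF lin_\<Psi>])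
next
  case (Q2_k \<alpha> \<beta>)
  then show ?thesis using q_nonzero
    by (simp add: \<Psi>_simps \<Psi>_k onT_pow_hom[OF f] onT_pow_hom[OF hom_scaleP[OF f]] weight_add_left[OF hom_orb[OF f]] power_int_add mult.commute)
next
  case Q2_k0
  then show ?thesis by (simp add: \<Psi>_simps \<Psi>_k onT_pow_hom[OF f] weight_0_left[OF hom_orb[OF f]])
next
  case (Q2_\<phi> s i m j n)
  then show ?thesis using \<Phi>_\<Phi>[OF f, of s i m j n] by (simp add: \<Psi>_simps \<Psi>_\<phi>)
next
  case (Q2_k\<phi> \<alpha> s i m)
  then show ?thesis
    by (simp add: \<Psi>_simps \<Psi>_\<phi> \<Psi>_k onT_pow_hom[OF f] onT_pow_hom[OF hom_\<Phi>[OF f]] P.lin_scale[OF lin_\<Phi>])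
next
  case (Q3 \<alpha> s i m)
  have \<gamma>: "\<gamma> \<in> Q_orb" by (rule hom_orb[OF f])
  have cancel: "q powi a * (inverse (q powi a) * b) = b" for a b using q_nonzero by simp
  have "(\<Sum>n<N. form \<alpha> (simple ((\<mu> ^^ n) i))) = form (orbit_sum \<alpha>) (simple i)"
    unfolding form_orbit_sum unfolding orbit_sum_def form_sum_right by (simp add: \<mu>Q_pow_simple)
  moreover have "form (orbit_sum \<alpha>) (signed_root s i) = sg s * form (orbit_sum \<alpha>) (simple i)"
    by (cases s) (simp_all add: signed_root_Upper signed_root_Lower form_uminus_right)
  ultimately have "weight \<alpha> (\<gamma> + orbit_sum (signed_root s i)) = weight \<alpha> \<gamma> + sg s * (\<Sum>n<N. form \<alpha> (simple ((\<mu> ^^ n) i)))"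
    by (simp add: weight_add[OF \<gamma>])
  then show ?thesis
    unfolding Q3 using q_nonzero
    by (simp add: cancel \<Psi>_simps \<Psi>_k \<Psi>_x onT_pow_hom[OF f] P.lin_scale[OF lin_X_always]
      P.lin_scale[OF lin_onT[OF lin_pow_orbit]] onT_pow_hom[OF hom_X[OF f e]] weight_uminus_left[OF \<gamma>]
      power_int_add power_int_minus mult_ac)
next
  case (Q4 i m j n)
  have gg: "\<Psi> (gg i j l) f = scaleP (\<Sum>r\<le>l. fps_nth (inverse (g i j)) r * fps_nth (g i j) (l - r) * q powi (int r - int (l - r))) f" for l
  proof -
    have "rt q powi (2 * a) = q powi a" for a by (simp add: power_int_mult rt_square)
    then have "rt q powi (2 * a - 2 * b) = q powi (a - b)" for a b :: int
      by (simp only: right_diff_distrib[symmetric])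
    then show ?thesis
      by (simp only: gg_def \<Psi>_sum \<Psi>_mult \<Psi>_sc \<Psi>_qch P.scale_scale P.scale_sum_left)
  qed
  show ?thesis unfolding Q4 \<Psi>_mult \<Psi>_\<phi> heisenberg_relation[OF f] \<Psi>_sum gg by (simp add: P.lin_scale[OF lin_\<Phi>])
next
  case (Q5 i m s j n)
  show ?thesis unfolding Q5 \<Psi>_mult \<Psi>_\<phi> \<Psi>_x \<Psi>_sum \<Psi>_sc \<Psi>_qch P.lin_scale[OF lin_\<Phi>] P.lin_scale[OF lin_X_always] \<Phi>_Upper_X[OF f e]
    by (simp add: P.scale_sum_right mult_ac)
next
  case (Q6 i m s j n)
  show ?thesis unfolding Q6 \<Psi>_mult \<Psi>_\<phi> \<Psi>_x \<Psi>_sum \<Psi>_sc \<Psi>_qch P.lin_scale[OF lin_\<Phi>] P.lin_scale[OF lin_X_always] \<Phi>_Lower_X[OF f e]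
    by (simp add: P.scale_sum_right mult_ac)
next
  case (Q7 i m j n)
  have "\<pi> (\<Psi> u f) = scaleF (\<epsilon> i * \<epsilon> j) (\<pi> (X Upper i m (X Lower j n f) - X Lower j n (X Upper i m f)))"
    unfolding Q7 \<Psi>_diff \<Psi>_xx by (simp add: \<pi>_diff \<pi>_scale FF.scale_right_diff_distrib mult.commute)
  also have "\<dots> = \<pi> (\<Psi> v f)"
    unfolding commutator_general[OF f e] Q7
    by (simp add: \<Psi>_simps \<Psi>_\<phi> \<Psi>_qch \<pi>_scale \<pi>_sum \<pi>_diff P.lin_scale[OF lin_\<Phi>])
  finally show ?thesis .
next
  case (Q8 s i j m)
  have "\<Psi> (poly_act (F s i j (zv 0) (zv 1)) (\<lambda>m. x s i (m 0) * x s j (m 1)) m) f =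
     P.pact (F s i j (zv 0) (zv 1)) (\<lambda>m. \<Psi> (x s i (m 0) * x s j (m 1)) f) m"
    by (rule \<Psi>_poly_act) simp_all
  moreover have "\<Psi> (poly_act (G s i j (zv 0) (zv 1)) (\<lambda>m. x s j (m 1) * x s i (m 0)) m) f =
     P.pact (G s i j (zv 0) (zv 1)) (\<lambda>m. \<Psi> (x s j (m 1) * x s i (m 0)) f) m"
    by (rule \<Psi>_poly_act) simp_all
  ultimately show ?thesis
    unfolding Q8 \<Psi>_xx pact_scale quadratic_relation[OF f e] by (simp only: mult.commute)
next
  case (Q9 i j s m)
  let ?D = "\<lambda>\<sigma> (m :: idx). x s i (m (\<sigma> 0)) * x s i (m (\<sigma> 1)) * x s j (m 2)
                   - sc (qint (q ^ dd i j) 2) * x s i (m (\<sigma> 0)) * x s j (m 2) * x s i (m (\<sigma> 1))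
                   + x s j (m 2) * x s i (m (\<sigma> 0)) * x s i (m (\<sigma> 1))"
  let ?E = "\<lambda>\<sigma> (m :: idx). X s i (m (\<sigma> 0)) (X s i (m (\<sigma> 1)) (X s j (m 2) f))
          - scaleP (qint (q ^ dd i j) 2) (X s i (m (\<sigma> 0)) (X s j (m 2) (X s i (m (\<sigma> 1)) f)))
          + X s j (m 2) (X s i (m (\<sigma> 0)) (X s i (m (\<sigma> 1)) f))"
  define c where "c = \<epsilon> i * \<epsilon> i * \<epsilon> j"
  have "\<Psi> (poly_act (p2 s i j (zv (\<sigma> 0)) (zv (\<sigma> 1))) (?D \<sigma>) m) f =
    scaleP c (P.pact (p2 s i j (zv (\<sigma> 0)) (zv (\<sigma> 1))) (?E \<sigma>) m)" if "\<sigma> permutes {0, 1}" for \<sigma>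
  proof -
    have "\<Psi> (poly_act (p2 s i j (zv (\<sigma> 0)) (zv (\<sigma> 1))) (?D \<sigma>) m) f =
      P.pact (p2 s i j (zv (\<sigma> 0)) (zv (\<sigma> 1)))
              (\<lambda>m. \<Psi> (?D \<sigma> m) f) m"
      by (rule \<Psi>_poly_act) (use sum_permutes_2_small[OF that] in simp_all)
    moreover have "\<Psi> (?D \<sigma> m) f =
      scaleP c (?E \<sigma> m)" for m :: idx
    proof -
      have "\<Psi> (sc b * x s i m1 * x s j m2 * x s i m3) f = scaleP c (scaleP b (X s i m1 (X s j m2 (X s i m3 f))))" for b m1 m2 m3
        unfolding mult.assoc[of "sc b"] by (simp only: \<Psi>_mult[of "sc b"] \<Psi>_sc \<Psi>_xxx P.scale_scale c_def) (simp only: mult_ac)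
      then show ?thesis
        by (simp only: \<Psi>_add \<Psi>_diff \<Psi>_xxx) (simp add: P.scale_right_distrib P.scale_right_diff_distrib c_def mult_ac)
    qed
    ultimately show ?thesis by (simp only: pact_scale)
  qed
  then have "\<Psi> u f = scaleP c ((\<Sum>\<sigma>\<in>{\<sigma>. \<sigma> permutes {0, 1}}. P.pact (p2 s i j (zv (\<sigma> 0)) (zv (\<sigma> 1))) (?E \<sigma>)) m)"
    unfolding Q9(1) \<Psi>_sum by (simp add: P.scale_sum_right P.sum_fun_apply)
  then show ?thesis
    unfolding quadratic_serre_relation[OF f e Q9(3,4)] Q9(2) by (simp add: \<Psi>_0)
next
  case (Q10 i s m)
  have "\<Psi> (poly_act (p3 s i (zv (\<sigma> 0)) (zv (\<sigma> 1)) (zv (\<sigma> 2)))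
              (\<lambda>m. x s i (m (\<sigma> 0)) * x s i (m (\<sigma> 1)) * x s i (m (\<sigma> 2))) m) f =
    scaleP (\<epsilon> i * \<epsilon> i * \<epsilon> i) (P.pact (p3 s i (zv (\<sigma> 0)) (zv (\<sigma> 1)) (zv (\<sigma> 2)))
       (\<lambda>m. X s i (m (\<sigma> 0)) (X s i (m (\<sigma> 1)) (X s i (m (\<sigma> 2)) f))) m)" if "\<sigma> permutes {0, 1, 2}" for \<sigma>
    unfolding pact_scale[symmetric] \<Psi>_xxx[symmetric]
    by (rule \<Psi>_poly_act) (use sum_permutes_3_small[OF that] in simp_all)
  then have "\<Psi> u f = scaleP (\<epsilon> i * \<epsilon> i * \<epsilon> i) ((\<Sum>\<sigma>\<in>{\<sigma>. \<sigma> permutes {0, 1, 2}}. P.pact (p3 s i (zv (\<sigma> 0)) (zv (\<sigma> 1)) (zv (\<sigma> 2)))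
       (\<lambda>m. X s i (m (\<sigma> 0)) (X s i (m (\<sigma> 1)) (X s i (m (\<sigma> 2)) f)))) m)"
    unfolding Q10(1) \<Psi>_sum by (simp add: P.scale_sum_right P.sum_fun_apply)
  then show ?thesis
    unfolding cubic_serre_relation[OF f e Q10(3)] Q10(2) by (simp add: \<Psi>_0)
qed

lemma defrel_sound:
  assumes d: "defrel u v" shows "\<pi> (\<Psi> u f) = \<pi> (\<Psi> v f)"
  using trivial_or_even
proof
  assume t: "\<forall>u v :: ('i, 't) poly_tensor. u = v"
  show ?thesis using t[rule_format, of "\<Psi> u f" "\<Psi> v f"] by simp
next
  assume e: "\<forall>i. even (orbit_form i i)"
  show ?thesis
    by (rule lin_ext_hom[of "\<lambda>f. \<pi> (\<Psi> u f)" "\<lambda>f. \<pi> (\<Psi> v f)"])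
      (use defrel_homog[OF d] e in \<open>simp_all add: P.lin_add[OF lin_\<Psi>] \<pi>_add\<close>)
qed

definition annihilator :: "'i gens free_alg set" where
  "annihilator = {u. \<forall>v. \<pi> (\<Psi> u v) = 0}"

lemma ideal_annihilator: "ideal annihilator free_ring"
proof (rule idealI[OF ring_free_ring])
  interpret R: ring "free_ring :: 'i gens free_alg ring" by (rule ring_free_ring)
  have m: "\<ominus>\<^bsub>free_ring\<^esub> u = - u" for u :: "'i gens free_alg"
    using R.minus_equality[of "- u" u] by (simp add: free_ring_def)
  show "subgroup annihilator (add_monoid free_ring)"
  proof (rule subgroup.intro)
    fix u assume "u \<in> annihilator"
    then show "inv\<^bsub>add_monoid free_ring\<^esub> u \<in> annihilator"
      using m[of u] \<Psi>_diff[of 0 u] by (simp add: a_inv_def annihilator_def \<Psi>_0 \<pi>_diff[of 0, simplified] \<pi>_0)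
  qed (auto simp: free_ring_def annihilator_def \<Psi>_0 \<pi>_0 \<Psi>_add \<pi>_add)
next
  fix a u assume a: "a \<in> annihilator"
  show "u \<otimes>\<^bsub>free_ring\<^esub> a \<in> annihilator"
    using a keeps_\<Psi>[of u] by (auto simp: free_ring_def annihilator_def \<Psi>_mult keeps_def)
  show "a \<otimes>\<^bsub>free_ring\<^esub> u \<in> annihilator"
    using a by (auto simp: free_ring_def annihilator_def \<Psi>_mult)
qed

lemma rel_ideal_annihilator: "rel_ideal \<subseteq> annihilator"
  unfolding rel_ideal_def
  by (rule ring.genideal_minimal[OF ring_free_ring ideal_annihilator])
    (auto simp: annihilator_def \<Psi>_diff \<pi>_diff defrel_sound)

lemma ideal_rel_ideal: "ideal rel_ideal free_ring"
  unfolding rel_ideal_def by (rule ring.genideal_ideal[OF ring_free_ring]) (simp add: free_ring_def)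

lemma cls_eq: "cls u = (\<lambda>a. a + u) ` rel_ideal"
  by (auto simp: cls_def a_r_coset_def' free_ring_def)

lemma cls_well_defined: "cls u = cls u' \<Longrightarrow> \<pi> (\<Psi> u v) = \<pi> (\<Psi> u' v)"
proof -
  assume c: "cls u = cls u'"
  have "0 \<in> rel_ideal"
    using additive_subgroup.zero_closed[OF ideal.axioms(1)[OF ideal_rel_ideal]] by (simp add: free_ring_def)
  then have "u \<in> cls u" unfolding cls_eq by (intro image_eqI[of _ _ 0]) simp_all
  then obtain a where a: "a \<in> rel_ideal" "u = a + u'" unfolding c by (auto simp: cls_eq)
  then have "\<pi> (\<Psi> a v) = 0" using rel_ideal_annihilator by (auto simp: annihilator_def)
  then show ?thesis by (simp add: a \<Psi>_add \<pi>_add)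
qed

text \<open>The values do not depend on the chosen representatives.\<close>

definition rep :: "'i gens free_alg set \<Rightarrow> 'f \<Rightarrow> 'f" where
  "rep c y = \<pi> (\<Psi> (SOME u. cls u = c) (SOME v. \<pi> v = y))"

lemma rep_cls: "rep (cls u) (\<pi> v) = \<pi> (\<Psi> u v)"
proof -
  have "cls (SOME u'. cls u' = cls u) = cls u" by (rule someI[of "\<lambda>u'. cls u' = cls u" u]) simp
  moreover have "\<pi> (SOME v'. \<pi> v' = \<pi> v) = \<pi> v" by (rule someI[of "\<lambda>v'. \<pi> v' = \<pi> v" v]) simp
  ultimately show ?thesis
    unfolding rep_def using cls_well_defined keeps_eq[OF keeps_\<Psi>] by metis
qed

lemma carrier_Uq: "w \<in> carrier Uq \<Longrightarrow> \<exists>u. w = cls u"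
  by (auto simp: Uq_def FactRing_def A_RCOSETS_def' cls_def)

lemma cls_hom: "cls u \<otimes>\<^bsub>Uq\<^esub> cls v = cls (u * v)" "cls u \<oplus>\<^bsub>Uq\<^esub> cls v = cls (u + v)" "\<one>\<^bsub>Uq\<^esub> = cls 1"
proof -
  note h = ideal.rcos_ring_hom[OF ideal_rel_ideal]
  show "cls u \<otimes>\<^bsub>Uq\<^esub> cls v = cls (u * v)" "cls u \<oplus>\<^bsub>Uq\<^esub> cls v = cls (u + v)" "\<one>\<^bsub>Uq\<^esub> = cls 1"
    using ring_hom_mult[OF h, of u v] ring_hom_add[OF h, of u v] ring_hom_one[OF h]
    by (simp_all add: Uq_def cls_def free_ring_def)
qed

lemma \<pi>_ex: "\<exists>v. y = \<pi> v" using \<pi>_surj by blast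

lemma representation: "is_representation scaleF rep"
  unfolding is_representation_def
proof (intro conjI allI)
  show "rep (cls (sc c)) = scaleF c" for c
  proof
    fix y
    obtain v where v: "y = \<pi> v" using \<pi>_ex by blast
    show "rep (cls (sc c)) y = scaleF c y" unfolding v rep_cls by (simp add: \<Psi>_sc \<pi>_scale)
  qed
  show "rep \<in> ring_hom Uq (lin_end_ring scaleF)"
  proof (rule ring_hom_memI)
    fix w w' assume "w \<in> carrier Uq" "w' \<in> carrier Uq"
    then obtain u u' where u: "w = cls u" "w' = cls u'" using carrier_Uq by blast
    show "rep (w \<otimes>\<^bsub>Uq\<^esub> w') = rep w \<otimes>\<^bsub>lin_end_ring scaleF\<^esub> rep w'"
    proof
      fix y
      obtain v where v: "y = \<pi> v" using \<pi>_ex by blast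
      show "rep (w \<otimes>\<^bsub>Uq\<^esub> w') y = (rep w \<otimes>\<^bsub>lin_end_ring scaleF\<^esub> rep w') y"
        by (simp add: u v cls_hom rep_cls lin_end_ring_def \<Psi>_mult)
    qed
    show "rep (w \<oplus>\<^bsub>Uq\<^esub> w') = rep w \<oplus>\<^bsub>lin_end_ring scaleF\<^esub> rep w'"
    proof
      fix y
      obtain v where v: "y = \<pi> v" using \<pi>_ex by blast
      show "rep (w \<oplus>\<^bsub>Uq\<^esub> w') y = (rep w \<oplus>\<^bsub>lin_end_ring scaleF\<^esub> rep w') y"
        by (simp add: u v cls_hom rep_cls lin_end_ring_def \<Psi>_add \<pi>_add)
    qed
  next
    fix w assume "w \<in> carrier Uq"
    then obtain u where u: "w = cls u" using carrier_Uq by blast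
    have "Vector_Spaces.linear scaleF scaleF (rep (cls u))"
    proof (rule Vector_Spaces.linear.intro[OF FF.vector_space_axioms FF.vector_space_axioms], unfold_locales)
      fix y y' c
      obtain v v' where v: "y = \<pi> v" "y' = \<pi> v'" using \<pi>_ex by metis
      show "rep (cls u) (y + y') = rep (cls u) y + rep (cls u) y'"
        unfolding v \<pi>_add[symmetric] rep_cls by (simp add: P.lin_add[OF lin_\<Psi>] \<pi>_add)
      show "rep (cls u) (scaleF c y) = scaleF c (rep (cls u) y)"
        unfolding v \<pi>_scale[symmetric] rep_cls by (simp add: P.lin_scale[OF lin_\<Psi>] \<pi>_scale)
    qed
    then show "rep w \<in> carrier (lin_end_ring scaleF)" by (simp add: lin_end_ring_def u)
  next
    show "rep \<one>\<^bsub>Uq\<^esub> = \<one>\<^bsub>lin_end_ring scaleF\<^esub>"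
    proof
      fix y
      obtain v where v: "y = \<pi> v" using \<pi>_ex by blast
      show "rep \<one>\<^bsub>Uq\<^esub> y = \<one>\<^bsub>lin_end_ring scaleF\<^esub> y"
        by (simp add: v cls_hom rep_cls lin_end_ring_def \<Psi>_1)
    qed
  qed
qed

lemma rep_qc: "rep (cls (qc s)) y = scaleF (rt q powi sg s) y"
proof -
  obtain v where v: "y = \<pi> v" using \<pi>_ex by blast
  show ?thesis unfolding v rep_cls by (simp add: \<Psi>_qc \<pi>_scale)
qed

lemma rep_\<phi>: "rep (cls (\<phi> s i m)) (\<pi> v) = \<pi> (\<Phi> s i m v)"
  by (simp add: rep_cls \<Psi>_\<phi>)

lemma rep_x: "rep (cls (x s i m)) (\<pi> v) = scaleF (\<epsilon> i) (\<pi> (X s i m v))"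
  by (simp add: rep_cls \<Psi>_x \<pi>_scale)

end

theorem theorem3p1:
  fixes A :: "'i::finite \<Rightarrow> 'i \<Rightarrow> int"
    and \<mu> :: "'i \<Rightarrow> 'i"
    and N :: nat
    and \<xi> q :: complex
    and rt :: "complex \<Rightarrow> complex"
    and Qh :: "'g monoid"
    and \<iota> :: "complex \<Rightarrow> 'g"
    and bar :: "'g \<Rightarrow> 'i \<Rightarrow> int"
    and \<mu>h :: "'g \<Rightarrow> 'g"
    and e :: "('i \<Rightarrow> int) \<Rightarrow> 'g"
    and scaleT :: "complex \<Rightarrow> 't \<Rightarrow> 't :: ab_group_add"
    and T :: "('i \<Rightarrow> int) \<Rightarrow> 't set"
    and act :: "'g \<Rightarrow> 't \<Rightarrow> 't"
    and scaleF :: "complex \<Rightarrow> 'f \<Rightarrow> 'f :: ab_group_add"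
    and \<pi> :: "('i, 't) poly_tensor \<Rightarrow> 'f"
  assumes "fock_space A \<mu> N \<xi> q rt Qh \<iota> bar \<mu>h e scaleT T act scaleF \<pi>"
  shows "\<exists>\<rho>. twisted_cartan.is_representation A \<mu> N \<xi> q rt scaleF \<rho> \<and>
     (\<forall>s v. \<rho> (twisted_cartan.cls A \<mu> N \<xi> q rt (twisted_cartan.qc s)) v =
        scaleF (rt q powi sg s) v) \<and>
     (\<forall>s i m v. \<rho> (twisted_cartan.cls A \<mu> N \<xi> q rt (twisted_cartan.\<phi> q s i m)) (\<pi> v) =
        \<pi> (graded_module.\<Phi> A \<mu> N \<xi> q scaleT T s i m v)) \<and>
     (\<forall>s i m v. \<rho> (twisted_cartan.cls A \<mu> N \<xi> q rt (twisted_cartan.x s i m)) (\<pi> v) =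
        scaleF (twisted_cartan.\<epsilon> A \<mu> N q rt i)
          (\<pi> (graded_module.X A \<mu> N \<xi> q rt e scaleT T act s i m v)))"
proof -
  interpret fock_space A \<mu> N \<xi> q rt Qh \<iota> bar \<mu>h e scaleT T act scaleF \<pi> by (rule assms)
  show ?thesis using representation rep_qc rep_\<phi> rep_x by blast
qed

end
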